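(* Let $p>2$. Assume that $G$ is a locally finite unbounded metric graph that is unbounded only along half-lines or chains equivalent to half-lines. Then all minimizing sequences (normalized by $\int_G|v_n|^p\,dx=1$) for the minimization problem $$\frac1{C_p(G)}=\inf_{v\in H^1_0(G)\setminus\{0\}}\frac{\int_G(|v'|^2+|v|^2)\,dx}{\left(\int_G|v|^p\,dx\right)^{2/p}}$$ are relatively compact in $H^1_0(G)$ if and only if $C_p(G)>C_p(\mathbb{R})$. Moreover, when this strict inequality holds, the infimum is attained by at least one $v\in H^1_0(G)\setminus\{0\}$.
   Context: A (planar, metric) graph $G$ consists of vertices and of edges, each edge being either a straight segment joining two vertices (bounded edge, of positive length equal to the distance between its endpoints) or a half-line issued from one vertex (unbounded edge, of infinite length). The graph is locally finite: there is no accumulation of edges at any vertex. A vertex is outer if it belongs to only one edge, and inner otherwise. Integrals over $G$ are sums over the edges of integrals with respect to arc length. $H^1(G)$ is the set of continuous functions on $G$ belonging to $H^1(e)$ for each edge $e$ with $\|f\|_{H^1(G)}^2=\sum_e\|f\|_{H^1(e)}^2<\infty$; $H^1_0(G)$ is the subspace of functions vanishing at all outer vertices (Dirichlet condition). $C_p(G)$ is the best constant in $\left(\int_G|v|^p\,dx\right)^{2/p}\le C_p(G)\int_G(|v'|^2+|v|^2)\,dx$ for all $v\in H^1_0(G)$; $C_p(\mathbb{R})$ is the same constant for the real line, with $H^1_0(\mathbb{R})=H^1(\mathbb{R})$. A chain is a finite or infinite sequence of consecutive edges $e_i=[V_i^-,V_i^+]$ with $V_i^+=V_{i+1}^-$;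 it is equivalent to a half-line if, parametrized by arc length, it is identified with $\mathbb{R}_+$ (one end at a finite vertex, infinite total length). "Unbounded only along half-lines or chains equivalent to half-lines" means that $G$ is the union of a compact graph (finitely many bounded edges) and of a finite, non-zero number of half-lines, or chains equivalent to half-lines, attached to it at their finite endpoint, the inner vertices of each such chain belonging to no edges other than those of the chain; thus near infinity $G$ is equivalent to a finite disjoint union of half-lines. *)

theory Defs
  imports "HOL-Analysis.Analysis" "HOL-Library.Extended_Nat"
begin

section \<open>The Sobolev space of an interval\<close>

text \<open>Only the interior of the interval I matters, so closed intervals may be used below.
  As usual in dimension one, test functions are continuously differentiable with compact
  support.\<close>

definition test_function :: "real set \<Rightarrow> (real \<Rightarrow> real) \<Rightarrow> bool" where
  "test_function I \<phi> \<longleftrightarrow>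
     \<phi> C1_differentiable_on UNIV \<and>
     compact (closure {t. \<phi> t \<noteq> 0}) \<and> closure {t. \<phi> t \<noteq> 0} \<subseteq> interior I"

definition square_integrable :: "real set \<Rightarrow> (real \<Rightarrow> real) \<Rightarrow> bool" where
  "square_integrable I f \<longleftrightarrow>
     set_borel_measurable lborel I f \<and> set_integrable lborel I (\<lambda>t. (f t)\<^sup>2)"

definition is_weak_deriv :: "real set \<Rightarrow> (real \<Rightarrow> real) \<Rightarrow> (real \<Rightarrow> real) \<Rightarrow> bool" where
  "is_weak_deriv I f g \<longleftrightarrow>
     (\<forall>\<phi>. test_function I \<phi> \<longrightarrow>
        (LINT t:I|lborel. f t * deriv \<phi> t) = - (LINT t:I|lborel. g t * \<phi> t))"

definition H1_interval :: "real set \<Rightarrow> (real \<Rightarrow> real) \<Rightarrow> bool" where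
  "H1_interval I f \<longleftrightarrow>
     square_integrable I f \<and> (\<exists>g. square_integrable I g \<and> is_weak_deriv I f g)"

text \<open>The weak derivative is unique only up to null sets; it is used only under integrals,
  which do not depend on the representative chosen here.\<close>

definition weak_deriv :: "real set \<Rightarrow> (real \<Rightarrow> real) \<Rightarrow> real \<Rightarrow> real" where
  "weak_deriv I f = (SOME g. square_integrable I g \<and> is_weak_deriv I f g)"

section \<open>Planar metric graphs\<close>

text \<open>\<open>Segment a b\<close> is the segment with endpoints a and b. \<open>Half_line a d\<close> is the half-line issued
  from a in the direction of the unit vector d. The order of the endpoints of a segment only
  fixes the direction of its arc length parametrization \<open>edge_param\<close> on \<open>edge_dom\<close>.\<close>

datatype edge = Segment "real^2" "real^2" | Half_line "real^2" "real^2"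

fun valid_edge :: "edge \<Rightarrow> bool" where
  "valid_edge (Segment a b) \<longleftrightarrow> a \<noteq> b"
| "valid_edge (Half_line a d) \<longleftrightarrow> norm d = 1"

fun bounded_edge :: "edge \<Rightarrow> bool" where
  "bounded_edge (Segment a b) \<longleftrightarrow> True"
| "bounded_edge (Half_line a d) \<longleftrightarrow> False"

fun edge_ends :: "edge \<Rightarrow> (real^2) set" where
  "edge_ends (Segment a b) = {a, b}"
| "edge_ends (Half_line a d) = {a}"

fun edge_length :: "edge \<Rightarrow> ennreal" where
  "edge_length (Segment a b) = ennreal (dist a b)"
| "edge_length (Half_line a d) = \<infinity>"

fun edge_dom :: "edge \<Rightarrow> real set" where
  "edge_dom (Segment a b) = {0..dist a b}"
| "edge_dom (Half_line a d) = {0..}"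

fun edge_param :: "edge \<Rightarrow> real \<Rightarrow> real^2" where
  "edge_param (Segment a b) t = a + (t / dist a b) *\<^sub>R (b - a)"
| "edge_param (Half_line a d) t = a + t *\<^sub>R d"

definition edge_points :: "edge \<Rightarrow> (real^2) set" where
  "edge_points e = edge_param e ` edge_dom e"

record pgraph =
  verts :: "(real^2) set"
  edges :: "edge set"

definition graph_points :: "pgraph \<Rightarrow> (real^2) set" where
  "graph_points G = (\<Union>e\<in>edges G. edge_points e)"

text \<open>There are no isolated vertices, so G is the union of its edges. Distinct edges meet only
  at common endpoints; in particular \<open>Segment a b\<close> and \<open>Segment b a\<close> are not both present.
  Connectedness is not required.\<close>

definition planar_metric_graph :: "pgraph \<Rightarrow> bool" where
  "planar_metric_graph G \<longleftrightarrow>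
     (\<forall>e\<in>edges G. valid_edge e) \<and>
     verts G = (\<Union>e\<in>edges G. edge_ends e) \<and>
     (\<forall>e\<in>edges G. \<forall>e'\<in>edges G. e \<noteq> e' \<longrightarrow>
        edge_points e \<inter> edge_points e' \<subseteq> edge_ends e \<inter> edge_ends e')"

definition locally_finite_graph :: "pgraph \<Rightarrow> bool" where
  "locally_finite_graph G \<longleftrightarrow> (\<forall>x\<in>verts G. finite {e\<in>edges G. x \<in> edge_ends e})"

definition outer_vertex :: "pgraph \<Rightarrow> real^2 \<Rightarrow> bool" where
  "outer_vertex G x \<longleftrightarrow> x \<in> verts G \<and> (\<exists>!e. e \<in> edges G \<and> x \<in> edge_ends e)"

text \<open>A chain with N edges (N may be infinite): its edges are \<open>e i\<close> and its vertices \<open>x i\<close>, for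
  i < N, where \<open>e i\<close> starts at \<open>x i\<close> and joins it to \<open>x (i + 1)\<close> if there is a next edge.
  If N is finite and the last edge is bounded, its far endpoint is not listed; such chains have
  finite length and are not equivalent to a half-line.\<close>

definition chain :: "pgraph \<Rightarrow> enat \<Rightarrow> (nat \<Rightarrow> real^2) \<Rightarrow> (nat \<Rightarrow> edge) \<Rightarrow> bool" where
  "chain G N x e \<longleftrightarrow>
     (\<forall>i. enat i < N \<longrightarrow> e i \<in> edges G \<and> x i \<in> edge_ends (e i)) \<and>
     (\<forall>i. enat (Suc i) < N \<longrightarrow> edge_ends (e i) = {x i, x (Suc i)})"

text \<open>The arc length parametrization starting from \<open>x 0\<close> identifies the chain with the half-line
  iff it is injective and the total length is infinite. So either N is finite and exactly the
  last edge is a half-line (N = 1 gives a single half-line), or N is infinite and all the edges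
  are bounded.\<close>

definition half_line_chain :: "pgraph \<Rightarrow> enat \<Rightarrow> (nat \<Rightarrow> real^2) \<Rightarrow> (nat \<Rightarrow> edge) \<Rightarrow> bool" where
  "half_line_chain G N x e \<longleftrightarrow>
     chain G N x e \<and> inj_on x {i. enat i < N} \<and>
     (\<Sum>\<^sub>\<infinity>i\<in>{i. enat i < N}. edge_length (e i)) = \<infinity>"

text \<open>\<open>(V\<^sub>0, E\<^sub>0)\<close> is the compact graph, which may be reduced to finitely many points (for
  instance when G is a single half-line). The m chains are numbered by j < m. Since
  m > 0, the total length of G is infinite.\<close>

definition unbounded_only_along_half_lines :: "pgraph \<Rightarrow> bool" where
  "unbounded_only_along_half_lines G \<longleftrightarrow>
     (\<exists>V\<^sub>0 E\<^sub>0 m N x e.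
        finite V\<^sub>0 \<and> V\<^sub>0 \<subseteq> verts G \<and> finite E\<^sub>0 \<and>
        (\<forall>f\<in>E\<^sub>0. bounded_edge f \<and> edge_ends f \<subseteq> V\<^sub>0) \<and>
        0 < (m::nat) \<and>
        (\<forall>j<m. half_line_chain G (N j) (x j) (e j) \<and> x j 0 \<in> V\<^sub>0 \<and>
           (\<forall>i. 0 < i \<and> enat i < N j \<longrightarrow>
              x j i \<notin> V\<^sub>0 \<and>
              (\<forall>f\<in>edges G. x j i \<in> edge_ends f \<longrightarrow> f \<in> e j ` {k. enat k < N j}))) \<and>
        edges G = E\<^sub>0 \<union> (\<Union>j<m. e j ` {i. enat i < N j}))"

section \<open>Function spaces on a graph\<close>

text \<open>An integrand is given by its expression \<open>F e t\<close> in the arc length parameter t of each edge e.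
  On the graphs of interest all the sums and integrals below converge for functions in \<open>H10\<close>.\<close>

definition graph_integral :: "pgraph \<Rightarrow> (edge \<Rightarrow> real \<Rightarrow> real) \<Rightarrow> real" where
  "graph_integral G F = (\<Sum>\<^sub>\<infinity>e\<in>edges G. LINT t:edge_dom e|lborel. F e t)"

definition on_edge :: "(real^2 \<Rightarrow> real) \<Rightarrow> edge \<Rightarrow> real \<Rightarrow> real" where
  "on_edge v e = v \<circ> edge_param e"

definition edge_deriv :: "(real^2 \<Rightarrow> real) \<Rightarrow> edge \<Rightarrow> real \<Rightarrow> real" where
  "edge_deriv v e = weak_deriv (edge_dom e) (on_edge v e)"

definition energy_density :: "(real^2 \<Rightarrow> real) \<Rightarrow> edge \<Rightarrow> real \<Rightarrow> real" where
  "energy_density v e t = (edge_deriv v e t)\<^sup>2 + (on_edge v e t)\<^sup>2"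

definition energy :: "pgraph \<Rightarrow> (real^2 \<Rightarrow> real) \<Rightarrow> real" where
  "energy G v = graph_integral G (energy_density v)"

definition Lp_integral :: "pgraph \<Rightarrow> real \<Rightarrow> (real^2 \<Rightarrow> real) \<Rightarrow> real" where
  "Lp_integral G p v = graph_integral G (\<lambda>e t. \<bar>on_edge v e t\<bar> powr p)"

text \<open>Functions on G are represented by functions on the plane that vanish off G. Continuity
  refers to the topology of G as a metric graph: for a locally finite graph it
  means continuity on every closed edge. (The topology induced by the plane may be coarser when
  the edges of an infinite chain accumulate somewhere.)\<close>

definition H1 :: "pgraph \<Rightarrow> (real^2 \<Rightarrow> real) set" where
  "H1 G = {v. (\<forall>x. x \<notin> graph_points G \<longrightarrow> v x = 0) \<and>
              (\<forall>e\<in>edges G. continuous_on (edge_points e) v \<and>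
                           H1_interval (edge_dom e) (on_edge v e)) \<and>
              (\<lambda>e. LINT t:edge_dom e|lborel. energy_density v e t) summable_on edges G}"

definition H10 :: "pgraph \<Rightarrow> (real^2 \<Rightarrow> real) set" where
  "H10 G = {v \<in> H1 G. \<forall>x. outer_vertex G x \<longrightarrow> v x = 0}"

definition H1_norm :: "pgraph \<Rightarrow> (real^2 \<Rightarrow> real) \<Rightarrow> real" where
  "H1_norm G v = sqrt (energy G v)"

definition H10_topology :: "pgraph \<Rightarrow> (real^2 \<Rightarrow> real) topology" where
  "H10_topology G = Metric_space.mtopology (H10 G) (\<lambda>u v. H1_norm G (\<lambda>x. u x - v x))"

definition relatively_compact_in_H10 :: "pgraph \<Rightarrow> (real^2 \<Rightarrow> real) set \<Rightarrow> bool" where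
  "relatively_compact_in_H10 G S \<longleftrightarrow>
     S \<subseteq> H10 G \<and> compactin (H10_topology G) (H10_topology G closure_of S)"

section \<open>Best constants and the minimization problem\<close>

definition best_const :: "pgraph \<Rightarrow> real \<Rightarrow> real" where
  "best_const G p =
     Inf {C. 0 \<le> C \<and> (\<forall>v\<in>H10 G. Lp_integral G p v powr (2 / p) \<le> C * energy G v)}"

definition best_const_line :: "real \<Rightarrow> real" where
  "best_const_line p =
     Inf {C. 0 \<le> C \<and>
           (\<forall>f. continuous_on UNIV f \<and> H1_interval UNIV f \<longrightarrow>
              (LINT t|lborel. \<bar>f t\<bar> powr p) powr (2 / p)
                \<le> C * (LINT t|lborel. (weak_deriv UNIV f t)\<^sup>2 + (f t)\<^sup>2))}"

definition rayleigh_quotient :: "pgraph \<Rightarrow> real \<Rightarrow> (real^2 \<Rightarrow> real) \<Rightarrow> real" where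
  "rayleigh_quotient G p v = energy G v / Lp_integral G p v powr (2 / p)"

definition min_value :: "pgraph \<Rightarrow> real \<Rightarrow> real" where
  "min_value G p = (INF v\<in>H10 G - {\<lambda>x. 0}. rayleigh_quotient G p v)"

definition normalized_minimizing_sequence ::
    "pgraph \<Rightarrow> real \<Rightarrow> (nat \<Rightarrow> real^2 \<Rightarrow> real) \<Rightarrow> bool" where
  "normalized_minimizing_sequence G p v \<longleftrightarrow>
     (\<forall>n. v n \<in> H10 G - {\<lambda>x. 0} \<and> Lp_integral G p (v n) = 1) \<and>
     (\<lambda>n. rayleigh_quotient G p (v n)) \<longlonglongrightarrow> min_value G p"

end

theory Submission
  imports Defs "HOL-Complex_Analysis.Great_Picard"
begin

text \<open>A chain equivalent to a half-line is treated as a single half-line, so the graph becomes a finite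
  family of intervals. A subsequence of a bounded sequence \<open>v\<^sub>n\<close> converges pointwise to some \<open>w\<close>, the
  energy splits asymptotically into the energies of \<open>w\<close> and of \<open>v\<^sub>n - w\<close>, and by the Brezis-Lieb lemma
  so does the integral of the p-th power. The remainder \<open>v\<^sub>n - w\<close> tends to 0 locally uniformly, so it lives
  on the half-lines and is asymptotically subject to the inequality on the line. If the constant of the
  graph is larger than that of the line, strict subadditivity of \<open>s \<mapsto> s powr (2 / p)\<close> forces the remainder
  of a minimizing sequence to vanish. If not, both constants agree, and compactly supported almost
  optimal functions of the line, transplanted to disjoint intervals of one half-line, form a
  minimizing sequence without limit points.\<close>

section \<open>Square integrable functions\<close>

text \<open>Weak convergence never appears. In dimension one the energy controls every point value,
  so a limit in energy, whatever its origin, is identified by its point values, and pointwise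
  convergence of a bounded sequence can do the work of weak convergence. Sobolev functions are
  handled through pairs \<open>H1_pair D f g\<close> satisfying the fundamental theorem of calculus
  rather than through test functions: this form survives restriction, gluing at a vertex and change
  of the arc length parameter, so that a chain with infinitely many edges becomes one function on a
  half-line. The remainder is not localized on the half-lines. On every piece, bounded or not, it is
  extended to the line by linear ramps, at the price of twice the squares of its values at the
  finitely many end points of the pieces, and these values tend to 0. In the opposite case only the
  inequality between the two constants is used: functions that violate the inequality on the line,
  with constants tending to the constant of the graph, are normalized on one half-line, and their
  quotients are squeezed to the minimal value.\<close>

definition L2 :: "'a measure \<Rightarrow> ('a \<Rightarrow> real) \<Rightarrow> bool" where
  "L2 M f \<longleftrightarrow> f \<in> borel_measurable M \<and> integrable M (\<lambda>x. (f x)\<^sup>2)"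

lemma L2_integrable_sq: "L2 M f \<Longrightarrow> integrable M (\<lambda>x. (f x)\<^sup>2)"
  by (simp add: L2_def)

lemma L2_mult_integrable:
  assumes "L2 M f" "L2 M g"
  shows "integrable M (\<lambda>x. f x * g x)"
proof (rule Bochner_Integration.integrable_bound)
  show "integrable M (\<lambda>x. (f x)\<^sup>2 + (g x)\<^sup>2)"
    using assms by (intro Bochner_Integration.integrable_add L2_integrable_sq)
  show "(\<lambda>x. f x * g x) \<in> borel_measurable M"
    using assms by (auto simp: L2_def)
  have "norm (a * b) \<le> norm (a\<^sup>2 + b\<^sup>2)" for a b :: real
  proof -
    have "2 * (\<bar>a\<bar> * \<bar>b\<bar>) \<le> a\<^sup>2 + b\<^sup>2" using sum_squares_bound[of "\<bar>a\<bar>" "\<bar>b\<bar>"] by (simp add: mult.assoc)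
    moreover have "0 \<le> \<bar>a\<bar> * \<bar>b\<bar>" by simp
    ultimately show ?thesis unfolding real_norm_def abs_mult by linarith
  qed
  then show "AE x in M. norm (f x * g x) \<le> norm ((f x)\<^sup>2 + (g x)\<^sup>2)" by simp
qed

lemma L2_lincomb:
  assumes "L2 M f" "L2 M g"
  shows "L2 M (\<lambda>x. a * f x + b * g x)"
proof -
  have "(\<lambda>x. (a * f x + b * g x)\<^sup>2) = (\<lambda>x. a\<^sup>2 * (f x)\<^sup>2 + b\<^sup>2 * (g x)\<^sup>2 + (2*a*b) * (f x * g x))"
    by (auto simp: power2_eq_square algebra_simps)
  moreover have "integrable M (\<lambda>x. a\<^sup>2 * (f x)\<^sup>2 + b\<^sup>2 * (g x)\<^sup>2 + (2*a*b) * (f x * g x))"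
    using assms L2_mult_integrable[OF assms]
    by (intro Bochner_Integration.integrable_add integrable_mult_right L2_integrable_sq) auto
  ultimately show ?thesis using assms by (auto simp: L2_def)
qed

lemma integral_lincomb_sq:
  assumes "L2 M f" "L2 M g"
  shows "(LINT x|M. (a * f x + b * g x)\<^sup>2) =
    a\<^sup>2 * (LINT x|M. (f x)\<^sup>2) + b\<^sup>2 * (LINT x|M. (g x)\<^sup>2) + 2 * a * b * (LINT x|M. f x * g x)"
proof -
  have "(\<lambda>x. (a * f x + b * g x)\<^sup>2) = (\<lambda>x. a\<^sup>2 * (f x)\<^sup>2 + b\<^sup>2 * (g x)\<^sup>2 + (2*a*b) * (f x * g x))"
    by (auto simp: power2_eq_square algebra_simps)
  moreover have "(LINT x|M. a\<^sup>2 * (f x)\<^sup>2 + b\<^sup>2 * (g x)\<^sup>2 + (2*a*b) * (f x * g x)) =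
      a\<^sup>2 * (LINT x|M. (f x)\<^sup>2) + b\<^sup>2 * (LINT x|M. (g x)\<^sup>2) + (2 * a * b) * (LINT x|M. f x * g x)"
    using L2_integrable_sq[OF assms(1)] L2_integrable_sq[OF assms(2)] L2_mult_integrable[OF assms]
    by (simp only: Bochner_Integration.integral_add Bochner_Integration.integral_mult_right_zero
        Bochner_Integration.integrable_add integrable_mult_right)
  ultimately show ?thesis by simp
qed

lemma L2_bound:
  assumes "L2 M g" "f \<in> borel_measurable M" "\<And>x. x \<in> space M \<Longrightarrow> \<bar>f x\<bar> \<le> \<bar>g x\<bar>"
  shows "L2 M f"
  unfolding L2_def
proof
  show "integrable M (\<lambda>x. (f x)\<^sup>2)"
    using assms by (intro Bochner_Integration.integrable_bound[OF L2_integrable_sq[OF assms(1)]])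
      (auto intro!: AE_I2 simp: abs_le_square_iff)
qed (use assms in auto)

lemma L2_add: "L2 M f \<Longrightarrow> L2 M g \<Longrightarrow> L2 M (\<lambda>x. f x + g x)"
  using L2_lincomb[of M f g 1 1] by simp

lemma L2_diff: "L2 M f \<Longrightarrow> L2 M g \<Longrightarrow> L2 M (\<lambda>x. f x - g x)"
  using L2_lincomb[of M f g 1 "-1"] by simp

lemma L2_abs: "L2 M f \<Longrightarrow> L2 M (\<lambda>x. \<bar>f x\<bar>)"
  by (auto simp: L2_def)

text \<open>If A > 0, evaluate the form at a = -B, b = A. If A = 0, the form with b = 1 is affine in
  a, so B has to vanish. This yields the Cauchy-Schwarz inequality for square integrable functions
  and later for the energy of the graph.\<close>

lemma nonneg_quadratic_discriminant:
  fixes A B C :: real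
  assumes "\<And>a b. a\<^sup>2 * A + b\<^sup>2 * C + 2 * a * b * B \<ge> 0" 
  shows "B\<^sup>2 \<le> A * C"
proof -
  have A: "A \<ge> 0" and C: "C \<ge> 0" using assms[of 1 0] assms[of 0 1] by auto
  show ?thesis
  proof (cases "A = 0")
    case True
    have "B = 0"
    proof (rule ccontr)
      assume "B \<noteq> 0"
      \<comment> \<open>At this point the form equals C - (C + 1) = -1.\<close>
      have "C + 2 * (-(C+1) / (2*B)) * B \<ge> 0" using assms[of "-(C+1)/(2*B)" 1] True by simp
      with \<open>B \<noteq> 0\<close> show False by (simp add: field_simps)
    qed
    then show ?thesis using True by simp
  next
    case False
    then have "A > 0" using A by simp
    have "B\<^sup>2 * A + A\<^sup>2 * C + 2 * (-B) * A * B \<ge> 0" using assms[of "-B" A] by simp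
    then have "A * (A * C - B\<^sup>2) \<ge> 0" by (simp add: power2_eq_square algebra_simps)
    then show ?thesis using \<open>A > 0\<close> by (simp add: zero_le_mult_iff)
  qed
qed

lemma L2_Cauchy_Schwarz:
  assumes "L2 M f" "L2 M g"
  shows "(LINT x|M. f x * g x)\<^sup>2 \<le> (LINT x|M. (f x)\<^sup>2) * (LINT x|M. (g x)\<^sup>2)"
proof (rule nonneg_quadratic_discriminant)
  fix a b :: real
  show "0 \<le> a\<^sup>2 * (LINT x|M. (f x)\<^sup>2) + b\<^sup>2 * (LINT x|M. (g x)\<^sup>2) + 2 * a * b * (LINT x|M. f x * g x)"
    unfolding integral_lincomb_sq[OF assms, symmetric] by (rule Bochner_Integration.integral_nonneg) simp
qed

text \<open>A substitute for weak convergence to 0. Where |v| \<le> d |w n| the product is at most d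
  times the square of \<open>w n\<close>, with integral at most d B; elsewhere it is dominated by
  v^2 / d, and dominated convergence applies.\<close>

lemma L2_weak_null:
  assumes w: "\<And>n. L2 M (w n)" and v: "L2 M v"
    and bd: "\<And>n. (LINT x|M. (w n x)\<^sup>2) \<le> B"
    and lim: "\<And>x. x \<in> space M \<Longrightarrow> (\<lambda>n. w n x) \<longlonglongrightarrow> 0"
  shows "(\<lambda>n. LINT x|M. \<bar>w n x\<bar> * \<bar>v x\<bar>) \<longlonglongrightarrow> 0"
proof (rule LIMSEQ_I)
  fix e :: real assume "e > 0"
  have B: "B \<ge> 0" using bd[of 0] by (meson Bochner_Integration.integral_nonneg order_trans zero_le_power2)
  \<comment> \<open>The parameter d gives half of e to the undominated part; B + 1 in place of B
    covers the case B = 0.\<close>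
  define d where "d = e / (2 * (B + 1))"
  have d: "d > 0" "d * B \<le> e/2" using \<open>e > 0\<close> B by (auto simp: d_def field_simps)
  \<comment> \<open>Truncation at v^2 / d makes the product dominated by a function independent of
    n; by \<open>key\<close> the part cut off is at most d times the square of
    \<open>w n\<close>.\<close>
  define h where "h n x = min (\<bar>w n x\<bar> * \<bar>v x\<bar>) ((v x)\<^sup>2 / d)" for n x
  have hm: "h n \<in> borel_measurable M" for n using w[of n] v by (auto simp: h_def[abs_def] L2_def)
  have hb: "0 \<le> h n x" "h n x \<le> (v x)\<^sup>2 / d" for n x using d by (auto simp: h_def)
  have hi: "integrable M (\<lambda>x. (v x)\<^sup>2 / d)" using v by (auto simp: L2_def)
  have hl: "(\<lambda>n. h n x) \<longlonglongrightarrow> 0" if "x \<in> space M" for x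
  proof -
    have "(\<lambda>n. min (\<bar>w n x\<bar> * \<bar>v x\<bar>) ((v x)\<^sup>2 / d)) \<longlonglongrightarrow> min (\<bar>0\<bar> * \<bar>v x\<bar>) ((v x)\<^sup>2 / d)"
      by (intro tendsto_intros lim that)
    then show ?thesis using d by (simp add: h_def)
  qed
  have "(\<lambda>n. LINT x|M. h n x) \<longlonglongrightarrow> (LINT x|M. 0)"
    by (rule integral_dominated_convergence[OF _ hm hi]) (use hl hb in auto)
  then have "(\<lambda>n. LINT x|M. h n x) \<longlonglongrightarrow> 0" by simp
  then obtain N where N: "\<And>n. n \<ge> N \<Longrightarrow> \<bar>LINT x|M. h n x\<bar> < e/2"
    using LIMSEQ_D[of "\<lambda>n. LINT x|M. h n x" 0 "e/2"] \<open>e > 0\<close> unfolding real_norm_def diff_0_right by (meson half_gt_zero)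
  have "norm (h n x) \<le> norm ((v x)\<^sup>2 / d)" for n x
    using hb[of n x] unfolding real_norm_def by linarith
  then have hint: "integrable M (h n)" for n
    by (intro Bochner_Integration.integrable_bound[OF hi hm] AE_I2)
  have key: "\<bar>a\<bar> * \<bar>b\<bar> \<le> min (\<bar>a\<bar> * \<bar>b\<bar>) (b\<^sup>2 / d) + d * a\<^sup>2" for a b :: real
  proof (cases "\<bar>b\<bar> \<le> d * \<bar>a\<bar>")
    case True
    then have "\<bar>a\<bar> * \<bar>b\<bar> \<le> \<bar>a\<bar> * (d * \<bar>a\<bar>)" by (intro mult_left_mono) auto
    also have "\<dots> = d * a\<^sup>2" by (simp add: power2_eq_square mult.left_commute[of "\<bar>a\<bar>"])
    finally have "\<bar>a\<bar> * \<bar>b\<bar> \<le> d * a\<^sup>2" .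
    moreover have "0 \<le> min (\<bar>a\<bar> * \<bar>b\<bar>) (b\<^sup>2 / d)" using d by simp
    ultimately show ?thesis by linarith
  next
    case False
    then have "\<bar>b\<bar> * (d * \<bar>a\<bar>) \<le> \<bar>b\<bar> * \<bar>b\<bar>" by (intro mult_left_mono) auto
    also have "\<dots> = b\<^sup>2" by (simp add: power2_eq_square)
    finally have "\<bar>a\<bar> * \<bar>b\<bar> \<le> b\<^sup>2 / d" using d by (simp add: pos_le_divide_eq mult_ac)
    moreover have "0 \<le> d * a\<^sup>2" using d by simp
    ultimately show ?thesis by linarith
  qed
  have "\<bar>LINT x|M. \<bar>w n x\<bar> * \<bar>v x\<bar>\<bar> < e" if "n \<ge> N" for n
  proof -
    have key': "\<bar>w n x\<bar> * \<bar>v x\<bar> \<le> h n x + d * (w n x)\<^sup>2" for x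
      unfolding h_def by (rule key)
    have "(LINT x|M. \<bar>w n x\<bar> * \<bar>v x\<bar>) \<le> (LINT x|M. h n x + d * (w n x)\<^sup>2)"
      using L2_mult_integrable[OF L2_abs[OF w] L2_abs[OF v]] hint w[of n]
      by (intro integral_mono Bochner_Integration.integrable_add integrable_mult_right L2_integrable_sq key')
    also have "\<dots> = (LINT x|M. h n x) + d * (LINT x|M. (w n x)\<^sup>2)"
      using hint w[of n] by (simp add: L2_def)
    also have "\<dots> \<le> (LINT x|M. h n x) + d * B"
      using bd d by (intro add_left_mono mult_left_mono) auto
    also have "\<dots> < e" using N[OF that] d by linarith
    finally show ?thesis by (simp add: Bochner_Integration.integral_nonneg)
  qed
  then show "\<exists>no. \<forall>n\<ge>no. norm ((LINT x|M. \<bar>w n x\<bar> * \<bar>v x\<bar>) - 0) < e" by auto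
qed

text \<open>Fatou's lemma along the almost everywhere convergent subsequence \<open>r\<close> passes
  the Cauchy bound from g n - g m to g n - h, which gives membership and convergence of the full
  sequence at once.\<close>

lemma L2_Cauchy_limit:
  assumes g: "\<And>n. L2 M (g n)"
    and Cau: "\<And>e. e > 0 \<Longrightarrow> \<exists>N. \<forall>m\<ge>N. \<forall>n\<ge>N. (LINT x|M. (g m x - g n x)\<^sup>2) < e"
    and r: "strict_mono r" and conv: "AE x in M. (\<lambda>i. g (r i) x) \<longlonglongrightarrow> h x"
    and hm [measurable]: "h \<in> borel_measurable M"
  shows "L2 M h" "(\<lambda>n. LINT x|M. (g n x - h x)\<^sup>2) \<longlonglongrightarrow> 0"
proof -
  have gm [measurable]: "g n \<in> borel_measurable M" for n using g[of n] by (simp add: L2_def)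
  have main: "L2 M (\<lambda>x. g n x - h x) \<and> (LINT x|M. (g n x - h x)\<^sup>2) \<le> e"
    if N: "\<And>m. m \<ge> N \<Longrightarrow> (LINT x|M. (g n x - g m x)\<^sup>2) \<le> e" and "e \<ge> 0" for n N e
  proof -
    have "(\<integral>\<^sup>+x. ennreal ((g n x - h x)\<^sup>2) \<partial>M) = (\<integral>\<^sup>+x. liminf (\<lambda>i. ennreal ((g n x - g (r i) x)\<^sup>2)) \<partial>M)"
    proof (rule nn_integral_cong_AE, rule AE_mp[OF conv], intro AE_I2 impI)
      fix x assume "(\<lambda>i. g (r i) x) \<longlonglongrightarrow> h x"
      then have "(\<lambda>i. ennreal ((g n x - g (r i) x)\<^sup>2)) \<longlonglongrightarrow> ennreal ((g n x - h x)\<^sup>2)"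
        by (intro tendsto_intros tendsto_ennrealI)
      then show "ennreal ((g n x - h x)\<^sup>2) = liminf (\<lambda>i. ennreal ((g n x - g (r i) x)\<^sup>2))"
        by (rule lim_imp_Liminf[OF trivial_limit_sequentially, symmetric])
    qed
    also have "\<dots> \<le> liminf (\<lambda>i. \<integral>\<^sup>+x. ennreal ((g n x - g (r i) x)\<^sup>2) \<partial>M)"
      by (rule nn_integral_liminf) measurable
    also have "\<dots> \<le> ennreal e"
    proof -
      have "(\<integral>\<^sup>+x. ennreal ((g n x - g (r i) x)\<^sup>2) \<partial>M) \<le> ennreal e" if "i \<ge> N" for i
      proof -
        have "(\<integral>\<^sup>+x. ennreal ((g n x - g (r i) x)\<^sup>2) \<partial>M) = ennreal (LINT x|M. (g n x - g (r i) x)\<^sup>2)"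
          by (intro nn_integral_eq_integral L2_integrable_sq L2_diff g) auto
        also have "\<dots> \<le> ennreal e" using N[of "r i"] that seq_suble[OF r, of i] by (intro ennreal_leI) auto
        finally show ?thesis .
      qed
      then have "eventually (\<lambda>i. (\<integral>\<^sup>+x. ennreal ((g n x - g (r i) x)\<^sup>2) \<partial>M) \<le> ennreal e) sequentially"
        by (auto simp: eventually_sequentially)
      then have "liminf (\<lambda>i. \<integral>\<^sup>+x. ennreal ((g n x - g (r i) x)\<^sup>2) \<partial>M) \<le> liminf (\<lambda>i. ennreal e)"
        by (rule Liminf_mono)
      then show ?thesis by (simp add: Liminf_const)
    qed
    finally have le: "(\<integral>\<^sup>+x. ennreal ((g n x - h x)\<^sup>2) \<partial>M) \<le> ennreal e" .
    then have int: "integrable M (\<lambda>x. (g n x - h x)\<^sup>2)"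
      by (intro integrableI_bounded) (auto simp: le_less_trans)
    have "ennreal (LINT x|M. (g n x - h x)\<^sup>2) \<le> ennreal e"
      using le by (subst nn_integral_eq_integral[OF int, symmetric]) auto
    then show ?thesis using int \<open>e \<ge> 0\<close> by (auto simp: L2_def)
  qed
  obtain N1 where N1: "\<And>m n. m \<ge> N1 \<Longrightarrow> n \<ge> N1 \<Longrightarrow> (LINT x|M. (g m x - g n x)\<^sup>2) < 1"
    using Cau[of 1] by auto
  have "L2 M (\<lambda>x. g N1 x - h x)" using main[of N1 N1 1] N1 by (auto simp: less_imp_le)
  \<comment> \<open>Fatou's lemma controls only differences with h, so h itself is written as g N1
    minus such a difference.\<close>
  then have "L2 M (\<lambda>x. g N1 x - (g N1 x - h x))" by (rule L2_diff[OF g])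
  moreover have "(\<lambda>x. g N1 x - (g N1 x - h x)) = h" by auto
  ultimately show "L2 M h" by simp
  show "(\<lambda>n. LINT x|M. (g n x - h x)\<^sup>2) \<longlonglongrightarrow> 0"
  proof (rule LIMSEQ_I)
    fix e :: real assume e: "e > 0"
    then have "e / 2 > 0" by simp
    then obtain N where N: "\<And>m n. m \<ge> N \<Longrightarrow> n \<ge> N \<Longrightarrow> (LINT x|M. (g m x - g n x)\<^sup>2) < e / 2"
      using Cau by meson
    have "(LINT x|M. (g n x - h x)\<^sup>2) \<le> e / 2" if "n \<ge> N" for n
      using main[of N n "e/2"] N that e by (auto simp: less_imp_le)
    then show "\<exists>no. \<forall>n\<ge>no. norm ((LINT x|M. (g n x - h x)\<^sup>2) - 0) < e"
      using e by (intro exI[of _ N]) (force simp: Bochner_Integration.integral_nonneg)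
  qed
qed

text \<open>On a sigma-finite space there is a positive integrable weight \<phi> \<le> 1, and \<phi>
  is then square integrable as well. Multiplication by \<phi> turns a Cauchy sequence of square
  integrable functions into one in the integral norm, which has an almost everywhere Cauchy
  subsequence; division by \<phi> > 0 undoes the multiplication.\<close>

lemma L2_complete:
  assumes "sigma_finite_measure M" and g: "\<And>n. L2 M (g n)"
    and Cau: "\<And>e. e > 0 \<Longrightarrow> \<exists>N. \<forall>m\<ge>N. \<forall>n\<ge>N. (LINT x|M. (g m x - g n x)\<^sup>2) < e"
  obtains h where "L2 M h" "(\<lambda>n. LINT x|M. (g n x - h x)\<^sup>2) \<longlonglongrightarrow> 0"
proof -
  interpret sigma_finite_measure M by fact
  obtain \<phi> :: "'a \<Rightarrow> real" where ph: "\<phi> \<in> borel_measurable M" "\<And>x. 0 < \<phi> x" "\<And>x. \<phi> x \<le> 1" "integrable M \<phi>"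
    using obtain_positive_integrable_function by blast
  have L2ph: "L2 M \<phi>"
    unfolding L2_def
  proof
    have "norm ((\<phi> x)\<^sup>2) \<le> norm (\<phi> x)" for x
      using ph(2,3)[of x] by (simp add: power2_eq_square mult_left_le)
    then show "integrable M (\<lambda>x. (\<phi> x)\<^sup>2)"
      using ph(1) by (intro Bochner_Integration.integrable_bound[OF ph(4)] AE_I2) auto
  qed (rule ph(1))
  define P where "P = (LINT x|M. (\<phi> x)\<^sup>2)"
  have P: "P \<ge> 0" unfolding P_def by (rule Bochner_Integration.integral_nonneg) simp
  have gm: "g n \<in> borel_measurable M" for n using g[of n] by (simp add: L2_def)
  obtain r where r: "strict_mono r" "AE x in M. Cauchy (\<lambda>i. g (r i) x * \<phi> x)"
  proof (rule cauchy_L1_AE_cauchy_subseq[of M "\<lambda>n x. g n x * \<phi> x"])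
    show "integrable M (\<lambda>x. g n x * \<phi> x)" for n by (rule L2_mult_integrable[OF g L2ph])
    fix e :: real assume e: "e > 0"
    have "e\<^sup>2 / (P + 1) > 0" using e P by simp
    then obtain N where N: "\<And>m n. m \<ge> N \<Longrightarrow> n \<ge> N \<Longrightarrow> (LINT x|M. (g m x - g n x)\<^sup>2) < e\<^sup>2 / (P + 1)"
      using Cau by meson
    have "(LINT x|M. norm (g i x * \<phi> x - g j x * \<phi> x)) < e" if "i \<ge> N" "j \<ge> N" for i j
    proof -
      let ?I = "LINT x|M. \<bar>g i x - g j x\<bar> * \<phi> x"
      have eq: "norm (g i x * \<phi> x - g j x * \<phi> x) = \<bar>g i x - g j x\<bar> * \<phi> x" for x
        using ph(2)[of x] by (simp add: abs_mult flip: left_diff_distrib)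
      have "?I\<^sup>2 \<le> (LINT x|M. \<bar>g i x - g j x\<bar>\<^sup>2) * P"
        unfolding P_def by (intro L2_Cauchy_Schwarz L2_abs L2_diff g L2ph)
      also have "\<dots> \<le> e\<^sup>2 / (P + 1) * P"
        using N[OF that] P by (intro mult_right_mono) auto
      also have "\<dots> < e\<^sup>2" using e P by (simp add: field_simps)
      finally have "?I < e" using e by (simp add: power_less_imp_less_base)
      then show ?thesis by (simp only: eq)
    qed
    then show "\<exists>N. \<forall>i\<ge>N. \<forall>j\<ge>N. (LINT x|M. norm (g i x * \<phi> x - g j x * \<phi> x)) < e" by blast
  qed
  have conv: "AE x in M. (\<lambda>i. g (r i) x) \<longlonglongrightarrow> lim (\<lambda>i. g (r i) x)"
    using r(2)
  proof (rule AE_mp, intro AE_I2 impI)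
    fix x assume "Cauchy (\<lambda>i. g (r i) x * \<phi> x)"
    then obtain L where "(\<lambda>i. g (r i) x * \<phi> x) \<longlonglongrightarrow> L" by (meson convergent_eq_Cauchy)
    then have "(\<lambda>i. g (r i) x * \<phi> x / \<phi> x) \<longlonglongrightarrow> L / \<phi> x" using ph(2)[of x] by (intro tendsto_intros) auto
    then have "convergent (\<lambda>i. g (r i) x)" using ph(2)[of x] by (auto simp: convergent_def)
    then show "(\<lambda>i. g (r i) x) \<longlonglongrightarrow> lim (\<lambda>i. g (r i) x)" by (simp add: convergent_LIMSEQ_iff)
  qed
  define h where "h = (\<lambda>x. lim (\<lambda>i. g (r i) x))"
  have hm [measurable]: "h \<in> borel_measurable M" unfolding h_def using gm by measurable
  show thesis
    using that L2_Cauchy_limit[OF g Cau r(1), of h] conv hm by (simp add: h_def)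
qed

section \<open>Weak derivatives on an interval\<close>

lemma sets_borel_is_interval:
  fixes D :: "real set" assumes "is_interval D" shows "D \<in> sets borel"
  using assms by (simp add: real_interval_borel_measurable)

lemma square_integrable_iff_L2:
  assumes "D \<in> sets borel"
  shows "square_integrable D f \<longleftrightarrow> L2 (restrict_space lborel D) f"
proof -
  have D: "D \<inter> space lborel \<in> sets lborel" using assms by simp
  show ?thesis
    unfolding square_integrable_def L2_def set_borel_measurable_def set_integrable_def
      borel_measurable_restrict_space_iff[OF D] integrable_restrict_space[OF D] by simp
qed

lemma set_integral_restrict:
  assumes "D \<in> sets borel"
  shows "(LINT t:D|lborel. f t) = (LINT t|restrict_space lborel D. (f t::real))"
  using assms by (simp add: set_lebesgue_integral_def integral_restrict_space)

lemma set_integrable_restrict: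
  assumes "D \<in> sets borel"
  shows "set_integrable lborel D f \<longleftrightarrow> integrable (restrict_space lborel D) (f::real \<Rightarrow> real)"
  using assms by (simp add: set_integrable_def integrable_restrict_space)

lemma square_integrable_subset:
  assumes "square_integrable D f" "A \<in> sets borel" "A \<subseteq> D"
  shows "square_integrable A f"
proof -
  have "set_borel_measurable lborel A f"
    using assms by (intro set_borel_measurable_subset[of lborel D f A]) (auto simp: square_integrable_def)
  moreover have "set_integrable lborel A (\<lambda>t. (f t)\<^sup>2)"
    using assms by (intro set_integrable_subset[of lborel D _ A]) (auto simp: square_integrable_def)
  ultimately show ?thesis by (simp add: square_integrable_def)
qed

lemma integrable_indicator_Icc: "integrable lborel (indicat_real {s..t::real})"
  by (cases "s \<le> t") (auto intro!: integrable_real_indicator)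

lemma L2_const_Icc: "L2 (restrict_space lborel {s..t::real}) (\<lambda>_. c)"
  unfolding L2_def by (simp add: integrable_restrict_space integrable_indicator_Icc del: integrable_const lebesgue_integral_const)

lemma square_integrable_imp_integrable_Icc:
  assumes "square_integrable D g" "{s..t} \<subseteq> D"
  shows "set_integrable lborel {s..t} g"
proof -
  have "L2 (restrict_space lborel {s..t}) g"
    using square_integrable_subset[OF assms(1) _ assms(2)] by (simp add: square_integrable_iff_L2)
  then have "integrable (restrict_space lborel {s..t}) (\<lambda>x. g x * 1)"
    by (rule L2_mult_integrable[OF _ L2_const_Icc])
  then show ?thesis by (simp add: set_integrable_restrict)
qed

lemma set_integral_Icc_combine:
  fixes g :: "real \<Rightarrow> real"
  assumes "set_integrable lborel {a..c} g" "a \<le> b" "b \<le> c"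
  shows "(LINT u:{a..c}|lborel. g u) = (LINT u:{a..b}|lborel. g u) + (LINT u:{b..c}|lborel. g u)"
proof -
  have "set_integrable lborel {a..b} g" "set_integrable lborel {b..c} g"
    using assms by (auto intro: set_integrable_subset)
  then show ?thesis
    using assms Henstock_Kurzweil_Integration.integral_combine[of a b c g] by (simp add: set_borel_integral_eq_integral)
qed

definition H1_pair :: "real set \<Rightarrow> (real \<Rightarrow> real) \<Rightarrow> (real \<Rightarrow> real) \<Rightarrow> bool" where
  "H1_pair D f g \<longleftrightarrow> square_integrable D f \<and> square_integrable D g \<and>
     (\<forall>s\<in>D. \<forall>t\<in>D. s \<le> t \<longrightarrow> f t - f s = (LINT u:{s..t}|lborel. g u))"

lemma Icc_subset_interval:
  fixes D :: "real set"
  assumes "is_interval D" "s \<in> D" "t \<in> D" shows "{s..t} \<subseteq> D"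
  using mem_is_interval_1_I[OF assms] by auto

text \<open>Cauchy-Schwarz against the constant 1, whose square has integral t - s.\<close>

lemma L2_integral_Icc_sq_le:
  assumes g: "square_integrable D g" and D: "D \<in> sets borel" "{s..t} \<subseteq> D" "s \<le> t"
  shows "(LINT u:{s..t}|lborel. \<bar>g u\<bar>)\<^sup>2 \<le> (t - s) * (LINT u:D|lborel. (g u)\<^sup>2)"
proof -
  let ?M = "restrict_space lborel {s..t}"
  have L: "L2 ?M g"
    using square_integrable_subset[OF g _ D(2)] by (simp add: square_integrable_iff_L2)
  have st: "{s..t} \<in> sets borel" by simp
  have 1: "(LINT u|?M. (1::real)\<^sup>2) = t - s"
  proof -
    have "(LINT u|?M. (1::real)\<^sup>2) = (LINT u|lborel. indicat_real {s..t} u *\<^sub>R 1)"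
      by (subst integral_restrict_space) simp_all
    then show ?thesis using D(3) by simp
  qed
  have 2: "(LINT u|?M. \<bar>g u\<bar>\<^sup>2) = (LINT u:{s..t}|lborel. (g u)\<^sup>2)"
    unfolding set_integral_restrict[OF st] by (simp only: power2_abs)
  have i: "set_integrable lborel D (\<lambda>u. (g u)\<^sup>2)" using g by (simp add: square_integrable_def)
  have 3: "(LINT u:{s..t}|lborel. (g u)\<^sup>2) \<le> (LINT u:D|lborel. (g u)\<^sup>2)"
    unfolding set_lebesgue_integral_def
  proof (rule integral_mono)
    show "integrable lborel (\<lambda>u. indicat_real {s..t} u *\<^sub>R (g u)\<^sup>2)"
      using set_integrable_subset[OF i _ D(2)] by (simp add: set_integrable_def)
    show "integrable lborel (\<lambda>u. indicat_real D u *\<^sub>R (g u)\<^sup>2)"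
      using i by (simp add: set_integrable_def)
    show "indicat_real {s..t} u *\<^sub>R (g u)\<^sup>2 \<le> indicat_real D u *\<^sub>R (g u)\<^sup>2" for u
      using D(2) by (auto simp: indicator_def)
  qed
  have "(LINT u|?M. \<bar>g u\<bar> * 1)\<^sup>2 \<le> (LINT u|?M. \<bar>g u\<bar>\<^sup>2) * (LINT u|?M. 1\<^sup>2)"
    by (rule L2_Cauchy_Schwarz[OF L2_abs[OF L] L2_const_Icc])
  also have "\<dots> \<le> (LINT u:D|lborel. (g u)\<^sup>2) * (t - s)"
    unfolding 1 2 using 3 D(3) by (intro mult_right_mono) auto
  finally show ?thesis
    unfolding set_integral_restrict[OF st, of "\<lambda>u. \<bar>g u\<bar>"] by (simp add: mult.commute)
qed

lemma abs_set_integral_le: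
  "\<bar>LINT u:A|M. (g u::real)\<bar> \<le> (LINT u:A|M. \<bar>g u\<bar>)"
proof -
  have "\<bar>LINT u|M. indicator A u *\<^sub>R g u\<bar> \<le> (LINT u|M. norm (indicator A u *\<^sub>R g u))"
    using integral_norm_bound[of M "\<lambda>u. indicator A u *\<^sub>R g u"] unfolding real_norm_def .
  also have "(\<lambda>u. norm (indicator A u *\<^sub>R g u)) = (\<lambda>u. indicator A u *\<^sub>R \<bar>g u\<bar>)"
    by (auto simp: indicator_def)
  finally show ?thesis by (simp only: set_lebesgue_integral_def)
qed

text \<open>Squared form of Hoelder continuity with exponent 1/2. The modulus depends only on the
  integral of g^2, so functions of bounded energy are equicontinuous.\<close>

lemma H1_pair_Hoelder:
  assumes "H1_pair D f g" "is_interval D" "s \<in> D" "t \<in> D"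
  shows "(f t - f s)\<^sup>2 \<le> \<bar>t - s\<bar> * (LINT u:D|lborel. (g u)\<^sup>2)"
proof -
  have *: "(f t - f s)\<^sup>2 \<le> (t - s) * (LINT u:D|lborel. (g u)\<^sup>2)" if "s \<in> D" "t \<in> D" "s \<le> t" for s t
  proof -
    have "f t - f s = (LINT u:{s..t}|lborel. g u)"
      using assms(1) that by (auto simp: H1_pair_def)
    then have "\<bar>f t - f s\<bar> \<le> (LINT u:{s..t}|lborel. \<bar>g u\<bar>)"
      by (simp only: abs_set_integral_le)
    from power_mono[OF this, of 2] have "(f t - f s)\<^sup>2 \<le> (LINT u:{s..t}|lborel. \<bar>g u\<bar>)\<^sup>2"
      by simp
    also have "\<dots> \<le> (t - s) * (LINT u:D|lborel. (g u)\<^sup>2)"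
      using assms that by (intro L2_integral_Icc_sq_le Icc_subset_interval)
        (auto simp: H1_pair_def sets_borel_is_interval)
    finally show ?thesis .
  qed
  show ?thesis
  proof (cases "s \<le> t")
    case True then show ?thesis using *[of s t] assms by simp
  next
    case False then show ?thesis using *[of t s] assms by (simp add: power2_commute)
  qed
qed

lemma H1_pair_continuous:
  assumes "H1_pair D f g" "is_interval D"
  shows "continuous_on D f"
proof -
  define E where "E = (LINT u:D|lborel. (g u)\<^sup>2)"
  have "E \<ge> 0" unfolding E_def set_lebesgue_integral_def by (rule Bochner_Integration.integral_nonneg) (auto simp: indicator_def)
  show ?thesis
    unfolding continuous_on_iff
  proof (intro ballI allI impI)
    fix s and e :: real assume s: "s \<in> D" "e > 0"
    define d where "d = e\<^sup>2 / (E + 1)"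
    have "d > 0" using s \<open>E \<ge> 0\<close> by (auto simp: d_def)
    have "dist (f t) (f s) < e" if "t \<in> D" "dist t s < d" for t
    proof -
      have "(f t - f s)\<^sup>2 \<le> \<bar>t - s\<bar> * E"
        unfolding E_def using assms s that by (intro H1_pair_Hoelder)
      also have "\<dots> \<le> d * E" using that \<open>E \<ge> 0\<close> by (intro mult_right_mono) (auto simp: dist_real_def)
      also have "\<dots> < e\<^sup>2" using \<open>E \<ge> 0\<close> s by (simp add: d_def field_simps)
      finally have "\<bar>f t - f s\<bar>\<^sup>2 < e\<^sup>2" by simp
      then have "\<bar>f t - f s\<bar> < e" by (rule power2_less_imp_less) (use s in simp)
      then show ?thesis by (simp add: dist_real_def)
    qed
    then show "\<exists>d>0. \<forall>t\<in>D. dist t s < d \<longrightarrow> dist (f t) (f s) < e" using \<open>d > 0\<close> by blast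
  qed
qed

lemma H1_pair_lincomb:
  assumes "H1_pair D f g" "H1_pair D f' g'" "is_interval D"
  shows "H1_pair D (\<lambda>t. a * f t + b * f' t) (\<lambda>t. a * g t + b * g' t)"
  unfolding H1_pair_def
proof (intro conjI ballI impI)
  have D: "D \<in> sets borel" using assms(3) by (rule sets_borel_is_interval)
  show "square_integrable D (\<lambda>t. a * f t + b * f' t)" "square_integrable D (\<lambda>t. a * g t + b * g' t)"
    using assms D by (auto simp: H1_pair_def square_integrable_iff_L2 intro: L2_lincomb)
  fix s t assume st: "s \<in> D" "t \<in> D" "s \<le> t"
  have i: "set_integrable lborel {s..t} g" "set_integrable lborel {s..t} g'"
    using assms(1,2) Icc_subset_interval[OF assms(3) st(1,2)]
    by (auto intro: square_integrable_imp_integrable_Icc simp: H1_pair_def)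
  have "(LINT u:{s..t}|lborel. a * g u + b * g' u) =
      a * (LINT u:{s..t}|lborel. g u) + b * (LINT u:{s..t}|lborel. g' u)"
    using i by (simp add: set_integral_add(2))
  also have "\<dots> = a * (f t - f s) + b * (f' t - f' s)" using assms st by (simp add: H1_pair_def)
  finally show "a * f t + b * f' t - (a * f s + b * f' s) = (LINT u:{s..t}|lborel. a * g u + b * g' u)"
    by (simp add: algebra_simps)
qed

section \<open>Test functions and integration by parts\<close>

lemma test_function_has_deriv:
  assumes "test_function I \<phi>"
  shows "(\<phi> has_real_derivative deriv \<phi> x) (at x)" "continuous_on UNIV (deriv \<phi>)"
proof -
  obtain D where D: "\<And>x. (\<phi> has_vector_derivative D x) (at x)" "continuous_on UNIV D"
    using assms by (auto simp: test_function_def C1_differentiable_on_def)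
  then have d: "(\<phi> has_real_derivative D x) (at x)" for x
    by (simp add: has_real_derivative_iff_has_vector_derivative)
  then have "deriv \<phi> = D" using DERIV_imp_deriv by blast
  with d D show "(\<phi> has_real_derivative deriv \<phi> x) (at x)" "continuous_on UNIV (deriv \<phi>)" by auto
qed

text \<open>The support is compact in the interior of D, which leaves room on both sides: the
  interval can be taken larger than the support, so that \<phi> vanishes at a and b themselves and
  no boundary terms appear later.\<close>

lemma test_function_support:
  assumes "test_function D \<phi>" "is_interval D" "D \<noteq> {}"
  obtains a b where "a \<le> b" "{a..b} \<subseteq> D" "\<And>t. t \<notin> {a<..<b} \<Longrightarrow> \<phi> t = 0" "\<And>t. t \<notin> {a..b} \<Longrightarrow> deriv \<phi> t = 0"
proof -
  define K where "K = closure {t. \<phi> t \<noteq> 0}"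
  have K: "compact K" "K \<subseteq> interior D" using assms by (auto simp: test_function_def K_def)
  have z: "\<phi> t = 0" if "t \<notin> K" for t using that closure_subset[of "{t. \<phi> t \<noteq> 0}"] by (auto simp: K_def)
  have dz: "deriv \<phi> t = 0" if "t \<notin> K" for t
  proof -
    have "open (- K)" using K(1) compact_imp_closed by blast
    have "((\<lambda>_. 0) has_real_derivative deriv \<phi> t) (at t)"
      by (rule has_field_derivative_transform_within_open[OF test_function_has_deriv(1)[OF assms(1)] \<open>open (- K)\<close>])
         (use that z in auto)
    then show ?thesis using DERIV_unique DERIV_const by blast
  qed
  show thesis
  proof (cases "K = {}")
    case True
    \<comment> \<open>If \<phi> vanishes identically, a degenerate interval at any point of D will
      do.\<close>
    obtain a where "a \<in> D" using assms by auto
    then show thesis using that[of a a] z dz True by auto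
  next
    case False
    obtain p where p: "p \<in> K" "\<And>x. x \<in> K \<Longrightarrow> p \<le> x" using compact_attains_inf[OF K(1) False] by blast
    obtain q where q: "q \<in> K" "\<And>x. x \<in> K \<Longrightarrow> x \<le> q" using compact_attains_sup[OF K(1) False] by blast
    obtain e1 where e1: "e1 > 0" "ball p e1 \<subseteq> D"
      using p K by (meson interior_subset open_contains_ball open_interior subset_iff order_trans)
    obtain e2 where e2: "e2 > 0" "ball q e2 \<subseteq> D"
      using q K by (meson interior_subset open_contains_ball open_interior subset_iff order_trans)
    have a: "p - e1/2 \<in> D" using e1 by (auto simp: subset_iff dist_real_def)
    have b: "q + e2/2 \<in> D" using e2 by (auto simp: subset_iff dist_real_def)
    show thesis
    proof (rule that[of "p - e1/2" "q + e2/2"])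
      show "p - e1/2 \<le> q + e2/2" using p q e1 e2 by force
      show "{p - e1/2..q + e2/2} \<subseteq> D" by (rule Icc_subset_interval[OF assms(2) a b])
      show "\<phi> t = 0" if "t \<notin> {p - e1/2<..<q + e2/2}" for t
        using z[of t] that p(2)[of t] q(2)[of t] e1 e2 by force
      show "deriv \<phi> t = 0" if "t \<notin> {p - e1/2..q + e2/2}" for t
        using dz[of t] that p(2)[of t] q(2)[of t] e1 e2 by force
    qed
  qed
qed

lemma set_integral_restrict_support:
  assumes "A \<subseteq> D" "\<And>t. t \<in> D \<Longrightarrow> t \<notin> A \<Longrightarrow> f t = 0"
  shows "(LINT t:D|M. f t) = (LINT t:A|M. (f t :: real))"
  unfolding set_lebesgue_integral_def
  by (rule Bochner_Integration.integral_cong) (use assms in \<open>auto simp: indicator_def\<close>)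

text \<open>Integration by parts without differentiability of f: Fubini's theorem for \<phi>'(t)
  g(u) on the triangle t \<le> u. Integrating in t first gives g(u) \<phi>(u), integrating in u
  first gives \<phi>'(t) (f(b) - f(t)).\<close>

lemma H1_pair_imp_weak_deriv:
  assumes H: "H1_pair D f g" and D: "is_interval D" "D \<noteq> {}"
  shows "is_weak_deriv D f g"
  unfolding is_weak_deriv_def
proof (intro allI impI)
  fix \<phi> assume \<phi>: "test_function D \<phi>"
  obtain a b where ab: "a \<le> b" "{a..b} \<subseteq> D" "\<And>t. t \<notin> {a<..<b} \<Longrightarrow> \<phi> t = 0" "\<And>t. t \<notin> {a..b} \<Longrightarrow> deriv \<phi> t = 0"
    using test_function_support[OF \<phi> D] by metis
  note d\<phi> = test_function_has_deriv[OF \<phi>]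
  have gi: "set_integrable lborel {a..b} g"
    using H ab by (auto intro: square_integrable_imp_integrable_Icc simp: H1_pair_def)
  have di: "set_integrable lborel {a..b} (deriv \<phi>)"
    using d\<phi>(2) by (intro borel_integrable_atLeastAtMost') (auto intro: continuous_on_subset)
  define G where "G u = indicator {a..b} u * g u" for u
  define P where "P t = indicator {a..b} t * deriv \<phi> t" for t
  have G: "integrable lborel G" using gi by (simp add: set_integrable_def G_def[abs_def])
  have P: "integrable lborel P" using di by (simp add: set_integrable_def P_def[abs_def])
  have Gm [measurable]: "G \<in> borel_measurable borel" using G by (simp add: integrable_iff_bounded)
  have Pm [measurable]: "P \<in> borel_measurable borel" using P by (simp add: integrable_iff_bounded)
  \<comment> \<open>The triangle t \<le> u is built into the kernel, so that both iterated integrals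
    range over the whole line; the cut-offs in \<open>P\<close> and \<open>G\<close> restrict it to
    [a, b].\<close>
  define K where "K t u = (if t \<le> u then P t * G u else 0)" for t u
  have PG: "integrable (lborel \<Otimes>\<^sub>M lborel) (\<lambda>(t,u). P t * G u)"
  proof (rule lborel_pair.Fubini_integrable)
    have "(\<lambda>x. LINT y|lborel. norm (case (x, y) of (t, u) \<Rightarrow> P t * G u)) = (\<lambda>x. \<bar>P x\<bar> * (LINT y|lborel. \<bar>G y\<bar>))"
      by (simp add: abs_mult)
    then show "integrable lborel (\<lambda>x. LINT y|lborel. norm (case (x, y) of (t, u) \<Rightarrow> P t * G u))"
      using P by simp
  qed (use G in auto)
  have K: "integrable (lborel \<Otimes>\<^sub>M lborel) (case_prod K)"
    by (rule Bochner_Integration.integrable_bound[OF PG]) (auto simp: K_def[abs_def])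
  have fub: "(LINT u|lborel. LINT t|lborel. K t u) = (LINT t|lborel. LINT u|lborel. K t u)"
    by (rule lborel_pair.Fubini_integral[OF K])
  have inner1: "(LINT t|lborel. K t u) = G u * \<phi> u" for u
  proof (cases "u \<in> {a..b}")
    case True
    have "(LINT t|lborel. K t u) = (LINT t|lborel. G u * (deriv \<phi> t * indicator {a..u} t))"
      by (rule Bochner_Integration.integral_cong) (use True in \<open>auto simp: K_def P_def indicator_def\<close>)
    also have "\<dots> = G u * (LINT t|lborel. deriv \<phi> t * indicator {a..u} t)" by simp
    also have "(LINT t|lborel. deriv \<phi> t * indicator {a..u} t) = \<phi> u - \<phi> a"
      using True d\<phi> by (intro integral_FTC_Icc_real) (auto simp: continuous_on_eq_continuous_at)
    also have "\<phi> a = 0" using ab by auto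
    finally show ?thesis by simp
  next
    case False then have "G u = 0" by (simp add: G_def)
    then have "K t u = 0" for t by (simp add: K_def)
    then show ?thesis using \<open>G u = 0\<close> by simp
  qed
  have inner2: "(LINT u|lborel. K t u) = P t * (f b - f t)" for t
  proof (cases "t \<in> {a..b}")
    case True
    have "(LINT u|lborel. K t u) = (LINT u|lborel. P t * (indicator {t..b} u *\<^sub>R g u))"
      by (rule Bochner_Integration.integral_cong) (use True in \<open>auto simp: K_def G_def indicator_def\<close>)
    also have "\<dots> = P t * (LINT u:{t..b}|lborel. g u)" by (simp add: set_lebesgue_integral_def)
    also have "(LINT u:{t..b}|lborel. g u) = f b - f t"
    proof -
      have "t \<in> D" "b \<in> D" "t \<le> b" using True ab by auto
      then show ?thesis using H by (simp add: H1_pair_def)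
    qed
    finally show ?thesis .
  next
    case False then have "P t = 0" by (simp add: P_def)
    then have "K t u = 0" for u by (simp add: K_def)
    then show ?thesis using \<open>P t = 0\<close> by simp
  qed
  have fP: "integrable lborel (\<lambda>t. P t * f t)"
  proof -
    have "continuous_on {a..b} (\<lambda>t. deriv \<phi> t * f t)"
      using H1_pair_continuous[OF H D(1)] ab d\<phi>
      by (intro continuous_intros) (auto intro: continuous_on_subset)
    from borel_integrable_atLeastAtMost'[OF this] show ?thesis
      by (simp add: set_integrable_def P_def mult.assoc)
  qed
  have "(LINT t|lborel. P t) = \<phi> b - \<phi> a"
    using integral_FTC_Icc_real[of a b \<phi> "deriv \<phi>"] ab(1) d\<phi>
    by (simp add: P_def mult.commute continuous_on_eq_continuous_at)
  \<comment> \<open>This removes the constant f(b) from the iterated integral.\<close>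
  then have P0: "(LINT t|lborel. P t) = 0" using ab(3)[of a] ab(3)[of b] by simp
  have "(LINT t:D|lborel. f t * deriv \<phi> t) = (LINT t:{a..b}|lborel. f t * deriv \<phi> t)"
    by (rule set_integral_restrict_support) (use ab in auto)
  also have "\<dots> = (LINT t|lborel. P t * f t)"
    by (simp add: set_lebesgue_integral_def P_def mult_ac)
  also have "\<dots> = - (LINT t|lborel. P t * (f b - f t))"
    using fP P P0 by (simp add: right_diff_distrib)
  also have "\<dots> = - (LINT u|lborel. G u * \<phi> u)"
    using fub inner1 inner2 by simp
  also have "(LINT u|lborel. G u * \<phi> u) = (LINT t:{a..b}|lborel. g t * \<phi> t)"
    by (simp add: set_lebesgue_integral_def G_def mult_ac)
  also have "\<dots> = (LINT t:D|lborel. g t * \<phi> t)"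
    by (rule set_integral_restrict_support[symmetric]) (use ab in auto)
  finally show "(LINT t:D|lborel. f t * deriv \<phi> t) = - (LINT t:D|lborel. g t * \<phi> t)" .
qed

section \<open>Smooth steps and the passage from weak derivatives to increments\<close>

definition ramp_sq :: "real \<Rightarrow> real" where "ramp_sq x = (max 0 x)\<^sup>2"

lemma ramp_sq_deriv: "(ramp_sq has_real_derivative 2 * max 0 x) (at x)"
proof -
  consider "x > 0" | "x < 0" | "x = 0" by linarith
  then show ?thesis
  proof cases
    case 1
    have "((\<lambda>x. x\<^sup>2) has_real_derivative 2 * x) (at x)" by (auto intro!: derivative_eq_intros)
    then have "(ramp_sq has_real_derivative 2 * x) (at x)"
      by (rule has_field_derivative_transform_within_open[of _ _ _ "{0<..}"]) (use 1 in \<open>auto simp: ramp_sq_def\<close>)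
    then show ?thesis using 1 by simp
  next
    case 2
    have "(ramp_sq has_real_derivative 0) (at x)"
      by (rule has_field_derivative_transform_within_open[of "\<lambda>_. 0" _ _ "{..<0}"]) (use 2 in \<open>auto simp: ramp_sq_def\<close>)
    then show ?thesis using 2 by simp
  next
    case 3
    \<comment> \<open>At 0 the difference quotient is h or 0, hence at most |h|.\<close>
    have "((\<lambda>h. (ramp_sq (0 + h) - ramp_sq 0) / h) \<longlongrightarrow> 0) (at 0)"
    proof (rule tendsto_norm_zero_cancel, rule tendsto_0_le[of "\<lambda>h. h" _ _ 1])
      have "norm (norm ((ramp_sq (0 + h) - ramp_sq 0) / h)) \<le> norm h * 1" for h :: real
        by (cases "h = 0"; cases "h > 0") (auto simp: ramp_sq_def power2_eq_square)
      then show "\<forall>\<^sub>F h in at 0. norm (norm ((ramp_sq (0 + h) - ramp_sq 0) / h)) \<le> norm (h::real) * 1" by simp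
    qed (simp add: tendsto_ident_at)
    then show ?thesis unfolding 3 DERIV_def by simp
  qed
qed

text \<open>\<open>tent\<close> is the continuous tent of mass 1 on [0,1], and \<open>smooth_step\<close> is its primitive.\<close>

definition tent :: "real \<Rightarrow> real" where
  "tent x = 4 * (max 0 x - 2 * max 0 (x - 1/2) + max 0 (x - 1))"

definition smooth_step :: "real \<Rightarrow> real" where
  "smooth_step x = 2 * (ramp_sq x - 2 * ramp_sq (x - 1/2) + ramp_sq (x - 1))"

lemma smooth_step_deriv: "(smooth_step has_real_derivative tent x) (at x)"
proof -
  have r: "((\<lambda>x. ramp_sq (x - c)) has_real_derivative 2 * max 0 (x - c)) (at x)" for c
    using DERIV_shift[of ramp_sq "2 * max 0 (x - c)" x "- c"] ramp_sq_deriv[of "x - c"] by simp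
  have "((\<lambda>x. 2 * (ramp_sq x - 2 * ramp_sq (x - 1/2) + ramp_sq (x - 1))) has_real_derivative
      2 * (2 * max 0 x - 2 * (2 * max 0 (x - 1/2)) + 2 * max 0 (x - 1))) (at x)"
    by (intro DERIV_cmult DERIV_add DERIV_diff r ramp_sq_deriv)
  moreover have "smooth_step = (\<lambda>x. 2 * (ramp_sq x - 2 * ramp_sq (x - 1/2) + ramp_sq (x - 1)))"
    by (auto simp: smooth_step_def)
  moreover have "2 * (2 * max 0 x - 2 * (2 * max 0 (x - 1/2)) + 2 * max 0 (x - 1)) = tent x"
    unfolding tent_def by (simp add: algebra_simps)
  ultimately show ?thesis by simp
qed

lemma tent_continuous: "continuous_on A tent"
  unfolding tent_def by (intro continuous_intros)

lemma tent_bounds: "0 \<le> tent x" "tent x \<le> 2" "x \<notin> {0<..<1} \<Longrightarrow> tent x = 0"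
  unfolding tent_def by (auto simp: max_def)

lemma smooth_step_bounds: "x \<le> 0 \<Longrightarrow> smooth_step x = 0" "x \<ge> 1 \<Longrightarrow> smooth_step x = 1"
    "0 \<le> smooth_step x" "smooth_step x \<le> 1"
proof -
  show 1: "x \<le> 0 \<Longrightarrow> smooth_step x = 0" for x by (auto simp: smooth_step_def ramp_sq_def max_def)
  show 2: "x \<ge> 1 \<Longrightarrow> smooth_step x = 1" for x
    by (auto simp: smooth_step_def ramp_sq_def max_def power2_eq_square algebra_simps)
  have mono: "smooth_step x \<le> smooth_step y" if "x \<le> y" for x y
    by (rule DERIV_nonneg_imp_nondecreasing[OF that]) (use smooth_step_deriv tent_bounds in blast)
  show "0 \<le> smooth_step x" using mono[of "min x 0" x] 1[of "min x 0"] by simp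
  show "smooth_step x \<le> 1" using mono[of x "max x 1"] 2[of "max x 1"] by simp
qed

lemma tent_integral: "has_bochner_integral lborel tent 1"
proof -
  have "has_bochner_integral lborel (\<lambda>x. tent x * indicator {0..1} x) (smooth_step 1 - smooth_step 0)"
    using smooth_step_deriv tent_continuous[of UNIV]
    by (intro has_bochner_integral_FTC_Icc_real) (auto simp: continuous_on_eq_continuous_at)
  moreover have "tent x * indicator {0..1} x = tent x" for x
    using tent_bounds(3)[of x] by (cases "x \<in> {0<..<1}") auto
  then have "(\<lambda>x. tent x * indicator {0..1} x) = tent" by blast
  ultimately show ?thesis by (simp add: smooth_step_bounds)
qed

text \<open>One-sided mollification: the rescaled tents have mass 1 and vanish outside the interval
  from s to s + 1 / c k, which is contained in [s, s + \<delta>]. Only values of f to the right of s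
  enter.\<close>

lemma tent_average_tendsto:
  fixes f :: "real \<Rightarrow> real"
  assumes f: "continuous_on {s..s+\<delta>} f" and d: "\<delta> > 0"
  defines "c k \<equiv> real (Suc k) / \<delta>"
  shows "integrable lborel (\<lambda>x. indicator {s..s+\<delta>} x * f x * (c k * tent (c k * (x - s))))"
    and "(\<lambda>k. LINT x|lborel. indicator {s..s+\<delta>} x * f x * (c k * tent (c k * (x - s)))) \<longlonglongrightarrow> f s"
proof -
  have c: "c k > 0" "1 / c k \<le> \<delta>" for k using d by (auto simp: c_def field_simps)
  show int: "integrable lborel (\<lambda>x. indicator {s..s+\<delta>} x * f x * (c k * tent (c k * (x - s))))" for k
  proof -
    have "continuous_on {s..s+\<delta>} (\<lambda>x. f x * (c k * tent (c k * (x - s))))"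
      by (intro continuous_intros f continuous_on_compose2[OF tent_continuous[of UNIV]]) auto
    from borel_integrable_atLeastAtMost'[OF this] show ?thesis by (simp add: set_integrable_def mult.assoc)
  qed
  \<comment> \<open>The integrand after the substitution x = s + y / c k. The scale disappears from
    the kernel, and a bound of f on [s, s + \<delta>] times \<open>tent\<close> dominates all
    k.\<close>
  define F where "F k y = indicator {s..s+\<delta>} (s + y / c k) * f (s + y / c k) * tent y" for k y
  have eq: "(LINT x|lborel. indicator {s..s+\<delta>} x * f x * (c k * tent (c k * (x - s)))) = (LINT y|lborel. F k y)" for k
  proof -
    have "(LINT x|lborel. indicator {s..s+\<delta>} x * f x * (c k * tent (c k * (x - s)))) =
      \<bar>1 / c k\<bar> *\<^sub>R (LINT y|lborel. indicator {s..s+\<delta>} (s + 1 / c k * y) * f (s + 1 / c k * y) * (c k * tent (c k * ((s + 1 / c k * y) - s))))"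
      by (rule lborel_integral_real_affine) (use c(1)[of k] in simp)
    also have "\<dots> = (LINT y|lborel. F k y)"
      using c(1)[of k] by (simp add: F_def mult_ac flip: Bochner_Integration.integral_mult_right_zero)
    finally show ?thesis .
  qed
  obtain B where "\<forall>y\<in>f ` {s..s+\<delta>}. norm y \<le> B"
    using compact_imp_bounded[OF compact_continuous_image[OF f compact_Icc]] unfolding bounded_iff by blast
  then have B: "\<And>x. x \<in> {s..s+\<delta>} \<Longrightarrow> \<bar>f x\<bar> \<le> B" by auto
  have Bpos: "B \<ge> 0" using B[of s] d by auto
  have Fm: "F k \<in> borel_measurable lborel" for k
  proof -
    have "(\<lambda>x. indicator {s..s+\<delta>} x * f x) \<in> borel_measurable borel"
      using borel_integrable_atLeastAtMost'[OF f] by (auto simp: set_integrable_def integrable_iff_bounded)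
    then have "(\<lambda>y. (\<lambda>x. indicator {s..s+\<delta>} x * f x) (s + y / c k)) \<in> borel_measurable borel"
      by (rule measurable_compose[rotated]) simp
    moreover have "tent \<in> borel_measurable borel" using tent_continuous[of UNIV] by (rule borel_measurable_continuous_onI)
    ultimately show ?thesis unfolding F_def[abs_def] by simp
  qed
  have "(\<lambda>k. LINT y|lborel. F k y) \<longlonglongrightarrow> (LINT y|lborel. f s * tent y)"
  proof (rule integral_dominated_convergence[where w = "\<lambda>y. B * tent y"])
    show "integrable lborel (\<lambda>y. B * tent y)" using tent_integral by (auto simp: has_bochner_integral_iff)
    show "(\<lambda>y. f s * tent y) \<in> borel_measurable lborel"
      using borel_measurable_continuous_onI[OF tent_continuous] by simp
    show "AE y in lborel. norm (F k y) \<le> B * tent y" for k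
      using B Bpos tent_bounds(1) by (intro AE_I2) (auto simp: F_def indicator_def abs_mult intro!: mult_right_mono)
    show "AE y in lborel. (\<lambda>k. F k y) \<longlonglongrightarrow> f s * tent y"
    proof (rule AE_I2)
      fix y :: real
      show "(\<lambda>k. F k y) \<longlonglongrightarrow> f s * tent y"
      proof (cases "y \<in> {0<..<1}")
        case True
        have in1: "s + y / c k \<in> {s..s+\<delta>}" for k
        proof -
          have "y / c k \<le> 1 / c k" using True c(1)[of k] by (intro divide_right_mono) auto
          then show ?thesis using True c[of k] by auto
        qed
        have "(\<lambda>k. s + y * (\<delta> * inverse (real (Suc k)))) \<longlonglongrightarrow> s + y * (\<delta> * 0)"
          by (intro tendsto_intros LIMSEQ_inverse_real_of_nat)
        then have "(\<lambda>k. s + y / c k) \<longlonglongrightarrow> s" by (simp add: c_def divide_inverse mult_ac)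
        then have "(\<lambda>k. f (s + y / c k)) \<longlonglongrightarrow> f s"
          using f d in1 unfolding continuous_on_sequentially comp_def by (auto simp del: of_nat_Suc)
        then have "(\<lambda>k. f (s + y / c k) * tent y) \<longlonglongrightarrow> f s * tent y" by (intro tendsto_intros)
        moreover have "F k y = f (s + y / c k) * tent y" for k using in1[of k] by (simp add: F_def)
        ultimately show ?thesis by simp
      qed (simp add: F_def tent_bounds)
    qed
  qed (use Fm in auto)
  moreover have one: "(LINT y|lborel. f s * tent y) = f s" using tent_integral by (simp add: has_bochner_integral_iff)
  ultimately show "(\<lambda>k. LINT x|lborel. indicator {s..s+\<delta>} x * f x * (c k * tent (c k * (x - s)))) \<longlonglongrightarrow> f s"
    by (simp only: eq one)
qed

text \<open>The test functions rise from 0 to 1 just to the right of s and fall back just to the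
  right of t. Their derivatives average f near s and, with the opposite sign, near t, while the
  functions themselves tend to the indicator of [s, t] almost everywhere.\<close>

lemma weak_deriv_imp_ftc_interior:
  assumes D: "is_interval D" and f: "continuous_on D f" and g: "square_integrable D g"
    and w: "is_weak_deriv D f g" and s: "s \<in> interior D" and t: "t \<in> interior D" and st: "s < t"
  shows "f t - f s = (LINT u:{s..t}|lborel. g u)"
proof -
  \<comment> \<open>The falling step lives to the right of t, so room inside D is needed there and
    only there.\<close>
  obtain e where e: "e > 0" "cball t e \<subseteq> interior D"
    using t open_interior open_contains_cball by blast
  define \<delta> where "\<delta> = e"
  have d: "\<delta> > 0" "t + \<delta> \<in> interior D" using e by (auto simp: \<delta>_def subset_iff dist_real_def)
  have intD: "is_interval (interior D)" using D by (simp add: is_interval_convex_1 convex_interior)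
  have sub: "{s..t+\<delta>} \<subseteq> interior D" by (rule Icc_subset_interval[OF intD s d(2)])
  have subD: "{s..t+\<delta>} \<subseteq> D" using sub interior_subset by blast
  define c where "c k = real (Suc k) / \<delta>" for k
  have c: "c k > 0" "c k * \<delta> \<ge> 1" for k using d by (auto simp: c_def)
  define \<phi> where "\<phi> k x = smooth_step (c k * (x - s)) - smooth_step (c k * (x - t))" for k x
  define \<psi> where "\<psi> k x = c k * tent (c k * (x - s)) - c k * tent (c k * (x - t))" for k x
  have step: "((\<lambda>x. smooth_step (c k * (x - r))) has_real_derivative c k * tent (c k * (x - r))) (at x)" for k r x
  proof -
    have "((\<lambda>x. c k * (x - r)) has_real_derivative c k) (at x)"
      by (auto intro!: derivative_eq_intros)
    from DERIV_chain[OF smooth_step_deriv this] show ?thesis by (simp add: o_def mult.commute)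
  qed
  have d\<phi>: "(\<phi> k has_real_derivative \<psi> k x) (at x)" for k x
    unfolding \<phi>_def[abs_def] \<psi>_def by (intro DERIV_diff step)
  have deriv_\<phi>: "deriv (\<phi> k) = \<psi> k" for k using DERIV_imp_deriv[OF d\<phi>] by blast
  have \<psi>cont: "continuous_on UNIV (\<psi> k)" for k
    unfolding \<psi>_def[abs_def]
    by (intro continuous_intros continuous_on_compose2[OF tent_continuous[of UNIV]]) auto
  have ge1: "c k * (x - r) \<ge> 1" if "x \<ge> r + \<delta>" for k x r
  proof -
    have "c k * \<delta> \<le> c k * (x - r)" using c(1)[of k] that by (intro mult_left_mono) auto
    then show ?thesis using c(2)[of k] by linarith
  qed
  have \<phi>0: "\<phi> k x = 0" if "x \<notin> {s..t+\<delta>}" for k x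
  proof (cases "x < s")
    case True
    then have "c k * (x - s) \<le> 0" "c k * (x - t) \<le> 0" using c(1)[of k] st by (auto simp: mult_le_0_iff)
    then show ?thesis by (simp add: \<phi>_def smooth_step_bounds)
  next
    case False
    then have "c k * (x - s) \<ge> 1" "c k * (x - t) \<ge> 1" using that st by (auto intro!: ge1)
    then show ?thesis by (simp add: \<phi>_def smooth_step_bounds)
  qed
  have \<phi>1: "\<bar>\<phi> k x\<bar> \<le> 1" for k x
    using smooth_step_bounds(3,4)[of "c k * (x - s)"] smooth_step_bounds(3,4)[of "c k * (x - t)"]
    by (simp add: \<phi>_def abs_le_iff)
  have tf: "test_function D (\<phi> k)" for k
    unfolding test_function_def
  proof (intro conjI)
    show "\<phi> k C1_differentiable_on UNIV"
      unfolding C1_differentiable_on_def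
      using d\<phi> \<psi>cont by (auto simp: has_real_derivative_iff_has_vector_derivative)
    have "{x. \<phi> k x \<noteq> 0} \<subseteq> {s..t+\<delta>}" using \<phi>0 by blast
    then have *: "closure {x. \<phi> k x \<noteq> 0} \<subseteq> {s..t+\<delta>}" by (rule closure_minimal) simp
    then show "closure {x. \<phi> k x \<noteq> 0} \<subseteq> interior D" using sub by blast
    show "compact (closure {x. \<phi> k x \<noteq> 0})"
      using compact_Int_closed[OF compact_Icc[of s "t+\<delta>"] closed_closure[of "{x. \<phi> k x \<noteq> 0}"]] *
      by (simp add: Int_absorb1)
  qed
  have fs: "continuous_on {s..s+\<delta>} f" and ft: "continuous_on {t..t+\<delta>} f"
    using f subD st by (auto intro!: continuous_on_subset[OF f] simp: subset_iff)
  let ?A = "\<lambda>r k x. indicator {r..r+\<delta>} x * f x * (c k * tent (c k * (x - r)))"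
  note tA = tent_average_tendsto[OF fs d(1), folded c_def] and tB = tent_average_tendsto[OF ft d(1), folded c_def]
  have tz: "tent (c k * (x - r)) = 0" if "x \<notin> {r..r+\<delta>}" for k x r
  proof (rule tent_bounds(3))
    show "c k * (x - r) \<notin> {0<..<1}"
    proof (cases "x < r")
      case True then show ?thesis using c(1)[of k] by (auto simp: zero_less_mult_iff)
    next
      case False then show ?thesis using ge1[of r x k] that by auto
    qed
  qed
  have lhs: "(LINT x:D|lborel. f x * deriv (\<phi> k) x) = (LINT x|lborel. ?A s k x) - (LINT x|lborel. ?A t k x)" for k
  proof -
    have pt: "indicator D x *\<^sub>R (f x * \<psi> k x) = ?A s k x - ?A t k x" for x
    proof -
      have a: "indicator D x * (f x * (c k * tent (c k * (x - r)))) = ?A r k x" if "{r..r+\<delta>} \<subseteq> D" for r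
        using tz[of x r k] that by (cases "x \<in> {r..r+\<delta>}") (auto simp: indicator_def)
      have "{s..s+\<delta>} \<subseteq> D" "{t..t+\<delta>} \<subseteq> D" using subD st by auto
      then show ?thesis using a[of s] a[of t] by (simp only: \<psi>_def right_diff_distrib real_scaleR_def)
    qed
    show ?thesis
      unfolding set_lebesgue_integral_def deriv_\<phi> pt by (rule Bochner_Integration.integral_diff[OF tA(1) tB(1)])
  qed
  have lim1: "(\<lambda>k. LINT x:D|lborel. f x * deriv (\<phi> k) x) \<longlonglongrightarrow> f s - f t"
    unfolding lhs by (intro tendsto_diff tA(2) tB(2))
  have gi: "set_integrable lborel {s..t+\<delta>} g" by (rule square_integrable_imp_integrable_Icc[OF g subD])
  have rhs: "(LINT x:D|lborel. g x * \<phi> k x) = (LINT x|lborel. (indicator {s..t+\<delta>} x * g x) * \<phi> k x)" for k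
    unfolding set_lebesgue_integral_def
    by (rule Bochner_Integration.integral_cong) (use \<phi>0 subD in \<open>auto simp: indicator_def\<close>)
  have lim2: "(\<lambda>k. LINT x:D|lborel. g x * \<phi> k x) \<longlonglongrightarrow> (LINT x|lborel. indicator {s..t} x * g x)"
    unfolding rhs
  proof (rule integral_dominated_convergence[where w = "\<lambda>x. \<bar>indicator {s..t+\<delta>} x * g x\<bar>"])
    have gi': "integrable lborel (\<lambda>x. indicator {s..t+\<delta>} x * g x)" using gi by (simp add: set_integrable_def)
    then show "integrable lborel (\<lambda>x. \<bar>indicator {s..t+\<delta>} x * g x\<bar>)" by simp
    have m: "(\<lambda>x. indicator {s..t+\<delta>} x * g x) \<in> borel_measurable lborel" using gi' by (simp add: integrable_iff_bounded)
    have "\<phi> k \<in> borel_measurable lborel" for k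
      using d\<phi>[of k] by (auto intro!: borel_measurable_continuous_onI DERIV_continuous_on simp: has_field_derivative_at_within)
    then show "(\<lambda>x. indicator {s..t+\<delta>} x * g x * \<phi> k x) \<in> borel_measurable lborel" for k by (intro borel_measurable_times[OF m])
    have "integrable lborel (\<lambda>x. indicator {s..t} x * g x)"
      using set_integrable_subset[OF gi, of "{s..t}"] d by (simp add: set_integrable_def)
    then show "(\<lambda>x. indicator {s..t} x * g x) \<in> borel_measurable lborel" by (simp add: integrable_iff_bounded)
    show "AE x in lborel. norm (indicator {s..t+\<delta>} x * g x * \<phi> k x) \<le> \<bar>indicator {s..t+\<delta>} x * g x\<bar>" for k
      using mult_left_mono[OF \<phi>1] by (intro AE_I2) (auto simp: indicator_def abs_mult mult_left_le)
    show "AE x in lborel. (\<lambda>k. indicator {s..t+\<delta>} x * g x * \<phi> k x) \<longlonglongrightarrow> indicator {s..t} x * g x"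
      \<comment> \<open>At s itself all \<open>\<phi> k\<close> vanish although the indicator of
        [s, t] is 1.\<close>
      using AE_lborel_singleton[of s]
    proof eventually_elim
      case (elim x)
      have one: "eventually (\<lambda>k. smooth_step (c k * (x - r)) = 1) sequentially" if "x > r" for r
      proof -
        obtain K where K: "real K > \<delta> / (x - r)" using reals_Archimedean2 by blast
        have "smooth_step (c k * (x - r)) = 1" if "k \<ge> K" for k
        proof (rule smooth_step_bounds(2))
          have "\<delta> / (x - r) \<le> real (Suc k)" using K that by linarith
          then show "1 \<le> c k * (x - r)" using \<open>x > r\<close> d by (simp add: c_def field_simps)
        qed
        then show ?thesis by (auto simp: eventually_sequentially)
      qed
      have zero: "smooth_step (c k * (x - r)) = 0" if "x \<le> r" for k r
        using that c(1)[of k] by (intro smooth_step_bounds) (auto simp: mult_le_0_iff)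
      consider "x < s" | "s < x" "x \<le> t" | "t < x" using elim by linarith
      then have "eventually (\<lambda>k. indicator {s..t+\<delta>} x * g x * \<phi> k x = indicator {s..t} x * g x) sequentially"
      proof cases
        case 1 then show ?thesis using st by simp
      next
        case 2
        from one[OF 2(1)] show ?thesis
          by eventually_elim (use 2 d zero in \<open>auto simp: \<phi>_def\<close>)
      next
        case 3
        then have "s < x" using st by simp
        from one[OF 3] one[OF this] show ?thesis
          by eventually_elim (use 3 d zero in \<open>auto simp: \<phi>_def\<close>)
      qed
      then show ?case by (rule tendsto_eventually)
    qed
  qed
  have "(\<lambda>k. LINT x:D|lborel. f x * deriv (\<phi> k) x) = (\<lambda>k. - (LINT x:D|lborel. g x * \<phi> k x))"
    using w tf by (auto simp: is_weak_deriv_def)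
  then have "f s - f t = - (LINT x|lborel. indicator {s..t} x * g x)"
    using LIMSEQ_unique[OF lim1] tendsto_minus[OF lim2] by simp
  then show ?thesis by (simp add: set_lebesgue_integral_def)
qed

text \<open>Test functions see only the interior of D; the identity reaches end points of D because
  both f and the indefinite integral of g are continuous on [s, t].\<close>

lemma weak_deriv_imp_H1_pair:
  assumes D: "is_interval D" and f: "continuous_on D f" "square_integrable D f"
    and g: "square_integrable D g" and w: "is_weak_deriv D f g"
  shows "H1_pair D f g"
  unfolding H1_pair_def
proof (intro conjI ballI impI f g)
  fix s t assume st: "s \<in> D" "t \<in> D" "s \<le> t"
  show "f t - f s = (LINT u:{s..t}|lborel. g u)"
  proof (cases "s = t")
    case True then show ?thesis by (simp add: set_integral_at_point)
  next
    case False
    then have lt: "s < t" using st by simp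
    have sub: "{s..t} \<subseteq> D" by (rule Icc_subset_interval[OF D st(1,2)])
    have "{s<..<t} \<subseteq> D" using sub by auto
    then have int: "{s<..<t} \<subseteq> interior D" by (simp add: interior_maximal)
    have gi: "set_integrable lborel {s..t} g" by (rule square_integrable_imp_integrable_Icc[OF g sub])
    define F where "F x = integral {s..x} g" for x
    have Fc: "continuous_on {s..t} F" unfolding F_def
      using gi by (intro indefinite_integral_continuous_1) (auto dest: set_borel_integral_eq_integral)
    have fc: "continuous_on {s..t} f" using f(1) sub by (rule continuous_on_subset)
    \<comment> \<open>The factor 1/3 keeps a n < b n already for n = 0.\<close>
    define a where "a n = s + (t - s) / 3 * inverse (real (Suc n))" for n
    define b where "b n = t - (t - s) / 3 * inverse (real (Suc n))" for n
    have ab: "s < a n" "a n < b n" "b n < t" for n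
    proof -
      have i: "0 < inverse (real (Suc n))" "inverse (real (Suc n)) \<le> 1" by (auto simp: field_simps)
      define y where "y = (t - s) / 3 * inverse (real (Suc n))"
      have "0 < y" using i lt by (simp add: y_def)
      moreover have "y \<le> (t - s) / 3" unfolding y_def using i(2) lt by (intro mult_left_le) auto
      moreover have "a n = s + y" "b n = t - y" by (simp_all add: a_def b_def y_def)
      ultimately show "s < a n" "a n < b n" "b n < t" using lt by auto
    qed
    have "a \<longlonglongrightarrow> s + (t - s) / 3 * 0" "b \<longlonglongrightarrow> t - (t - s) / 3 * 0"
      unfolding a_def b_def by (intro tendsto_intros LIMSEQ_inverse_real_of_nat)+
    then have lim: "a \<longlonglongrightarrow> s" "b \<longlonglongrightarrow> t" by simp_all
    have in_st: "a n \<in> {s..t}" "b n \<in> {s..t}" for n using ab[of n] by auto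
    have eq: "f (b n) - f (a n) = F (b n) - F (a n)" for n
    proof -
      have "f (b n) - f (a n) = (LINT u:{a n..b n}|lborel. g u)"
        using ab[of n] int by (intro weak_deriv_imp_ftc_interior[OF D f(1) g w]) auto
      also have "\<dots> = (LINT u:{s..b n}|lborel. g u) - (LINT u:{s..a n}|lborel. g u)"
        using set_integral_Icc_combine[of s "b n" g "a n"] ab[of n] set_integrable_subset[OF gi, of "{s..b n}"] by auto
      also have "\<dots> = F (b n) - F (a n)"
        using set_integrable_subset[OF gi, of "{s..b n}"] set_integrable_subset[OF gi, of "{s..a n}"] ab[of n]
        by (simp add: F_def set_borel_integral_eq_integral)
      finally show ?thesis .
    qed
    have l: "(\<lambda>n. h (b n) - h (a n)) \<longlonglongrightarrow> h t - h s" if "continuous_on {s..t} h" for h :: "real \<Rightarrow> real"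
    proof -
      have "(\<lambda>n. h (x n)) \<longlonglongrightarrow> h y" if "\<And>n. x n \<in> {s..t}" "x \<longlonglongrightarrow> y" "y \<in> {s..t}" for x y
        using \<open>continuous_on {s..t} h\<close> that unfolding continuous_on_sequentially comp_def by blast
      then show ?thesis using in_st lim lt by (intro tendsto_diff) auto
    qed
    have "f t - f s = F t - F s"
      using l[OF fc] l[OF Fc] unfolding eq by (rule LIMSEQ_unique)
    also have "\<dots> = (LINT u:{s..t}|lborel. g u)"
      using gi by (simp add: F_def set_borel_integral_eq_integral)
    finally show ?thesis .
  qed
qed

section \<open>Uniqueness of weak derivatives\<close>

lemma integral_Icc_zero_imp_AE_zero:
  fixes h :: "real \<Rightarrow> real"
  assumes h: "set_integrable lborel {a..b} h"
    and z: "\<And>s t. a \<le> s \<Longrightarrow> s \<le> t \<Longrightarrow> t \<le> b \<Longrightarrow> (LINT u:{s..t}|lborel. h u) = 0"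
  shows "AE x in lborel. x \<in> {a..b} \<longrightarrow> h x = 0"
proof -
  define k where "k x = indicator {a..b} x * h x" for x
  have k: "integrable lborel k" using h by (simp add: set_integrable_def k_def[abs_def])
  have km [measurable]: "k \<in> borel_measurable borel" using k by (simp add: integrable_iff_bounded)
  define M where "M = density lborel (\<lambda>x. ennreal (k x))"
  \<comment> \<open>Since \<open>ennreal\<close> cuts off at 0, \<open>M\<close> and
    \<open>N\<close> have the positive and the negative part of k as densities. They agree on all
    rays and are finite there, hence are equal, and so are their densities almost everywhere; then k
    = 0.\<close>
  define N where "N = density lborel (\<lambda>x. ennreal (- k x))"
  have fin: "(\<integral>\<^sup>+x. ennreal (k x) \<partial>lborel) < \<infinity>" "(\<integral>\<^sup>+x. ennreal (- k x) \<partial>lborel) < \<infinity>"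
    using k by (auto simp: real_integrable_def less_top)
  have eM: "emeasure M A = (\<integral>\<^sup>+x. ennreal (k x * indicator A x) \<partial>lborel)" if "A \<in> sets borel" for A
    using that unfolding M_def by (subst emeasure_density) (auto simp: indicator_def intro!: nn_integral_cong)
  have eN: "emeasure N A = (\<integral>\<^sup>+x. ennreal (- (k x * indicator A x)) \<partial>lborel)" if "A \<in> sets borel" for A
    using that unfolding N_def by (subst emeasure_density) (auto simp: indicator_def intro!: nn_integral_cong)
  have "M = N"
  proof (rule measure_eqI_lessThan)
    fix x :: real
    have ki: "integrable lborel (\<lambda>y. k y * indicator {x<..} y)"
      using integrable_mult_indicator[OF _ k, of "{x<..}"] by (simp add: mult.commute)
    have ki': "integrable lborel (\<lambda>y. k y * indicator {x..} y)"
      using integrable_mult_indicator[OF _ k, of "{x..}"] by (simp add: mult.commute)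
    show "emeasure M {x<..} < \<infinity>"
      using ki by (simp add: eM real_integrable_def less_top)
    have "(LINT y|lborel. k y * indicator {x<..} y) = (LINT y|lborel. k y * indicator {x..} y)"
      using AE_lborel_singleton[of x] ki ki'
      by (intro integral_cong_AE) (auto simp: indicator_def)
    also have "\<dots> = 0"
    proof (cases "max a x \<le> b")
      case True
      have "(LINT y|lborel. k y * indicator {x..} y) = (LINT u:{max a x..b}|lborel. h u)"
        unfolding set_lebesgue_integral_def
        by (rule Bochner_Integration.integral_cong) (auto simp: k_def indicator_def)
      then show ?thesis using z[of "max a x" b] True by simp
    next
      case False
      then have "(\<lambda>y. k y * indicator {x..} y) = (\<lambda>_. 0)" by (auto simp: k_def indicator_def)
      then show ?thesis by (simp only: Bochner_Integration.integral_zero)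
    qed
    finally have "(LINT y|lborel. k y * indicator {x<..} y) = 0" .
    then have "enn2real (emeasure M {x<..}) = enn2real (emeasure N {x<..})"
      using real_lebesgue_integral_def[OF ki] by (simp add: eM eN)
    moreover have "emeasure M {x<..} \<noteq> \<infinity>" "emeasure N {x<..} \<noteq> \<infinity>"
      using ki by (simp_all add: eM eN real_integrable_def)
    ultimately show "emeasure M {x<..} = emeasure N {x<..}"
      by (metis ennreal_enn2real infinity_ennreal_def less_top)
  qed (auto simp: M_def N_def)
  then have "AE x in lborel. ennreal (k x) = ennreal (- k x)"
    unfolding M_def N_def by (intro sigma_finite_measure.density_unique[OF sigma_finite_lborel]) auto
  then show ?thesis
  proof eventually_elim
    case (elim x)
    then have "k x = 0" by (metis ennreal_eq_0_iff ennreal_inj le_cases neg_0_le_iff_le neg_le_0_iff_le linorder_not_less order_antisym_conv)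
    then show ?case by (auto simp: k_def)
  qed
qed

lemma test_function_L2:
  assumes "test_function D \<phi>" "is_interval D" "D \<noteq> {}"
  shows "square_integrable D \<phi>" "square_integrable D (deriv \<phi>)"
proof -
  obtain a b where ab: "{a..b} \<subseteq> D" "\<And>t. t \<notin> {a<..<b} \<Longrightarrow> \<phi> t = 0" "\<And>t. t \<notin> {a..b} \<Longrightarrow> deriv \<phi> t = 0"
    using test_function_support[OF assms] by metis
  have *: "square_integrable D \<psi>" if c: "continuous_on UNIV \<psi>" and z: "\<And>t. t \<notin> {a..b} \<Longrightarrow> \<psi> t = 0" for \<psi>
    unfolding square_integrable_def set_borel_measurable_def set_integrable_def
  proof
    have D: "D \<in> sets lborel" using sets_borel_is_interval[OF assms(2)] by simp
    have "\<psi> \<in> borel_measurable borel" using c by (rule borel_measurable_continuous_onI)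
    then show "(\<lambda>x. indicat_real D x *\<^sub>R \<psi> x) \<in> borel_measurable lborel" using D by simp
    have "set_integrable lborel {a..b} (\<lambda>t. (\<psi> t)\<^sup>2)"
      by (intro borel_integrable_atLeastAtMost' continuous_intros continuous_on_subset[OF c]) auto
    moreover have "(\<lambda>x. indicat_real D x *\<^sub>R (\<psi> x)\<^sup>2) = (\<lambda>x. indicat_real {a..b} x *\<^sub>R (\<psi> x)\<^sup>2)"
    proof
      fix x show "indicat_real D x *\<^sub>R (\<psi> x)\<^sup>2 = indicat_real {a..b} x *\<^sub>R (\<psi> x)\<^sup>2"
        using z[of x] ab(1) by (cases "x \<in> {a..b}") auto
    qed
    ultimately show "integrable lborel (\<lambda>x. indicat_real D x *\<^sub>R (\<psi> x)\<^sup>2)" by (simp add: set_integrable_def)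
  qed
  have "continuous_on UNIV \<phi>"
    using test_function_has_deriv(1)[OF assms(1)] by (meson DERIV_isCont continuous_at_imp_continuous_on)
  then show "square_integrable D \<phi>" by (rule *) (use ab(2) in auto)
  show "square_integrable D (deriv \<phi>)" by (rule *[OF test_function_has_deriv(2)[OF assms(1)] ab(3)])
qed

lemma square_integrable_mult:
  assumes "square_integrable D f" "square_integrable D g" "D \<in> sets borel"
  shows "set_integrable lborel D (\<lambda>t. f t * g t)"
  using L2_mult_integrable[of "restrict_space lborel D" f g] assms
  by (simp add: square_integrable_iff_L2 set_integrable_restrict)

lemma AE_interval_countable:
  assumes D: "is_interval D" "closed D"
    and P: "\<And>a b::real. {a..b} \<subseteq> D \<Longrightarrow> AE x in lborel. x \<in> {a..b} \<longrightarrow> P x"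
  shows "AE x in lborel. x \<in> D \<longrightarrow> P x"
proof -
  have "AE x in lborel. x \<in> D \<inter> {- real n..real n} \<longrightarrow> P x" for n
  proof -
    have "is_interval (D \<inter> {- real n..real n})" using D by (intro is_interval_Int) auto
    moreover have "compact (D \<inter> {- real n..real n})" using D(2) by (intro closed_Int_compact) auto
    ultimately obtain a b where "D \<inter> {- real n..real n} = {a..b}"
      using connected_compact_interval_1 is_interval_connected_1 by metis
    moreover from this have "{a..b} \<subseteq> D" by blast
    ultimately show ?thesis using P by auto
  qed
  then have "AE x in lborel. \<forall>n. x \<in> D \<inter> {- real n..real n} \<longrightarrow> P x" unfolding AE_all_countable by blast
  then show ?thesis
  proof eventually_elim
    case (elim x)
    obtain n where "\<bar>x\<bar> \<le> real n" using real_arch_simple by blast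
    then show ?case using elim[rule_format, of n] by (auto simp: abs_le_iff)
  qed
qed

text \<open>The difference is a weak derivative of the continuous function 0, so by the fundamental
  theorem its integral over every interval in D vanishes.\<close>

lemma weak_deriv_AE_unique:
  assumes D: "is_interval D" "closed D" "D \<noteq> {}" and g: "square_integrable D g" "square_integrable D g'"
    and w: "is_weak_deriv D f g" "is_weak_deriv D f g'"
  shows "AE x in lborel. x \<in> D \<longrightarrow> g x = g' x"
proof -
  define h where "h x = g x - g' x" for x
  have DB: "D \<in> sets borel" using D(1) by (rule sets_borel_is_interval)
  have h: "square_integrable D h"
    using g DB unfolding h_def[abs_def] by (simp add: square_integrable_iff_L2 L2_diff)
  have z: "square_integrable D (\<lambda>_. 0)" by (simp add: square_integrable_def set_borel_measurable_def set_integrable_def)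
  have "is_weak_deriv D (\<lambda>_. 0) h"
    unfolding is_weak_deriv_def
  proof (intro allI impI)
    fix \<phi> assume \<phi>: "test_function D \<phi>"
    note L = test_function_L2[OF \<phi> D(1,3)]
    have "(LINT t:D|lborel. h t * \<phi> t) = (LINT t:D|lborel. g t * \<phi> t) - (LINT t:D|lborel. g' t * \<phi> t)"
      unfolding h_def left_diff_distrib
      by (rule set_integral_diff(2)[OF square_integrable_mult[OF g(1) L(1) DB] square_integrable_mult[OF g(2) L(1) DB]])
    also have "\<dots> = 0"
      using w \<phi> by (simp add: is_weak_deriv_def)
    finally show "(LINT t:D|lborel. 0 * deriv \<phi> t) = - (LINT t:D|lborel. h t * \<phi> t)" by simp
  qed
  then have H: "H1_pair D (\<lambda>_. 0) h"
    by (intro weak_deriv_imp_H1_pair D z h) auto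
  have "AE x in lborel. x \<in> D \<longrightarrow> h x = 0"
  proof (rule AE_interval_countable[OF D(1,2)])
    fix a b :: real assume ab: "{a..b} \<subseteq> D"
    show "AE x in lborel. x \<in> {a..b} \<longrightarrow> h x = 0"
    proof (rule integral_Icc_zero_imp_AE_zero)
      show "set_integrable lborel {a..b} h" by (rule square_integrable_imp_integrable_Icc[OF h ab])
      fix s t assume "a \<le> s" "s \<le> t" "t \<le> b"
      then have "s \<in> D" "t \<in> D" using ab by auto
      then show "(LINT u:{s..t}|lborel. h u) = 0" using H \<open>s \<le> t\<close> by (auto simp: H1_pair_def)
    qed
  qed
  then show ?thesis by (simp add: h_def)
qed

section \<open>Energy and integral of the power on an interval\<close>

definition H1_cont :: "real set \<Rightarrow> (real \<Rightarrow> real) \<Rightarrow> bool" where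
  "H1_cont D f \<longleftrightarrow> continuous_on D f \<and> H1_interval D f"

definition interval_energy :: "real set \<Rightarrow> (real \<Rightarrow> real) \<Rightarrow> real" where
  "interval_energy D f = (LINT t:D|lborel. (weak_deriv D f t)\<^sup>2 + (f t)\<^sup>2)"

definition interval_Lp :: "real set \<Rightarrow> real \<Rightarrow> (real \<Rightarrow> real) \<Rightarrow> real" where
  "interval_Lp D p f = (LINT t:D|lborel. \<bar>f t\<bar> powr p)"

lemma weak_deriv_props:
  assumes "H1_interval D f"
  shows "square_integrable D (weak_deriv D f)" "is_weak_deriv D f (weak_deriv D f)"
proof -
  have "\<exists>g. square_integrable D g \<and> is_weak_deriv D f g" using assms by (auto simp: H1_interval_def)
  from someI_ex[OF this] show "square_integrable D (weak_deriv D f)" "is_weak_deriv D f (weak_deriv D f)"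
    unfolding weak_deriv_def by auto
qed

lemma H1_cont_imp_pair:
  assumes "H1_cont D f" "is_interval D"
  shows "H1_pair D f (weak_deriv D f)"
  using assms weak_deriv_props[of D f] by (auto simp: H1_cont_def H1_interval_def intro: weak_deriv_imp_H1_pair)

lemma H1_pair_imp_cont:
  assumes "H1_pair D f g" "is_interval D" "D \<noteq> {}"
  shows "H1_cont D f"
  using assms H1_pair_imp_weak_deriv[OF assms] H1_pair_continuous[OF assms(1,2)]
  by (auto simp: H1_cont_def H1_interval_def H1_pair_def)

lemma H1_pair_AE_weak_deriv:
  assumes "H1_pair D f g" "is_interval D" "closed D" "D \<noteq> {}"
  shows "AE x in lborel. x \<in> D \<longrightarrow> weak_deriv D f x = g x"
proof (rule weak_deriv_AE_unique[OF assms(2-4)])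
  have "H1_interval D f" using H1_pair_imp_cont[OF assms(1,2,4)] by (simp add: H1_cont_def)
  from weak_deriv_props[OF this]
  show "square_integrable D (weak_deriv D f)" "is_weak_deriv D f (weak_deriv D f)" .
  show "is_weak_deriv D f g" by (rule H1_pair_imp_weak_deriv[OF assms(1,2,4)])
qed (use assms in \<open>auto simp: H1_pair_def\<close>)

text \<open>The function selected by \<open>weak_deriv\<close> agrees almost everywhere on D with
  the partner g of any pair, so an energy may be computed with whatever derivative is at
  hand.\<close>

lemma interval_energy_eq:
  assumes H: "H1_pair D f g" and D: "is_interval D" "closed D" "D \<noteq> {}"
  shows "interval_energy D f = (LINT t:D|lborel. (g t)\<^sup>2) + (LINT t:D|lborel. (f t)\<^sup>2)"
    and "set_integrable lborel D (\<lambda>t. (g t)\<^sup>2)" "set_integrable lborel D (\<lambda>t. (f t)\<^sup>2)"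
    and "set_integrable lborel D (\<lambda>t. (weak_deriv D f t)\<^sup>2 + (f t)\<^sup>2)"
proof -
  have DB: "D \<in> sets borel" using D(1) by (rule sets_borel_is_interval)
  show g: "set_integrable lborel D (\<lambda>t. (g t)\<^sup>2)" and f: "set_integrable lborel D (\<lambda>t. (f t)\<^sup>2)"
    using H by (auto simp: H1_pair_def square_integrable_def)
  have "H1_interval D f" using H1_pair_imp_cont[OF H D(1,3)] by (simp add: H1_cont_def)
  then have w: "set_integrable lborel D (\<lambda>t. (weak_deriv D f t)\<^sup>2)"
    using weak_deriv_props(1) by (auto simp: square_integrable_def)
  show "set_integrable lborel D (\<lambda>t. (weak_deriv D f t)\<^sup>2 + (f t)\<^sup>2)" by (rule set_integral_add(1)[OF w f])
  have "(LINT t:D|lborel. (weak_deriv D f t)\<^sup>2) = (LINT t:D|lborel. (g t)\<^sup>2)"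
    unfolding set_lebesgue_integral_def
  proof (rule integral_cong_AE)
    show "AE x in lborel. indicat_real D x *\<^sub>R (weak_deriv D f x)\<^sup>2 = indicat_real D x *\<^sub>R (g x)\<^sup>2"
      using H1_pair_AE_weak_deriv[OF H D] by eventually_elim (auto simp: indicator_def)
  qed (use w g in \<open>auto simp: set_integrable_def\<close>)
  then show "interval_energy D f = (LINT t:D|lborel. (g t)\<^sup>2) + (LINT t:D|lborel. (f t)\<^sup>2)"
    unfolding interval_energy_def by (simp add: set_integral_add(2)[OF w f])
qed

lemma set_integral_nonneg_real: "(\<And>t. t \<in> D \<Longrightarrow> 0 \<le> f t) \<Longrightarrow> 0 \<le> (LINT t:D|M. (f t :: real))"
  unfolding set_lebesgue_integral_def by (rule Bochner_Integration.integral_nonneg) (auto simp: indicator_def)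

lemma interval_energy_nonneg: "0 \<le> interval_energy D f"
  unfolding interval_energy_def by (rule set_integral_nonneg_real) simp

lemma interval_Lp_nonneg: "0 \<le> interval_Lp D p f"
  unfolding interval_Lp_def by (rule set_integral_nonneg_real) simp

lemma H1_pair_sq_integrals_le:
  assumes "H1_pair D f g" "is_interval D" "closed D" "D \<noteq> {}"
  shows "(LINT t:D|lborel. (g t)\<^sup>2) \<le> interval_energy D f" "(LINT t:D|lborel. (f t)\<^sup>2) \<le> interval_energy D f"
  using interval_energy_eq(1)[OF assms] set_integral_nonneg_real[of D "\<lambda>t. (g t)\<^sup>2" lborel]
    set_integral_nonneg_real[of D "\<lambda>t. (f t)\<^sup>2" lborel] by auto

definition interval_inner :: "real set \<Rightarrow> (real \<Rightarrow> real) \<Rightarrow> (real \<Rightarrow> real) \<Rightarrow> real" where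
  "interval_inner D f f' =
     (LINT t:D|lborel. weak_deriv D f t * weak_deriv D f' t) + (LINT t:D|lborel. f t * f' t)"

lemma H1_cont_lincomb:
  assumes "H1_cont D f" "H1_cont D f'" "is_interval D" "D \<noteq> {}"
  shows "H1_cont D (\<lambda>t. a * f t + b * f' t)"
  by (rule H1_pair_imp_cont[OF H1_pair_lincomb[OF H1_cont_imp_pair[OF assms(1,3)] H1_cont_imp_pair[OF assms(2,3)] assms(3)] assms(3,4)])

lemma interval_energy_lincomb:
  assumes f: "H1_cont D f" "H1_cont D f'" and D: "is_interval D" "closed D" "D \<noteq> {}"
  shows "interval_energy D (\<lambda>t. a * f t + b * f' t) =
    a\<^sup>2 * interval_energy D f + b\<^sup>2 * interval_energy D f' + 2 * a * b * interval_inner D f f'"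
proof -
  have DB: "D \<in> sets borel" using D(1) by (rule sets_borel_is_interval)
  let ?M = "restrict_space lborel D"
  let ?g = "weak_deriv D f" and ?g' = "weak_deriv D f'"
  have ar: "(a\<^sup>2 * G + b\<^sup>2 * G' + 2 * a * b * I) + (a\<^sup>2 * F + b\<^sup>2 * F' + 2 * a * b * J) =
      a\<^sup>2 * (G + F) + b\<^sup>2 * (G' + F') + 2 * a * b * (I + J)" for G G' F F' I J :: real
    by (simp add: algebra_simps)
  have P: "H1_pair D f ?g" "H1_pair D f' ?g'" by (rule H1_cont_imp_pair[OF _ D(1)], rule f)+
  then have L: "L2 ?M f" "L2 ?M ?g" "L2 ?M f'" "L2 ?M ?g'"
    unfolding H1_pair_def square_integrable_iff_L2[OF DB] by blast+
  have "interval_energy D (\<lambda>t. a * f t + b * f' t) =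
      (LINT t|?M. (a * ?g t + b * ?g' t)\<^sup>2) + (LINT t|?M. (a * f t + b * f' t)\<^sup>2)"
    unfolding set_integral_restrict[OF DB, symmetric]
    by (rule interval_energy_eq(1)[OF H1_pair_lincomb[OF P D(1)] D])
  also have "\<dots> = (a\<^sup>2 * (LINT t|?M. (?g t)\<^sup>2) + b\<^sup>2 * (LINT t|?M. (?g' t)\<^sup>2) + 2 * a * b * (LINT t|?M. ?g t * ?g' t)) +
      (a\<^sup>2 * (LINT t|?M. (f t)\<^sup>2) + b\<^sup>2 * (LINT t|?M. (f' t)\<^sup>2) + 2 * a * b * (LINT t|?M. f t * f' t))"
    by (rule arg_cong2[where f = "(+)", OF integral_lincomb_sq[OF L(2) L(4)] integral_lincomb_sq[OF L(1) L(3)]])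
  also have "\<dots> = a\<^sup>2 * ((LINT t|?M. (?g t)\<^sup>2) + (LINT t|?M. (f t)\<^sup>2)) + b\<^sup>2 * ((LINT t|?M. (?g' t)\<^sup>2) + (LINT t|?M. (f' t)\<^sup>2)) +
      2 * a * b * ((LINT t|?M. ?g t * ?g' t) + (LINT t|?M. f t * f' t))"
    by (rule ar)
  also have "(LINT t|?M. (?g t)\<^sup>2) + (LINT t|?M. (f t)\<^sup>2) = interval_energy D f"
    unfolding set_integral_restrict[OF DB, symmetric] by (rule interval_energy_eq(1)[OF P(1) D, symmetric])
  also have "(LINT t|?M. (?g' t)\<^sup>2) + (LINT t|?M. (f' t)\<^sup>2) = interval_energy D f'"
    unfolding set_integral_restrict[OF DB, symmetric] by (rule interval_energy_eq(1)[OF P(2) D, symmetric])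
  also have "(LINT t|?M. ?g t * ?g' t) + (LINT t|?M. f t * f' t) = interval_inner D f f'"
    unfolding set_integral_restrict[OF DB, symmetric] by (rule interval_inner_def[symmetric])
  finally show ?thesis .
qed

text \<open>Compare f(t) with f(r) by the Hoelder estimate and average over r in an interval of
  length l. The constant depends only on l, so it is uniform over all intervals that contain one of
  length l around each of their points.\<close>

lemma H1_pair_sup_bound:
  assumes H: "H1_pair D f g" and D: "is_interval D" "closed D"
    and l: "l > 0" "{s..s+l} \<subseteq> D" "t \<in> {s..s+l}"
  shows "(f t)\<^sup>2 \<le> (2 / l + 2 * l) * interval_energy D f"
proof -
  have ne: "D \<noteq> {}" using l by auto
  define G where "G = (LINT u:D|lborel. (g u)\<^sup>2)"
  have G0: "G \<ge> 0" unfolding G_def by (rule set_integral_nonneg_real) simp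
  have fi: "set_integrable lborel {s..s+l} (\<lambda>r. (f r)\<^sup>2)"
    by (rule set_integrable_subset[OF interval_energy_eq(3)[OF H D ne] _ l(2)]) simp
  have ci: "set_integrable lborel {s..s+l} (\<lambda>r. c::real)" for c by (rule borel_integrable_atLeastAtMost') simp
  have cv: "(LINT r:{s..s+l}|lborel. c) = l * c" for c :: real
    using l(1) by (simp add: set_lebesgue_integral_def)
  have pt: "(f t)\<^sup>2 \<le> 2 * (f r)\<^sup>2 + 2 * l * G" if "r \<in> {s..s+l}" for r
  proof -
    have "(f t - f r)\<^sup>2 \<le> \<bar>t - r\<bar> * G"
      unfolding G_def using H D l that by (intro H1_pair_Hoelder) auto
    also have "\<dots> \<le> l * G" using that l G0 by (intro mult_right_mono) auto
    finally have 1: "(f t - f r)\<^sup>2 \<le> l * G" .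
    \<comment> \<open>The difference of the two sides is the square of f(t) - 2 f(r).\<close>
    have "(f t)\<^sup>2 \<le> 2 * (f r)\<^sup>2 + 2 * (f t - f r)\<^sup>2"
      using zero_le_power2[of "f t - 2 * f r"] by (simp add: power2_eq_square algebra_simps)
    with 1 show ?thesis by simp
  qed
  have "l * (f t)\<^sup>2 = (LINT r:{s..s+l}|lborel. (f t)\<^sup>2)" by (simp only: cv)
  also have "\<dots> \<le> (LINT r:{s..s+l}|lborel. 2 * (f r)\<^sup>2 + 2 * l * G)"
    using pt by (intro set_integral_mono ci set_integral_add(1) set_integrable_mult_right fi) auto
  also have "\<dots> = 2 * (LINT r:{s..s+l}|lborel. (f r)\<^sup>2) + l * (2 * l * G)"
    by (subst set_integral_add(2)[OF _ ci]) (use fi cv in auto)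
  also have "(LINT r:{s..s+l}|lborel. (f r)\<^sup>2) \<le> (LINT r:D|lborel. (f r)\<^sup>2)"
    unfolding set_lebesgue_integral_def
  proof (rule integral_mono)
    show "indicat_real {s..s+l} r *\<^sub>R (f r)\<^sup>2 \<le> indicat_real D r *\<^sub>R (f r)\<^sup>2" for r
      using l(2) by (auto simp: indicator_def)
  qed (use fi interval_energy_eq(3)[OF H D ne] in \<open>auto simp: set_integrable_def\<close>)
  finally have 2: "l * (f t)\<^sup>2 \<le> 2 * (LINT r:D|lborel. (f r)\<^sup>2) + l * (2 * l * G)" by simp
  define N where "N = (LINT r:D|lborel. (f r)\<^sup>2)"
  have N0: "N \<ge> 0" unfolding N_def by (rule set_integral_nonneg_real) simp
  have E: "interval_energy D f = G + N" using interval_energy_eq(1)[OF H D ne] by (simp add: G_def N_def)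
  have "(f t)\<^sup>2 \<le> 2 / l * N + 2 * l * G" using 2 l(1) by (simp add: N_def[symmetric] field_simps)
  also have "\<dots> \<le> (2 / l + 2 * l) * (G + N)"
    using l(1) N0 G0 by (simp add: distrib_right distrib_left)
  finally show ?thesis by (simp add: E)
qed

lemma abs_powr_le_sq:
  fixes x :: real assumes "\<bar>x\<bar> \<le> S" "p > 2"
  shows "\<bar>x\<bar> powr p \<le> S powr (p - 2) * x\<^sup>2"
proof (cases "x = 0")
  case False
  have "\<bar>x\<bar> powr p = \<bar>x\<bar> powr (p - 2) * \<bar>x\<bar> powr 2" by (simp only: powr_add[symmetric]) simp
  also have "\<bar>x\<bar> powr 2 = x\<^sup>2" using False by (simp add: powr_numeral)
  also have "\<bar>x\<bar> powr (p - 2) * x\<^sup>2 \<le> S powr (p - 2) * x\<^sup>2"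
    using assms by (intro mult_right_mono powr_mono2) auto
  finally show ?thesis .
qed (use assms in simp)

lemma powr_integrable:
  assumes f: "square_integrable D f" "D \<in> sets borel" and S: "\<And>t. t \<in> D \<Longrightarrow> \<bar>f t\<bar> \<le> S" and p: "p > 2"
  shows "set_integrable lborel D (\<lambda>t. \<bar>f t\<bar> powr p)"
    and "interval_Lp D p f \<le> S powr (p - 2) * (LINT t:D|lborel. (f t)\<^sup>2)"
proof -
  have L: "L2 (restrict_space lborel D) f" using f by (simp add: square_integrable_iff_L2)
  have i: "integrable (restrict_space lborel D) (\<lambda>t. S powr (p - 2) * (f t)\<^sup>2)"
    using L by (simp add: L2_def)
  have m: "(\<lambda>t. \<bar>f t\<bar> powr p) \<in> borel_measurable (restrict_space lborel D)"
    using L by (auto simp: L2_def)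
  have le: "\<bar>f t\<bar> powr p \<le> S powr (p - 2) * (f t)\<^sup>2" if "t \<in> D" for t
    by (rule abs_powr_le_sq[OF S[OF that] p])
  have j: "integrable (restrict_space lborel D) (\<lambda>t. \<bar>f t\<bar> powr p)"
    by (rule Bochner_Integration.integrable_bound[OF i m]) (use le in \<open>auto simp: space_restrict_space abs_mult intro!: AE_I2\<close>)
  then show "set_integrable lborel D (\<lambda>t. \<bar>f t\<bar> powr p)" using f by (simp add: set_integrable_restrict)
  have "interval_Lp D p f = (LINT t|restrict_space lborel D. \<bar>f t\<bar> powr p)"
    using f by (simp add: interval_Lp_def set_integral_restrict)
  also have "\<dots> \<le> (LINT t|restrict_space lborel D. S powr (p - 2) * (f t)\<^sup>2)"
    by (rule integral_mono[OF j i]) (use le in \<open>auto simp: space_restrict_space\<close>)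
  also have "\<dots> = S powr (p - 2) * (LINT t:D|lborel. (f t)\<^sup>2)"
    using f by (simp add: set_integral_restrict)
  finally show "interval_Lp D p f \<le> S powr (p - 2) * (LINT t:D|lborel. (f t)\<^sup>2)" .
qed

text \<open>Interpolation: the supremum to the power p - 2 times the integral of the square bounds
  the integral of the p-th power. With both factors estimated by the energy, the exponents (p - 2) /
  p and 2 / p add up to 1.\<close>

lemma Sobolev_interval:
  assumes H: "H1_pair D f g" and D: "is_interval D" "closed D" "D \<noteq> {}"
    and K: "\<And>t. t \<in> D \<Longrightarrow> (f t)\<^sup>2 \<le> K * interval_energy D f" "K \<ge> 0" and p: "p > 2"
  shows "interval_Lp D p f powr (2 / p) \<le> K powr ((p - 2) / p) * interval_energy D f"
proof -
  let ?E = "interval_energy D f"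
  have E0: "?E \<ge> 0" by (rule interval_energy_nonneg)
  have DB: "D \<in> sets borel" using D(1) by (rule sets_borel_is_interval)
  have S: "\<bar>f t\<bar> \<le> sqrt (K * ?E)" if "t \<in> D" for t
    using K(1)[OF that] by (simp add: real_le_rsqrt)
  have "interval_Lp D p f \<le> sqrt (K * ?E) powr (p - 2) * (LINT t:D|lborel. (f t)\<^sup>2)"
    using H by (intro powr_integrable DB S p) (auto simp: H1_pair_def)
  also have "\<dots> \<le> sqrt (K * ?E) powr (p - 2) * ?E"
    using H1_pair_sq_integrals_le[OF H D] by (intro mult_left_mono) auto
  finally have "interval_Lp D p f powr (2 / p) \<le> (sqrt (K * ?E) powr (p - 2) * ?E) powr (2 / p)"
    using p by (intro powr_mono2 interval_Lp_nonneg) auto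
  also have "\<dots> = (sqrt (K * ?E) powr (p - 2)) powr (2 / p) * ?E powr (2 / p)"
    by (rule powr_mult)
  also have "(sqrt (K * ?E) powr (p - 2)) powr (2 / p) = (K * ?E) powr ((p - 2) / p)"
  proof -
    have "sqrt (K * ?E) = (K * ?E) powr (1/2)" using K E0 by (simp add: powr_half_sqrt)
    moreover have "1/2 * (p - 2) * (2 / p) = (p - 2) / p" using p by (simp add: field_simps)
    ultimately show ?thesis by (simp only: powr_powr)
  qed
  also have "\<dots> = K powr ((p - 2) / p) * ?E powr ((p - 2) / p)" by (rule powr_mult)
  also have "K powr ((p - 2) / p) * ?E powr ((p - 2) / p) * ?E powr (2 / p) = K powr ((p - 2) / p) * ?E powr 1"
    using p by (simp add: mult.assoc flip: powr_add add_divide_distrib)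
  also have "?E powr 1 = ?E" using E0 by simp
  finally show ?thesis .
qed

section \<open>Restriction, gluing and change of parameter\<close>

lemma H1_pair_subset:
  assumes "H1_pair D f g" "A \<subseteq> D" "A \<in> sets borel"
  shows "H1_pair A f g"
  using assms square_integrable_subset[of D _ A] unfolding H1_pair_def by blast

lemma H1_pair_cong:
  assumes "H1_pair D f g" "\<And>t. t \<in> D \<Longrightarrow> f t = f' t" "\<And>t. t \<in> D \<Longrightarrow> g t = g' t" "is_interval D"
  shows "H1_pair D f' g'"
proof -
  have sq: "square_integrable D h'" if "square_integrable D h" "\<And>t. t \<in> D \<Longrightarrow> h t = h' t" for h h'
  proof -
    have "(\<lambda>x. indicat_real D x *\<^sub>R h x) = (\<lambda>x. indicat_real D x *\<^sub>R h' x)"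
      "(\<lambda>x. indicat_real D x *\<^sub>R (h x)\<^sup>2) = (\<lambda>x. indicat_real D x *\<^sub>R (h' x)\<^sup>2)"
      using that(2) by (auto simp: indicator_def)
    with that(1) show ?thesis by (simp add: square_integrable_def set_borel_measurable_def set_integrable_def)
  qed
  have "(LINT u:{s..t}|lborel. g u) = (LINT u:{s..t}|lborel. g' u)" if "s \<in> D" "t \<in> D" for s t
    using Icc_subset_interval[OF assms(4) that] assms(3) by (intro set_lebesgue_integral_cong) auto
  with assms sq show ?thesis unfolding H1_pair_def by auto
qed

lemma square_integrable_Un:
  assumes "square_integrable A g" "square_integrable B g" "A \<in> sets borel" "B \<in> sets borel"
  shows "square_integrable (A \<union> B) g"
proof -
  have "set_integrable lborel (A \<union> B) (\<lambda>t. (g t)\<^sup>2)"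
    using assms by (intro set_integrable_Un) (auto simp: square_integrable_def)
  moreover have "set_borel_measurable lborel (A \<union> B) g"
  proof -
    have 1: "(\<lambda>x. indicat_real A x *\<^sub>R g x) \<in> borel_measurable borel" "(\<lambda>x. indicat_real B x *\<^sub>R g x) \<in> borel_measurable borel"
      using assms by (auto simp: square_integrable_def set_borel_measurable_def)
    have "(\<lambda>x. if x \<in> A then indicat_real A x *\<^sub>R g x else indicat_real B x *\<^sub>R g x) \<in> borel_measurable borel"
      using 1 assms(3) by (intro measurable_If_set) auto
    moreover have "(\<lambda>x. if x \<in> A then indicat_real A x *\<^sub>R g x else indicat_real B x *\<^sub>R g x) = (\<lambda>x. indicat_real (A \<union> B) x *\<^sub>R g x)"
      by (auto simp: indicator_def)
    ultimately show ?thesis by (simp add: set_borel_measurable_def)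
  qed
  ultimately show ?thesis by (simp add: square_integrable_def)
qed

text \<open>Additivity of the integral at the common point c. The values match at c because one
  function f serves both sides, and the derivative may jump there.\<close>

lemma H1_pair_glue:
  assumes A: "H1_pair A f g" "is_interval A" and B: "H1_pair B f g" "is_interval B"
    and c: "c \<in> A" "c \<in> B" "A \<subseteq> {..c}" "B \<subseteq> {c..}"
  shows "H1_pair (A \<union> B) f g"
  unfolding H1_pair_def
proof (intro conjI ballI impI)
  have bor: "A \<in> sets borel" "B \<in> sets borel" using A B by (auto intro: sets_borel_is_interval)
  show "square_integrable (A \<union> B) f" "square_integrable (A \<union> B) g"
    using A B bor by (auto simp: H1_pair_def intro: square_integrable_Un)
  fix s t assume st: "s \<in> A \<union> B" "t \<in> A \<union> B" "s \<le> t"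
  consider "s \<in> A" "t \<in> A" | "s \<in> B" "t \<in> B" | "s \<in> A" "t \<in> B" "s \<le> c" "c \<le> t"
    using st c by (smt (verit) Un_iff atLeast_iff atMost_iff subsetD)
  then show "f t - f s = (LINT u:{s..t}|lborel. g u)"
  proof cases
    case 3
    have i1: "set_integrable lborel {s..c} g"
      using A 3 c by (intro square_integrable_imp_integrable_Icc[of A] Icc_subset_interval) (auto simp: H1_pair_def)
    have i2: "set_integrable lborel {c..t} g"
      using B 3 c by (intro square_integrable_imp_integrable_Icc[of B] Icc_subset_interval) (auto simp: H1_pair_def)
    have "{s..c} \<union> {c..t} = {s..t}" using 3 by auto
    then have "set_integrable lborel {s..t} g" using set_integrable_Un[OF i1 i2] by simp
    then have "(LINT u:{s..t}|lborel. g u) = (LINT u:{s..c}|lborel. g u) + (LINT u:{c..t}|lborel. g u)"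
      by (rule set_integral_Icc_combine) (use 3 in auto)
    also have "\<dots> = (f c - f s) + (f t - f c)" using A B 3 c by (simp add: H1_pair_def)
    finally show ?thesis by simp
  qed (use A B st in \<open>auto simp: H1_pair_def\<close>)
qed

lemma set_integral_glue:
  fixes h :: "real \<Rightarrow> real"
  assumes "set_integrable lborel A h" "set_integrable lborel B h" "A \<in> sets borel" "B \<in> sets borel"
    and "A \<subseteq> {..c}" "B \<subseteq> {c..}"
  shows "(LINT t:A\<union>B|lborel. h t) = (LINT t:A|lborel. h t) + (LINT t:B|lborel. h t)"
proof (rule set_integral_Un_AE)
  show "AE x in lborel. \<not> (x \<in> A \<and> x \<in> B)"
    using AE_lborel_singleton[of c] by eventually_elim (use assms in force)
qed (use assms in auto)

lemma H1_pair_C1: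
  assumes "\<And>x. a \<le> x \<Longrightarrow> x \<le> b \<Longrightarrow> (f has_real_derivative g x) (at x)" "continuous_on {a..b} g"
  shows "H1_pair {a..b} f g"
proof -
  have sq: "square_integrable {a..b} h" if "continuous_on {a..b} h" for h
    unfolding square_integrable_def
    using that borel_integrable_atLeastAtMost'[of a b "\<lambda>t. (h t)\<^sup>2"] borel_integrable_atLeastAtMost'[OF that]
    by (auto intro: continuous_intros simp: set_integrable_def set_borel_measurable_def)
  have "continuous_on {a..b} f"
    using assms(1) by (meson DERIV_isCont atLeastAtMost_iff continuous_at_imp_continuous_on)
  moreover have "f t - f s = (LINT u:{s..t}|lborel. g u)" if "s \<in> {a..b}" "t \<in> {a..b}" "s \<le> t" for s t
  proof -
    have "integral\<^sup>L lborel (\<lambda>x. indicator {s .. t} x *\<^sub>R g x) = f t - f s"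
    proof (rule integral_FTC_atLeastAtMost[OF that(3)])
      show "(f has_vector_derivative g x) (at x within {s..t})" if "s \<le> x" "x \<le> t" for x
        using assms(1)[of x] that \<open>s \<in> {a..b}\<close> \<open>t \<in> {a..b}\<close>
        by (auto simp: has_real_derivative_iff_has_vector_derivative has_vector_derivative_at_within)
      show "continuous_on {s..t} g" by (rule continuous_on_subset[OF assms(2)]) (use that in auto)
    qed
    then show ?thesis by (simp add: set_lebesgue_integral_def)
  qed
  ultimately show ?thesis using sq assms(2) by (auto simp: H1_pair_def)
qed

lemma H1_pair_zero: "H1_pair D (\<lambda>_. 0) (\<lambda>_. 0)"
  by (simp add: H1_pair_def square_integrable_def set_borel_measurable_def set_integrable_def)

lemma set_integral_isometry:
  fixes h :: "real \<Rightarrow> real"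
  assumes "\<sigma> = 1 \<or> \<sigma> = -1"
  shows "(LINT t:{t. c + \<sigma> * t \<in> D}|lborel. h (c + \<sigma> * t)) = (LINT t:D|lborel. h t)"
proof -
  have "(LINT t:D|lborel. h t) = \<bar>\<sigma>\<bar> *\<^sub>R (LINT t|lborel. indicator D (c + \<sigma> * t) *\<^sub>R h (c + \<sigma> * t))"
    unfolding set_lebesgue_integral_def by (rule lborel_integral_real_affine) (use assms in auto)
  also have "\<dots> = (LINT t:{t. c + \<sigma> * t \<in> D}|lborel. h (c + \<sigma> * t))"
    using assms by (auto simp: set_lebesgue_integral_def indicator_def)
  finally show ?thesis by simp
qed

lemma square_integrable_isometry:
  assumes s: "\<sigma> = 1 \<or> \<sigma> = -1" and h: "square_integrable D h"
  shows "square_integrable {t. c + \<sigma> * t \<in> D} (\<lambda>t. h (c + \<sigma> * t))"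
proof -
  have "set_integrable lborel {t. c + \<sigma> * t \<in> D} (\<lambda>t. (h (c + \<sigma> * t))\<^sup>2)"
    using lborel_integrable_real_affine[of "\<lambda>x. indicat_real D x *\<^sub>R (h x)\<^sup>2" \<sigma> c] h s
    by (auto simp: square_integrable_def set_integrable_def indicator_def)
  moreover have "set_borel_measurable lborel {t. c + \<sigma> * t \<in> D} (\<lambda>t. h (c + \<sigma> * t))"
  proof -
    have "(\<lambda>x. indicat_real D x *\<^sub>R h x) \<in> borel_measurable borel"
      using h by (simp add: square_integrable_def set_borel_measurable_def)
    then have "(\<lambda>t. (\<lambda>x. indicat_real D x *\<^sub>R h x) (c + \<sigma> * t)) \<in> borel_measurable borel"
      by (rule measurable_compose[rotated]) simp
    then show ?thesis by (simp add: set_borel_measurable_def indicator_def)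
  qed
  ultimately show ?thesis by (simp add: square_integrable_def)
qed

text \<open>The sign \<sigma> covers translations and reflections. Reflections are needed for edges
  traversed against their own orientation and for extension to the right.\<close>

lemma H1_pair_isometry:
  assumes s: "\<sigma> = 1 \<or> \<sigma> = -1" and H: "H1_pair D f g"
  shows "H1_pair {t. c + \<sigma> * t \<in> D} (\<lambda>t. f (c + \<sigma> * t)) (\<lambda>t. \<sigma> * g (c + \<sigma> * t))"
  unfolding H1_pair_def
proof (intro conjI ballI impI)
  show "square_integrable {t. c + \<sigma> * t \<in> D} (\<lambda>t. f (c + \<sigma> * t))"
    using H s by (auto simp: H1_pair_def intro!: square_integrable_isometry)
  have "square_integrable {t. c + \<sigma> * t \<in> D} (\<lambda>t. g (c + \<sigma> * t))"
    using H s by (auto simp: H1_pair_def intro!: square_integrable_isometry)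
  then show "square_integrable {t. c + \<sigma> * t \<in> D} (\<lambda>t. \<sigma> * g (c + \<sigma> * t))"
    using s by (auto simp: square_integrable_def set_borel_measurable_def set_integrable_def)
  fix u v assume uv: "u \<in> {t. c + \<sigma> * t \<in> D}" "v \<in> {t. c + \<sigma> * t \<in> D}" "u \<le> v"
  \<comment> \<open>A reflection exchanges the end points.\<close>
  define a where "a = min (c + \<sigma> * u) (c + \<sigma> * v)"
  define b where "b = max (c + \<sigma> * u) (c + \<sigma> * v)"
  have ab: "a \<in> D" "b \<in> D" "a \<le> b" using uv by (auto simp: a_def b_def min_def max_def)
  have eq: "{t. c + \<sigma> * t \<in> {a..b}} = {u..v}" using s uv by (auto simp: a_def b_def)
  have "(LINT t:{u..v}|lborel. \<sigma> * g (c + \<sigma> * t)) = \<sigma> * (LINT t:{a..b}|lborel. g t)"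
    using set_integral_isometry[OF s, of c "{a..b}" g] unfolding eq by simp
  also have "\<dots> = \<sigma> * (f b - f a)" using H ab by (simp add: H1_pair_def)
  also have "\<dots> = f (c + \<sigma> * v) - f (c + \<sigma> * u)" using s uv by (auto simp: a_def b_def min_def max_def)
  finally show "f (c + \<sigma> * v) - f (c + \<sigma> * u) = (LINT t:{u..v}|lborel. \<sigma> * g (c + \<sigma> * t))" by simp
qed

lemma is_interval_isometry:
  assumes "is_interval D" "\<sigma> = 1 \<or> \<sigma> = -1"
  shows "is_interval {t::real. c + \<sigma> * t \<in> D}"
  unfolding is_interval_1
proof (intro ballI allI impI)
  fix a b x assume "a \<in> {t. c + \<sigma> * t \<in> D}" "b \<in> {t. c + \<sigma> * t \<in> D}" "a \<le> x \<and> x \<le> b"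
  then show "x \<in> {t. c + \<sigma> * t \<in> D}"
    using assms mem_is_interval_1_I[OF assms(1), of "c + \<sigma> * a" "c + \<sigma> * b" "c + \<sigma> * x"]
      mem_is_interval_1_I[OF assms(1), of "c + \<sigma> * b" "c + \<sigma> * a" "c + \<sigma> * x"] by auto
qed

text \<open>The derivative may be changed on a null set. As \<open>lborel\<close> carries only the
  Borel sets, measurability of g' does not follow from that of g and is asked for
  separately.\<close>

lemma H1_pair_cong_AE:
  assumes H: "H1_pair D f g" and m: "set_borel_measurable lborel D g'"
    and ae: "AE t in lborel. t \<in> D \<longrightarrow> g t = g' t" and D: "is_interval D"
  shows "H1_pair D f g'"
  unfolding H1_pair_def
proof (intro conjI ballI impI)
  show "square_integrable D f" using H by (simp add: H1_pair_def)
  have gi: "integrable lborel (\<lambda>t. indicat_real D t *\<^sub>R (g t)\<^sup>2)"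
    using H by (simp add: H1_pair_def square_integrable_def set_integrable_def)
  have sqm: "(\<lambda>t. indicat_real D t *\<^sub>R (g' t)\<^sup>2) \<in> borel_measurable lborel"
  proof -
    have "(\<lambda>t. (indicat_real D t *\<^sub>R g' t)\<^sup>2) \<in> borel_measurable lborel"
      using m unfolding set_borel_measurable_def by simp
    moreover have "(\<lambda>t. (indicat_real D t *\<^sub>R g' t)\<^sup>2) = (\<lambda>t. indicat_real D t *\<^sub>R (g' t)\<^sup>2)"
      by (auto simp: indicator_def)
    ultimately show ?thesis by simp
  qed
  have "integrable lborel (\<lambda>t. indicat_real D t *\<^sub>R (g' t)\<^sup>2)"
  proof (rule Bochner_Integration.integrable_bound[OF gi sqm])
    show "AE t in lborel. norm (indicat_real D t *\<^sub>R (g' t)\<^sup>2) \<le> norm (indicat_real D t *\<^sub>R (g t)\<^sup>2)"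
      using ae by eventually_elim (auto simp: indicator_def)
  qed
  then show sq': "square_integrable D g'" using m by (simp add: square_integrable_def set_integrable_def)
  fix s t assume st: "s \<in> D" "t \<in> D" "s \<le> t"
  have sub: "{s..t} \<subseteq> D" by (rule Icc_subset_interval[OF D st(1,2)])
  have "square_integrable D g" using H by (simp add: H1_pair_def)
  note i = square_integrable_imp_integrable_Icc[OF this sub] square_integrable_imp_integrable_Icc[OF sq' sub]
  have "(LINT u:{s..t}|lborel. g u) = (LINT u:{s..t}|lborel. g' u)"
    unfolding set_lebesgue_integral_def
  proof (rule integral_cong_AE)
    show "AE u in lborel. indicat_real {s..t} u *\<^sub>R g u = indicat_real {s..t} u *\<^sub>R g' u"
      using ae by eventually_elim (use sub in \<open>auto simp: indicator_def\<close>)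
  qed (use i in \<open>auto simp: set_integrable_def\<close>)
  moreover have "f t - f s = (LINT u:{s..t}|lborel. g u)" using H st unfolding H1_pair_def by blast
  ultimately show "f t - f s = (LINT u:{s..t}|lborel. g' u)" by simp
qed

lemma closed_isometry:
  fixes D :: "real set" assumes "closed D" shows "closed {t. c + \<sigma> * t \<in> D}"
proof -
  have "closed ((\<lambda>t. c + \<sigma> * t) -` D)" by (rule closed_vimage[OF assms]) (intro continuous_intros)
  then show ?thesis by (simp add: vimage_def)
qed

section \<open>Extension to the line\<close>

text \<open>Outside D the function descends linearly from f(a) to 0 over a unit interval. There
  neither the function nor its slope exceeds |f(a)|, so each contributes at most the square of f(a),
  whence the factor 2.\<close>

lemma extend_left:
  assumes H: "H1_pair D f g" and D: "is_interval D" "closed D" "a \<in> D" "D \<subseteq> {a..}"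
  obtains F G where "H1_pair ({..a} \<union> D) F G" "\<And>t. t \<in> D \<Longrightarrow> F t = f t"
    "interval_energy ({..a} \<union> D) F \<le> interval_energy D f + 2 * (f a)\<^sup>2"
proof -
  define F where "F t = (if a \<le> t then f t else f a * max 0 (t - a + 1))" for t
  define G where "G t = (if a \<le> t then g t else if a - 1 < t then f a else 0)" for t
  have DB: "D \<in> sets borel" using D(1) by (rule sets_borel_is_interval)
  have HD: "H1_pair D F G"
    by (rule H1_pair_cong[OF H _ _ D(1)]) (use D(4) in \<open>auto simp: F_def G_def\<close>)
  have "H1_pair {a-1..a} (\<lambda>t. f a * (t - a + 1)) (\<lambda>t. f a)"
    by (rule H1_pair_C1) (auto intro!: derivative_eq_intros)
  have mid: "H1_pair {a-1..a} F (\<lambda>t. f a)"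
    by (rule H1_pair_cong[OF \<open>H1_pair {a-1..a} (\<lambda>t. f a * (t - a + 1)) (\<lambda>t. f a)\<close>]) (auto simp: F_def)
  have left: "H1_pair {..a-1} F G"
    by (rule H1_pair_cong[OF H1_pair_zero]) (auto simp: F_def G_def)
  \<comment> \<open>At the single point a the function G takes the value g a, which is treated as a
    separate branch.\<close>
  have Gm: "(\<lambda>t. indicat_real A t *\<^sub>R G t) \<in> borel_measurable lborel" if "A \<subseteq> {..a}" "A \<in> sets borel" for A
  proof -
    have [measurable]: "A \<in> sets borel" by fact
    have "(\<lambda>t. if t = a then indicat_real A t * g a else if a - 1 < t then indicat_real A t * f a else 0) \<in> borel_measurable borel"
      by measurable
    moreover have "(\<lambda>t. if t = a then indicat_real A t * g a else if a - 1 < t then indicat_real A t * f a else 0) =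
        (\<lambda>t. indicat_real A t *\<^sub>R G t)"
    proof
      fix t show "(if t = a then indicat_real A t * g a else if a - 1 < t then indicat_real A t * f a else 0) =
          indicat_real A t *\<^sub>R G t"
        using that(1) by (cases "t \<in> A") (auto simp: G_def)
    qed
    ultimately show ?thesis by simp
  qed
  have mid': "H1_pair {a-1..a} F G"
  proof (rule H1_pair_cong_AE[OF mid])
    show "AE t in lborel. t \<in> {a-1..a} \<longrightarrow> f a = G t"
      using AE_lborel_singleton[of a] AE_lborel_singleton[of "a-1"] by eventually_elim (auto simp: G_def)
  qed (use Gm in \<open>auto simp: set_borel_measurable_def\<close>)
  have HL: "H1_pair {..a} F G"
  proof -
    have "H1_pair ({..a-1} \<union> {a-1..a}) F G" by (rule H1_pair_glue[OF left _ mid']) auto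
    moreover have "{..a-1} \<union> {a-1..a} = {..a}" by auto
    ultimately show ?thesis by simp
  qed
  have l3: "square_integrable {..a} G" using HL by (simp add: H1_pair_def)
  have H': "H1_pair ({..a} \<union> D) F G"
    by (rule H1_pair_glue[OF HL _ HD D(1), of a]) (use D in auto)
  have I: "is_interval ({..a} \<union> D)"
    unfolding is_interval_1
  proof (intro ballI allI impI)
    fix u v x assume u: "u \<in> {..a} \<union> D" and v: "v \<in> {..a} \<union> D" and x: "u \<le> x \<and> x \<le> v"
    show "x \<in> {..a} \<union> D"
    proof (cases "x \<le> a")
      case False
      then have "v \<in> D" using v x by auto
      then show ?thesis using mem_is_interval_1_I[OF D(1,3), of v x] False x by auto
    qed simp
  qed
  have C: "closed ({..a} \<union> D)" using D(2) by (intro closed_Un) auto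
  have e: "(LINT t:{..a} \<union> D|lborel. (h t)\<^sup>2) = (LINT t:{..a}|lborel. (h t)\<^sup>2) + (LINT t:D|lborel. (h t)\<^sup>2)"
    if "square_integrable {..a} h" "square_integrable D h" for h
    by (rule set_integral_glue[where c = a]) (use that DB D(4) in \<open>auto simp: square_integrable_def\<close>)
  have "interval_energy ({..a} \<union> D) F = (LINT t:{..a} \<union> D|lborel. (G t)\<^sup>2) + (LINT t:{..a} \<union> D|lborel. (F t)\<^sup>2)"
    using D by (intro interval_energy_eq(1)[OF H' I C]) auto
  also have "\<dots> = ((LINT t:{..a}|lborel. (G t)\<^sup>2) + (LINT t:{..a}|lborel. (F t)\<^sup>2)) + ((LINT t:D|lborel. (G t)\<^sup>2) + (LINT t:D|lborel. (F t)\<^sup>2))"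
    using HL HD by (subst (1 2) e) (auto simp: H1_pair_def)
  also have "(LINT t:D|lborel. (G t)\<^sup>2) + (LINT t:D|lborel. (F t)\<^sup>2) = interval_energy D F"
    using D by (intro interval_energy_eq(1)[OF HD D(1,2), symmetric]) auto
  also have "interval_energy D F = interval_energy D f"
  proof -
    have "interval_energy D F = (LINT t:D|lborel. (G t)\<^sup>2) + (LINT t:D|lborel. (F t)\<^sup>2)"
      using D by (intro interval_energy_eq(1)[OF HD D(1,2)]) auto
    also have "(LINT t:D|lborel. (G t)\<^sup>2) = (LINT t:D|lborel. (g t)\<^sup>2)"
      by (rule set_lebesgue_integral_cong) (use DB D(4) in \<open>auto simp: G_def\<close>)
    also have "(LINT t:D|lborel. (F t)\<^sup>2) = (LINT t:D|lborel. (f t)\<^sup>2)"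
      by (rule set_lebesgue_integral_cong) (use DB D(4) in \<open>auto simp: F_def\<close>)
    also have "(LINT t:D|lborel. (g t)\<^sup>2) + (LINT t:D|lborel. (f t)\<^sup>2) = interval_energy D f"
      using D by (intro interval_energy_eq(1)[OF H D(1,2), symmetric]) auto
    finally show ?thesis .
  qed
  also have "(LINT t:{..a}|lborel. (G t)\<^sup>2) + (LINT t:{..a}|lborel. (F t)\<^sup>2) \<le> (f a)\<^sup>2 + (f a)\<^sup>2"
  proof (rule add_mono)
    have b: "(LINT t:{..a}|lborel. (h t)\<^sup>2) \<le> (f a)\<^sup>2"
      if h: "square_integrable {..a} h" "AE t in lborel. t \<in> {..a} \<longrightarrow> (h t)\<^sup>2 \<le> indicator {a-1..a} t * (f a)\<^sup>2" for h
    proof -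
      have "(LINT t:{..a}|lborel. (h t)\<^sup>2) \<le> (LINT t|lborel. indicat_real {a-1..a} t * (f a)\<^sup>2)"
        unfolding set_lebesgue_integral_def
      proof (rule integral_mono_AE)
        show "integrable lborel (\<lambda>t. indicat_real {..a} t *\<^sub>R (h t)\<^sup>2)"
          using h(1) by (simp add: square_integrable_def set_integrable_def)
        show "integrable lborel (\<lambda>t. indicat_real {a-1..a} t * (f a)\<^sup>2)" using integrable_indicator_Icc by simp
        show "AE t in lborel. indicat_real {..a} t *\<^sub>R (h t)\<^sup>2 \<le> indicat_real {a-1..a} t * (f a)\<^sup>2"
          using h(2) by eventually_elim (auto simp: indicator_def)
      qed
      then show ?thesis by simp
    qed
    show "(LINT t:{..a}|lborel. (G t)\<^sup>2) \<le> (f a)\<^sup>2"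
    proof (rule b[OF l3])
      \<comment> \<open>The point a is excluded because the value g a is not controlled by f
        a.\<close>
      show "AE t in lborel. t \<in> {..a} \<longrightarrow> (G t)\<^sup>2 \<le> indicator {a-1..a} t * (f a)\<^sup>2"
        using AE_lborel_singleton[of "a"] by eventually_elim (auto simp: G_def)
    qed
    show "(LINT t:{..a}|lborel. (F t)\<^sup>2) \<le> (f a)\<^sup>2"
    proof (rule b)
      show "square_integrable {..a} F" using HL by (simp add: H1_pair_def)
      have "(F t)\<^sup>2 \<le> indicator {a-1..a} t * (f a)\<^sup>2" if "t \<le> a" for t
      proof (cases "t < a - 1")
        case False
        have "(max 0 (t - a + 1))\<^sup>2 \<le> 1" using that by (intro power_le_one) auto
        then have "(f a)\<^sup>2 * (max 0 (t - a + 1))\<^sup>2 \<le> (f a)\<^sup>2" by (simp add: mult_left_le)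
        then show ?thesis using that False by (cases "t = a") (auto simp: F_def power_mult_distrib)
      qed (auto simp: F_def)
      then show "AE t in lborel. t \<in> {..a} \<longrightarrow> (F t)\<^sup>2 \<le> indicator {a-1..a} t * (f a)\<^sup>2" by auto
    qed
  qed
  finally have "interval_energy ({..a} \<union> D) F \<le> interval_energy D f + 2 * (f a)\<^sup>2" by simp
  moreover have "F t = f t" if "t \<in> D" for t using that D(4) by (auto simp: F_def)
  ultimately show thesis using that H' by blast
qed

lemma interval_energy_isometry:
  assumes s: "\<sigma> = 1 \<or> \<sigma> = -1" and H: "H1_pair D f g" and D: "is_interval D" "closed D" "D \<noteq> {}"
    and D': "D' = {t. c + \<sigma> * t \<in> D}"
  shows "interval_energy D' (\<lambda>t. f (c + \<sigma> * t)) = interval_energy D f"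
proof -
  have I: "is_interval D'" unfolding D' by (rule is_interval_isometry[OF D(1) s])
  have C: "closed D'"
    unfolding D' by (rule closed_isometry[OF D(2)])
  obtain d where "d \<in> D" using D by auto
  then have "c + \<sigma> * (\<sigma> * (d - c)) \<in> D" using s by auto
  then have N: "D' \<noteq> {}" unfolding D' by blast
  have sq: "(\<lambda>t. (\<sigma> * g (c + \<sigma> * t))\<^sup>2) = (\<lambda>t. (g (c + \<sigma> * t))\<^sup>2)" using s by auto
  show ?thesis
    unfolding interval_energy_eq(1)[OF H D] interval_energy_eq(1)[OF H1_pair_isometry[OF s H, of c, folded D'] I C N] sq
    using set_integral_isometry[OF s, of c D "\<lambda>t. (g t)\<^sup>2"] set_integral_isometry[OF s, of c D "\<lambda>t. (f t)\<^sup>2"]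
    by (simp add: D')
qed

text \<open>The reflection t -> -t reduces this to the extension to the left.\<close>

lemma extend_right:
  assumes H: "H1_pair D f g" and D: "is_interval D" "closed D" "b \<in> D" "D \<subseteq> {..b}"
  obtains F G where "H1_pair (D \<union> {b..}) F G" "\<And>t. t \<in> D \<Longrightarrow> F t = f t"
    "interval_energy (D \<union> {b..}) F \<le> interval_energy D f + 2 * (f b)\<^sup>2"
proof -
  let ?D = "{t. 0 + (-1) * t \<in> D}"
  have m: "(-1::real) = 1 \<or> (-1::real) = -1" by simp
  have ne: "D \<noteq> {}" using D by auto
  have H': "H1_pair ?D (\<lambda>t. f (0 + (-1) * t)) (\<lambda>t. (-1) * g (0 + (-1) * t))"
    by (rule H1_pair_isometry[OF m H])
  have I: "is_interval ?D" by (rule is_interval_isometry[OF D(1) m])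
  have C: "closed ?D" by (rule closed_isometry[OF D(2)])
  obtain F G where F: "H1_pair ({..-b} \<union> ?D) F G" "\<And>t. t \<in> ?D \<Longrightarrow> F t = f (0 + (-1) * t)"
    "interval_energy ({..-b} \<union> ?D) F \<le> interval_energy ?D (\<lambda>t. f (0 + (-1) * t)) + 2 * (f (0 + (-1) * (-b)))\<^sup>2"
    by (rule extend_left[OF H' I C, of "-b"]) (use D in auto)
  let ?E = "{t. 0 + (-1) * t \<in> {..-b} \<union> ?D}"
  have E: "?E = D \<union> {b..}" by auto
  have IE: "is_interval ({..-b} \<union> ?D)"
    unfolding is_interval_1
  proof (intro ballI allI impI)
    fix u v x assume u: "u \<in> {..-b} \<union> ?D" and v: "v \<in> {..-b} \<union> ?D" and x: "u \<le> x \<and> x \<le> v"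
    show "x \<in> {..-b} \<union> ?D"
    proof (cases "x \<le> -b")
      case False
      then have "v \<in> ?D" using v x by auto
      then show ?thesis using mem_is_interval_1_I[OF I, of "-b" v x] False x D(3) by auto
    qed simp
  qed
  have "H1_pair ?E (\<lambda>t. F (0 + (-1) * t)) (\<lambda>t. (-1) * G (0 + (-1) * t))"
    by (rule H1_pair_isometry[OF m F(1)])
  moreover have "F (0 + (-1) * t) = f t" if "t \<in> D" for t
    using F(2)[of "-t"] that by simp
  moreover have "interval_energy ?E (\<lambda>t. F (0 + (-1) * t)) = interval_energy ({..-b} \<union> ?D) F"
    using C by (intro interval_energy_isometry[OF m F(1) IE] closed_Un) auto
  moreover have "interval_energy ?D (\<lambda>t. f (0 + (-1) * t)) = interval_energy D f"
    by (rule interval_energy_isometry[OF m H D(1,2) ne]) simp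
  ultimately show thesis using that[of "\<lambda>t. F (0 + (-1) * t)" "\<lambda>t. (-1) * G (0 + (-1) * t)"] F(3)
    unfolding E by simp
qed

lemma H1_pair_powr_integrable_UNIV:
  assumes H: "H1_pair UNIV F G" and p: "p > 2"
  shows "set_integrable lborel UNIV (\<lambda>t. \<bar>F t\<bar> powr p)"
proof (rule powr_integrable(1)[OF _ _ _ p])
  have "(F t)\<^sup>2 \<le> (2 / 1 + 2 * 1) * interval_energy UNIV F" for t
    by (rule H1_pair_sup_bound[OF H, of 1 t]) auto
  then show "\<bar>F t\<bar> \<le> sqrt ((2 / 1 + 2 * 1) * interval_energy UNIV F)" for t
    by (simp add: real_le_rsqrt)
qed (use H in \<open>auto simp: H1_pair_def\<close>)

lemma line_Sobolev_mono:
  assumes sob: "\<And>F. H1_cont UNIV F \<Longrightarrow> interval_Lp UNIV p F powr (2 / p) \<le> C * interval_energy UNIV F"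
    and C: "C \<ge> 0" and p: "p > 2" and H: "H1_pair UNIV F G" and f: "\<And>t. t \<in> D \<Longrightarrow> F t = f t"
    and D: "D \<in> sets borel" and E: "interval_energy UNIV F \<le> E"
  shows "interval_Lp D p f powr (2 / p) \<le> C * E"
proof -
  have i: "set_integrable lborel UNIV (\<lambda>t. \<bar>F t\<bar> powr p)" by (rule H1_pair_powr_integrable_UNIV[OF H p])
  have "interval_Lp D p f = (LINT t:D|lborel. \<bar>F t\<bar> powr p)"
    unfolding interval_Lp_def by (rule set_lebesgue_integral_cong) (use D f in auto)
  also have "\<dots> \<le> interval_Lp UNIV p F"
    unfolding interval_Lp_def set_lebesgue_integral_def
  proof (rule integral_mono)
    show "integrable lborel (\<lambda>t. indicat_real D t *\<^sub>R \<bar>F t\<bar> powr p)"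
      using set_integrable_subset[OF i, of D] D by (simp add: set_integrable_def)
    show "integrable lborel (\<lambda>t. indicat_real UNIV t *\<^sub>R \<bar>F t\<bar> powr p)" using i by (simp add: set_integrable_def)
  qed (auto simp: indicator_def)
  finally have "interval_Lp D p f powr (2 / p) \<le> interval_Lp UNIV p F powr (2 / p)"
    using p by (intro powr_mono2 interval_Lp_nonneg) auto
  also have "\<dots> \<le> C * interval_energy UNIV F"
    by (rule sob[OF H1_pair_imp_cont[OF H]]) auto
  also have "\<dots> \<le> C * E" using E C by (rule mult_left_mono)
  finally show ?thesis .
qed

text \<open>The extension to the line does not decrease the integral of the power and raises the
  energy by at most twice the squares of the end values. Thus the constant of the line governs every
  piece up to boundary terms; the frontier is {0} or {0, L}.\<close>

lemma Sobolev_extension: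
  assumes sob: "\<And>F. H1_cont UNIV F \<Longrightarrow> interval_Lp UNIV p F powr (2 / p) \<le> C * interval_energy UNIV F"
    and C: "C \<ge> 0" and p: "p > 2" and f: "H1_cont D f" and D: "D = {0..} \<or> (\<exists>L>0. D = {0..L})"
  shows "interval_Lp D p f powr (2 / p) \<le> C * (interval_energy D f + 2 * (\<Sum>c\<in>frontier D. (f c)\<^sup>2))"
  using D
proof
  assume D: "D = {0..}"
  have H: "H1_pair D f (weak_deriv D f)" by (rule H1_cont_imp_pair[OF f]) (simp add: D is_interval_1)
  obtain F G where F: "H1_pair ({..0} \<union> D) F G" "\<And>t. t \<in> D \<Longrightarrow> F t = f t"
    "interval_energy ({..0} \<union> D) F \<le> interval_energy D f + 2 * (f 0)\<^sup>2"
  proof (rule extend_left[OF H])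
    show "is_interval D" "closed D" "0 \<in> D" "D \<subseteq> {0..}" by (auto simp: D is_interval_1)
  qed blast
  have U: "{..0} \<union> D = UNIV" by (auto simp: D)
  have fr: "frontier D = {0}" by (auto simp: D frontier_def)
  show ?thesis
    unfolding fr by (rule line_Sobolev_mono[OF sob C p F(1)[unfolded U] F(2)]) (use F(3) in \<open>auto simp: D U[unfolded D]\<close>)
next
  assume "\<exists>L>0. D = {0..L}"
  then obtain L where L: "L > 0" and D: "D = {0..L}" by blast
  have H: "H1_pair D f (weak_deriv D f)" by (rule H1_cont_imp_pair[OF f]) (simp add: D is_interval_1)
  obtain F G where F: "H1_pair ({..0} \<union> D) F G" "\<And>t. t \<in> D \<Longrightarrow> F t = f t"
    "interval_energy ({..0} \<union> D) F \<le> interval_energy D f + 2 * (f 0)\<^sup>2"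
  proof (rule extend_left[OF H])
    show "is_interval D" "closed D" "0 \<in> D" "D \<subseteq> {0..}" using L by (auto simp: D is_interval_1)
  qed blast
  have U1: "{..0} \<union> D = {..L}" using L by (auto simp: D)
  obtain F' G' where F': "H1_pair ({..L} \<union> {L..}) F' G'" "\<And>t. t \<in> {..L} \<Longrightarrow> F' t = F t"
    "interval_energy ({..L} \<union> {L..}) F' \<le> interval_energy {..L} F + 2 * (F L)\<^sup>2"
  proof (rule extend_right[OF F(1)[unfolded U1]])
    show "is_interval {..L}" "closed {..L}" "L \<in> {..L}" "{..L} \<subseteq> {..L}" by (auto simp: is_interval_1)
  qed blast
  have U2: "{..L} \<union> {L..} = UNIV" by auto
  have fr: "frontier D = {0, L}" using L by (auto simp: D frontier_def)
  have "interval_energy UNIV F' \<le> interval_energy D f + 2 * (\<Sum>c\<in>{0,L}. (f c)\<^sup>2)"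
    using F'(3) F(3) F(2)[of L] L unfolding U1 U2 by (simp add: D)
  then show ?thesis
    unfolding fr
    using F'(2) F(2) by (intro line_Sobolev_mono[OF sob C p F'(1)[unfolded U2]]) (auto simp: D)
qed

text \<open>The product rule is verified weakly: \<eta> \<phi> is again an admissible test function
  for F, and its derivative produces both terms.\<close>

lemma H1_pair_mult_test:
  assumes H: "H1_pair UNIV F G" and \<eta>: "test_function UNIV \<eta>"
  shows "H1_pair UNIV (\<lambda>t. F t * \<eta> t) (\<lambda>t. G t * \<eta> t + F t * deriv \<eta> t)"
proof -
  have sqF: "square_integrable UNIV F" "square_integrable UNIV G" using H by (auto simp: H1_pair_def)
  note d\<eta> = test_function_has_deriv[OF \<eta>]
  have c\<eta>: "continuous_on UNIV \<eta>" using d\<eta>(1) by (meson DERIV_isCont continuous_at_imp_continuous_on)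
  obtain a b where ab: "\<And>t. t \<notin> {a<..<b} \<Longrightarrow> \<eta> t = 0" "\<And>t. t \<notin> {a..b} \<Longrightarrow> deriv \<eta> t = 0"
    using test_function_support[OF \<eta>] by (metis UNIV_not_empty is_interval_univ)
  have bd: "\<exists>B. \<forall>t. \<bar>\<psi> t\<bar> \<le> B" if c: "continuous_on UNIV \<psi>" and z: "\<And>t. t \<notin> {a..b} \<Longrightarrow> \<psi> t = 0" for \<psi> :: "real \<Rightarrow> real"
  proof -
    obtain B where B: "\<forall>y\<in>\<psi> ` {a..b}. norm y \<le> B"
      using compact_imp_bounded[OF compact_continuous_image[OF continuous_on_subset[OF c] compact_Icc]]
      unfolding bounded_iff by blast
    have "\<bar>\<psi> t\<bar> \<le> max B 0" for t
      using B z[of t] by (cases "t \<in> {a..b}") (auto simp: le_max_iff_disj)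
    then show ?thesis by blast
  qed
  have "\<exists>B. \<forall>t. \<bar>\<eta> t\<bar> \<le> B" by (rule bd[OF c\<eta>]) (use ab in auto)
  then obtain B1 where B1: "\<And>t. \<bar>\<eta> t\<bar> \<le> B1" by blast
  have "\<exists>B. \<forall>t. \<bar>deriv \<eta> t\<bar> \<le> B" by (rule bd[OF d\<eta>(2)]) (use ab in auto)
  then obtain B2 where B2: "\<And>t. \<bar>deriv \<eta> t\<bar> \<le> B2" by blast
  have L2U: "square_integrable UNIV f \<longleftrightarrow> L2 lborel f" for f
    by (simp add: square_integrable_def L2_def set_borel_measurable_def set_integrable_def)
  have prod: "L2 lborel (\<lambda>t. f t * \<psi> t)"
    if f: "L2 lborel f" and c: "continuous_on UNIV \<psi>" and b: "\<And>t. \<bar>\<psi> t\<bar> \<le> B" for f \<psi> B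
  proof (rule L2_bound)
    show "L2 lborel (\<lambda>t. B * f t + 0 * f t)" by (rule L2_lincomb[OF f f])
    show "(\<lambda>t. f t * \<psi> t) \<in> borel_measurable lborel"
      using f borel_measurable_continuous_onI[OF c] by (auto simp: L2_def)
    show "\<bar>f t * \<psi> t\<bar> \<le> \<bar>B * f t + 0 * f t\<bar>" for t
    proof -
      have "\<bar>f t\<bar> * \<bar>\<psi> t\<bar> \<le> \<bar>f t\<bar> * \<bar>B\<bar>" using b[of t] by (intro mult_left_mono) auto
      then show ?thesis by (simp add: abs_mult mult.commute)
    qed
  qed
  have L: "L2 lborel F" "L2 lborel G" using sqF by (auto simp: L2U)
  have L1: "L2 lborel (\<lambda>t. F t * \<eta> t)" by (rule prod[OF L(1) c\<eta> B1])
  have L2': "L2 lborel (\<lambda>t. G t * \<eta> t)" by (rule prod[OF L(2) c\<eta> B1])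
  have L3: "L2 lborel (\<lambda>t. F t * deriv \<eta> t)" by (rule prod[OF L(1) d\<eta>(2) B2])
  have L4: "L2 lborel (\<lambda>t. G t * \<eta> t + F t * deriv \<eta> t)" by (rule L2_add[OF L2' L3])
  have cF: "continuous_on UNIV F" by (rule H1_pair_continuous[OF H]) simp
  show ?thesis
  proof (rule weak_deriv_imp_H1_pair)
    show "is_weak_deriv UNIV (\<lambda>t. F t * \<eta> t) (\<lambda>t. G t * \<eta> t + F t * deriv \<eta> t)"
      unfolding is_weak_deriv_def
    proof (intro allI impI)
      fix \<phi> assume \<phi>: "test_function UNIV \<phi>"
      note d\<phi> = test_function_has_deriv[OF \<phi>]
      have c\<phi>: "continuous_on UNIV \<phi>" using d\<phi>(1) by (meson DERIV_isCont continuous_at_imp_continuous_on)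
      have dp: "((\<lambda>t. \<eta> t * \<phi> t) has_real_derivative (\<eta> t * deriv \<phi> t + deriv \<eta> t * \<phi> t)) (at t)" for t
        using DERIV_mult[OF d\<eta>(1) d\<phi>(1)] by (simp add: add.commute mult.commute)
      then have deriv: "deriv (\<lambda>t. \<eta> t * \<phi> t) = (\<lambda>t. \<eta> t * deriv \<phi> t + deriv \<eta> t * \<phi> t)"
        using DERIV_imp_deriv by blast
      have tp: "test_function UNIV (\<lambda>t. \<eta> t * \<phi> t)"
        unfolding test_function_def
      proof (intro conjI)
        have "continuous_on UNIV (\<lambda>t. \<eta> t * deriv \<phi> t + deriv \<eta> t * \<phi> t)"
          by (intro continuous_intros c\<eta> c\<phi> d\<eta>(2) d\<phi>(2))
        then show "(\<lambda>t. \<eta> t * \<phi> t) C1_differentiable_on UNIV"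
          using dp unfolding C1_differentiable_on_def has_real_derivative_iff_has_vector_derivative
          by (intro exI[of _ "\<lambda>t. \<eta> t * deriv \<phi> t + deriv \<eta> t * \<phi> t"]) auto
        have "closure {t. \<eta> t * \<phi> t \<noteq> 0} \<subseteq> closure {t. \<eta> t \<noteq> 0}" by (rule closure_mono) auto
        moreover have "compact (closure {t. \<eta> t \<noteq> 0})" using \<eta> by (simp add: test_function_def)
        ultimately show "compact (closure {t. \<eta> t * \<phi> t \<noteq> 0})"
          using compact_Int_closed[of "closure {t. \<eta> t \<noteq> 0}" "closure {t. \<eta> t * \<phi> t \<noteq> 0}"]
          by (simp add: Int_absorb1)
      qed simp
      have Lphi: "L2 lborel \<phi>" "L2 lborel (deriv \<phi>)"
        using test_function_L2[OF \<phi>] by (auto simp: L2U)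
      have w: "(LINT t|lborel. F t * (\<eta> t * deriv \<phi> t + deriv \<eta> t * \<phi> t)) = - (LINT t|lborel. G t * (\<eta> t * \<phi> t))"
        using H1_pair_imp_weak_deriv[OF H] tp unfolding is_weak_deriv_def
        by (auto simp: set_lebesgue_integral_def deriv)
      have i: "integrable lborel (\<lambda>t. (F t * \<eta> t) * deriv \<phi> t)" "integrable lborel (\<lambda>t. (F t * deriv \<eta> t) * \<phi> t)"
        "integrable lborel (\<lambda>t. (G t * \<eta> t) * \<phi> t)"
        using L1 L2' L3 Lphi by (auto intro: L2_mult_integrable)
      have "(LINT t|lborel. (F t * \<eta> t) * deriv \<phi> t) =
          (LINT t|lborel. F t * (\<eta> t * deriv \<phi> t + deriv \<eta> t * \<phi> t) - (F t * deriv \<eta> t) * \<phi> t)"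
        by (simp add: algebra_simps)
      also have "\<dots> = (LINT t|lborel. F t * (\<eta> t * deriv \<phi> t + deriv \<eta> t * \<phi> t)) - (LINT t|lborel. (F t * deriv \<eta> t) * \<phi> t)"
      proof (rule Bochner_Integration.integral_diff[OF _ i(2)])
        have "integrable lborel (\<lambda>t. (F t * \<eta> t) * deriv \<phi> t + (F t * deriv \<eta> t) * \<phi> t)" using i by simp
        then show "integrable lborel (\<lambda>t. F t * (\<eta> t * deriv \<phi> t + deriv \<eta> t * \<phi> t))" by (simp add: algebra_simps)
      qed
      also have "\<dots> = - ((LINT t|lborel. (G t * \<eta> t) * \<phi> t) + (LINT t|lborel. (F t * deriv \<eta> t) * \<phi> t))"
        unfolding w by (simp add: mult.assoc)
      also have "(LINT t|lborel. (G t * \<eta> t) * \<phi> t) + (LINT t|lborel. (F t * deriv \<eta> t) * \<phi> t) =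
          (LINT t|lborel. (G t * \<eta> t + F t * deriv \<eta> t) * \<phi> t)"
        unfolding distrib_right by (rule Bochner_Integration.integral_add[OF i(3) i(2), symmetric])
      finally show "(LINT t:UNIV|lborel. F t * \<eta> t * deriv \<phi> t) = - (LINT t:UNIV|lborel. (G t * \<eta> t + F t * deriv \<eta> t) * \<phi> t)"
        by (simp add: set_lebesgue_integral_def)
    qed
  qed (use L1 L4 cF c\<eta> in \<open>auto simp: L2U intro: continuous_intros\<close>)
qed

section \<open>Cut-off functions and compactly supported competitors\<close>

definition cutoff :: "real \<Rightarrow> real \<Rightarrow> real" where
  "cutoff R t = ramp_sq (1 - (t / R)\<^sup>2)"

lemma cutoff_deriv:
  assumes "R > 0"
  shows "(cutoff R has_real_derivative - 4 * t / R\<^sup>2 * max 0 (1 - (t / R)\<^sup>2)) (at t)"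
proof -
  have "((\<lambda>t. 1 - (t / R)\<^sup>2) has_real_derivative - 2 * t / R\<^sup>2) (at t)"
    using assms by (auto intro!: derivative_eq_intros simp: power2_eq_square)
  from DERIV_chain[OF ramp_sq_deriv this] show ?thesis
    by (simp add: cutoff_def[abs_def] o_def algebra_simps)
qed

lemma cutoff_test:
  assumes "R > 0"
  shows "test_function UNIV (cutoff R)" "t \<notin> {-R..R} \<Longrightarrow> cutoff R t = 0" "0 \<le> cutoff R t" "cutoff R t \<le> 1"
    "\<bar>deriv (cutoff R) t\<bar> \<le> 4 / R"
proof -
  have z: "1 - (t / R)\<^sup>2 \<le> 0" if "t \<notin> {-R..R}" for t
  proof -
    have "\<bar>t / R\<bar> \<ge> 1" using that assms by (auto simp: abs_if field_simps)
    then show ?thesis using abs_le_square_iff[of 1 "t / R"] by simp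
  qed
  then show z': "cutoff R t = 0" if "t \<notin> {-R..R}" for t
    using z[OF that] by (auto simp: cutoff_def ramp_sq_def max_def)
  show "0 \<le> cutoff R t" by (simp add: cutoff_def ramp_sq_def)
  show "cutoff R t \<le> 1" unfolding cutoff_def ramp_sq_def by (rule power_le_one) auto
  show "test_function UNIV (cutoff R)"
    unfolding test_function_def
  proof (intro conjI)
    have "continuous_on UNIV (\<lambda>t. - 4 * t / R\<^sup>2 * max 0 (1 - (t / R)\<^sup>2))" using assms by (intro continuous_intros) auto
    then show "cutoff R C1_differentiable_on UNIV"
      using cutoff_deriv[OF assms] unfolding C1_differentiable_on_def has_real_derivative_iff_has_vector_derivative
      by (intro exI[of _ "\<lambda>t. - 4 * t / R\<^sup>2 * max 0 (1 - (t / R)\<^sup>2)"]) auto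
    have "{t. cutoff R t \<noteq> 0} \<subseteq> {-R..R}" using z' by blast
    then have "closure {t. cutoff R t \<noteq> 0} \<subseteq> {-R..R}" by (rule closure_minimal) simp
    then show "compact (closure {t. cutoff R t \<noteq> 0})"
      using compact_Int_closed[OF compact_Icc[of "-R" R] closed_closure[of "{t. cutoff R t \<noteq> 0}"]]
      by (simp add: Int_absorb1)
  qed simp
  have d: "deriv (cutoff R) t = - 4 * t / R\<^sup>2 * max 0 (1 - (t / R)\<^sup>2)"
    by (rule DERIV_imp_deriv[OF cutoff_deriv[OF assms]])
  show "\<bar>deriv (cutoff R) t\<bar> \<le> 4 / R"
  proof (cases "t \<in> {-R..R}")
    case True
    have "\<bar>- 4 * t / R\<^sup>2\<bar> \<le> 4 / R"
    proof -
      have "\<bar>- 4 * t / R\<^sup>2\<bar> = 4 * \<bar>t\<bar> / R\<^sup>2" by (simp add: abs_mult)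
      also have "\<dots> \<le> 4 * R / R\<^sup>2" using True by (intro divide_right_mono) auto
      also have "\<dots> = 4 / R" using assms by (simp add: power2_eq_square)
      finally show ?thesis .
    qed
    moreover have "\<bar>max 0 (1 - (t / R)\<^sup>2)\<bar> \<le> 1" by simp
    ultimately have "\<bar>- 4 * t / R\<^sup>2\<bar> * \<bar>max 0 (1 - (t / R)\<^sup>2)\<bar> \<le> 4 / R * 1"
      using assms by (intro mult_mono) auto
    then show ?thesis unfolding d by (simp only: abs_mult[symmetric] mult_1_right)
  next
    case False
    then have "max 0 (1 - (t / R)\<^sup>2) = 0" using z by simp
    then show ?thesis using assms unfolding d by simp
  qed
qed

text \<open>The products with cut-offs of growing radius converge to F in energy and in the integral
  of the power by dominated convergence, and a strict inequality survives a small
  perturbation.\<close>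

lemma compactly_supported_almost_optimal:
  assumes F: "H1_cont UNIV F" and p: "p > 2" and gt: "interval_Lp UNIV p F powr (2 / p) > C * interval_energy UNIV F"
  obtains F' R where "H1_cont UNIV F'" "R > 0" "\<And>t. t \<notin> {-R..R} \<Longrightarrow> F' t = 0"
    "interval_Lp UNIV p F' powr (2 / p) > C * interval_energy UNIV F'"
proof -
  define G where "G = weak_deriv UNIV F"
  have H: "H1_pair UNIV F G" unfolding G_def by (rule H1_cont_imp_pair[OF F]) simp
  define R where "R n = real (Suc n)" for n
  have R: "R n > 0" "R n \<ge> 1" for n by (auto simp: R_def)
  define \<eta> where "\<eta> n = cutoff (R n)" for n
  define F' where "F' n t = F t * \<eta> n t" for n t
  define G' where "G' n t = G t * \<eta> n t + F t * deriv (\<eta> n) t" for n t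
  note ct = cutoff_test[OF R(1), folded \<eta>_def]
  have H': "H1_pair UNIV (F' n) (G' n)" for n
    unfolding F'_def[abs_def] G'_def[abs_def] by (rule H1_pair_mult_test[OF H ct(1)])
  have L2U: "square_integrable UNIV f \<longleftrightarrow> L2 lborel f" for f
    by (simp add: square_integrable_def L2_def set_borel_measurable_def set_integrable_def)
  have LF: "L2 lborel F" "L2 lborel G" using H by (auto simp: H1_pair_def L2U)
  have LF': "L2 lborel (F' n)" "L2 lborel (G' n)" for n using H'[of n] by (auto simp: H1_pair_def L2U)
  have meas: "F' n \<in> borel_measurable lborel" "G' n \<in> borel_measurable lborel" "F \<in> borel_measurable lborel" "G \<in> borel_measurable lborel" for n
    using LF LF' by (simp_all add: L2_def)
  have R_lim: "(\<lambda>n. x / R n) \<longlonglongrightarrow> 0" for x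
  proof -
    have "(\<lambda>n. x * inverse (real (Suc n))) \<longlonglongrightarrow> x * 0" by (intro tendsto_intros LIMSEQ_inverse_real_of_nat)
    then show ?thesis by (simp add: R_def divide_inverse)
  qed
  have \<eta>_lim: "(\<lambda>n. \<eta> n t) \<longlonglongrightarrow> 1" for t
  proof -
    have "(\<lambda>n. (max 0 (1 - (t / R n)\<^sup>2))\<^sup>2) \<longlonglongrightarrow> (max 0 (1 - 0\<^sup>2))\<^sup>2" by (intro tendsto_intros R_lim)
    then show ?thesis by (simp add: \<eta>_def cutoff_def ramp_sq_def)
  qed
  have d\<eta>_lim: "(\<lambda>n. deriv (\<eta> n) t) \<longlonglongrightarrow> 0" for t
    by (rule Lim_null_comparison[OF _ R_lim[of 4]]) (use ct(5) in simp)
  have F'_lim: "(\<lambda>n. F' n t) \<longlonglongrightarrow> F t" for t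
  proof -
    have "(\<lambda>n. F t * \<eta> n t) \<longlonglongrightarrow> F t * 1" by (intro tendsto_intros \<eta>_lim)
    then show ?thesis by (simp add: F'_def)
  qed
  have G'_lim: "(\<lambda>n. G' n t) \<longlonglongrightarrow> G t" for t
  proof -
    have "(\<lambda>n. G t * \<eta> n t + F t * deriv (\<eta> n) t) \<longlonglongrightarrow> G t * 1 + F t * 0" by (intro tendsto_intros \<eta>_lim d\<eta>_lim)
    then show ?thesis by (simp add: G'_def)
  qed
  have F'_le: "\<bar>F' n t\<bar> \<le> \<bar>F t\<bar>" for n t
    using ct(3,4)[of n t] by (simp add: F'_def abs_mult mult_left_le)
  \<comment> \<open>R n \<ge> 1 bounds the slope of the cut-off by 4, which gives a majorant
    independent of n.\<close>
  have G'_le: "\<bar>G' n t\<bar> \<le> \<bar>G t\<bar> + 4 * \<bar>F t\<bar>" for n t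
  proof -
    have "\<bar>G t * \<eta> n t\<bar> \<le> \<bar>G t\<bar>" using ct(3,4)[of n t] by (simp add: abs_mult mult_left_le)
    moreover have "\<bar>F t * deriv (\<eta> n) t\<bar> \<le> 4 * \<bar>F t\<bar>"
    proof -
      have "4 / R n \<le> 4" using R[of n] by (simp add: field_simps)
      then have "\<bar>deriv (\<eta> n) t\<bar> \<le> 4" using ct(5)[of n t] by linarith
      then have "\<bar>F t\<bar> * \<bar>deriv (\<eta> n) t\<bar> \<le> \<bar>F t\<bar> * 4" by (intro mult_left_mono) auto
      then show ?thesis by (simp add: abs_mult mult.commute)
    qed
    ultimately show ?thesis unfolding G'_def by linarith
  qed
  have limF: "(\<lambda>n. LINT t|lborel. (F' n t)\<^sup>2) \<longlonglongrightarrow> (LINT t|lborel. (F t)\<^sup>2)"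
  proof (rule integral_dominated_convergence)
    show "integrable lborel (\<lambda>t. (F t)\<^sup>2)" using LF by (simp add: L2_def)
    show "AE t in lborel. (\<lambda>n. (F' n t)\<^sup>2) \<longlonglongrightarrow> (F t)\<^sup>2" using F'_lim by (intro AE_I2 tendsto_intros)
    show "AE t in lborel. norm ((F' n t)\<^sup>2) \<le> (F t)\<^sup>2" for n using F'_le by (intro AE_I2) (simp add: abs_le_square_iff)
  qed (use meas in auto)
  have limG: "(\<lambda>n. LINT t|lborel. (G' n t)\<^sup>2) \<longlonglongrightarrow> (LINT t|lborel. (G t)\<^sup>2)"
  proof (rule integral_dominated_convergence)
    have "L2 lborel (\<lambda>t. 1 * \<bar>G t\<bar> + 4 * \<bar>F t\<bar>)" by (rule L2_lincomb[OF L2_abs[OF LF(2)] L2_abs[OF LF(1)]])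
    then show "integrable lborel (\<lambda>t. (\<bar>G t\<bar> + 4 * \<bar>F t\<bar>)\<^sup>2)" by (simp add: L2_def)
    show "AE t in lborel. (\<lambda>n. (G' n t)\<^sup>2) \<longlonglongrightarrow> (G t)\<^sup>2" using G'_lim by (intro AE_I2 tendsto_intros)
    have "\<bar>G' n t\<bar> \<le> \<bar>\<bar>G t\<bar> + 4 * \<bar>F t\<bar>\<bar>" for n t using G'_le[of n t] by linarith
    then show "AE t in lborel. norm ((G' n t)\<^sup>2) \<le> (\<bar>G t\<bar> + 4 * \<bar>F t\<bar>)\<^sup>2" for n
      by (intro AE_I2) (simp only: real_norm_def abs_power2 abs_le_square_iff[symmetric])
  qed (use meas in auto)
  have en: "interval_energy UNIV f = (LINT t|lborel. (g t)\<^sup>2) + (LINT t|lborel. (f t)\<^sup>2)" if "H1_pair UNIV f g" for f g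
    using interval_energy_eq(1)[OF that] by (simp add: set_lebesgue_integral_def)
  have lim_en: "(\<lambda>n. interval_energy UNIV (F' n)) \<longlonglongrightarrow> interval_energy UNIV F"
    unfolding en[OF H] en[OF H'] by (intro tendsto_add limF limG)
  have lim_Lp: "(\<lambda>n. interval_Lp UNIV p (F' n)) \<longlonglongrightarrow> interval_Lp UNIV p F"
    unfolding interval_Lp_def set_lebesgue_integral_def
  proof (rule integral_dominated_convergence)
    show i: "integrable lborel (\<lambda>t. indicat_real UNIV t *\<^sub>R \<bar>F t\<bar> powr p)"
      using H1_pair_powr_integrable_UNIV[OF H p] by (simp add: set_integrable_def)
    show "AE t in lborel. (\<lambda>n. indicat_real UNIV t *\<^sub>R \<bar>F' n t\<bar> powr p) \<longlonglongrightarrow> indicat_real UNIV t *\<^sub>R \<bar>F t\<bar> powr p"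
      using F'_lim p by (intro AE_I2 tendsto_intros) auto
    show "AE t in lborel. norm (indicat_real UNIV t *\<^sub>R \<bar>F' n t\<bar> powr p) \<le> indicat_real UNIV t *\<^sub>R \<bar>F t\<bar> powr p" for n
      using F'_le p by (intro AE_I2) (auto intro: powr_mono2)
    show "(\<lambda>t. indicat_real UNIV t *\<^sub>R \<bar>F' n t\<bar> powr p) \<in> borel_measurable lborel" for n
      using meas(1)[of n] by simp
  qed (use meas in simp)
  have "(\<lambda>n. interval_Lp UNIV p (F' n) powr (2 / p) - C * interval_energy UNIV (F' n)) \<longlonglongrightarrow>
      interval_Lp UNIV p F powr (2 / p) - C * interval_energy UNIV F"
    using p by (intro tendsto_intros lim_Lp lim_en) (auto simp: interval_Lp_nonneg)
  then have "eventually (\<lambda>n. interval_Lp UNIV p (F' n) powr (2 / p) - C * interval_energy UNIV (F' n) > 0) sequentially"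
    by (rule order_tendstoD(1)) (use gt in simp)
  then obtain n where n: "interval_Lp UNIV p (F' n) powr (2 / p) - C * interval_energy UNIV (F' n) > 0"
    by (auto simp: eventually_sequentially)
  show thesis
  proof (rule that[of "F' n" "R n"])
    show "H1_cont UNIV (F' n)" by (rule H1_pair_imp_cont[OF H']) auto
    show "F' n t = 0" if "t \<notin> {- R n..R n}" for t using ct(2)[OF that] by (simp add: F'_def)
  qed (use n R in auto)
qed

section \<open>Splitting of the energy and of the integral of the power\<close>

text \<open>Binary combinations generate the convex hull and are all that is used; any property
  stable under them passes to the hull by induction.\<close>

inductive_set convex_combs :: "('a \<Rightarrow> real) set \<Rightarrow> ('a \<Rightarrow> real) set" for S where
  base: "u \<in> S \<Longrightarrow> u \<in> convex_combs S"
| step: "u \<in> convex_combs S \<Longrightarrow> v \<in> convex_combs S \<Longrightarrow> 0 \<le> \<theta> \<Longrightarrow> \<theta> \<le> 1 \<Longrightarrow>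
    (\<lambda>x. (1 - \<theta>) * u x + \<theta> * v x) \<in> convex_combs S"

lemma convex_combs_mono: "S \<subseteq> T \<Longrightarrow> convex_combs S \<subseteq> convex_combs T"
proof
  fix u assume "S \<subseteq> T" "u \<in> convex_combs S"
  from this(2) show "u \<in> convex_combs T"
    by induction (use \<open>S \<subseteq> T\<close> in \<open>auto intro: convex_combs.intros\<close>)
qed

text \<open>Approximate minimal norm elements u of the convex hulls of the tails form a Cauchy sequence by
  the parallelogram law, so its limit has to be the pointwise limit; the variational inequality for u
  tested with the members of the tail gives the splitting of the energy.\<close>

lemma pointwise_limit_energy_splitting:
  fixes X :: "('a \<Rightarrow> real) set" and E :: "('a \<Rightarrow> real) \<Rightarrow> real" and B :: "('a \<Rightarrow> real) \<Rightarrow> ('a \<Rightarrow> real) \<Rightarrow> real"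
  assumes lin: "\<And>u v a b. u \<in> X \<Longrightarrow> v \<in> X \<Longrightarrow> (\<lambda>x. a * u x + b * v x) \<in> X"
    and quad: "\<And>u v a b. u \<in> X \<Longrightarrow> v \<in> X \<Longrightarrow> E (\<lambda>x. a * u x + b * v x) = a\<^sup>2 * E u + b\<^sup>2 * E v + 2 * a * b * B u v"
    and pos: "\<And>u. u \<in> X \<Longrightarrow> 0 \<le> E u"
    and complete: "\<And>u. (\<And>n::nat. u n \<in> X) \<Longrightarrow> (\<And>e. e > 0 \<Longrightarrow> \<exists>N. \<forall>m\<ge>N. \<forall>n\<ge>N. E (\<lambda>x. u m x - u n x) < e) \<Longrightarrow>
        \<exists>w\<in>X. (\<lambda>n. E (\<lambda>x. u n x - w x)) \<longlonglongrightarrow> 0"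
    and eval: "\<And>u w x. (\<And>n::nat. u n \<in> X) \<Longrightarrow> w \<in> X \<Longrightarrow> (\<lambda>n. E (\<lambda>x. u n x - w x)) \<longlonglongrightarrow> 0 \<Longrightarrow> (\<lambda>n. u n x) \<longlonglongrightarrow> w x"
    and v: "\<And>n::nat. v n \<in> X" "\<And>n. E (v n) \<le> M" "\<And>x. (\<lambda>n. v n x) \<longlonglongrightarrow> w x"
  shows "w \<in> X" and "\<And>e. e > 0 \<Longrightarrow> \<forall>\<^sub>F k in sequentially. E (\<lambda>x. v k x - w x) \<le> E (v k) - E w + e"
proof -
  have diffX: "(\<lambda>x. u x - u' x) \<in> X" if "u \<in> X" "u' \<in> X" for u u'
    using lin[OF that, of 1 "-1"] by simp
  have Ediff: "E (\<lambda>x. u x - u' x) = E u + E u' - 2 * B u u'" if "u \<in> X" "u' \<in> X" for u u'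
    using quad[OF that, of 1 "-1"] by simp
  \<comment> \<open>The parallelogram law with weights. With \<theta> = 1/2 it shows that near
    minimizers are close to each other, with small \<theta> it gives the variational
    inequality.\<close>
  have conv: "E (\<lambda>x. (1 - \<theta>) * u x + \<theta> * u' x) = (1 - \<theta>) * E u + \<theta> * E u' - \<theta> * (1 - \<theta>) * E (\<lambda>x. u' x - u x)"
    if "u \<in> X" "u' \<in> X" for u u' \<theta>
  proof -
    have "B u' u = B u u'"
      using quad[OF that, of 1 1] quad[OF that(2,1), of 1 1] by (simp add: add.commute)
    then show ?thesis
      unfolding quad[OF that] Ediff[OF that(2,1)] by (simp add: power2_eq_square algebra_simps)
  qed
  \<comment> \<open>The triangle inequality through c in squared form; expanding the energy of s f +
    g bounds the mixed term.\<close>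
  have young: "E (\<lambda>x. a x - b x) \<le> (1 + s) * E (\<lambda>x. a x - c x) + (1 + 1 / s) * E (\<lambda>x. b x - c x)"
    if "a \<in> X" "b \<in> X" "c \<in> X" "s > 0" for a b c s
  proof -
    define f where "f = (\<lambda>x. a x - c x)"
    define g where "g = (\<lambda>x. b x - c x)"
    have fg: "f \<in> X" "g \<in> X" unfolding f_def g_def using that by (auto intro: diffX)
    have "(\<lambda>x. a x - b x) = (\<lambda>x. f x - g x)" by (simp add: f_def g_def)
    then have 1: "E (\<lambda>x. a x - b x) = E f + E g - 2 * B f g" using Ediff[OF fg] by simp
    have "0 \<le> E (\<lambda>x. s * f x + 1 * g x)" by (rule pos[OF lin[OF fg]])
    then have "0 \<le> s\<^sup>2 * E f + E g + 2 * s * B f g" using quad[OF fg, of s 1] by simp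
    then have "0 \<le> (s\<^sup>2 * E f + E g + 2 * s * B f g) / s" using \<open>s > 0\<close> by simp
    also have "\<dots> = s * E f + E g / s + 2 * B f g" using \<open>s > 0\<close> by (simp add: field_simps power2_eq_square)
    finally have "- 2 * B f g \<le> s * E f + E g / s" by simp
    with 1 have "E (\<lambda>x. a x - b x) \<le> (1 + s) * E f + (1 + 1 / s) * E g" by (simp add: algebra_simps)
    then show ?thesis by (simp add: f_def g_def)
  qed
  have zeroX: "(\<lambda>x. 0) \<in> X" using lin[OF v(1) v(1), of 0 0 0 0] by simp
  have Ezero: "E (\<lambda>x. u x - 0) = E u" for u by simp
  define C where "C n = convex_combs (v ` {n..})" for n :: nat
  have CX: "u \<in> X" if "u \<in> C n" for u n
    using that unfolding C_def by induction (use v(1) lin in auto)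
  have Cmono: "C m \<subseteq> C n" if "n \<le> m" for m n
    unfolding C_def by (rule convex_combs_mono) (use that in auto)
  have vC: "v k \<in> C n" if "n \<le> k" for k n unfolding C_def using that by (intro convex_combs.base) auto
  define d where "d n = Inf (E ` C n)" for n
  have bdd: "bdd_below (E ` C n)" for n by (rule bdd_belowI[of _ 0]) (use pos CX in auto)
  have ne: "E ` C n \<noteq> {}" for n using vC[of n n] by auto
  have d_le: "d n \<le> E u" if "u \<in> C n" for u n unfolding d_def using that bdd by (intro cInf_lower) auto
  have d0: "0 \<le> d n" for n unfolding d_def using ne pos CX by (intro cInf_greatest) auto
  have dM: "d n \<le> M" for n using d_le[OF vC[of n n]] v(2)[of n] by simp
  \<comment> \<open>The hulls of the tails shrink, so their minimal energies increase; being bounded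
    by M, they converge.\<close>
  have dmono: "d n \<le> d m" if "n \<le> m" for n m
    unfolding d_def by (rule cInf_superset_mono) (use Cmono[OF that] bdd ne in auto)
  have "\<exists>u. u \<in> C n \<and> E u < d n + 1 / (real n + 1)" for n
  proof -
    have "Inf (E ` C n) < d n + 1 / (real n + 1)" by (simp add: d_def)
    then obtain y where "y \<in> E ` C n" "y < d n + 1 / (real n + 1)"
      using cInf_lessD[OF ne] by blast
    then show ?thesis by blast
  qed
  then obtain u where u: "\<And>n. u n \<in> C n" "\<And>n. E (u n) < d n + 1 / (real n + 1)" by metis
  have uX: "u n \<in> X" for n by (rule CX[OF u(1)])
  define M' where "M' = M + 1"
  have M: "0 \<le> M" using pos[OF v(1)] v(2) order_trans by blast
  have uM: "E (u n) \<le> M'" for n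
  proof -
    have "1 / (real n + 1) \<le> 1" by simp
    then show ?thesis using u(2)[of n] dM[of n] unfolding M'_def by linarith
  qed
  have dconv: "Cauchy d"
  proof -
    have "Bseq d" by (rule BseqI'[of d M]) (use d0 dM in auto)
    then have "convergent d" by (intro Bseq_monoseq_convergent) (auto simp: monoseq_def dmono)
    then show ?thesis by (rule convergent_Cauchy)
  qed
  \<comment> \<open>The midpoint of u n and u m still belongs to \<open>C n\<close>, so its energy
    is at least d n.\<close>
  have gap: "E (\<lambda>x. u m x - u n x) \<le> 2 * (d m - d n) + 4 / (real n + 1)" if "n \<le> m" for m n
  proof -
    have "(\<lambda>x. (1 - 1/2) * u n x + 1/2 * u m x) \<in> C n"
      unfolding C_def by (rule convex_combs.step) (use u(1)[of n] u(1)[of m] Cmono[OF that] in \<open>auto simp: C_def\<close>)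
    then have "d n \<le> E (\<lambda>x. (1 - 1/2) * u n x + 1/2 * u m x)" by (rule d_le)
    also have "\<dots> = (E (u n) + E (u m)) / 2 - E (\<lambda>x. u m x - u n x) / 4"
      by (subst conv[OF uX uX]) (simp add: field_simps)
    finally have *: "E (\<lambda>x. u m x - u n x) \<le> 2 * (E (u n) + E (u m)) - 4 * d n" by (simp add: field_simps)
    have "1 / (real m + 1) \<le> 1 / (real n + 1)" using that by (intro divide_left_mono) auto
    then have "2 * E (u n) + 2 * E (u m) \<le> 2 * d n + 2 * d m + 4 * (1 / (real n + 1))"
      using u(2)[of n] u(2)[of m] by argo
    with * show ?thesis by simp
  qed
  have small: "\<exists>N. \<forall>n\<ge>N. c / (real n + 1) < e" if "e > 0" for c e :: real
  proof -
    obtain N where N: "real N > \<bar>c\<bar> / e" using reals_Archimedean2 by blast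
    have "c / (real n + 1) < e" if "n \<ge> N" for n
    proof -
      have "\<bar>c\<bar> / e < real n + 1" using N that by linarith
      then have "\<bar>c\<bar> < e * (real n + 1)" using \<open>e > 0\<close> by (simp add: field_simps)
      then have "c < e * (real n + 1)" by linarith
      then show ?thesis by (simp add: field_simps)
    qed
    then show ?thesis by blast
  qed
  have "\<exists>w'\<in>X. (\<lambda>n. E (\<lambda>x. u n x - w' x)) \<longlonglongrightarrow> 0"
  proof (rule complete[OF uX])
    fix e :: real assume e: "e > 0"
    obtain N1 where N1: "\<And>m n. m \<ge> N1 \<Longrightarrow> n \<ge> N1 \<Longrightarrow> \<bar>d m - d n\<bar> < e / 4"
      using dconv e unfolding Cauchy_def dist_real_def by (metis divide_pos_pos zero_less_numeral)
    obtain N2 where N2: "\<And>n. n \<ge> N2 \<Longrightarrow> 4 / (real n + 1) < e / 2" using small[of "e/2" 4] e by auto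
    have *: "E (\<lambda>x. u m x - u n x) < e" if "n \<le> m" "n \<ge> max N1 N2" for m n
    proof -
      have "\<bar>d m - d n\<bar> < e / 4" by (rule N1) (use that in auto)
      moreover have "4 / (real n + 1) < e / 2" by (rule N2) (use that in auto)
      moreover have "d m - d n \<le> \<bar>d m - d n\<bar>" by simp
      ultimately show ?thesis using gap[OF that(1)] by argo
    qed
    have sym: "E (\<lambda>x. u m x - u n x) = E (\<lambda>x. u n x - u m x)" for m n
      using conv[OF uX[of m] uX[of n], of 1] Ediff[OF uX[of m] uX[of n]] Ediff[OF uX[of n] uX[of m]]
        quad[OF uX[of m] uX[of n], of 1 1] quad[OF uX[of n] uX[of m], of 1 1] by (simp add: add.commute)
    show "\<exists>N. \<forall>m\<ge>N. \<forall>n\<ge>N. E (\<lambda>x. u m x - u n x) < e"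
    proof (intro exI[of _ "max N1 N2"] allI impI)
      fix m n assume mn: "m \<ge> max N1 N2" "n \<ge> max N1 N2"
      show "E (\<lambda>x. u m x - u n x) < e"
      proof (cases "n \<le> m")
        case True then show ?thesis using * mn by blast
      next
        case False then show ?thesis using *[of m n] mn sym[of m n] by simp
      qed
    qed
  qed
  then obtain w' where w': "w' \<in> X" "(\<lambda>n. E (\<lambda>x. u n x - w' x)) \<longlonglongrightarrow> 0" by blast
  have "w' = w"
  proof
    fix x
    have "(\<lambda>n. u n x) \<longlonglongrightarrow> w x"
    proof (rule LIMSEQ_I)
      fix e :: real assume e: "e > 0"
      then obtain N where N: "\<And>n. n \<ge> N \<Longrightarrow> \<bar>v n x - w x\<bar> < e"
        using LIMSEQ_D[OF v(3)[of x] e] by (auto simp: real_norm_def)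
      \<comment> \<open>An interval around w x is convex, so it contains the values at x of the
        whole hull as soon as it contains those of the tail.\<close>
      have "\<bar>y x - w x\<bar> < e" if "y \<in> C n" "n \<ge> N" for y n
        using that(1) unfolding C_def
      proof induction
        case (base y) then show ?case using N that(2) by auto
      next
        case (step y y' \<theta>)
        have "\<bar>(1 - \<theta>) * y x + \<theta> * y' x - w x\<bar> = \<bar>(1 - \<theta>) * (y x - w x) + \<theta> * (y' x - w x)\<bar>"
          by (simp add: algebra_simps)
        also have "\<dots> \<le> (1 - \<theta>) * \<bar>y x - w x\<bar> + \<theta> * \<bar>y' x - w x\<bar>"
          using step by (intro order_trans[OF abs_triangle_ineq]) (simp add: abs_mult)
        also have "\<dots> < e"
          using convex_bound_lt[OF step.IH, of "1 - \<theta>" \<theta>] step by simp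
        finally show ?case .
      qed
      then show "\<exists>no. \<forall>n\<ge>no. norm (u n x - w x) < e" using u(1) by (auto simp: real_norm_def)
    qed
    with eval[OF uX w'] show "w' x = w x" by (rule LIMSEQ_unique)
  qed
  with w' show wX: "w \<in> X" by simp
  have uw: "(\<lambda>n. E (\<lambda>x. u n x - w x)) \<longlonglongrightarrow> 0" using w'(2) \<open>w' = w\<close> by simp
  \<comment> \<open>The inequality \<open>young\<close> through 0 with s = 1, which costs a factor 2
    for each of the two energies.\<close>
  have E_le: "E (\<lambda>x. a x - b x) \<le> 4 * M'" if "a \<in> X" "b \<in> X" "E a \<le> M'" "E b \<le> M'" for a b
    using young[OF that(1,2) zeroX, of 1] that(3,4) Ezero by simp
  fix e :: real assume e: "e > 0"
  \<comment> \<open>All energies involved are at most M', and the final estimate contains nine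
    multiples of s M'; the bound e / 40 keeps their sum below e / 4.\<close>
  define s where "s = e / (40 * (M' + 1))"
  have M'0: "M' \<ge> 0" using M by (simp add: M'_def)
  have s: "s > 0" "s * M' \<le> e / 40" using e M'0 by (auto simp: s_def field_simps)
  obtain N1 where N1: "\<And>n. n \<ge> N1 \<Longrightarrow> \<bar>E (\<lambda>x. u n x - w x)\<bar> < e / (8 * (1 + 1 / s))"
    using LIMSEQ_D[OF uw, of "e / (8 * (1 + 1 / s))"] e s by (auto simp: real_norm_def add_pos_pos)
  \<comment> \<open>The index n is fixed after s, so that the defect \<eta> of u n is small even
    after division by s.\<close>
  obtain N2 where N2: "\<And>n. n \<ge> N2 \<Longrightarrow> (1 / s) / (real n + 1) < e / 8" using small[of "e/8" "1/s"] e by auto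
  define n where "n = max N1 N2"
  define \<eta> where "\<eta> = 1 / (real n + 1)"
  have \<eta>: "0 < \<eta>" "\<eta> \<le> 1" by (simp_all add: \<eta>_def)
  have un: "E (u n) < d n + \<eta>" using u(2)[of n] by (simp add: \<eta>_def)
  have "E (\<lambda>x. u n x - w x) \<le> e / (8 * (1 + 1 / s))" using N1[of n] by (simp add: n_def)
  then have dn: "(1 + 1 / s) * E (\<lambda>x. u n x - w x) \<le> e / 8" using s by (simp add: field_simps)
  have dn': "(1 / s) * \<eta> < e / 8" using N2[of n] by (simp add: n_def \<eta>_def)
  have sym: "E (\<lambda>x. a x - b x) = E (\<lambda>x. b x - a x)" if "a \<in> X" "b \<in> X" for a b
    using Ediff[OF that] Ediff[OF that(2,1)] quad[OF that, of 1 1] quad[OF that(2,1), of 1 1] by (simp add: add.commute)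
  define Y where "Y = (1 + 1 / s) * E (\<lambda>x. w x - u n x)"
  have Y: "Y \<le> e / 8" using dn sym[OF uX[of n] wX] by (simp add: Y_def)
  have sE: "s * E (u n) \<le> s * M'" using uM s by (intro mult_left_mono) auto
  have "E w = E (\<lambda>x. 0 - w x)" using sym[OF zeroX wX] by simp
  also have "\<dots> \<le> (1 + s) * E (\<lambda>x. 0 - u n x) + Y"
    unfolding Y_def by (rule young[OF zeroX wX uX[of n] s(1)])
  also have "E (\<lambda>x. 0 - u n x) = E (u n)" using sym[OF zeroX uX[of n]] by simp
  also have "(1 + s) * E (u n) + Y = E (u n) + s * E (u n) + Y" by (simp add: distrib_right)
  finally have Ew: "E w \<le> E (u n) + s * M' + e / 8" using sE Y by linarith
  show "\<forall>\<^sub>F k in sequentially. E (\<lambda>x. v k x - w x) \<le> E (v k) - E w + e"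
    unfolding eventually_sequentially
  proof (intro exI[of _ n] allI impI)
    fix k assume k: "k \<ge> n"
    let ?D = "E (\<lambda>x. v k x - u n x)"
    have vM: "E (v k) \<le> M'" using v(2)[of k] by (simp add: M'_def)
    have D4: "?D \<le> 4 * M'" by (rule E_le[OF v(1) uX vM uM])
    have D0: "0 \<le> ?D" by (rule pos[OF diffX[OF v(1) uX]])
    \<comment> \<open>Near minimality of u n is tested by moving towards v k by the fraction
      \<theta>. The minimum with 1 makes \<theta> an admissible weight, since s grows with
      e.\<close>
    define \<theta> where "\<theta> = min s 1"
    have th: "0 < \<theta>" "\<theta> \<le> 1" "\<theta> \<le> s" using s by (auto simp: \<theta>_def)
    have "d n \<le> E (\<lambda>x. (1 - \<theta>) * u n x + \<theta> * v k x)"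
      using u(1)[of n] vC[OF k] th by (intro d_le) (auto simp: C_def intro: convex_combs.step)
    also have "\<dots> = (1 - \<theta>) * E (u n) + \<theta> * E (v k) - \<theta> * (1 - \<theta>) * ?D"
      by (rule conv[OF uX v(1)])
    finally have "E (u n) - \<eta> \<le> (1 - \<theta>) * E (u n) + \<theta> * E (v k) - \<theta> * (1 - \<theta>) * ?D"
      using un by argo
    then have "\<theta> * ((1 - \<theta>) * ?D) \<le> \<theta> * (E (v k) - E (u n) + \<eta> / \<theta>)"
    proof -
      have "\<theta> * (E (v k) - E (u n) + \<eta> / \<theta>) = \<theta> * E (v k) - \<theta> * E (u n) + \<eta>"
        using th by (simp add: algebra_simps)
      moreover have "(1 - \<theta>) * E (u n) = E (u n) - \<theta> * E (u n)" by (simp add: left_diff_distrib)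
      moreover have "\<theta> * ((1 - \<theta>) * ?D) = \<theta> * (1 - \<theta>) * ?D" by simp
      ultimately show ?thesis
        using \<open>E (u n) - \<eta> \<le> (1 - \<theta>) * E (u n) + \<theta> * E (v k) - \<theta> * (1 - \<theta>) * ?D\<close> by linarith
    qed
    then have A: "(1 - \<theta>) * ?D \<le> E (v k) - E (u n) + \<eta> / \<theta>"
      using th by (simp add: mult_le_cancel_left)
    have th1: "\<eta> / \<theta> \<le> e / 8 + \<eta>"
    proof (cases "s \<le> 1")
      case True
      then have th_s: "\<theta> = s" by (simp add: \<theta>_def)
      have "\<eta> / s < e / 8" using dn' by (simp only: times_divide_eq_left mult_1_left)
      then show ?thesis unfolding th_s using \<eta>(1) by linarith
    next
      case False
      then have "\<theta> = 1" by (simp add: \<theta>_def)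
      then show ?thesis using e by simp
    qed
    have th2: "\<theta> * ?D \<le> s * (4 * M')" using th s D4 D0 by (intro mult_mono) auto
    have n1: "\<eta> \<le> e / 8 * s"
      using dn' s by (simp add: field_simps)
    have "E (\<lambda>x. v k x - w x) \<le> (1 + s) * ?D + Y"
      unfolding Y_def by (rule young[OF v(1) wX uX s(1)])
    also have "(1 + s) * ?D + Y = ?D + s * ?D + Y" by (simp add: distrib_right)
    finally have F: "E (\<lambda>x. v k x - w x) \<le> ?D + s * (4 * M') + e / 8"
      using mult_left_mono[OF D4, of s] s(1) Y by linarith
    have "?D \<le> E (v k) - E (u n) + \<eta> / \<theta> + s * (4 * M')"
    proof -
      have "(1 - \<theta>) * ?D = ?D - \<theta> * ?D" by (simp add: left_diff_distrib)
      with A th2 show ?thesis by argo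
    qed
    with F Ew th1 have G: "E (\<lambda>x. v k x - w x) \<le> E (v k) - E w + (e / 8 + \<eta>) + 9 * (s * M') + e / 4"
      by argo
    have s_le: "s \<le> e / 40" using e M'0 by (auto simp: s_def field_simps)
    show "E (\<lambda>x. v k x - w x) \<le> E (v k) - E w + e"
    \<comment> \<open>If s > 1, then e > 40 because s \<le> e / 40, and \<eta> \<le> 1 is
      harmless.\<close>
    proof (cases "s \<le> 1")
      case True
      then have "e / 8 * s \<le> e / 8" using e by simp
      then show ?thesis using G n1 s(2) e by argo
    next
      case False
      have "1 \<le> e / 40" using False s_le by linarith
      then show ?thesis using G s(2) e \<eta> by argo
    qed
  qed
qed

section \<open>Inequalities for powers\<close>

lemma powr_add_le:
  fixes a b q :: real
  assumes "0 \<le> a" "0 \<le> b" "0 < q" "q \<le> 1"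
  shows "(a + b) powr q \<le> a powr q + b powr q"
proof (cases "a + b = 0")
  case False
  define s where "s = a + b"
  have s: "s > 0" using False assms by (simp add: s_def)
  \<comment> \<open>By homogeneity the sum may be scaled to 1, and on [0, 1] every number is at most
    its q-th power.\<close>
  have *: "x / s \<le> (x / s) powr q" if "0 \<le> x" "x \<le> s" for x
  proof (cases "x = 0")
    case False
    then have "(x / s) powr 1 \<le> (x / s) powr q" using that s assms by (intro powr_mono') auto
    then show ?thesis using that s by simp
  qed simp
  have "1 = a / s + b / s" using s by (simp add: s_def flip: add_divide_distrib)
  also have "\<dots> \<le> (a / s) powr q + (b / s) powr q"
    using *[of a] *[of b] assms by (auto simp: s_def)
  also have "\<dots> = (a powr q + b powr q) / s powr q"
    using assms s by (simp add: powr_divide add_divide_distrib)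
  finally have "s powr q \<le> a powr q + b powr q" using s by (simp add: field_simps)
  then show ?thesis by (simp add: s_def)
qed (use assms in simp)

lemma powr_sum_le:
  fixes f :: "'k \<Rightarrow> real"
  assumes "finite K" "\<And>k. k \<in> K \<Longrightarrow> 0 \<le> f k" "0 < q" "q \<le> 1"
  shows "(\<Sum>k\<in>K. f k) powr q \<le> (\<Sum>k\<in>K. f k powr q)"
  using assms(1,2)
proof induction
  case (insert k K)
  have "(f k + sum f K) powr q \<le> f k powr q + sum f K powr q"
    using insert assms by (intro powr_add_le sum_nonneg) auto
  also have "sum f K powr q \<le> (\<Sum>k\<in>K. f k powr q)" using insert by auto
  finally show ?case using insert by simp
qed simp

text \<open>The mean value theorem for the p-th power. The case of a vanishing end point is
  separate, because the derivative rule for \<open>powr\<close> is applied at positive points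
  only.\<close>

lemma powr_diff_le:
  fixes x y p :: real
  assumes "0 \<le> x" "0 \<le> y" "x \<le> S" "y \<le> S" "p > 1"
  shows "\<bar>x powr p - y powr p\<bar> \<le> p * S powr (p - 1) * \<bar>x - y\<bar>"
proof -
  have *: "y powr p - x powr p \<le> p * S powr (p - 1) * (y - x)" if xy: "0 \<le> x" "x < y" "y \<le> S" for x y
  proof (cases "x = 0")
    case True
    have "y powr p = y powr (p - 1) * y powr 1" by (simp only: powr_add[symmetric]) simp
    also have "\<dots> = y powr (p - 1) * y" using xy by simp
    also have "\<dots> \<le> S powr (p - 1) * y" using xy assms by (intro mult_right_mono powr_mono2) auto
    also have "\<dots> \<le> p * S powr (p - 1) * y"
      using xy assms mult_right_mono[of 1 p "S powr (p - 1) * y"] by (simp add: mult.assoc)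
    finally show ?thesis using True by simp
  next
    case False
    then have x: "x > 0" using xy by simp
    have "\<exists>z. x < z \<and> z < y \<and> y powr p - x powr p = (y - x) * (p * z powr (p - 1))"
    proof (rule MVT2[OF xy(2)])
      show "((\<lambda>z. z powr p) has_real_derivative p * z powr (p - 1)) (at z)" if "x \<le> z" for z
        using that x by (auto intro!: derivative_eq_intros)
    qed
    then obtain z where z: "x < z" "z < y" "y powr p - x powr p = (y - x) * (p * z powr (p - 1))" by blast
    have "z powr (p - 1) \<le> S powr (p - 1)" using z x xy assms by (intro powr_mono2) auto
    then have "(y - x) * (p * z powr (p - 1)) \<le> (y - x) * (p * S powr (p - 1))"
      using xy assms by (intro mult_left_mono) auto
    then show ?thesis using z by (simp add: mult_ac)
  qed
  have mono: "x powr p \<le> y powr p" if "0 \<le> x" "x \<le> y" for x y using that assms by (intro powr_mono2) auto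
  consider "x < y" | "x = y" | "y < x" by linarith
  then show ?thesis
  proof cases
    case 1 then show ?thesis using *[of x y] mono[of x y] assms by (simp add: abs_if)
  next
    case 3 then show ?thesis using *[of y x] mono[of y x] assms by (simp add: abs_if)
  qed simp
qed

text \<open>By symmetry |b| \<le> |a|. Then |a + b| and |a| are at most 2 |a|, and the mean value
  theorem gives the first term of the constant; |b|^p \<le> S^(p-2) |a| |b| gives the second. For
  bounded functions the error is thus controlled by a product of two square integrable functions,
  which suits \<open>L2_weak_null\<close>.\<close>

lemma Brezis_Lieb_pointwise:
  fixes a b S p :: real
  assumes ab: "\<bar>a\<bar> \<le> S" "\<bar>b\<bar> \<le> S" and p: "p > 2"
  shows "\<bar>\<bar>a + b\<bar> powr p - \<bar>a\<bar> powr p - \<bar>b\<bar> powr p\<bar> \<le> (p * 2 powr (p - 1) + 1) * S powr (p - 2) * (\<bar>a\<bar> * \<bar>b\<bar>)"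
proof -
  have *: "\<bar>\<bar>a + b\<bar> powr p - \<bar>a\<bar> powr p - \<bar>b\<bar> powr p\<bar> \<le> (p * 2 powr (p - 1) + 1) * S powr (p - 2) * (\<bar>a\<bar> * \<bar>b\<bar>)"
    if ab: "\<bar>b\<bar> \<le> \<bar>a\<bar>" "\<bar>a\<bar> \<le> S" for a b
  proof -
    have S: "\<bar>a\<bar> powr (p - 2) \<le> S powr (p - 2)" "\<bar>b\<bar> powr (p - 2) \<le> S powr (p - 2)"
      using ab p by (auto intro!: powr_mono2)
    have split: "\<bar>x\<bar> powr r = \<bar>x\<bar> powr (r - 1) * \<bar>x\<bar>" for x r :: real
    proof -
      have "\<bar>x\<bar> powr r = \<bar>x\<bar> powr (r - 1) * \<bar>x\<bar> powr 1" by (simp only: powr_add[symmetric]) simp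
      then show ?thesis by simp
    qed
    have "\<bar>\<bar>a + b\<bar> powr p - \<bar>a\<bar> powr p\<bar> \<le> p * (2 * \<bar>a\<bar>) powr (p - 1) * \<bar>\<bar>a + b\<bar> - \<bar>a\<bar>\<bar>"
      using ab p by (intro powr_diff_le) auto
    also have "\<dots> \<le> p * (2 * \<bar>a\<bar>) powr (p - 1) * \<bar>b\<bar>"
      using p by (intro mult_left_mono) auto
    also have "(2 * \<bar>a\<bar>) powr (p - 1) = 2 powr (p - 1) * (\<bar>a\<bar> powr (p - 2) * \<bar>a\<bar>)"
      using split[of a "p - 1"] by (simp add: powr_mult)
    also have "p * (2 powr (p - 1) * (\<bar>a\<bar> powr (p - 2) * \<bar>a\<bar>)) * \<bar>b\<bar> = (p * 2 powr (p - 1) * (\<bar>a\<bar> * \<bar>b\<bar>)) * \<bar>a\<bar> powr (p - 2)"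
      by (simp add: mult_ac)
    also have "\<dots> \<le> (p * 2 powr (p - 1) * (\<bar>a\<bar> * \<bar>b\<bar>)) * S powr (p - 2)"
      using p S by (intro mult_left_mono) auto
    finally have 1: "\<bar>\<bar>a + b\<bar> powr p - \<bar>a\<bar> powr p\<bar> \<le> (p * 2 powr (p - 1) * (\<bar>a\<bar> * \<bar>b\<bar>)) * S powr (p - 2)" .
    have "\<bar>b\<bar> powr p = \<bar>b\<bar> powr (p - 2) * (\<bar>b\<bar> * \<bar>b\<bar>)" using split[of b p] split[of b "p - 1"] by simp
    also have "\<dots> \<le> S powr (p - 2) * (\<bar>a\<bar> * \<bar>b\<bar>)"
      using S ab by (intro mult_mono) auto
    finally have 2: "\<bar>b\<bar> powr p \<le> S powr (p - 2) * (\<bar>a\<bar> * \<bar>b\<bar>)" .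
    have "\<bar>\<bar>a + b\<bar> powr p - \<bar>a\<bar> powr p - \<bar>b\<bar> powr p\<bar> \<le> \<bar>\<bar>a + b\<bar> powr p - \<bar>a\<bar> powr p\<bar> + \<bar>b\<bar> powr p"
      using powr_ge_zero[of "\<bar>b\<bar>" p] by linarith
    also have "\<dots> \<le> (p * 2 powr (p - 1) * (\<bar>a\<bar> * \<bar>b\<bar>)) * S powr (p - 2) + S powr (p - 2) * (\<bar>a\<bar> * \<bar>b\<bar>)"
      using 1 2 by linarith
    finally show ?thesis by (simp add: algebra_simps)
  qed
  show ?thesis
  proof (cases "\<bar>b\<bar> \<le> \<bar>a\<bar>")
    case True then show ?thesis using *[of b a] ab by simp
  next
    case False
    then have "\<bar>\<bar>b + a\<bar> powr p - \<bar>b\<bar> powr p - \<bar>a\<bar> powr p\<bar> \<le> (p * 2 powr (p - 1) + 1) * S powr (p - 2) * (\<bar>b\<bar> * \<bar>a\<bar>)"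
      using *[of a b] ab by simp
    moreover have "\<bar>b + a\<bar> powr p - \<bar>b\<bar> powr p - \<bar>a\<bar> powr p = \<bar>a + b\<bar> powr p - \<bar>a\<bar> powr p - \<bar>b\<bar> powr p"
      by (simp add: add.commute)
    ultimately show ?thesis by (simp only: mult.commute[of "\<bar>b\<bar>" "\<bar>a\<bar>"])
  qed
qed

section \<open>Finite families of intervals\<close>

text \<open>The derivatives converge in the square integrable sense to some G. By Cauchy-Schwarz
  their integrals over [s, t] converge as well, so the fundamental theorem passes to the pair F,
  G.\<close>

lemma H1_pair_complete:
  assumes H: "\<And>n. H1_pair D (f n) (g n)" and D: "is_interval D" "closed D" "D \<noteq> {}"
    and Cau: "\<And>e. e > 0 \<Longrightarrow> \<exists>N. \<forall>m\<ge>N. \<forall>n\<ge>N. interval_energy D (\<lambda>t. f m t - f n t) < e"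
    and lim: "\<And>t. t \<in> D \<Longrightarrow> (\<lambda>n. f n t) \<longlonglongrightarrow> F t"
  shows "H1_cont D F" "(\<lambda>n. interval_energy D (\<lambda>t. f n t - F t)) \<longlonglongrightarrow> 0"
proof -
  let ?M = "restrict_space lborel D"
  have DB: "D \<in> sets borel" using D(1) by (rule sets_borel_is_interval)
  have L: "L2 ?M (f n)" "L2 ?M (g n)" for n
    using H[of n] unfolding H1_pair_def square_integrable_iff_L2[OF DB] by blast+
  have Hd: "H1_pair D (\<lambda>t. f m t - f n t) (\<lambda>t. g m t - g n t)" for m n
    using H1_pair_lincomb[OF H[of m] H[of n] D(1), of 1 "-1"] by simp
  have Cg: "\<exists>N. \<forall>m\<ge>N. \<forall>n\<ge>N. (LINT t|?M. (g m t - g n t)\<^sup>2) < e" if "e > 0" for e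
    using Cau[OF that] H1_pair_sq_integrals_le(1)[OF Hd D] unfolding set_integral_restrict[OF DB] by (meson le_less_trans)
  have Cf: "\<exists>N. \<forall>m\<ge>N. \<forall>n\<ge>N. (LINT t|?M. (f m t - f n t)\<^sup>2) < e" if "e > 0" for e
    using Cau[OF that] H1_pair_sq_integrals_le(2)[OF Hd D] unfolding set_integral_restrict[OF DB] by (meson le_less_trans)
  have "sigma_finite_measure ?M"
    by (rule sigma_finite_measure_restrict_space[OF sigma_finite_lborel]) (use DB in simp)
  then obtain G where G: "L2 ?M G" "(\<lambda>n. LINT t|?M. (g n t - G t)\<^sup>2) \<longlonglongrightarrow> 0"
    using L2_complete[OF _ L(2) Cg] by blast
  have Fm: "F \<in> borel_measurable ?M"
    by (rule borel_measurable_LIMSEQ_real[of _ "f"]) (use lim L in \<open>auto simp: L2_def space_restrict_space\<close>)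
  have F: "L2 ?M F" "(\<lambda>n. LINT t|?M. (f n t - F t)\<^sup>2) \<longlonglongrightarrow> 0"
  proof -
    have "AE t in ?M. (\<lambda>i. f (id i) t) \<longlonglongrightarrow> F t" using lim by (intro AE_I2) (simp add: space_restrict_space)
    from L2_Cauchy_limit[OF L(1) Cf strict_mono_id this Fm]
    show "L2 ?M F" "(\<lambda>n. LINT t|?M. (f n t - F t)\<^sup>2) \<longlonglongrightarrow> 0" by simp_all
  qed
  have sqG: "square_integrable D G" "square_integrable D F" using F G by (simp_all add: square_integrable_iff_L2[OF DB])
  have pair: "H1_pair D F G"
    unfolding H1_pair_def
  proof (intro conjI ballI impI sqG)
    fix s t assume st: "s \<in> D" "t \<in> D" "s \<le> t"
    have sub: "{s..t} \<subseteq> D" by (rule Icc_subset_interval[OF D(1) st(1,2)])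
    have sqd: "square_integrable D (\<lambda>t. g n t - G t)" for n
      using L2_diff[OF L(2) G(1)] by (simp add: square_integrable_iff_L2[OF DB])
    have "(\<lambda>n. (LINT u:{s..t}|lborel. g n u) - (LINT u:{s..t}|lborel. G u)) \<longlonglongrightarrow> 0"
    proof (rule Lim_null_comparison)
      show "\<forall>\<^sub>F n in sequentially. norm ((LINT u:{s..t}|lborel. g n u) - (LINT u:{s..t}|lborel. G u)) \<le>
          sqrt ((t - s) * (LINT u|?M. (g n u - G u)\<^sup>2))"
      proof (rule always_eventually, rule allI)
        fix n
        have sqg: "square_integrable D (g n)" using H[of n] by (simp add: H1_pair_def)
        have "(LINT u:{s..t}|lborel. g n u) - (LINT u:{s..t}|lborel. G u) = (LINT u:{s..t}|lborel. g n u - G u)"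
          by (rule set_integral_diff(2)[symmetric, OF square_integrable_imp_integrable_Icc[OF sqg sub] square_integrable_imp_integrable_Icc[OF sqG(1) sub]])
        also have "\<bar>\<dots>\<bar> \<le> (LINT u:{s..t}|lborel. \<bar>g n u - G u\<bar>)" by (rule abs_set_integral_le)
        also have "\<dots> \<le> sqrt ((t - s) * (LINT u|?M. (g n u - G u)\<^sup>2))"
          using L2_integral_Icc_sq_le[OF sqd DB sub st(3)] unfolding set_integral_restrict[OF DB] by (rule real_le_rsqrt)
        finally show "norm ((LINT u:{s..t}|lborel. g n u) - (LINT u:{s..t}|lborel. G u)) \<le> sqrt ((t - s) * (LINT u|?M. (g n u - G u)\<^sup>2))"
          by simp
      qed
      have "(\<lambda>n. sqrt ((t - s) * (LINT u|?M. (g n u - G u)\<^sup>2))) \<longlonglongrightarrow> sqrt ((t - s) * 0)"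
        by (intro tendsto_intros G(2))
      then show "(\<lambda>n. sqrt ((t - s) * (LINT u|?M. (g n u - G u)\<^sup>2))) \<longlonglongrightarrow> 0" by simp
    qed
    moreover have "(LINT u:{s..t}|lborel. g n u) = f n t - f n s" for n
      using H[of n] st unfolding H1_pair_def by metis
    ultimately have "(\<lambda>n. (f n t - f n s) - (LINT u:{s..t}|lborel. G u)) \<longlonglongrightarrow> 0" by simp
    moreover have "(\<lambda>n. (f n t - f n s) - (LINT u:{s..t}|lborel. G u)) \<longlonglongrightarrow> (F t - F s) - (LINT u:{s..t}|lborel. G u)"
      by (intro tendsto_intros lim st)
    ultimately show "F t - F s = (LINT u:{s..t}|lborel. G u)" using LIMSEQ_unique by fastforce
  qed
  then show "H1_cont D F" by (rule H1_pair_imp_cont[OF _ D(1,3)])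
  have "H1_pair D (\<lambda>t. f n t - F t) (\<lambda>t. g n t - G t)" for n
    using H1_pair_lincomb[OF H[of n] pair D(1), of 1 "-1"] by simp
  then have "interval_energy D (\<lambda>t. f n t - F t) = (LINT t|?M. (g n t - G t)\<^sup>2) + (LINT t|?M. (f n t - F t)\<^sup>2)" for n
    using interval_energy_eq(1)[OF _ D] unfolding set_integral_restrict[OF DB] by blast
  then show "(\<lambda>n. interval_energy D (\<lambda>t. f n t - F t)) \<longlonglongrightarrow> 0"
    using tendsto_add[OF G(2) F(2)] by simp
qed

lemma interval_Lp_zero_imp_zero:
  assumes H: "H1_cont D f" and i: "set_integrable lborel D (\<lambda>t. \<bar>f t\<bar> powr p)" and z: "interval_Lp D p f = 0"
    and p: "p > 0" and l: "l > 0" "{s..s+l} \<subseteq> D" "t \<in> {s..s+l}"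
  shows "f t = 0"
proof -
  have c: "continuous_on {s..s+l} (\<lambda>t. \<bar>f t\<bar> powr p)"
    using H l(2) p by (intro continuous_intros continuous_on_powr') (auto simp: H1_cont_def intro: continuous_on_subset)
  have si: "set_integrable lborel {s..s+l} (\<lambda>t. \<bar>f t\<bar> powr p)"
    by (rule set_integrable_subset[OF i _ l(2)]) simp
  have "(LINT t:{s..s+l}|lborel. \<bar>f t\<bar> powr p) \<le> interval_Lp D p f"
    unfolding interval_Lp_def set_lebesgue_integral_def
    by (rule integral_mono) (use si i l(2) in \<open>auto simp: set_integrable_def indicator_def\<close>)
  moreover have "0 \<le> (LINT t:{s..s+l}|lborel. \<bar>f t\<bar> powr p)" by (rule set_integral_nonneg_real) simp
  ultimately have "integral {s..s+l} (\<lambda>t. \<bar>f t\<bar> powr p) = 0"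
    using z set_borel_integral_eq_integral(2)[OF si] by simp
  then have "((\<lambda>t. \<bar>f t\<bar> powr p) has_integral 0) {s..s+l}"
    using set_borel_integral_eq_integral(1)[OF si] by (metis integrable_integral)
  then have "\<bar>f t\<bar> powr p = 0"
    using has_integral_0_cbox_imp_0[of s "s+l" "\<lambda>t. \<bar>f t\<bar> powr p" t] c l by auto
  then show ?thesis by simp
qed

text \<open>Pieces are parametrized intervals in an abstract set of points. Adjacent pieces share
  points, and a function is given on the points, so agreement of its values at a common vertex is
  built in. \<open>Z\<close> is the set where the Dirichlet condition is imposed.\<close>

locale finite_pieces =
  fixes K :: "'k set" and dom :: "'k \<Rightarrow> real set" and \<gamma> :: "'k \<Rightarrow> real \<Rightarrow> 'a" and Z :: "'a set" and p :: real
  assumes finK: "finite K"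
    and dom: "\<And>k. k \<in> K \<Longrightarrow> dom k = {0..} \<or> (\<exists>L>0. dom k = {0..L})"
    and p: "p > 2"
begin

definition points :: "'a set" where "points = (\<Union>k\<in>K. \<gamma> k ` dom k)"

definition X :: "('a \<Rightarrow> real) set" where
  "X = {v. (\<forall>x. x \<notin> points \<longrightarrow> v x = 0) \<and> (\<forall>x\<in>Z. v x = 0) \<and> (\<forall>k\<in>K. H1_cont (dom k) (\<lambda>t. v (\<gamma> k t)))}"

definition E :: "('a \<Rightarrow> real) \<Rightarrow> real" where "E v = (\<Sum>k\<in>K. interval_energy (dom k) (\<lambda>t. v (\<gamma> k t)))"

definition Lp :: "('a \<Rightarrow> real) \<Rightarrow> real" where "Lp v = (\<Sum>k\<in>K. interval_Lp (dom k) p (\<lambda>t. v (\<gamma> k t)))"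

definition B :: "('a \<Rightarrow> real) \<Rightarrow> ('a \<Rightarrow> real) \<Rightarrow> real" where
  "B u v = (\<Sum>k\<in>K. interval_inner (dom k) (\<lambda>t. u (\<gamma> k t)) (\<lambda>t. v (\<gamma> k t)))"

lemma dom_props:
  assumes "k \<in> K"
  shows "is_interval (dom k)" "closed (dom k)" "dom k \<noteq> {}" "dom k \<in> sets borel"
  using dom[OF assms] by (auto simp: is_interval_cc is_interval_ci)

text \<open>One length l for all pieces makes the constant of the pointwise bound uniform. A minimum
  over finitely many pieces suffices.\<close>

lemma dom_thick: "\<exists>l>0. \<forall>k\<in>K. \<forall>t\<in>dom k. \<exists>s. t \<in> {s..s+l} \<and> {s..s+l} \<subseteq> dom k"
proof -
  have "\<exists>l>0. \<forall>t\<in>dom k. \<exists>s. t \<in> {s..s+l} \<and> {s..s+l} \<subseteq> dom k" if k: "k \<in> K" for k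
    using dom[OF k]
  proof
    assume "dom k = {0..}"
    then have "\<forall>t\<in>dom k. t \<in> {t..t+1} \<and> {t..t+1} \<subseteq> dom k" by auto
    then show ?thesis by (intro exI[of _ 1] conjI) (simp, blast)
  next
    assume "\<exists>L>0. dom k = {0..L}"
    then obtain L where "L > 0" "dom k = {0..L}" by blast
    then show ?thesis by (intro exI[of _ L] conjI ballI exI[of _ 0]) auto
  qed
  then obtain l where l: "\<And>k. k \<in> K \<Longrightarrow> l k > 0"
    "\<And>k t. k \<in> K \<Longrightarrow> t \<in> dom k \<Longrightarrow> \<exists>s. t \<in> {s..s+l k} \<and> {s..s+l k} \<subseteq> dom k" by metis
  define m where "m = Min (insert 1 (l ` K))"
  have m: "m > 0" "\<And>k. k \<in> K \<Longrightarrow> m \<le> l k" using finK l(1) by (auto simp: m_def)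
  show ?thesis
  proof (rule exI[of _ m], intro conjI m(1) ballI)
    fix k t assume kt: "k \<in> K" "t \<in> dom k"
    obtain s where s: "t \<in> {s..s+l k}" "{s..s+l k} \<subseteq> dom k" using l(2)[OF kt] by blast
    show "\<exists>s. t \<in> {s..s+m} \<and> {s..s+m} \<subseteq> dom k"
    \<comment> \<open>The long interval is shortened to length m either from its left end or so that
      it ends at t.\<close>
    proof (cases "t \<le> s + m")
      case True
      then show ?thesis using s m(2)[OF kt(1)] by (intro exI[of _ s]) (auto simp: subset_iff)
    next
      case False
      then show ?thesis using s m(1) m(2)[OF kt(1)] by (intro exI[of _ "t - m"]) (auto simp: subset_iff)
    qed
  qed
qed

lemma XD:
  assumes "v \<in> X"
  shows "x \<notin> points \<Longrightarrow> v x = 0" "x \<in> Z \<Longrightarrow> v x = 0" "k \<in> K \<Longrightarrow> H1_cont (dom k) (\<lambda>t. v (\<gamma> k t))"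
  using assms by (auto simp: X_def)

lemma X_pair: "v \<in> X \<Longrightarrow> k \<in> K \<Longrightarrow> H1_pair (dom k) (\<lambda>t. v (\<gamma> k t)) (weak_deriv (dom k) (\<lambda>t. v (\<gamma> k t)))"
  by (rule H1_cont_imp_pair[OF XD(3) dom_props(1)])

lemma X_lincomb: "u \<in> X \<Longrightarrow> v \<in> X \<Longrightarrow> (\<lambda>x. a * u x + b * v x) \<in> X"
  using H1_cont_lincomb[OF XD(3) XD(3) dom_props(1,3)] by (simp add: X_def)

lemma X_diff: "u \<in> X \<Longrightarrow> v \<in> X \<Longrightarrow> (\<lambda>x. u x - v x) \<in> X"
  using X_lincomb[of u v 1 "-1"] by simp

lemma X_scale: "u \<in> X \<Longrightarrow> (\<lambda>x. a * u x) \<in> X"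
  using X_lincomb[of u u a 0] by simp

lemma E_lincomb:
  assumes "u \<in> X" "v \<in> X"
  shows "E (\<lambda>x. a * u x + b * v x) = a\<^sup>2 * E u + b\<^sup>2 * E v + 2 * a * b * B u v"
proof -
  have "E (\<lambda>x. a * u x + b * v x) = (\<Sum>k\<in>K. a\<^sup>2 * interval_energy (dom k) (\<lambda>t. u (\<gamma> k t)) +
      b\<^sup>2 * interval_energy (dom k) (\<lambda>t. v (\<gamma> k t)) + 2 * a * b * interval_inner (dom k) (\<lambda>t. u (\<gamma> k t)) (\<lambda>t. v (\<gamma> k t)))"
    unfolding E_def
    by (rule sum.cong[OF refl]) (rule interval_energy_lincomb[OF XD(3)[OF assms(1)] XD(3)[OF assms(2)] dom_props(1-3)])
  then show ?thesis
    by (simp add: E_def B_def sum.distrib sum_distrib_left)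
qed

lemma E_nonneg: "0 \<le> E v"
  unfolding E_def by (rule sum_nonneg) (rule interval_energy_nonneg)

lemma Lp_nonneg: "0 \<le> Lp v"
  unfolding Lp_def by (rule sum_nonneg) (rule interval_Lp_nonneg)

lemma E_scale: "u \<in> X \<Longrightarrow> E (\<lambda>x. a * u x) = a\<^sup>2 * E u"
  using E_lincomb[of u u a 0] by simp

lemma Lp_scale: "Lp (\<lambda>x. a * u x) = \<bar>a\<bar> powr p * Lp u"
proof -
  have "interval_Lp D p (\<lambda>t. a * f t) = \<bar>a\<bar> powr p * interval_Lp D p f" for D f
    unfolding interval_Lp_def by (simp add: abs_mult powr_mult)
  then show ?thesis by (simp add: Lp_def sum_distrib_left)
qed

lemma piece_energy_le: "k \<in> K \<Longrightarrow> interval_energy (dom k) (\<lambda>t. v (\<gamma> k t)) \<le> E v"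
  unfolding E_def by (rule member_le_sum[OF _ interval_energy_nonneg finK])

lemma piece_sup_bound: "\<exists>M\<ge>0. \<forall>v\<in>X. \<forall>k\<in>K. \<forall>t\<in>dom k. (v (\<gamma> k t))\<^sup>2 \<le> M * interval_energy (dom k) (\<lambda>t. v (\<gamma> k t))"
proof -
  obtain l where l: "l > 0" "\<And>k t. k \<in> K \<Longrightarrow> t \<in> dom k \<Longrightarrow> \<exists>s. t \<in> {s..s+l} \<and> {s..s+l} \<subseteq> dom k"
    using dom_thick by blast
  show ?thesis
  proof (intro exI[of _ "2 / l + 2 * l"] conjI ballI)
    fix v k t assume v: "v \<in> X" "k \<in> K" "t \<in> dom k"
    then obtain s where "t \<in> {s..s+l}" "{s..s+l} \<subseteq> dom k" using l(2) by blast
    then show "(v (\<gamma> k t))\<^sup>2 \<le> (2 / l + 2 * l) * interval_energy (dom k) (\<lambda>t. v (\<gamma> k t))"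
      using H1_pair_sup_bound[OF X_pair[OF v(1,2)] dom_props(1,2)[OF v(2)] l(1)] by blast
  qed (use l in simp)
qed

lemma sup_bound: "\<exists>M\<ge>0. \<forall>v\<in>X. \<forall>x. (v x)\<^sup>2 \<le> M * E v"
proof -
  obtain M where M: "M \<ge> 0" "\<And>v k t. v \<in> X \<Longrightarrow> k \<in> K \<Longrightarrow> t \<in> dom k \<Longrightarrow> (v (\<gamma> k t))\<^sup>2 \<le> M * interval_energy (dom k) (\<lambda>t. v (\<gamma> k t))"
    using piece_sup_bound by blast
  show ?thesis
  proof (intro exI[of _ M] conjI M(1) ballI allI)
    fix v x assume v: "v \<in> X"
    show "(v x)\<^sup>2 \<le> M * E v"
    proof (cases "x \<in> points")
      case True
      then obtain k t where kt: "k \<in> K" "t \<in> dom k" "x = \<gamma> k t" by (auto simp: points_def)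
      show ?thesis using M(2)[OF v kt(1,2)] mult_left_mono[OF piece_energy_le[OF kt(1), of v] M(1)] kt(3) by simp
    next
      case False
      then show ?thesis using XD(1)[OF v] M(1) E_nonneg[of v] by simp
    qed
  qed
qed

lemma Lp_integrable: "v \<in> X \<Longrightarrow> k \<in> K \<Longrightarrow> set_integrable lborel (dom k) (\<lambda>t. \<bar>v (\<gamma> k t)\<bar> powr p)"
proof -
  assume v: "v \<in> X" and k: "k \<in> K"
  obtain M where M: "\<And>x. (v x)\<^sup>2 \<le> M * E v" using sup_bound v by blast
  show ?thesis
  proof (rule powr_integrable(1)[OF _ dom_props(4)[OF k] _ p])
    show "square_integrable (dom k) (\<lambda>t. v (\<gamma> k t))" using X_pair[OF v k] by (simp add: H1_pair_def)
    show "\<bar>v (\<gamma> k t)\<bar> \<le> sqrt (M * E v)" for t using M by (simp add: real_le_rsqrt)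
  qed
qed

text \<open>Subadditivity of s -> s powr (2 / p) adds up the inequalities of the pieces without a
  factor for their number.\<close>

lemma Sobolev: "\<exists>C\<ge>0. \<forall>v\<in>X. Lp v powr (2 / p) \<le> C * E v"
proof -
  obtain M where M: "M \<ge> 0" "\<And>v k t. v \<in> X \<Longrightarrow> k \<in> K \<Longrightarrow> t \<in> dom k \<Longrightarrow> (v (\<gamma> k t))\<^sup>2 \<le> M * interval_energy (dom k) (\<lambda>t. v (\<gamma> k t))"
    using piece_sup_bound by blast
  show ?thesis
  proof (intro exI[of _ "M powr ((p - 2) / p)"] conjI ballI)
    fix v assume v: "v \<in> X"
    have "Lp v powr (2 / p) \<le> (\<Sum>k\<in>K. interval_Lp (dom k) p (\<lambda>t. v (\<gamma> k t)) powr (2 / p))"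
      unfolding Lp_def using p by (intro powr_sum_le finK interval_Lp_nonneg) auto
    also have "\<dots> \<le> (\<Sum>k\<in>K. M powr ((p - 2) / p) * interval_energy (dom k) (\<lambda>t. v (\<gamma> k t)))"
    proof (rule sum_mono)
      fix k assume k: "k \<in> K"
      show "interval_Lp (dom k) p (\<lambda>t. v (\<gamma> k t)) powr (2 / p) \<le> M powr ((p - 2) / p) * interval_energy (dom k) (\<lambda>t. v (\<gamma> k t))"
        by (rule Sobolev_interval[OF X_pair[OF v k] dom_props(1-3)[OF k] _ M(1) p]) (rule M(2)[OF v k])
    qed
    finally show "Lp v powr (2 / p) \<le> M powr ((p - 2) / p) * E v" by (simp add: E_def sum_distrib_left)
  qed simp
qed

lemma Lp_pos: assumes v: "v \<in> X" "v \<noteq> (\<lambda>_. 0)" shows "Lp v > 0"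
proof (rule ccontr)
  assume "\<not> Lp v > 0"
  then have "Lp v = 0" using Lp_nonneg[of v] by simp
  then have z: "interval_Lp (dom k) p (\<lambda>t. v (\<gamma> k t)) = 0" if "k \<in> K" for k
    using that finK by (simp add: Lp_def sum_nonneg_eq_0_iff interval_Lp_nonneg)
  obtain l where l: "l > 0" "\<And>k t. k \<in> K \<Longrightarrow> t \<in> dom k \<Longrightarrow> \<exists>s. t \<in> {s..s+l} \<and> {s..s+l} \<subseteq> dom k"
    using dom_thick by blast
  have "v x = 0" for x
  proof (cases "x \<in> points")
    case True
    then obtain k t where kt: "k \<in> K" "t \<in> dom k" "x = \<gamma> k t" by (auto simp: points_def)
    obtain s where "t \<in> {s..s+l}" "{s..s+l} \<subseteq> dom k" using l(2)[OF kt(1,2)] by blast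
    then show ?thesis
      using interval_Lp_zero_imp_zero[OF XD(3)[OF v(1) kt(1)] Lp_integrable[OF v(1) kt(1)] z[OF kt(1)] _ l(1)] p kt(3) by simp
  qed (use XD(1)[OF v(1)] in simp)
  then show False using v(2) by blast
qed

lemma E_pos: assumes v: "v \<in> X" "v \<noteq> (\<lambda>_. 0)" shows "E v > 0"
proof (rule ccontr)
  assume "\<not> E v > 0"
  then have "E v = 0" using E_nonneg[of v] by simp
  moreover obtain M where "\<And>x. (v x)\<^sup>2 \<le> M * E v" using sup_bound v(1) by blast
  ultimately have "v x = 0" for x by (metis mult_zero_right power2_less_eq_zero_iff)
  then show False using v(2) by blast
qed

text \<open>The pointwise limit on the set of points is formed before the pieces are considered, so
  the limits on different pieces agree at shared vertices by construction.\<close>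

lemma E_complete:
  assumes u: "\<And>n::nat. u n \<in> X" and Cau: "\<And>e. e > 0 \<Longrightarrow> \<exists>N. \<forall>m\<ge>N. \<forall>n\<ge>N. E (\<lambda>x. u m x - u n x) < e"
  shows "\<exists>w\<in>X. (\<lambda>n. E (\<lambda>x. u n x - w x)) \<longlonglongrightarrow> 0"
proof -
  obtain M where M: "M \<ge> 0" "\<And>v x. v \<in> X \<Longrightarrow> (v x)\<^sup>2 \<le> M * E v" using sup_bound by blast
  have "Cauchy (\<lambda>n. u n x)" for x
    unfolding Cauchy_def
  proof (intro allI impI)
    fix e :: real assume e: "e > 0"
    have "e\<^sup>2 / (M + 1) > 0" using e M(1) by simp
    then obtain N where N: "\<And>m n. m \<ge> N \<Longrightarrow> n \<ge> N \<Longrightarrow> E (\<lambda>x. u m x - u n x) < e\<^sup>2 / (M + 1)"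
      using Cau by meson
    have "dist (u m x) (u n x) < e" if "m \<ge> N" "n \<ge> N" for m n
    proof -
      have "(u m x - u n x)\<^sup>2 \<le> M * E (\<lambda>x. u m x - u n x)" by (rule M(2)[OF X_diff[OF u u]])
      also have "\<dots> \<le> M * (e\<^sup>2 / (M + 1))" using N[OF that] M(1) by (intro mult_left_mono) auto
      also have "\<dots> < e\<^sup>2" using e M(1) by (simp add: field_simps)
      finally have "\<bar>u m x - u n x\<bar>\<^sup>2 < e\<^sup>2" by simp
      then have "\<bar>u m x - u n x\<bar> < e" by (rule power2_less_imp_less) (use e in simp)
      then show ?thesis by (simp add: dist_real_def)
    qed
    then show "\<exists>N. \<forall>m\<ge>N. \<forall>n\<ge>N. dist (u m x) (u n x) < e" by blast
  qed
  then have "\<exists>L. (\<lambda>n. u n x) \<longlonglongrightarrow> L" for x using convergent_eq_Cauchy by blast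
  then obtain w where w: "\<And>x. (\<lambda>n. u n x) \<longlonglongrightarrow> w x" by metis
  have wk: "H1_cont (dom k) (\<lambda>t. w (\<gamma> k t)) \<and> (\<lambda>n. interval_energy (dom k) (\<lambda>t. u n (\<gamma> k t) - w (\<gamma> k t))) \<longlonglongrightarrow> 0"
    if k: "k \<in> K" for k
  proof -
    have C: "\<exists>N. \<forall>m\<ge>N. \<forall>n\<ge>N. interval_energy (dom k) (\<lambda>t. u m (\<gamma> k t) - u n (\<gamma> k t)) < e" if "e > 0" for e
      using Cau[OF that] piece_energy_le[OF k, of "\<lambda>x. u _ x - u _ x"] by (meson le_less_trans)
    show ?thesis
      using H1_pair_complete[OF X_pair[OF u k] dom_props(1-3)[OF k] C w] by blast
  qed
  have lim_eq: "w x = 0" if "\<And>n. u n x = 0" for x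
    using w[of x] that LIMSEQ_unique[of "\<lambda>n. 0" "w x" 0] by simp
  have "w \<in> X"
    unfolding X_def using wk lim_eq XD(1,2)[OF u] by auto
  moreover have "(\<lambda>n. E (\<lambda>x. u n x - w x)) \<longlonglongrightarrow> (\<Sum>k\<in>K. 0)"
    unfolding E_def by (intro tendsto_sum) (use wk in blast)
  ultimately show ?thesis by auto
qed

lemma E_tendsto_pointwise:
  assumes "\<And>n::nat. u n \<in> X" "w \<in> X" "(\<lambda>n. E (\<lambda>x. u n x - w x)) \<longlonglongrightarrow> 0"
  shows "(\<lambda>n. u n x) \<longlonglongrightarrow> w x"
proof -
  obtain M where M: "M \<ge> 0" "\<And>v x. v \<in> X \<Longrightarrow> (v x)\<^sup>2 \<le> M * E v" using sup_bound by blast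
  have "(\<lambda>n. u n x - w x) \<longlonglongrightarrow> 0"
  proof (rule Lim_null_comparison)
    show "\<forall>\<^sub>F n in sequentially. norm (u n x - w x) \<le> sqrt (M * E (\<lambda>x. u n x - w x))"
      using M(2)[OF X_diff[OF assms(1,2)]] by (intro always_eventually allI) (simp add: real_le_rsqrt)
    have "(\<lambda>n. sqrt (M * E (\<lambda>x. u n x - w x))) \<longlonglongrightarrow> sqrt (M * 0)" by (intro tendsto_intros assms(3))
    then show "(\<lambda>n. sqrt (M * E (\<lambda>x. u n x - w x))) \<longlonglongrightarrow> 0" by simp
  qed
  then show ?thesis by (simp add: LIM_zero_iff)
qed

lemma dense_rationals_dom:
  assumes k: "k \<in> K" and t: "t \<in> dom k" and d: "d > 0"
  obtains q where "q \<in> dom k \<inter> \<rat>" "\<bar>t - q\<bar> < d"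
proof -
  obtain l where l: "l > 0" "\<And>k t. k \<in> K \<Longrightarrow> t \<in> dom k \<Longrightarrow> \<exists>s. t \<in> {s..s+l} \<and> {s..s+l} \<subseteq> dom k"
    using dom_thick by blast
  obtain s where s: "t \<in> {s..s+l}" "{s..s+l} \<subseteq> dom k" using l(2)[OF k t] by blast
  have "max s (t - d) < min (s + l) (t + d)" using s l d by auto
  then obtain q where q: "q \<in> \<rat>" "max s (t - d) < q" "q < min (s + l) (t + d)" using Rats_dense_in_real by blast
  then have "q \<in> {s..s+l}" "\<bar>t - q\<bar> < d" by auto
  with q(1) s(2) that show thesis by blast
qed

text \<open>An argument of Arzela-Ascoli type: a subsequence converging at the countably many
  rational parameters exists by boundedness, and the common Hoelder modulus carries convergence to
  all parameters.\<close>

lemma pointwise_convergent_subsequence: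
  assumes v: "\<And>n::nat. v n \<in> X" and M: "\<And>n. E (v n) \<le> A"
  obtains r w where "strict_mono r" "\<And>x. (\<lambda>n. v (r n) x) \<longlonglongrightarrow> w x"
proof -
  obtain S where S: "S \<ge> 0" "\<And>v x. v \<in> X \<Longrightarrow> (v x)\<^sup>2 \<le> S * E v" using sup_bound by blast
  have A: "A \<ge> 0" using E_nonneg M order_trans by blast
  have bd: "norm (v n x) \<le> sqrt (S * A)" for n x
  proof -
    have "(v n x)\<^sup>2 \<le> S * A" using S(2)[OF v, of n x] mult_left_mono[OF M S(1), of n] by linarith
    then show ?thesis by (simp add: real_le_rsqrt)
  qed
  let ?Q = "Sigma K (\<lambda>k. dom k \<inter> \<rat>)"
  have "countable ?Q" using finK countable_rat by (intro countable_SIGMA) (auto intro: countable_finite)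
  then obtain r where r: "strict_mono r" "\<And>z. z \<in> ?Q \<Longrightarrow> \<exists>L. (\<lambda>n. (case z of (k, q) \<Rightarrow> v (r n) (\<gamma> k q))) \<longlonglongrightarrow> L"
    by (rule function_convergent_subsequence[of ?Q "\<lambda>n z. case z of (k, q) \<Rightarrow> v n (\<gamma> k q)" "sqrt (S * A)"]) (use bd in auto)
  have conv: "Cauchy (\<lambda>n. v (r n) (\<gamma> k t))" if kt: "k \<in> K" "t \<in> dom k" for k t
    unfolding Cauchy_def
  proof (intro allI impI)
    fix e :: real assume e: "e > 0"
    \<comment> \<open>Parameters closer than d have values closer than e / 3, for all members of the
      sequence at once.\<close>
    define d where "d = (e / 3)\<^sup>2 / (A + 1)"
    have d: "d > 0" using e A by (auto simp: d_def)
    obtain q where q: "q \<in> dom k \<inter> \<rat>" "\<bar>t - q\<bar> < d" using dense_rationals_dom[OF kt d] by blast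
    have near: "\<bar>v n (\<gamma> k t) - v n (\<gamma> k q)\<bar> < e / 3" for n
    proof -
      note P = X_pair[OF v[of n] kt(1)]
      have "(v n (\<gamma> k t) - v n (\<gamma> k q))\<^sup>2 \<le> \<bar>t - q\<bar> * (LINT u:dom k|lborel. (weak_deriv (dom k) (\<lambda>t. v n (\<gamma> k t)) u)\<^sup>2)"
        using q kt by (intro H1_pair_Hoelder[OF P dom_props(1)]) auto
      also have "\<dots> \<le> d * A"
      proof (rule mult_mono)
        show "(LINT u:dom k|lborel. (weak_deriv (dom k) (\<lambda>t. v n (\<gamma> k t)) u)\<^sup>2) \<le> A"
          using H1_pair_sq_integrals_le(1)[OF P dom_props(1-3)[OF kt(1)]] piece_energy_le[OF kt(1), of "v n"] M[of n] by linarith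
      qed (use q d in \<open>auto intro: set_integral_nonneg_real\<close>)
      also have "\<dots> < (e / 3)\<^sup>2" using e A by (simp add: d_def field_simps)
      finally have "\<bar>v n (\<gamma> k t) - v n (\<gamma> k q)\<bar>\<^sup>2 < (e / 3)\<^sup>2" by simp
      then show ?thesis by (rule power2_less_imp_less) (use e in simp)
    qed
    have "\<exists>L. (\<lambda>n. v (r n) (\<gamma> k q)) \<longlonglongrightarrow> L" using r(2)[of "(k, q)"] kt q by auto
    then have "Cauchy (\<lambda>n. v (r n) (\<gamma> k q))" using convergent_eq_Cauchy by blast
    then obtain N where N: "\<And>m n. m \<ge> N \<Longrightarrow> n \<ge> N \<Longrightarrow> dist (v (r m) (\<gamma> k q)) (v (r n) (\<gamma> k q)) < e / 3"
      using e unfolding Cauchy_def by (metis divide_pos_pos zero_less_numeral)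
    have "dist (v (r m) (\<gamma> k t)) (v (r n) (\<gamma> k t)) < e" if "m \<ge> N" "n \<ge> N" for m n
      using N[OF that] near[of "r m"] near[of "r n"] unfolding dist_real_def by linarith
    then show "\<exists>N. \<forall>m\<ge>N. \<forall>n\<ge>N. dist (v (r m) (\<gamma> k t)) (v (r n) (\<gamma> k t)) < e" by blast
  qed
  have "\<exists>L. (\<lambda>n. v (r n) x) \<longlonglongrightarrow> L" for x
  proof (cases "x \<in> points")
    case True
    then obtain k t where "k \<in> K" "t \<in> dom k" "x = \<gamma> k t" by (auto simp: points_def)
    then show ?thesis using conv convergent_eq_Cauchy by blast
  next
    case False
    then show ?thesis using XD(1)[OF v] by (intro exI[of _ 0]) simp
  qed
  then obtain w where "\<And>x. (\<lambda>n. v (r n) x) \<longlonglongrightarrow> w x" by metis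
  with r(1) that show thesis by blast
qed

end

context finite_pieces
begin

lemma E_diff_le: "u \<in> X \<Longrightarrow> v \<in> X \<Longrightarrow> E (\<lambda>x. u x - v x) \<le> 2 * E u + 2 * E v"
  using E_lincomb[of u v 1 1] E_lincomb[of u v 1 "-1"] E_nonneg[of "\<lambda>x. u x + v x"] by simp

text \<open>The energy bound makes both v n - w and w bounded by one S. The pointwise estimate then
  bounds the defect on each piece by a constant times the integral of |v n - w| |w|, which tends to
  0 by \<open>L2_weak_null\<close>.\<close>

lemma Lp_split:
  assumes v: "\<And>n::nat. v n \<in> X" and A: "\<And>n. E (v n) \<le> A" and w: "w \<in> X" and lim: "\<And>x. (\<lambda>n. v n x) \<longlonglongrightarrow> w x"
    and Lp_lim: "(\<lambda>n. Lp (v n)) \<longlonglongrightarrow> L"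
  shows "(\<lambda>n. Lp (\<lambda>x. v n x - w x)) \<longlonglongrightarrow> L - Lp w"
proof -
  obtain S0 where S0: "S0 \<ge> 0" "\<And>v x. v \<in> X \<Longrightarrow> (v x)\<^sup>2 \<le> S0 * E v" using sup_bound by blast
  define A' where "A' = 2 * A + 2 * E w"
  have A0: "A \<ge> 0" using E_nonneg A order_trans by blast
  have dX: "(\<lambda>x. v n x - w x) \<in> X" for n by (rule X_diff[OF v w])
  have dA: "E (\<lambda>x. v n x - w x) \<le> A'" for n using E_diff_le[OF v w, of n] A[of n] by (simp add: A'_def)
  have wA: "E w \<le> A'" using A0 E_nonneg[of w] by (simp add: A'_def)
  define S where "S = sqrt (S0 * A')"
  have bd: "\<bar>u x\<bar> \<le> S" if "u \<in> X" "E u \<le> A'" for u x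
  proof -
    have "(u x)\<^sup>2 \<le> S0 * A'" using S0(2)[OF that(1), of x] mult_left_mono[OF that(2) S0(1)] by linarith
    then show ?thesis by (simp add: S_def real_le_rsqrt)
  qed
  define c where "c = (p * 2 powr (p - 1) + 1) * S powr (p - 2)"
  have piece: "(\<lambda>n. interval_Lp (dom k) p (\<lambda>t. v n (\<gamma> k t)) - interval_Lp (dom k) p (\<lambda>t. v n (\<gamma> k t) - w (\<gamma> k t))
      - interval_Lp (dom k) p (\<lambda>t. w (\<gamma> k t))) \<longlonglongrightarrow> 0" if k: "k \<in> K" for k
  proof (rule Lim_null_comparison)
    let ?M = "restrict_space lborel (dom k)"
    note DB = dom_props(4)[OF k]
    have L: "L2 ?M (\<lambda>t. u (\<gamma> k t))" if "u \<in> X" for u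
      using X_pair[OF that k] by (simp add: H1_pair_def square_integrable_iff_L2[OF DB])
    have I: "integrable ?M (\<lambda>t. \<bar>u (\<gamma> k t)\<bar> powr p)" if "u \<in> X" for u
      using Lp_integrable[OF that k] by (simp add: set_integrable_restrict[OF DB])
    have prod: "integrable ?M (\<lambda>t. \<bar>v n (\<gamma> k t) - w (\<gamma> k t)\<bar> * \<bar>w (\<gamma> k t)\<bar>)" for n
      by (rule L2_mult_integrable[OF L2_abs[OF L[OF dX]] L2_abs[OF L[OF w]]])
    show "\<forall>\<^sub>F n in sequentially. norm (interval_Lp (dom k) p (\<lambda>t. v n (\<gamma> k t)) - interval_Lp (dom k) p (\<lambda>t. v n (\<gamma> k t) - w (\<gamma> k t))
      - interval_Lp (dom k) p (\<lambda>t. w (\<gamma> k t))) \<le> c * (LINT t|?M. \<bar>v n (\<gamma> k t) - w (\<gamma> k t)\<bar> * \<bar>w (\<gamma> k t)\<bar>)"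
    proof (rule always_eventually, rule allI)
      fix n
      define f where "f t = \<bar>v n (\<gamma> k t)\<bar> powr p" for t
      define g where "g t = \<bar>v n (\<gamma> k t) - w (\<gamma> k t)\<bar> powr p" for t
      define h where "h t = \<bar>w (\<gamma> k t)\<bar> powr p" for t
      define q where "q t = \<bar>v n (\<gamma> k t) - w (\<gamma> k t)\<bar> * \<bar>w (\<gamma> k t)\<bar>" for t
      have i: "integrable ?M f" "integrable ?M g" "integrable ?M h" "integrable ?M q"
        unfolding f_def[abs_def] g_def[abs_def] h_def[abs_def] q_def[abs_def] by (rule I[OF v] I[OF dX] I[OF w] prod)+
      have le: "\<bar>f t - g t - h t\<bar> \<le> c * q t" for t
        using Brezis_Lieb_pointwise[OF bd[OF dX dA] bd[OF w wA] p, of n "\<gamma> k t" "\<gamma> k t"]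
        by (simp add: c_def f_def g_def h_def q_def)
      have i2: "integrable ?M (\<lambda>t. f t - g t - h t)"
        by (rule Bochner_Integration.integrable_diff[OF Bochner_Integration.integrable_diff[OF i(1,2)] i(3)])
      have "(LINT t|?M. f t) - (LINT t|?M. g t) - (LINT t|?M. h t) = (LINT t|?M. f t - g t - h t)"
        using Bochner_Integration.integral_diff[OF Bochner_Integration.integrable_diff[OF i(1,2)] i(3)]
          Bochner_Integration.integral_diff[OF i(1,2)] by simp
      also have "\<bar>\<dots>\<bar> \<le> (LINT t|?M. \<bar>f t - g t - h t\<bar>)"
        using integral_norm_bound[of ?M "\<lambda>t. f t - g t - h t"] by simp
      also have "\<dots> \<le> (LINT t|?M. c * q t)"
        by (rule integral_mono[OF integrable_abs[OF i2] integrable_mult_right[OF i(4)] le])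
      also have "\<dots> = c * (LINT t|?M. q t)" by simp
      finally show "norm (interval_Lp (dom k) p (\<lambda>t. v n (\<gamma> k t)) - interval_Lp (dom k) p (\<lambda>t. v n (\<gamma> k t) - w (\<gamma> k t))
        - interval_Lp (dom k) p (\<lambda>t. w (\<gamma> k t))) \<le> c * (LINT t|?M. \<bar>v n (\<gamma> k t) - w (\<gamma> k t)\<bar> * \<bar>w (\<gamma> k t)\<bar>)"
        unfolding interval_Lp_def set_integral_restrict[OF DB] f_def g_def h_def q_def by simp
    qed
    have "(\<lambda>n. LINT t|?M. \<bar>v n (\<gamma> k t) - w (\<gamma> k t)\<bar> * \<bar>w (\<gamma> k t)\<bar>) \<longlonglongrightarrow> 0"
    proof (rule L2_weak_null[of ?M "\<lambda>n t. v n (\<gamma> k t) - w (\<gamma> k t)", OF L[OF dX] L[OF w]])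
      show "(LINT t|?M. (v n (\<gamma> k t) - w (\<gamma> k t))\<^sup>2) \<le> A'" for n
        using H1_pair_sq_integrals_le(2)[OF X_pair[OF dX k] dom_props(1-3)[OF k], of n] piece_energy_le[OF k, of "\<lambda>x. v n x - w x"] dA[of n]
        unfolding set_integral_restrict[OF DB] by linarith
      show "(\<lambda>n. v n (\<gamma> k t) - w (\<gamma> k t)) \<longlonglongrightarrow> 0" for t
        using lim by (intro LIM_zero)
    qed
    then have "(\<lambda>n. c * (LINT t|?M. \<bar>v n (\<gamma> k t) - w (\<gamma> k t)\<bar> * \<bar>w (\<gamma> k t)\<bar>)) \<longlonglongrightarrow> c * 0" by (intro tendsto_intros)
    then show "(\<lambda>n. c * (LINT t|?M. \<bar>v n (\<gamma> k t) - w (\<gamma> k t)\<bar> * \<bar>w (\<gamma> k t)\<bar>)) \<longlonglongrightarrow> 0" by simp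
  qed
  have "(\<lambda>n. Lp (v n) - Lp (\<lambda>x. v n x - w x) - Lp w) \<longlonglongrightarrow> (\<Sum>k\<in>K. 0)"
    unfolding Lp_def sum_subtractf[symmetric] by (intro tendsto_sum piece)
  then have "(\<lambda>n. (Lp (v n) - (Lp (v n) - Lp (\<lambda>x. v n x - w x) - Lp w)) - Lp w) \<longlonglongrightarrow> (L - 0) - Lp w"
    by (intro tendsto_diff tendsto_const Lp_lim) auto
  then show ?thesis by simp
qed

lemma energy_splitting:
  assumes v: "\<And>n::nat. v n \<in> X" "\<And>n. E (v n) \<le> A" "\<And>x. (\<lambda>n. v n x) \<longlonglongrightarrow> w x"
  shows "w \<in> X" and "\<And>e. e > 0 \<Longrightarrow> \<forall>\<^sub>F k in sequentially. E (\<lambda>x. v k x - w x) \<le> E (v k) - E w + e"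
proof -
  have c: "\<exists>w\<in>X. (\<lambda>n. E (\<lambda>x. u n x - w x)) \<longlonglongrightarrow> 0"
    if "\<And>n::nat. u n \<in> X" "\<And>e. e > 0 \<Longrightarrow> \<exists>N. \<forall>m\<ge>N. \<forall>n\<ge>N. E (\<lambda>x. u m x - u n x) < e" for u
    using that by (rule E_complete)
  have ev: "(\<lambda>n. u n x) \<longlonglongrightarrow> w x"
    if "\<And>n::nat. u n \<in> X" "w \<in> X" "(\<lambda>n. E (\<lambda>x. u n x - w x)) \<longlonglongrightarrow> 0" for u w x
    using that by (rule E_tendsto_pointwise)
  have q: "E (\<lambda>x. a * u x + b * v x) = a\<^sup>2 * E u + b\<^sup>2 * E v + 2 * a * b * B u v" if "u \<in> X" "v \<in> X" for u v a b
    using that by (rule E_lincomb)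
  have l: "(\<lambda>x. a * u x + b * v x) \<in> X" if "u \<in> X" "v \<in> X" for u v a b
    using that by (rule X_lincomb)
  have en: "0 \<le> E u" if "u \<in> X" for u by (rule E_nonneg)
  show "w \<in> X"
    by (rule pointwise_limit_energy_splitting(1)[where X = X and E = E and B = B and v = v and w = w and M = A])
      (fact l q en c ev v)+
  show "\<forall>\<^sub>F k in sequentially. E (\<lambda>x. v k x - w x) \<le> E (v k) - E w + e" if "e > 0" for e
    by (rule pointwise_limit_energy_splitting(2)[where X = X and E = E and B = B and v = v and w = w and M = A])
      (fact l q en c ev v that)+
qed

text \<open>The constant of the line is kept without loss; the only error is a sum of squares of
  values at the end points of the pieces.\<close>

lemma line_constant_bound:
  assumes line: "\<And>F. H1_cont UNIV F \<Longrightarrow> interval_Lp UNIV p F powr (2 / p) \<le> CR * interval_energy UNIV F"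
    and CR: "CR \<ge> 0" and u: "u \<in> X"
  shows "Lp u powr (2 / p) \<le> CR * (E u + 2 * (\<Sum>k\<in>K. \<Sum>c\<in>frontier (dom k). (u (\<gamma> k c))\<^sup>2))"
proof -
  have "Lp u powr (2 / p) \<le> (\<Sum>k\<in>K. interval_Lp (dom k) p (\<lambda>t. u (\<gamma> k t)) powr (2 / p))"
    unfolding Lp_def using p by (intro powr_sum_le finK interval_Lp_nonneg) auto
  also have "\<dots> \<le> (\<Sum>k\<in>K. CR * (interval_energy (dom k) (\<lambda>t. u (\<gamma> k t)) + 2 * (\<Sum>c\<in>frontier (dom k). (u (\<gamma> k c))\<^sup>2)))"
    by (intro sum_mono Sobolev_extension[OF line CR p XD(3)[OF u]] dom)
  finally show ?thesis by (simp add: E_def sum.distrib flip: sum_distrib_left)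
qed

text \<open>Let t be the integral of the power of w, and \<epsilon> = 1 / C - E w the energy left
  for the remainder. The constant of the line gives (1 - t)^(2/p) \<le> CR \<epsilon>, the constant
  of the graph gives t^(2/p) \<le> 1 - C \<epsilon>. By subadditivity 1 \<le> 1 - (C - CR)
  \<epsilon>, so \<epsilon> = 0, and then t = 1.\<close>

theorem minimizing_sequence_compact:
  assumes line: "\<And>F. H1_cont UNIV F \<Longrightarrow> interval_Lp UNIV p F powr (2 / p) \<le> CR * interval_energy UNIV F"
    and CR: "CR \<ge> 0" "CR < C" and C: "\<And>u. u \<in> X \<Longrightarrow> Lp u powr (2 / p) \<le> C * E u"
    and v: "\<And>n::nat. v n \<in> X" "\<And>n. Lp (v n) = 1" "(\<lambda>n. E (v n)) \<longlonglongrightarrow> 1 / C"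
  obtains r w where "strict_mono r" "w \<in> X" "(\<lambda>n. E (\<lambda>x. v (r n) x - w x)) \<longlonglongrightarrow> 0" "Lp w = 1" "E w = 1 / C"
proof -
  have "Bseq (\<lambda>n. E (v n))" by (rule convergent_imp_Bseq[OF convergentI[OF v(3)]])
  then obtain A where An: "\<And>n. norm (E (v n)) \<le> A" unfolding Bseq_def by blast
  have A: "E (v n) \<le> A" for n using An[of n] by (simp add: abs_le_iff)
  obtain r w where r: "strict_mono r" and w: "\<And>x. (\<lambda>n. v (r n) x) \<longlonglongrightarrow> w x"
    by (rule pointwise_convergent_subsequence[where v = v and A = A, OF v(1) A]) blast
  define u where "u n = v (r n)" for n
  have u: "u n \<in> X" "Lp (u n) = 1" "E (u n) \<le> A" for n using v A by (simp_all add: u_def)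
  have u_lim: "(\<lambda>n. E (u n)) \<longlonglongrightarrow> 1 / C"
    unfolding u_def using LIMSEQ_subseq_LIMSEQ[OF v(3) r] by (simp add: o_def)
  have pw: "(\<lambda>n. u n x) \<longlonglongrightarrow> w x" for x using w by (simp add: u_def)
  note sp = energy_splitting[where v = u and w = w and A = A, OF u(1) u(3) pw]
  note wX = sp(1) and es = sp(2)
  define t where "t = Lp w"
  have t0: "t \<ge> 0" by (simp add: t_def Lp_nonneg)
  have s_lim: "(\<lambda>n. Lp (\<lambda>x. u n x - w x)) \<longlonglongrightarrow> 1 - t"
    using Lp_split[where v = u and w = w and A = A and L = 1, OF u(1) u(3) wX pw] by (simp add: u(2) t_def)
  have t1: "t \<le> 1"
    using LIMSEQ_le_const[OF s_lim, of 0] Lp_nonneg by auto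
  \<comment> \<open>The boundary terms of the remainder at the end points of the pieces.\<close>
  define b where "b n = 2 * (\<Sum>k\<in>K. \<Sum>c\<in>frontier (dom k). (u n (\<gamma> k c) - w (\<gamma> k c))\<^sup>2)" for n
  have b_lim: "b \<longlonglongrightarrow> 0"
  proof -
    have "(\<lambda>n. u n x - w x) \<longlonglongrightarrow> 0" for x using pw by (intro LIM_zero)
    then have "(\<lambda>n. 2 * (\<Sum>k\<in>K. \<Sum>c\<in>frontier (dom k). (u n (\<gamma> k c) - w (\<gamma> k c))\<^sup>2)) \<longlonglongrightarrow> 2 * (\<Sum>k\<in>K. \<Sum>c\<in>frontier (dom k). 0\<^sup>2)"
      by (intro tendsto_mult tendsto_const tendsto_sum tendsto_power)
    then show ?thesis by (simp add: b_def[abs_def])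
  qed
  define \<epsilon> where "\<epsilon> = 1 / C - E w"
  \<comment> \<open>The slack e is inherited from the splitting of the energy, which is available
    only eventually and up to e.\<close>
  have key: "(1 - t) powr (2 / p) \<le> CR * (\<epsilon> + e)" if e: "e > 0" for e
  proof (rule tendsto_le[OF trivial_limit_sequentially])
    show "(\<lambda>n. Lp (\<lambda>x. u n x - w x) powr (2 / p)) \<longlonglongrightarrow> (1 - t) powr (2 / p)"
      using p by (intro tendsto_powr'[OF s_lim tendsto_const]) (auto simp: Lp_nonneg)
    have "(\<lambda>n. CR * (E (u n) - E w + e + b n)) \<longlonglongrightarrow> CR * (1 / C - E w + e + 0)"
      by (intro tendsto_intros u_lim b_lim)
    then show "(\<lambda>n. CR * (E (u n) - E w + e + b n)) \<longlonglongrightarrow> CR * (\<epsilon> + e)" by (simp add: \<epsilon>_def)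
    show "\<forall>\<^sub>F n in sequentially. Lp (\<lambda>x. u n x - w x) powr (2 / p) \<le> CR * (E (u n) - E w + e + b n)"
    proof (rule eventually_mono[OF es[OF e]])
      fix n assume elim: "E (\<lambda>x. u n x - w x) \<le> E (u n) - E w + e"
      have "Lp (\<lambda>x. u n x - w x) powr (2 / p) \<le> CR * (E (\<lambda>x. u n x - w x) + b n)"
        unfolding b_def by (rule line_constant_bound[OF line CR(1) X_diff[OF u(1) wX]])
      also have "\<dots> \<le> CR * (E (u n) - E w + e + b n)" using elim CR(1) by (intro mult_left_mono) auto
      finally show "Lp (\<lambda>x. u n x - w x) powr (2 / p) \<le> CR * (E (u n) - E w + e + b n)" .
    qed
  qed
  have eps_e: "0 \<le> \<epsilon> + e" if e: "e > 0" for e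
  proof (rule tendsto_lowerbound[OF _ _ trivial_limit_sequentially])
    have "(\<lambda>n. E (u n) - E w + e) \<longlonglongrightarrow> 1 / C - E w + e" by (intro tendsto_intros u_lim)
    then show "(\<lambda>n. E (u n) - E w + e) \<longlonglongrightarrow> \<epsilon> + e" by (simp add: \<epsilon>_def)
    show "\<forall>\<^sub>F n in sequentially. 0 \<le> E (u n) - E w + e"
    proof (rule eventually_mono[OF es[OF e]])
      fix n assume "E (\<lambda>x. u n x - w x) \<le> E (u n) - E w + e"
      then show "0 \<le> E (u n) - E w + e" using E_nonneg[of "\<lambda>x. u n x - w x"] by linarith
    qed
  qed
  have eps0: "0 \<le> \<epsilon>" by (rule field_le_epsilon) (rule eps_e)
  have key0: "(1 - t) powr (2 / p) \<le> CR * \<epsilon>"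
  proof (rule field_le_epsilon)
    fix d :: real assume d: "d > 0"
    \<comment> \<open>The divisor is CR + 1 because CR is only known to be nonnegative.\<close>
    have "(1 - t) powr (2 / p) \<le> CR * (\<epsilon> + d / (CR + 1))" using CR d by (intro key) auto
    also have "\<dots> \<le> CR * \<epsilon> + d" using CR d by (simp add: field_simps)
    finally show "(1 - t) powr (2 / p) \<le> CR * \<epsilon> + d" .
  qed
  have C0: "C > 0" using CR by linarith
  have "1 = (t + (1 - t)) powr (2 / p)" by simp
  also have "\<dots> \<le> t powr (2 / p) + (1 - t) powr (2 / p)" using t0 t1 p by (intro powr_add_le) auto
  also have "\<dots> \<le> C * E w + CR * \<epsilon>" using C[OF wX] key0 by (simp add: t_def)
  also have "\<dots> = 1 - (C - CR) * \<epsilon>" using C0 by (simp add: \<epsilon>_def field_simps)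
  finally have "(C - CR) * \<epsilon> \<le> 0" by simp
  then have eps: "\<epsilon> = 0" using CR eps0 by (simp add: mult_le_0_iff)
  then have Ew: "E w = 1 / C" by (simp add: \<epsilon>_def)
  have "(1 - t) powr (2 / p) \<le> 0" using key0 eps by simp
  then have "(1 - t) powr (2 / p) = 0" using powr_ge_zero[of "1 - t" "2 / p"] by linarith
  then have "Lp w = 1" by (simp add: t_def)
  \<comment> \<open>Now E (u n) tends to E w, so the splitting leaves no energy to the
    remainder.\<close>
  have "(\<lambda>n. E (\<lambda>x. u n x - w x)) \<longlonglongrightarrow> 0"
  proof (rule LIMSEQ_I)
    fix e :: real assume e: "e > 0"
    have e2: "e / 2 > 0" using e by simp
    have "\<forall>\<^sub>F n in sequentially. E (u n) < 1 / C + e / 2"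
      using order_tendstoD(2)[OF u_lim, of "1 / C + e / 2"] e by simp
    then have "\<forall>\<^sub>F n in sequentially. E (\<lambda>x. u n x - w x) < e"
    proof (rule eventually_mono[OF eventually_conj[OF _ es[OF e2]]])
      fix n assume "E (u n) < 1 / C + e / 2 \<and> E (\<lambda>x. u n x - w x) \<le> E (u n) - E w + e / 2"
      then show "E (\<lambda>x. u n x - w x) < e" unfolding Ew by linarith
    qed
    then show "\<exists>no. \<forall>n\<ge>no. norm (E (\<lambda>x. u n x - w x) - 0) < e"
      by (simp add: E_nonneg eventually_sequentially)
  qed
  then show thesis unfolding u_def by (rule that[OF r wX _ \<open>Lp w = 1\<close> Ew])
qed

end

section \<open>Transplantation to a half-line\<close>

lemma interval_energy_mono:
  assumes H: "H1_pair D f g" and D: "is_interval D" "closed D" and A: "A \<subseteq> D" "is_interval A" "closed A" "A \<noteq> {}"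
  shows "interval_energy A f \<le> interval_energy D f"
proof -
  have ne: "D \<noteq> {}" using A by auto
  have AB: "A \<in> sets borel" by (rule sets_borel_is_interval[OF A(2)])
  have HA: "H1_pair A f g" by (rule H1_pair_subset[OF H A(1) AB])
  have mono: "(LINT t:A|lborel. (h t)\<^sup>2) \<le> (LINT t:D|lborel. (h t)\<^sup>2)"
    if i: "set_integrable lborel A (\<lambda>t. (h t)\<^sup>2)" "set_integrable lborel D (\<lambda>t. (h t)\<^sup>2)" for h :: "real \<Rightarrow> real"
    unfolding set_lebesgue_integral_def
    by (rule integral_mono) (use i A(1) in \<open>auto simp: set_integrable_def indicator_def\<close>)
  show ?thesis
    unfolding interval_energy_eq(1)[OF HA A(2-4)] interval_energy_eq(1)[OF H D ne]
    by (intro add_mono mono interval_energy_eq(2,3)[OF HA A(2-4)] interval_energy_eq(2,3)[OF H D ne])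
qed

lemma interval_energy_zero: "is_interval D \<Longrightarrow> closed D \<Longrightarrow> D \<noteq> {} \<Longrightarrow> interval_energy D (\<lambda>_. 0) = 0"
  by (subst interval_energy_eq(1)[OF H1_pair_zero]) auto

text \<open>By \<open>sep\<close> the open half-line is visited once and by no other piece, and it
  avoids the Dirichlet set. A function on it that vanishes at its origin can therefore be continued
  by 0 to everything else.\<close>

locale pieces_with_half_line = finite_pieces K dom \<gamma> Z p
  for K :: "'k set" and dom and \<gamma> :: "'k \<Rightarrow> real \<Rightarrow> 'a" and Z p +
  fixes k0
  assumes k0: "k0 \<in> K" "dom k0 = {0..}"
    and sep: "\<And>t k s. t > 0 \<Longrightarrow> k \<in> K \<Longrightarrow> s \<in> dom k \<Longrightarrow> \<gamma> k0 t = \<gamma> k s \<Longrightarrow> k = k0 \<and> s = t"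
    and not_Z: "\<And>t. t > 0 \<Longrightarrow> \<gamma> k0 t \<notin> Z"
begin

text \<open>The description recovers the parameter of a point of the open half-line, which is unique
  by \<open>sep\<close>. The origin of the half-line counts as outside and gets the value 0.\<close>

definition bump :: "(real \<Rightarrow> real) \<Rightarrow> 'a \<Rightarrow> real" where
  "bump h x = (if \<exists>t>0. x = \<gamma> k0 t then h (THE t. t > 0 \<and> x = \<gamma> k0 t) else 0)"

lemma bump_at: "t > 0 \<Longrightarrow> bump h (\<gamma> k0 t) = h t"
proof -
  assume t: "t > 0"
  have "(THE s. s > 0 \<and> \<gamma> k0 t = \<gamma> k0 s) = t"
    by (rule the_equality) (use t sep[OF t k0(1)] k0 in auto)
  then show ?thesis using t by (auto simp: bump_def)
qed

lemma bump_off: "(\<And>t. t > 0 \<Longrightarrow> x \<noteq> \<gamma> k0 t) \<Longrightarrow> bump h x = 0"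
  by (auto simp: bump_def)

lemma bump_k0: "t \<ge> 0 \<Longrightarrow> h 0 = 0 \<Longrightarrow> bump h (\<gamma> k0 t) = h t"
proof (cases "t = 0")
  case True
  assume h: "h 0 = 0"
  have "\<gamma> k0 0 \<noteq> \<gamma> k0 s" if "s > 0" for s using sep[OF that k0(1), of 0] k0 that by auto
  then show ?thesis using bump_off[of "\<gamma> k0 0" h] h True by auto
qed (simp add: bump_at)

lemma bump_other: "k \<in> K \<Longrightarrow> k \<noteq> k0 \<Longrightarrow> s \<in> dom k \<Longrightarrow> bump h (\<gamma> k s) = 0"
  by (rule bump_off) (metis sep)

lemma H1_cont_cong: "H1_cont D f \<Longrightarrow> is_interval D \<Longrightarrow> D \<noteq> {} \<Longrightarrow> (\<And>t. t \<in> D \<Longrightarrow> f t = f' t) \<Longrightarrow> H1_cont D f'"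
  by (rule H1_pair_imp_cont[OF H1_pair_cong[OF H1_cont_imp_pair[of D f], of f' "weak_deriv D f"]]) auto

lemma interval_energy_cong:
  assumes "H1_cont D f" "is_interval D" "closed D" "D \<noteq> {}" "\<And>t. t \<in> D \<Longrightarrow> f t = f' t"
  shows "interval_energy D f' = interval_energy D f"
proof -
  have P: "H1_pair D f (weak_deriv D f)" by (rule H1_cont_imp_pair[OF assms(1,2)])
  have P': "H1_pair D f' (weak_deriv D f)" by (rule H1_pair_cong[OF P _ _ assms(2)]) (use assms(5) in auto)
  have "(LINT t:D|lborel. (f t)\<^sup>2) = (LINT t:D|lborel. (f' t)\<^sup>2)"
    by (rule set_lebesgue_integral_cong) (use assms(5) sets_borel_is_interval[OF assms(2)] in auto)
  then show ?thesis
    unfolding interval_energy_eq(1)[OF P assms(2-4)] interval_energy_eq(1)[OF P' assms(2-4)] by simp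
qed

lemma bump_X:
  assumes h: "H1_cont {0..} h" "h 0 = 0"
  shows "bump h \<in> X" "E (bump h) = interval_energy {0..} h" "Lp (bump h) = interval_Lp {0..} p h"
proof -
  have c0: "H1_cont (dom k) (\<lambda>_. 0)" if "k \<in> K" for k
    by (rule H1_pair_imp_cont[OF H1_pair_zero dom_props(1,3)[OF that]])
  have I0: "is_interval {0::real..}" "closed {0::real..}" "{0::real..} \<noteq> {}" by (auto simp: is_interval_ci)
  show "bump h \<in> X"
    unfolding X_def
  proof (intro CollectI conjI allI impI ballI)
    fix x assume "x \<notin> points"
    then show "bump h x = 0" using k0 by (intro bump_off) (auto simp: points_def)
  next
    fix x assume "x \<in> Z"
    then show "bump h x = 0" using not_Z by (intro bump_off) auto
  next
    fix k assume k: "k \<in> K"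
    show "H1_cont (dom k) (\<lambda>t. bump h (\<gamma> k t))"
    proof (cases "k = k0")
      case True
      then show ?thesis using h k0 I0 by (auto intro: H1_cont_cong[OF h(1)] simp: bump_k0)
    next
      case False
      then show ?thesis using bump_other[OF k] by (intro H1_cont_cong[OF c0[OF k] dom_props(1,3)[OF k]]) auto
    qed
  qed
  have "E (bump h) = (\<Sum>k\<in>K. if k = k0 then interval_energy {0..} h else 0)"
    unfolding E_def
  proof (rule sum.cong[OF refl])
    fix k assume k: "k \<in> K"
    show "interval_energy (dom k) (\<lambda>t. bump h (\<gamma> k t)) = (if k = k0 then interval_energy {0..} h else 0)"
    proof (cases "k = k0")
      case True
      then show ?thesis using k0 interval_energy_cong[OF h(1) I0, of "\<lambda>t. bump h (\<gamma> k0 t)"] h by (simp add: bump_k0)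
    next
      case False
      then show ?thesis
        using interval_energy_cong[OF c0[OF k] dom_props(1-3)[OF k], of "\<lambda>t. bump h (\<gamma> k t)"] bump_other[OF k]
          interval_energy_zero[OF dom_props(1-3)[OF k]] by simp
    qed
  qed
  then show "E (bump h) = interval_energy {0..} h" using k0 finK by simp
  have "Lp (bump h) = (\<Sum>k\<in>K. if k = k0 then interval_Lp {0..} p h else 0)"
    unfolding Lp_def
  proof (rule sum.cong[OF refl])
    fix k assume k: "k \<in> K"
    show "interval_Lp (dom k) p (\<lambda>t. bump h (\<gamma> k t)) = (if k = k0 then interval_Lp {0..} p h else 0)"
    proof (cases "k = k0")
      case True
      then show ?thesis using k0 h unfolding interval_Lp_def by (auto intro!: set_lebesgue_integral_cong simp: bump_k0)
    next
      case False
      have "interval_Lp (dom k) p (\<lambda>t. bump h (\<gamma> k t)) = interval_Lp (dom k) p (\<lambda>t. 0)"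
        unfolding interval_Lp_def using bump_other[OF k False] dom_props(4)[OF k] by (intro set_lebesgue_integral_cong) auto
      then show ?thesis using False by (simp add: interval_Lp_def)
    qed
  qed
  then show "Lp (bump h) = interval_Lp {0..} p h" using k0 finK by simp
qed

text \<open>S > R moves the support into the open half-line. Cutting the line at 0 can only lower
  the energy, and an inequality for the energy is enough, whereas the integral of the power is
  preserved exactly.\<close>

lemma transplant:
  assumes F: "H1_cont UNIV F" "\<And>t. t \<notin> {-R..R} \<Longrightarrow> F t = 0" and S: "S > R"
  defines "u \<equiv> bump (\<lambda>t. F (t - S))"
  shows "u \<in> X" "E u \<le> interval_energy UNIV F" "Lp u = interval_Lp UNIV p F"
    "\<And>x. u x \<noteq> 0 \<Longrightarrow> \<exists>t\<in>{S-R..S+R}. t > 0 \<and> x = \<gamma> k0 t"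
proof -
  define G where "G = weak_deriv UNIV F"
  have P: "H1_pair UNIV F G" unfolding G_def by (rule H1_cont_imp_pair[OF F(1)]) simp
  have P': "H1_pair UNIV (\<lambda>t. F (t - S)) (\<lambda>t. G (t - S))"
    using H1_pair_isometry[OF _ P, of 1 "-S"] by simp
  have I0: "is_interval {0::real..}" "closed {0::real..}" "{0::real..} \<noteq> {}" by (auto simp: is_interval_ci)
  have H0: "H1_pair {0..} (\<lambda>t. F (t - S)) (\<lambda>t. G (t - S))" by (rule H1_pair_subset[OF P']) auto
  have h: "H1_cont {0..} (\<lambda>t. F (t - S))" by (rule H1_pair_imp_cont[OF H0 I0(1,3)])
  have z: "F (0 - S) = 0" using F(2)[of "-S"] S by auto
  note b = bump_X[OF h z, folded u_def]
  show "u \<in> X" by (rule b(1))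
  have "interval_energy {0..} (\<lambda>t. F (t - S)) \<le> interval_energy UNIV (\<lambda>t. F (t - S))"
    by (rule interval_energy_mono[OF P']) (use I0 in auto)
  also have "\<dots> = interval_energy UNIV F"
    using interval_energy_isometry[of 1 UNIV F G UNIV "-S"] P by simp
  finally show "E u \<le> interval_energy UNIV F" using b(2) by simp
  have "interval_Lp {0..} p (\<lambda>t. F (t - S)) = interval_Lp UNIV p (\<lambda>t. F (t - S))"
    unfolding interval_Lp_def
  proof (rule set_integral_restrict_support[symmetric])
    fix t assume "t \<notin> {0::real..}"
    then have "t - S \<notin> {-R..R}" using S by auto
    then show "\<bar>F (t - S)\<bar> powr p = 0" using F(2) p by simp
  qed simp
  also have "\<dots> = interval_Lp UNIV p F"
    unfolding interval_Lp_def using set_integral_isometry[of 1 "-S" UNIV "\<lambda>t. \<bar>F t\<bar> powr p"] by simp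
  finally show "Lp u = interval_Lp UNIV p F" using b(3) by simp
  fix x assume x: "u x \<noteq> 0"
  then obtain t where t: "t > 0" "x = \<gamma> k0 t" unfolding u_def using bump_off by blast
  then have "F (t - S) \<noteq> 0" using x by (simp add: u_def bump_at)
  then have "t - S \<in> {-R..R}" using F(2) by blast
  then have "t \<in> {S-R..S+R}" by auto
  with t show "\<exists>t\<in>{S-R..S+R}. t > 0 \<and> x = \<gamma> k0 t" by blast
qed

lemma X_nontrivial: "X - {\<lambda>_. 0} \<noteq> {}"
proof -
  define F where "F t = cutoff 1 t" for t
  note ct = cutoff_test[of 1, folded F_def[abs_def]]
  have F: "F = cutoff 1" by (simp add: F_def fun_eq_iff)
  have "H1_cont UNIV (cutoff 1)"
  proof (rule H1_pair_imp_cont)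
    show "H1_pair UNIV (cutoff 1) (deriv (cutoff 1))"
      using test_function_has_deriv[OF cutoff_test(1)[of 1]] test_function_L2[OF cutoff_test(1)[of 1]]
      unfolding H1_pair_def
    proof (intro conjI ballI impI)
      fix s t :: real assume "s \<le> t"
      have "H1_pair {s..t} (cutoff 1) (deriv (cutoff 1))"
        by (rule H1_pair_C1)
          (use test_function_has_deriv[OF cutoff_test(1)[of 1]] in \<open>auto intro: continuous_on_subset\<close>)
      then show "cutoff 1 t - cutoff 1 s = (LINT u:{s..t}|lborel. deriv (cutoff 1) u)"
        using \<open>s \<le> t\<close> by (simp add: H1_pair_def)
    qed auto
  qed auto
  moreover have "cutoff 1 t = 0" if "t \<notin> {-1..1}" for t using cutoff_test(2)[of 1 t] that by simp
  ultimately have u: "bump (\<lambda>t. cutoff 1 (t - 2)) \<in> X" by (intro transplant(1)[of _ 1]) auto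
  have "bump (\<lambda>t. cutoff 1 (t - 2)) (\<gamma> k0 2) = 1"
    by (subst bump_at) (auto simp: cutoff_def ramp_sq_def)
  then have "bump (\<lambda>t. cutoff 1 (t - 2)) \<noteq> (\<lambda>_. 0)" by (metis zero_neq_one)
  with u show ?thesis by blast
qed

end

section \<open>Best constants and minimizing sequences\<close>

lemma Inf_constant_attained:
  fixes a b :: "'i \<Rightarrow> real"
  assumes c0: "0 \<le> c0" "\<And>i. i \<in> S \<Longrightarrow> a i \<le> c0 * b i" and b: "\<And>i. i \<in> S \<Longrightarrow> 0 \<le> b i"
  defines "C \<equiv> Inf {c. 0 \<le> c \<and> (\<forall>i\<in>S. a i \<le> c * b i)}"
  shows "0 \<le> C" "\<And>i. i \<in> S \<Longrightarrow> a i \<le> C * b i" "\<And>c. 0 \<le> c \<Longrightarrow> (\<And>i. i \<in> S \<Longrightarrow> a i \<le> c * b i) \<Longrightarrow> C \<le> c"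
proof -
  let ?A = "{c. 0 \<le> c \<and> (\<forall>i\<in>S. a i \<le> c * b i)}"
  have ne: "?A \<noteq> {}" using c0 by blast
  have bdd: "bdd_below ?A" by (rule bdd_belowI[of _ 0]) auto
  show "0 \<le> C" unfolding C_def by (rule cInf_greatest[OF ne]) auto
  show "C \<le> c" if "0 \<le> c" "\<And>i. i \<in> S \<Longrightarrow> a i \<le> c * b i" for c
    unfolding C_def by (rule cInf_lower[OF _ bdd]) (use that in auto)
  fix i assume i: "i \<in> S"
  show "a i \<le> C * b i"
  proof (rule field_le_epsilon)
    fix e :: real assume e: "e > 0"
    \<comment> \<open>The slack is chosen so that its product with b i stays below e, also when b i
      = 0.\<close>
    have "Inf ?A < C + e / (b i + 1)" using e b[OF i] by (simp add: C_def)
    then obtain c where c: "c \<in> ?A" "c < C + e / (b i + 1)" using cInf_lessD[OF ne] by blast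
    have "a i \<le> c * b i" using c(1) i by auto
    also have "\<dots> \<le> (C + e / (b i + 1)) * b i" using c(2) b[OF i] by (intro mult_right_mono) auto
    also have "\<dots> \<le> C * b i + e"
    proof -
      have "e / (b i + 1) * b i \<le> e" using e b[OF i] by (simp add: field_simps)
      then show ?thesis by (simp add: distrib_right)
    qed
    finally show "a i \<le> C * b i + e" .
  qed
qed

definition line_best :: "real \<Rightarrow> real" where
  "line_best p = Inf {c. 0 \<le> c \<and> (\<forall>F\<in>Collect (H1_cont UNIV). interval_Lp UNIV p F powr (2 / p) \<le> c * interval_energy UNIV F)}"

lemma line_best:
  assumes p: "p > 2"
  shows "0 \<le> line_best p" "\<And>F. H1_cont UNIV F \<Longrightarrow> interval_Lp UNIV p F powr (2 / p) \<le> line_best p * interval_energy UNIV F"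
    "\<And>c. 0 \<le> c \<Longrightarrow> (\<And>F. H1_cont UNIV F \<Longrightarrow> interval_Lp UNIV p F powr (2 / p) \<le> c * interval_energy UNIV F) \<Longrightarrow> line_best p \<le> c"
proof -
  \<comment> \<open>The number 4 is 2 / l + 2 l for intervals of length l = 1.\<close>
  have sob: "interval_Lp UNIV p F powr (2 / p) \<le> 4 powr ((p - 2) / p) * interval_energy UNIV F"
    if "F \<in> Collect (H1_cont UNIV)" for F
  proof -
    have P: "H1_pair UNIV F (weak_deriv UNIV F)" using that by (intro H1_cont_imp_pair) auto
    have "(F t)\<^sup>2 \<le> (2 / 1 + 2 * 1) * interval_energy UNIV F" for t
      by (rule H1_pair_sup_bound[OF P, of 1 t]) auto
    then show ?thesis by (intro Sobolev_interval[OF P _ _ _ _ _ p]) auto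
  qed
  note I = Inf_constant_attained[of "4 powr ((p - 2) / p)" "Collect (H1_cont UNIV)" "\<lambda>F. interval_Lp UNIV p F powr (2 / p)" "interval_energy UNIV",
      OF _ sob interval_energy_nonneg, folded line_best_def]
  show "0 \<le> line_best p" by (rule I(1)) auto
  show "interval_Lp UNIV p F powr (2 / p) \<le> line_best p * interval_energy UNIV F" if "H1_cont UNIV F" for F
    by (rule I(2)) (use that in auto)
  show "line_best p \<le> c" if "0 \<le> c" "\<And>F. H1_cont UNIV F \<Longrightarrow> interval_Lp UNIV p F powr (2 / p) \<le> c * interval_energy UNIV F" for c
    by (rule I(3)) (use that in auto)
qed

context pieces_with_half_line
begin

definition best :: real where
  "best = Inf {c. 0 \<le> c \<and> (\<forall>v\<in>X. Lp v powr (2 / p) \<le> c * E v)}"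

definition ray :: "('a \<Rightarrow> real) \<Rightarrow> real" where "ray v = E v / Lp v powr (2 / p)"

lemma best:
  shows best_nonneg: "0 \<le> best" and best_ineq: "\<And>v. v \<in> X \<Longrightarrow> Lp v powr (2 / p) \<le> best * E v"
    and best_least: "\<And>c. 0 \<le> c \<Longrightarrow> (\<And>v. v \<in> X \<Longrightarrow> Lp v powr (2 / p) \<le> c * E v) \<Longrightarrow> best \<le> c"
proof -
  obtain c0 where c0: "0 \<le> c0" "\<And>v. v \<in> X \<Longrightarrow> Lp v powr (2 / p) \<le> c0 * E v" using Sobolev by blast
  note I = Inf_constant_attained[of c0 X "\<lambda>v. Lp v powr (2 / p)" E, OF c0 E_nonneg, folded best_def]
  show "0 \<le> best" by (rule I(1))
  show "Lp v powr (2 / p) \<le> best * E v" if "v \<in> X" for v by (rule I(2)) (use that in auto)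
  show "best \<le> c" if "0 \<le> c" "\<And>v. v \<in> X \<Longrightarrow> Lp v powr (2 / p) \<le> c * E v" for c by (rule I(3)) (use that in auto)
qed

lemma best_pos: "best > 0"
proof -
  obtain u where u: "u \<in> X" "u \<noteq> (\<lambda>_. 0)" using X_nontrivial by blast
  have "0 < Lp u powr (2 / p)" using Lp_pos[OF u] by simp
  also have "\<dots> \<le> best * E u" by (rule best_ineq[OF u(1)])
  finally show ?thesis using E_nonneg[of u] best_nonneg by (auto simp: zero_less_mult_iff)
qed

text \<open>The integral of the power scales with exponent p and the energy with exponent 2, so the
  factor with exponent -1 / p turns the energy into the quotient.\<close>

lemma normalize:
  assumes v: "v \<in> X" "v \<noteq> (\<lambda>_. 0)"
  defines "u \<equiv> (\<lambda>x. Lp v powr (- 1 / p) * v x)"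
  shows "u \<in> X" "u \<noteq> (\<lambda>_. 0)" "Lp u = 1" "E u = ray v"
proof -
  have L: "Lp v > 0" by (rule Lp_pos[OF v])
  show uX: "u \<in> X" unfolding u_def by (rule X_scale[OF v(1)])
  have "\<bar>Lp v powr (- 1 / p)\<bar> powr p = Lp v powr (-1)" using p by (simp add: powr_powr)
  then show "Lp u = 1" unfolding u_def Lp_scale using L by (simp add: powr_minus)
  have "Lp (\<lambda>_. 0) = 0" by (simp add: Lp_def interval_Lp_def)
  with \<open>Lp u = 1\<close> show "u \<noteq> (\<lambda>_. 0)" by force
  have "(Lp v powr (- 1 / p))\<^sup>2 = Lp v powr (- 1 / p + - 1 / p)" by (simp only: power2_eq_square powr_add)
  also have "- 1 / p + - 1 / p = - (2 / p)" by simp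
  finally show "E u = ray v" unfolding u_def E_scale[OF v(1)] ray_def by (simp add: powr_minus divide_inverse mult.commute)
qed

lemma ray_ge: assumes v: "v \<in> X" "v \<noteq> (\<lambda>_. 0)" shows "1 / best \<le> ray v"
proof -
  have L: "0 < Lp v powr (2 / p)" using Lp_pos[OF v] by simp
  have "Lp v powr (2 / p) \<le> best * E v" by (rule best_ineq[OF v(1)])
  then show ?thesis using L best_pos by (simp add: ray_def field_simps)
qed

text \<open>One inequality is the best inequality read as a lower bound for quotients; conversely
  the reciprocal of the infimum is an admissible constant, hence not below the least one.\<close>

lemma min_eq: "(INF v\<in>X - {\<lambda>_. 0}. ray v) = 1 / best"
proof (rule antisym)
  let ?m = "INF v\<in>X - {\<lambda>_. 0}. ray v"
  show ge: "1 / best \<le> ?m" by (rule cINF_greatest[OF X_nontrivial]) (use ray_ge in auto)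
  have m0: "?m > 0" using ge best_pos by (meson less_le_trans zero_less_divide_1_iff)
  have bdd: "bdd_below (ray ` (X - {\<lambda>_. 0}))" by (rule bdd_belowI[of _ "1 / best"]) (use ray_ge in auto)
  have "best \<le> 1 / ?m"
  proof (rule best_least)
    show "0 \<le> 1 / ?m" using m0 by simp
    fix v assume v: "v \<in> X"
    show "Lp v powr (2 / p) \<le> 1 / ?m * E v"
    proof (cases "v = (\<lambda>_. 0)")
      case True
      then have "Lp v = 0" by (simp add: Lp_def interval_Lp_def)
      then show ?thesis using m0 E_nonneg[of v] by simp
    next
      case False
      have "?m \<le> ray v" by (rule cINF_lower[OF bdd]) (use v False in auto)
      moreover have "0 < Lp v powr (2 / p)" using Lp_pos[OF v False] by simp
      ultimately show ?thesis using m0 by (simp add: ray_def field_simps)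
    qed
  qed
  then show "?m \<le> 1 / best" using m0 best_pos by (simp add: field_simps)
qed

lemma minimizing_sequence_exists:
  obtains v where "\<And>n::nat. v n \<in> X - {\<lambda>_. 0}" "\<And>n. Lp (v n) = 1" "(\<lambda>n. E (v n)) \<longlonglongrightarrow> 1 / best"
proof -
  have "\<exists>u. u \<in> X - {\<lambda>_. 0} \<and> Lp u = 1 \<and> E u < 1 / best + inverse (real (Suc n))" for n
  proof -
    have "(INF v\<in>X - {\<lambda>_. 0}. ray v) < 1 / best + inverse (real (Suc n))" unfolding min_eq by simp
    then obtain v where v: "v \<in> X - {\<lambda>_. 0}" "ray v < 1 / best + inverse (real (Suc n))"
      using cInf_lessD[of "ray ` (X - {\<lambda>_. 0})"] X_nontrivial by auto
    then show ?thesis using normalize[of v] by (intro exI[of _ "\<lambda>x. Lp v powr (- 1 / p) * v x"]) auto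
  qed
  then obtain v where v: "\<And>n. v n \<in> X - {\<lambda>_. 0}" "\<And>n. Lp (v n) = 1" "\<And>n. E (v n) < 1 / best + inverse (real (Suc n))" by metis
  have "(\<lambda>n. E (v n)) \<longlonglongrightarrow> 1 / best"
  proof (rule tendsto_sandwich)
    show "\<forall>\<^sub>F n in sequentially. 1 / best \<le> E (v n)"
      using ray_ge[of "v _"] v(1,2) by (intro always_eventually) (auto simp: ray_def)
    show "\<forall>\<^sub>F n in sequentially. E (v n) \<le> 1 / best + inverse (real (Suc n))"
      using v(3) by (intro always_eventually allI less_imp_le)
    show "(\<lambda>n. 1 / best + inverse (real (Suc n))) \<longlonglongrightarrow> 1 / best"
      using tendsto_add[OF tendsto_const LIMSEQ_inverse_real_of_nat, of "1 / best"] by simp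
  qed simp
  with v(1,2) that show thesis by blast
qed

lemma minimizing_subsequence:
  assumes gt: "best > line_best p"
    and v: "\<And>n::nat. v n \<in> X" "\<And>n. Lp (v n) = 1" "(\<lambda>n. E (v n)) \<longlonglongrightarrow> 1 / best"
  obtains r w where "strict_mono r" "w \<in> X" "(\<lambda>n. E (\<lambda>x. v (r n) x - w x)) \<longlonglongrightarrow> 0" "Lp w = 1" "E w = 1 / best"
  using minimizing_sequence_compact[OF line_best(2)[OF p] line_best(1)[OF p] gt best_ineq v] by blast

text \<open>Any c n below the constant of the graph is below that of the line and hence violated by
  some function on the line, which may be taken with compact support. Translated far enough along
  the half-line, these functions have disjoint supports, and their quotients lie between 1 / best
  and 1 / c n.\<close>

lemma escaping_minimizing_sequence:
  assumes le: "best \<le> line_best p"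
  obtains u where "\<And>n::nat. u n \<in> X - {\<lambda>_. 0}" "\<And>n. Lp (u n) = 1" "(\<lambda>n. E (u n)) \<longlonglongrightarrow> 1 / best"
    "\<And>m n x. u m x \<noteq> 0 \<Longrightarrow> u n x \<noteq> 0 \<Longrightarrow> m = n"
proof -
  \<comment> \<open>Only nonnegative constants compete in the definition of the constant of the
    line, hence the maximum with 0.\<close>
  define c where "c n = max 0 (best - inverse (real (Suc n)))" for n
  have c: "0 \<le> c n" "c n < best" for n using best_pos by (auto simp: c_def)
  have "\<exists>F R. H1_cont UNIV F \<and> R > 0 \<and> (\<forall>t. t \<notin> {-R..R} \<longrightarrow> F t = 0) \<and>
      interval_Lp UNIV p F powr (2 / p) > c n * interval_energy UNIV F" for n
  proof -
    have "\<exists>F. H1_cont UNIV F \<and> interval_Lp UNIV p F powr (2 / p) > c n * interval_energy UNIV F"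
    proof (rule ccontr)
      assume "\<not> ?thesis"
      then have "line_best p \<le> c n" using c(1) by (intro line_best(3)[OF p]) (auto simp: not_less)
      then show False using le c(2)[of n] by linarith
    qed
    then obtain F where F: "H1_cont UNIV F" "interval_Lp UNIV p F powr (2 / p) > c n * interval_energy UNIV F" by blast
    show ?thesis by (rule compactly_supported_almost_optimal[OF F(1) p F(2)]) blast
  qed
  then obtain F R where F: "\<And>n. H1_cont UNIV (F n)" "\<And>n. R n > 0" "\<And>n t. t \<notin> {-R n..R n} \<Longrightarrow> F n t = 0"
      "\<And>n. interval_Lp UNIV p (F n) powr (2 / p) > c n * interval_energy UNIV (F n)" by metis
  \<comment> \<open>Each support has length 2 R i and is given a slot of length 2 (R i + 1), so
    consecutive supports are at distance at least 2.\<close>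
  define S where "S n = (\<Sum>i<n. 2 * (R i + 1)) + R n + 1" for n
  have S: "S n > R n" for n
  proof -
    have "0 \<le> (\<Sum>i<n. 2 * (R i + 1))" using F(2) by (intro sum_nonneg) (simp add: less_imp_le)
    then show ?thesis by (simp add: S_def)
  qed
  have sepS: "S m + R m < S n - R n" if "m < n" for m n
  proof -
    have "(\<Sum>i<Suc m. 2 * (R i + 1)) \<le> (\<Sum>i<n. 2 * (R i + 1))"
      using that F(2) by (intro sum_mono2) (auto simp: less_imp_le)
    then show ?thesis by (simp add: S_def)
  qed
  define v where "v n = bump (\<lambda>t. F n (t - S n))" for n
  have tr: "v n \<in> X" "E (v n) \<le> interval_energy UNIV (F n)" "Lp (v n) = interval_Lp UNIV p (F n)"
      "\<And>x. v n x \<noteq> 0 \<Longrightarrow> \<exists>t\<in>{S n - R n..S n + R n}. t > 0 \<and> x = \<gamma> k0 t" for n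
    using transplant[of "F n" "R n" "S n", OF F(1) F(3) S] unfolding v_def by blast+
  have Lpos: "0 < interval_Lp UNIV p (F n) powr (2 / p)" for n
    using F(4)[of n] mult_nonneg_nonneg[OF c(1)[of n] interval_energy_nonneg[of UNIV "F n"]] by linarith
  have vn: "v n \<noteq> (\<lambda>_. 0)" for n
  proof
    assume "v n = (\<lambda>_. 0)"
    then have "Lp (v n) = 0" by (simp add: Lp_def interval_Lp_def)
    then show False using Lpos[of n] tr(3)[of n] by simp
  qed
  define u where "u n = (\<lambda>x. Lp (v n) powr (- 1 / p) * v n x)" for n
  note nu = normalize[OF tr(1) vn, folded u_def]
  \<comment> \<open>The upper half of the squeeze, as E (u n) is the quotient of v n; it is stated
    without division because c n may be 0 for small n.\<close>
  have cE: "c n * E (u n) \<le> 1" for n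
  proof -
    have "c n * E (v n) \<le> c n * interval_energy UNIV (F n)" using tr(2)[of n] c(1) by (intro mult_left_mono) auto
    also have "\<dots> \<le> Lp (v n) powr (2 / p)" using F(4)[of n] tr(3)[of n] by simp
    finally show ?thesis using Lpos[of n] tr(3)[of n] unfolding nu(4) ray_def by (simp add: field_simps)
  qed
  have bE: "1 / best \<le> E (u n)" for n
    using ray_ge[OF nu(1,2)[of n]] nu(3)[of n] by (simp add: ray_def)
  have c_lim: "c \<longlonglongrightarrow> best"
  proof -
    have "(\<lambda>n. max 0 (best - inverse (real (Suc n)))) \<longlonglongrightarrow> max 0 (best - 0)"
      by (intro tendsto_intros LIMSEQ_inverse_real_of_nat)
    then show ?thesis using best_pos by (simp add: c_def[abs_def])
  qed
  have lim: "(\<lambda>n. E (u n)) \<longlonglongrightarrow> 1 / best"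
  proof (rule tendsto_sandwich)
    show "\<forall>\<^sub>F n in sequentially. 1 / best \<le> E (u n)" using bE by (intro always_eventually) blast
    show "\<forall>\<^sub>F n in sequentially. E (u n) \<le> 1 / c n"
      using order_tendstoD(1)[OF c_lim best_pos]
    proof (rule eventually_mono)
      fix n assume "0 < c n"
      then show "E (u n) \<le> 1 / c n" using cE[of n] by (simp add: field_simps)
    qed
    show "(\<lambda>n. 1 / c n) \<longlonglongrightarrow> 1 / best" using best_pos by (intro tendsto_divide tendsto_const c_lim) simp
  qed simp
  have dis: "m = n" if x: "u m x \<noteq> 0" "u n x \<noteq> 0" for m n x
  proof -
    have "v m x \<noteq> 0" "v n x \<noteq> 0" using x by (auto simp: u_def)
    then obtain s t where s: "s \<in> {S m - R m..S m + R m}" "s > 0" "x = \<gamma> k0 s"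
      and t: "t \<in> {S n - R n..S n + R n}" "t > 0" "x = \<gamma> k0 t"
      using tr(4)[OF \<open>v m x \<noteq> 0\<close>] tr(4)[OF \<open>v n x \<noteq> 0\<close>] by blast
    have "s = t" using sep[OF t(2) k0(1), of s] s t k0 by auto
    then show ?thesis using sepS[of m n] sepS[of n m] s(1) t(1) by (cases m n rule: linorder_cases) auto
  qed
  have nX: "u n \<in> X - {\<lambda>_. 0}" for n using nu(1,2)[of n] by blast
  show thesis by (rule that[OF nX nu(3) lim dis])
qed

end

section \<open>Chains as half-lines\<close>

lemma has_sum_set_integral_countable:
  fixes F :: "real \<Rightarrow> real"
  assumes A: "\<And>i::nat. A i \<in> sets borel" "disjoint_family A" and F: "set_integrable lborel (\<Union>i. A i) F"
    and pos: "\<And>t. 0 \<le> F t"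
  shows "((\<lambda>i. LINT t:A i|lborel. F t) has_sum (LINT t:(\<Union>i. A i)|lborel. F t)) UNIV"
proof -
  have i: "set_integrable lborel (A i) F" for i
    by (rule set_integrable_subset[OF F]) (use A in auto)
  have nn: "0 \<le> (LINT t:A i|lborel. F t)" for i by (rule set_integral_nonneg_real) (rule pos)
  have "summable (\<lambda>i. LINT t:A i|lborel. F t)"
  proof (rule summableI_nonneg_bounded[OF nn])
    fix n
    have "(\<Sum>i<n. LINT t:A i|lborel. F t) = (LINT t:(\<Union>i<n. A i)|lborel. F t)"
      by (rule set_integral_finite_Union[symmetric]) (use A i in \<open>auto simp: disjoint_family_on_def\<close>)
    also have "\<dots> \<le> (LINT t:(\<Union>i. A i)|lborel. F t)"
      unfolding set_lebesgue_integral_def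
    proof (rule integral_mono)
      have "set_integrable lborel (\<Union>i<n. A i) F" by (rule set_integrable_subset[OF F]) (use A in auto)
      then show "integrable lborel (\<lambda>t. indicat_real (\<Union>i<n. A i) t *\<^sub>R F t)" by (simp add: set_integrable_def)
      show "integrable lborel (\<lambda>t. indicat_real (\<Union>i. A i) t *\<^sub>R F t)" using F by (simp add: set_integrable_def)
      show "indicat_real (\<Union>i<n. A i) t *\<^sub>R F t \<le> indicat_real (\<Union>i. A i) t *\<^sub>R F t" for t
        using pos by (auto simp: indicator_def)
    qed
    finally show "(\<Sum>i<n. LINT t:A i|lborel. F t) \<le> (LINT t:(\<Union>i. A i)|lborel. F t)" .
  qed
  then have "(\<lambda>i. LINT t:A i|lborel. F t) sums (\<Sum>i. LINT t:A i|lborel. F t)" by (rule summable_sums)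
  also have "(\<Sum>i. LINT t:A i|lborel. F t) = (LINT t:(\<Union>i. A i)|lborel. F t)"
    by (rule lebesgue_integral_countable_add[symmetric]) (use A F in \<open>auto simp: disjoint_family_on_def\<close>)
  finally show ?thesis by (rule sums_nonneg_imp_has_sum[OF _ nn])
qed

lemma set_borel_measurable_UN:
  fixes f :: "real \<Rightarrow> real"
  assumes A: "\<And>i::nat. A i \<in> sets borel" and f: "\<And>i. set_borel_measurable lborel (A i) f"
  shows "set_borel_measurable lborel (\<Union>i. A i) f"
proof -
  let ?U = "\<Union>i. A i"
  let ?g = "\<lambda>x. indicat_real ?U x *\<^sub>R f x"
  have U: "?U \<in> sets borel" using A by auto
  have "?g \<in> borel_measurable lborel"
  \<comment> \<open>The complement of the union completes the cover by measurable sets; the function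
    is 0 there.\<close>
  proof (rule measurable_piecewise_restrict[of "insert (- ?U) (range A)"])
    fix \<Omega> assume "\<Omega> \<in> insert (- ?U) (range A)"
    then consider "\<Omega> = - ?U" | i where "\<Omega> = A i" by auto
    then show "?g \<in> borel_measurable (restrict_space lborel \<Omega>)"
    proof cases
      case 1
      have "(\<lambda>x. 0::real) \<in> borel_measurable (restrict_space lborel \<Omega>)" by simp
      then show ?thesis by (rule measurable_cong[THEN iffD1, rotated]) (use 1 in \<open>auto simp: space_restrict_space\<close>)
    next
      case 2
      have "f \<in> borel_measurable (restrict_space lborel (A i))"
        using f[of i] A[of i] by (simp add: borel_measurable_restrict_space_iff set_borel_measurable_def)
      then show ?thesis unfolding 2
        by (rule measurable_cong[THEN iffD1, rotated]) (auto simp: space_restrict_space indicator_def)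
    qed
  qed (use A U in auto)
  then show ?thesis by (simp add: set_borel_measurable_def)
qed

text \<open>For a nonnegative integrand the extended integral over the union is the series of the
  integrals over the cells, so summability gives finiteness.\<close>

lemma set_integrable_countable_UN:
  fixes F :: "real \<Rightarrow> real"
  assumes A: "\<And>i::nat. A i \<in> sets borel" "disjoint_family A" and F: "\<And>i. set_integrable lborel (A i) F"
    and pos: "\<And>t. 0 \<le> F t" and s: "summable (\<lambda>i. LINT t:A i|lborel. F t)"
  shows "set_integrable lborel (\<Union>i. A i) F"
proof -
  let ?U = "\<Union>i. A i"
  let ?g = "\<lambda>x. indicat_real ?U x *\<^sub>R F x"
  have nn: "0 \<le> (LINT t:A i|lborel. F t)" for i by (rule set_integral_nonneg_real) (rule pos)
  have "set_borel_measurable lborel (A i) F" for i using F[of i] by (auto simp: set_integrable_def set_borel_measurable_def)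
  then have g: "?g \<in> borel_measurable lborel"
    using set_borel_measurable_UN[OF A(1)] by (simp add: set_borel_measurable_def)
  have "(\<integral>\<^sup>+x. ennreal (norm (?g x)) \<partial>lborel) = (\<integral>\<^sup>+x\<in>?U. ennreal (?g x) \<partial>lborel)"
    by (rule nn_integral_cong) (auto simp: indicator_def pos)
  also have "\<dots> = (\<Sum>i. (\<integral>\<^sup>+x\<in>A i. ennreal (?g x) \<partial>lborel))"
    by (rule nn_integral_disjoint_family) (use g A in auto)
  also have "\<dots> = (\<Sum>i. ennreal (LINT t:A i|lborel. F t))"
  proof (rule suminf_cong)
    fix i
    have "(\<integral>\<^sup>+x\<in>A i. ennreal (?g x) \<partial>lborel) = (\<integral>\<^sup>+x. ennreal (indicat_real (A i) x *\<^sub>R F x) \<partial>lborel)"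
      by (rule nn_integral_cong) (auto simp: indicator_def)
    also have "\<dots> = ennreal (LINT t:A i|lborel. F t)"
      unfolding set_lebesgue_integral_def
      by (rule nn_integral_eq_integral) (use F[of i] pos in \<open>auto simp: set_integrable_def\<close>)
    finally show "(\<integral>\<^sup>+x\<in>A i. ennreal (?g x) \<partial>lborel) = ennreal (LINT t:A i|lborel. F t)" .
  qed
  also have "\<dots> = ennreal (\<Sum>i. LINT t:A i|lborel. F t)" by (rule suminf_ennreal2[OF nn s])
  finally have "(\<integral>\<^sup>+x. ennreal (norm (?g x)) \<partial>lborel) < \<infinity>" by simp
  with g have "integrable lborel ?g" by (rule integrableI_bounded)
  then show ?thesis by (simp add: set_integrable_def)
qed

section \<open>Sobolev functions on a single edge and on a piece\<close>

definition edge_H1 :: "(real^2 \<Rightarrow> real) \<Rightarrow> edge \<Rightarrow> bool" where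
  "edge_H1 v e \<longleftrightarrow> continuous_on (edge_points e) v \<and> H1_interval (edge_dom e) (on_edge v e)"

definition edge_energy :: "(real^2 \<Rightarrow> real) \<Rightarrow> edge \<Rightarrow> real" where
  "edge_energy v e = (LINT t:edge_dom e|lborel. energy_density v e t)"

definition edge_Lp :: "real \<Rightarrow> (real^2 \<Rightarrow> real) \<Rightarrow> edge \<Rightarrow> real" where
  "edge_Lp p v e = (LINT t:edge_dom e|lborel. \<bar>on_edge v e t\<bar> powr p)"

lemma edge_energy_eq: "edge_energy v e = interval_energy (edge_dom e) (on_edge v e)"
  by (simp add: edge_energy_def interval_energy_def energy_density_def edge_deriv_def)

lemma edge_Lp_eq: "edge_Lp p v e = interval_Lp (edge_dom e) p (on_edge v e)"
  by (simp add: edge_Lp_def interval_Lp_def)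

lemma edge_dom_cases:
  assumes "valid_edge e"
  shows "edge_dom e = {0..} \<or> (\<exists>L>0. edge_dom e = {0..L})"
  using assms by (cases e) auto

lemma edge_dom_props:
  shows "is_interval (edge_dom e)" "closed (edge_dom e)" "edge_dom e \<noteq> {}" "edge_dom e \<in> sets borel"
  by (cases e; auto simp: is_interval_cc is_interval_ci)+

lemma edge_param_dist:
  assumes "valid_edge e"
  shows "dist (edge_param e s) (edge_param e t) = \<bar>s - t\<bar>"
proof (cases e)
  case (Segment a b)
  then have ab: "dist a b > 0" using assms by simp
  have "edge_param e s - edge_param e t = ((s - t) / dist a b) *\<^sub>R (b - a)"
    by (simp add: Segment algebra_simps diff_divide_distrib)
  then have "dist (edge_param e s) (edge_param e t) = \<bar>(s - t) / dist a b\<bar> * dist a b"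
    by (simp add: dist_norm norm_minus_commute)
  then show ?thesis using ab by simp
next
  case (Half_line a d)
  have "edge_param e s - edge_param e t = (s - t) *\<^sub>R d" by (simp add: Half_line algebra_simps)
  then show ?thesis using assms Half_line by (simp add: dist_norm)
qed

text \<open>The parametrization is an isometry onto the edge, so continuity transfers in both
  directions, on half-lines as well as on segments.\<close>

lemma edge_H1_iff:
  assumes "valid_edge e"
  shows "edge_H1 v e \<longleftrightarrow> H1_cont (edge_dom e) (on_edge v e)"
proof -
  let ?D = "edge_dom e" and ?g = "edge_param e"
  have g: "continuous_on ?D ?g"
    unfolding continuous_on_iff using edge_param_dist[OF assms] by (auto simp: dist_real_def)
  have "continuous_on (?g ` ?D) v \<longleftrightarrow> continuous_on ?D (v \<circ> ?g)"
  proof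
    assume "continuous_on (?g ` ?D) v" then show "continuous_on ?D (v \<circ> ?g)" by (rule continuous_on_compose[OF g])
  next
    assume c: "continuous_on ?D (v \<circ> ?g)"
    show "continuous_on (?g ` ?D) v"
      unfolding continuous_on_iff
    proof (intro ballI allI impI)
      fix x and r :: real assume x: "x \<in> ?g ` ?D" and r: "r > 0"
      then obtain s where s: "s \<in> ?D" "x = ?g s" by blast
      obtain d where d: "d > 0" "\<And>t. t \<in> ?D \<Longrightarrow> dist t s < d \<Longrightarrow> dist ((v \<circ> ?g) t) ((v \<circ> ?g) s) < r"
        using c s(1) r unfolding continuous_on_iff by blast
      have "dist (v y) (v x) < r" if y: "y \<in> ?g ` ?D" "dist y x < d" for y
      proof -
        obtain t where t: "t \<in> ?D" "y = ?g t" using y by blast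
        have "dist t s < d" using y(2) edge_param_dist[OF assms, of t s] t s by (simp add: dist_real_def)
        then show ?thesis using d(2)[OF t(1)] t s by simp
      qed
      then show "\<exists>d>0. \<forall>y\<in>?g ` ?D. dist y x < d \<longrightarrow> dist (v y) (v x) < r" using d(1) by blast
    qed
  qed
  then show ?thesis by (simp add: edge_H1_def H1_cont_def edge_points_def on_edge_def)
qed

text \<open>A piece is a set of edges whose union is parametrized by arc length on one interval.\<close>

definition piece :: "edge set \<Rightarrow> (real \<Rightarrow> real^2) \<Rightarrow> real set \<Rightarrow> bool" where
  "piece P \<gamma> D \<longleftrightarrow>
     (D = {0..} \<or> (\<exists>L>0. D = {0..L})) \<and> (\<Union>e\<in>P. edge_points e) = \<gamma> ` D \<and>
     (\<forall>v. (\<forall>e\<in>P. edge_H1 v e) \<and> edge_energy v summable_on P \<longrightarrow> H1_cont D (\<lambda>t. v (\<gamma> t))) \<and>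
     (\<forall>v. H1_cont D (\<lambda>t. v (\<gamma> t)) \<longrightarrow>
        (\<forall>e\<in>P. edge_H1 v e) \<and> (edge_energy v has_sum interval_energy D (\<lambda>t. v (\<gamma> t))) P \<and>
        (\<forall>p>2. (edge_Lp p v has_sum interval_Lp D p (\<lambda>t. v (\<gamma> t))) P))"

lemma piece_single:
  assumes "valid_edge e"
  shows "piece {e} (edge_param e) (edge_dom e)"
  unfolding piece_def
proof (intro conjI allI impI ballI)
  show "edge_dom e = {0..} \<or> (\<exists>L>0. edge_dom e = {0..L})" by (rule edge_dom_cases[OF assms])
  show "(\<Union>e\<in>{e}. edge_points e) = edge_param e ` edge_dom e" by (simp add: edge_points_def)
  fix v
  have eq: "on_edge v e = (\<lambda>t. v (edge_param e t))" by (auto simp: on_edge_def)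
  {
    assume "(\<forall>e\<in>{e}. edge_H1 v e) \<and> edge_energy v summable_on {e}"
    then show "H1_cont (edge_dom e) (\<lambda>t. v (edge_param e t))" using edge_H1_iff[OF assms, of v] by (simp add: eq)
  }
  assume H: "H1_cont (edge_dom e) (\<lambda>t. v (edge_param e t))"
  show "edge_H1 v e'" if "e' \<in> {e}" for e' using that H edge_H1_iff[OF assms, of v] by (simp add: eq)
  show "(edge_energy v has_sum interval_energy (edge_dom e) (\<lambda>t. v (edge_param e t))) {e}"
    using has_sum_finite[of "{e}" "edge_energy v"] by (simp add: edge_energy_eq eq)
  show "(edge_Lp p v has_sum interval_Lp (edge_dom e) p (\<lambda>t. v (edge_param e t))) {e}" for p
    using has_sum_finite[of "{e}" "edge_Lp p v"] by (simp add: edge_Lp_eq eq)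
qed

section \<open>Arc length parametrization of a chain\<close>

locale chain_line =
  fixes N :: enat and x :: "nat \<Rightarrow> real^2" and e :: "nat \<Rightarrow> edge"
  assumes N0: "enat 0 < N"
    and seg: "\<And>i. enat (Suc i) < N \<Longrightarrow> x i \<noteq> x (Suc i) \<and> (e i = Segment (x i) (x (Suc i)) \<or> e i = Segment (x (Suc i)) (x i))"
    and last: "\<And>i. enat i < N \<Longrightarrow> \<not> enat (Suc i) < N \<Longrightarrow> \<exists>d. norm d = 1 \<and> e i = Half_line (x i) d"
    and unbdd: "\<And>b. N = \<infinity> \<Longrightarrow> \<exists>i. b < (\<Sum>k<i. dist (x k) (x (Suc k)))"
    and inj_x: "inj_on x {i. enat i < N}"
begin

definition a :: "nat \<Rightarrow> real" where "a i = (\<Sum>k<i. dist (x k) (x (Suc k)))"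

definition D :: "nat \<Rightarrow> real set" where "D i = {t. a i \<le> t \<and> (enat (Suc i) < N \<longrightarrow> t \<le> a (Suc i))}"

text \<open>Half-open counterpart of \<open>D i\<close>, empty beyond the end of the chain. This
  gives a disjoint family over all natural numbers that covers the half-line exactly, while
  \<open>D i\<close> is the closed interval on which an edge is parametrized.\<close>

definition A :: "nat \<Rightarrow> real set" where
  "A i = (if enat i < N then {t. a i \<le> t \<and> (enat (Suc i) < N \<longrightarrow> t < a (Suc i))} else {})"

definition I :: "nat set" where "I = {i. enat i < N}"

lemma lessN: "enat j < N \<Longrightarrow> i \<le> j \<Longrightarrow> enat i < N"
  by (meson enat_ord_simps(1) le_less_trans)

lemma a_0: "a 0 = 0" and a_Suc: "a (Suc i) = a i + dist (x i) (x (Suc i))"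
  by (simp_all add: a_def)

lemma a_less: "enat (Suc i) < N \<Longrightarrow> a i < a (Suc i)"
  using seg[of i] by (simp add: a_Suc)

lemma a_mono: "i \<le> j \<Longrightarrow> a i \<le> a j"
  unfolding a_def by (rule sum_mono2) auto

lemma a_nonneg: "0 \<le> a i"
  using a_mono[of 0 i] by (simp add: a_0)

lemma A_sub_D: "A i \<subseteq> D i" and D_minus_A: "enat i < N \<Longrightarrow> t \<in> D i \<Longrightarrow> t \<notin> A i \<Longrightarrow> enat (Suc i) < N \<and> t = a (Suc i)"
  by (auto simp: A_def D_def)

lemma D_sub: "D i \<subseteq> {0..}"
  using a_nonneg[of i] by (auto simp: D_def)

lemma D_eq: "D i = (if enat (Suc i) < N then {a i..a (Suc i)} else {a i..})"
  by (auto simp: D_def)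

lemma A_eq: "A i = (if enat i < N then if enat (Suc i) < N then {a i..<a (Suc i)} else {a i..} else {})"
  by (auto simp: A_def)

lemma A_borel: "A i \<in> sets borel"
  by (simp add: A_eq)

lemma D_props: "is_interval (D i)" "closed (D i)" "D i \<noteq> {}" "D i \<in> sets borel" "a i \<in> D i"
  using a_mono[of i "Suc i"] by (auto simp: D_eq is_interval_cc is_interval_ci)

lemma A_disjoint: "disjoint_family A"
proof -
  have "A i \<inter> A j = {}" if "i < j" for i j
  proof (rule ccontr)
    assume "A i \<inter> A j \<noteq> {}"
    then obtain t where t: "t \<in> A i" "t \<in> A j" by blast
    then have "enat j < N" by (auto simp: A_def split: if_splits)
    then have "enat (Suc i) < N" using that by (auto intro: lessN)
    with t have "t < a (Suc i)" "a j \<le> t" by (auto simp: A_def split: if_splits)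
    then show False using a_mono[of "Suc i" j] that by simp
  qed
  then show ?thesis unfolding disjoint_family_on_def by (metis inf_commute linorder_neqE_nat)
qed

text \<open>The cell of t has the least index i with t < a (Suc i). If there is no such index, the
  chain is finite and t lies in its last, unbounded cell, because the lengths of an infinite chain
  diverge.\<close>

lemma A_cover: "(\<Union>i. A i) = {0..}"
proof
  show "(\<Union>i. A i) \<subseteq> {0..}" using A_sub_D D_sub by blast
  show "{0..} \<subseteq> (\<Union>i. A i)"
  proof
    fix t :: real assume t: "t \<in> {0..}"
    show "t \<in> (\<Union>i. A i)"
    proof (cases "\<exists>i. enat (Suc i) < N \<and> t < a (Suc i)")
      case True
      define i where "i = (LEAST i. enat (Suc i) < N \<and> t < a (Suc i))"
      have i: "enat (Suc i) < N" "t < a (Suc i)" using LeastI_ex[OF True] by (auto simp: i_def)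
      have "a i \<le> t"
      proof (cases i)
        case 0 then show ?thesis using t by (simp add: a_0)
      next
        case (Suc k)
        have "k < i" using Suc by simp
        then have "\<not> (enat (Suc k) < N \<and> t < a (Suc k))" unfolding i_def by (rule not_less_Least)
        then show ?thesis using Suc lessN[OF i(1), of i] by auto
      qed
      then have "t \<in> A i" using i lessN[OF i(1), of i] by (auto simp: A_def)
      then show ?thesis by blast
    next
      case False
      show ?thesis
      proof (cases N)
        case (enat n)
        then obtain m where m: "n = Suc m" using N0 by (cases n) auto
        have "a m \<le> t"
        proof (cases m)
          case 0 then show ?thesis using t by (simp add: a_0)
        next
          case (Suc k) then show ?thesis using False m enat by auto
        qed
        moreover have "enat m < N" "\<not> enat (Suc m) < N" using m enat by auto
        ultimately have "t \<in> A m" unfolding A_def by simp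
        then show ?thesis by blast
      next
        case infinity
        then obtain i where "t < a i" using unbdd[of t] by (auto simp: a_def)
        then show ?thesis using False infinity t by (cases i) (auto simp: a_0)
      qed
    qed
  qed
qed

definition idx :: "real \<Rightarrow> nat" where "idx t = (THE i. t \<in> A i)"

lemma idx_eq: "t \<in> A i \<Longrightarrow> idx t = i"
  unfolding idx_def using A_disjoint by (intro the_equality) (auto simp: disjoint_family_on_def)

definition dir :: "nat \<Rightarrow> real^2" where
  "dir i = (if enat (Suc i) < N then (1 / dist (x i) (x (Suc i))) *\<^sub>R (x (Suc i) - x i) else (SOME d. e i = Half_line (x i) d))"

definition rev :: "nat \<Rightarrow> bool" where "rev i \<longleftrightarrow> enat (Suc i) < N \<and> e i = Segment (x (Suc i)) (x i)"

definition sg :: "nat \<Rightarrow> real" where "sg i = (if rev i then -1 else 1)"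

text \<open>The affine map s = \<open>off i + sg i * t\<close> turns arc length t along the chain
  into the own parameter s of \<open>e i\<close>. Since \<open>sg i\<close> squares to 1, the
  inverse is t = \<open>- sg i * off i + sg i * s\<close>.\<close>

definition off :: "nat \<Rightarrow> real" where "off i = (if rev i then a (Suc i) else - a i)"

definition \<gamma> :: "real \<Rightarrow> real^2" where "\<gamma> t = x (idx t) + (t - a (idx t)) *\<^sub>R dir (idx t)"

lemma sg: "sg i = 1 \<or> sg i = -1" "sg i * (sg i * t) = t"
  by (auto simp: sg_def)

lemma e_last: "enat i < N \<Longrightarrow> \<not> enat (Suc i) < N \<Longrightarrow> e i = Half_line (x i) (dir i) \<and> norm (dir i) = 1"
proof -
  assume i: "enat i < N" "\<not> enat (Suc i) < N"
  obtain d where d: "norm d = 1" "e i = Half_line (x i) d" using last[OF i] by blast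
  then have "dir i = d" using i by (simp add: dir_def)
  then show ?thesis using d by simp
qed

lemma valid_e: "enat i < N \<Longrightarrow> valid_edge (e i)"
  using e_last[of i] seg[of i] by (cases "enat (Suc i) < N") auto

text \<open>The definition of \<open>\<gamma>\<close> refers to the half-open cell of t. The right
  end point of D i belongs to the next cell, but the formula of cell i gives the same vertex x (Suc
  i) there.\<close>

lemma \<gamma>_D: assumes i: "enat i < N" and t: "t \<in> D i" shows "\<gamma> t = x i + (t - a i) *\<^sub>R dir i"
proof (cases "t \<in> A i")
  case True then show ?thesis by (simp add: \<gamma>_def idx_eq)
next
  case False
  then have s: "enat (Suc i) < N" "t = a (Suc i)" using D_minus_A[OF i t] by auto
  have "t \<in> A (Suc i)" using s a_less[of "Suc i"] by (auto simp: A_def)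
  then have "\<gamma> t = x (Suc i)" using s by (simp add: \<gamma>_def idx_eq)
  moreover have "x i + (t - a i) *\<^sub>R dir i = x (Suc i)" using s seg[OF s(1)] by (simp add: a_Suc dir_def)
  ultimately show ?thesis by simp
qed

lemma edge_param_e: assumes i: "enat i < N" shows "edge_param (e i) (off i + sg i * t) = x i + (t - a i) *\<^sub>R dir i"
proof (cases "enat (Suc i) < N")
  case False
  then show ?thesis using e_last[OF i False] by (simp add: off_def sg_def rev_def)
next
  case True
  then have ne: "dist (x i) (x (Suc i)) \<noteq> 0" using seg by simp
  show ?thesis
  proof (cases "rev i")
    case False
    then have "e i = Segment (x i) (x (Suc i))" using seg[OF True] True by (auto simp: rev_def)
    then show ?thesis using True False by (simp add: off_def sg_def dir_def)
  next
    case rv: True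
    then have e: "e i = Segment (x (Suc i)) (x i)" by (simp add: rev_def)
    let ?l = "dist (x i) (x (Suc i))"
    have "edge_param (e i) (off i + sg i * t) = x (Suc i) + ((a i + ?l - t) / ?l) *\<^sub>R (x i - x (Suc i))"
      using rv by (simp add: e off_def sg_def a_Suc dist_commute)
    also have "(a i + ?l - t) / ?l = 1 - (t - a i) / ?l" using ne by (simp add: field_simps)
    also have "x (Suc i) + (1 - (t - a i) / ?l) *\<^sub>R (x i - x (Suc i)) = x i + ((t - a i) / ?l) *\<^sub>R (x (Suc i) - x i)"
      by (simp add: algebra_simps)
    finally show ?thesis using True by (simp add: dir_def)
  qed
qed

lemma
  assumes i: "enat i < N"
  shows edge_dom_e: "edge_dom (e i) = {s. - sg i * off i + sg i * s \<in> D i}"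
    and D_e: "D i = {t. off i + sg i * t \<in> edge_dom (e i)}"
proof -
  show "edge_dom (e i) = {s. - sg i * off i + sg i * s \<in> D i}"
  proof (cases "enat (Suc i) < N")
    case False
    then show ?thesis using e_last[OF i False] by (auto simp: D_def off_def sg_def rev_def)
  next
    case True
    show ?thesis
    proof (cases "rev i")
      case False
      then have "e i = Segment (x i) (x (Suc i))" using seg[OF True] True by (auto simp: rev_def)
      then show ?thesis using True False by (auto simp: D_def off_def sg_def a_Suc)
    next
      case rv: True
      then have e: "e i = Segment (x (Suc i)) (x i)" by (simp add: rev_def)
      show ?thesis using True rv by (auto simp: e D_def off_def sg_def a_Suc dist_commute)
    qed
  qed
  then show "D i = {t. off i + sg i * t \<in> edge_dom (e i)}"
    using sg(2)[of i] sg(1)[of i] by (auto simp: distrib_left)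
qed

lemma on_edge_e:
  assumes i: "enat i < N" and s: "s \<in> edge_dom (e i)"
  shows "on_edge v (e i) s = v (\<gamma> (- sg i * off i + sg i * s))"
proof -
  let ?t = "- sg i * off i + sg i * s"
  have t: "?t \<in> D i" using s unfolding edge_dom_e[OF i] by simp
  have "off i + sg i * ?t = s" using sg(1)[of i] by (auto simp: algebra_simps)
  then have "edge_param (e i) s = edge_param (e i) (off i + sg i * ?t)" by (simp only:)
  also have "\<dots> = \<gamma> ?t" by (simp only: edge_param_e[OF i] \<gamma>_D[OF i t])
  finally show ?thesis by (simp only: on_edge_def o_apply)
qed

lemma on_edge_e': "enat i < N \<Longrightarrow> t \<in> D i \<Longrightarrow> v (\<gamma> t) = on_edge v (e i) (off i + sg i * t)"
  by (simp only: on_edge_def o_apply edge_param_e \<gamma>_D)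

lemma points_e: "(\<Union>f\<in>e ` I. edge_points f) = \<gamma> ` {0..}"
proof -
  have 1: "edge_points (e i) = \<gamma> ` D i" if i: "enat i < N" for i
  proof
    show "edge_points (e i) \<subseteq> \<gamma> ` D i"
    proof
      fix y assume "y \<in> edge_points (e i)"
      then obtain s where s: "s \<in> edge_dom (e i)" "y = edge_param (e i) s" by (auto simp: edge_points_def)
      let ?t = "- sg i * off i + sg i * s"
      have t: "?t \<in> D i" using s(1) unfolding edge_dom_e[OF i] by simp
      have "off i + sg i * ?t = s" using sg(1)[of i] by (auto simp: algebra_simps)
      then have "edge_param (e i) s = edge_param (e i) (off i + sg i * ?t)" by (simp only:)
      also have "\<dots> = \<gamma> ?t" by (simp only: edge_param_e[OF i] \<gamma>_D[OF i t])
      finally have "y = \<gamma> ?t" using s(2) by (simp only:)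
      with t show "y \<in> \<gamma> ` D i" by blast
    qed
    show "\<gamma> ` D i \<subseteq> edge_points (e i)"
    proof
      fix y assume "y \<in> \<gamma> ` D i"
      then obtain t where t: "t \<in> D i" "y = \<gamma> t" by blast
      then have "y = edge_param (e i) (off i + sg i * t)" by (simp only: edge_param_e[OF i] \<gamma>_D[OF i t(1)])
      moreover have "off i + sg i * t \<in> edge_dom (e i)" using t(1) unfolding D_e[OF i] by simp
      ultimately show "y \<in> edge_points (e i)" by (auto simp: edge_points_def)
    qed
  qed
  have "{0..} = (\<Union>i\<in>I. D i)"
  proof
    show "{0..} \<subseteq> (\<Union>i\<in>I. D i)"
    proof
      fix t :: real assume "t \<in> {0..}"
      then obtain i where i: "t \<in> A i" using A_cover by blast
      then have "i \<in> I" by (auto simp: A_def I_def split: if_splits)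
      then show "t \<in> (\<Union>i\<in>I. D i)" using i A_sub_D by blast
    qed
    show "(\<Union>i\<in>I. D i) \<subseteq> {0..}" using D_sub by blast
  qed
  then have "\<gamma> ` {0..} = (\<Union>i\<in>I. \<gamma> ` D i)" by blast
  also have "\<dots> = (\<Union>i\<in>I. edge_points (e i))" using 1 by (simp add: I_def)
  finally show ?thesis by simp
qed

text \<open>If e i = e j with i < j, this edge is bounded, so e j is not the last one and x (Suc j)
  is an end of e i; this contradicts injectivity of the vertices.\<close>

lemma inj_e: "inj_on e I"
proof -
  have ends: "x i \<in> edge_ends (e i)" "edge_ends (e i) \<subseteq> {x i, x (Suc i)}"
    "enat (Suc i) < N \<Longrightarrow> x (Suc i) \<in> edge_ends (e i)" "\<not> enat (Suc i) < N \<Longrightarrow> \<not> bounded_edge (e i)"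
    "enat (Suc i) < N \<Longrightarrow> bounded_edge (e i)" if "enat i < N" for i
    using e_last[OF that] seg[of i] by (cases "enat (Suc i) < N"; auto)+
  have "e i \<noteq> e j" if ij: "i < j" "enat j < N" for i j
  proof
    assume eq: "e i = e j"
    have i: "enat i < N" "enat (Suc i) < N" using ij by (auto intro: lessN)
    have "enat (Suc j) < N" using ends(4)[OF ij(2)] ends(5)[OF i] eq by auto
    then have "x (Suc j) \<in> edge_ends (e i)" using ends(3)[OF ij(2)] eq by simp
    then have "x (Suc j) = x i \<or> x (Suc j) = x (Suc i)" using ends(2)[OF i(1)] by blast
    then have "Suc j = i \<or> Suc j = Suc i"
      using inj_onD[OF inj_x, of "Suc j" i] inj_onD[OF inj_x, of "Suc j" "Suc i"] i \<open>enat (Suc j) < N\<close> by blast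
    then show False using ij by simp
  qed
  then show ?thesis unfolding inj_on_def I_def by (metis linorder_neqE_nat mem_Collect_eq)
qed

lemma set_integral_D_A:
  assumes i: "enat i < N" and F: "set_integrable lborel (D i) F"
  shows "(LINT t:D i|lborel. F t) = (LINT t:A i|lborel. (F t :: real))"
  unfolding set_lebesgue_integral_def
proof (rule integral_cong_AE)
  show "(\<lambda>t. indicat_real (D i) t *\<^sub>R F t) \<in> borel_measurable lborel" using F by (auto simp: set_integrable_def)
  have "set_integrable lborel (A i) F" by (rule set_integrable_subset[OF F _ A_sub_D]) (simp add: A_borel)
  then show "(\<lambda>t. indicat_real (A i) t *\<^sub>R F t) \<in> borel_measurable lborel" by (auto simp: set_integrable_def)
  show "AE t in lborel. indicat_real (D i) t *\<^sub>R F t = indicat_real (A i) t *\<^sub>R F t"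
    using AE_lborel_singleton[of "a (Suc i)"]
    by eventually_elim (use D_minus_A[OF i] A_sub_D in \<open>auto simp: indicator_def\<close>)
qed

text \<open>Cells beyond the end of the chain are empty and contribute 0, and closing a cell adds at
  most a point. Injectivity of e permits the reindexing from indices to edges.\<close>

lemma has_sum_pieces:
  assumes F: "set_integrable lborel {0..} F" "\<And>t. 0 \<le> F t"
    and q: "\<And>i. enat i < N \<Longrightarrow> q (e i) = (LINT t:D i|lborel. (F t :: real))"
  shows "(q has_sum (LINT t:{0..}|lborel. F t)) (e ` I)"
proof -
  have "((\<lambda>i. LINT t:A i|lborel. F t) has_sum (LINT t:(\<Union>i. A i)|lborel. F t)) UNIV"
    by (rule has_sum_set_integral_countable[OF A_borel A_disjoint _ F(2)]) (simp add: A_cover F(1))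
  then have "((q \<circ> e) has_sum (LINT t:{0..}|lborel. F t)) I"
    unfolding A_cover
  proof (rule has_sum_cong_neutral[THEN iffD1, rotated -1])
    fix i assume "i \<in> UNIV \<inter> I"
    then have i: "enat i < N" by (simp add: I_def)
    have "set_integrable lborel (D i) F" by (rule set_integrable_subset[OF F(1) _ D_sub]) (simp add: D_props)
    then show "(LINT t:A i|lborel. F t) = (q \<circ> e) i" using q[OF i] set_integral_D_A[OF i] by simp
  qed (auto simp: I_def A_def set_lebesgue_integral_def)
  then show ?thesis using has_sum_reindex[OF inj_e] by blast
qed

lemma restrict_to_edge:
  assumes h: "H1_cont {0..} (\<lambda>t. v (\<gamma> t))" and i: "enat i < N"
  shows "H1_cont (edge_dom (e i)) (on_edge v (e i))"
    and "interval_energy (edge_dom (e i)) (on_edge v (e i)) = interval_energy (D i) (\<lambda>t. v (\<gamma> t))"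
    and "interval_Lp (edge_dom (e i)) p (on_edge v (e i)) = interval_Lp (D i) p (\<lambda>t. v (\<gamma> t))"
proof -
  let ?h = "\<lambda>t. v (\<gamma> t)" and ?\<tau> = "\<lambda>s. - sg i * off i + sg i * s"
  note dm = edge_dom_props[of "e i"]
  have "H1_pair {0..} ?h (weak_deriv {0..} ?h)" by (rule H1_cont_imp_pair[OF h]) (simp add: is_interval_ci)
  then have P: "H1_pair (D i) ?h (weak_deriv {0..} ?h)" by (rule H1_pair_subset[OF _ D_sub D_props(4)])
  have P': "H1_pair (edge_dom (e i)) (\<lambda>s. ?h (?\<tau> s)) (\<lambda>s. sg i * weak_deriv {0..} ?h (?\<tau> s))"
    using H1_pair_isometry[OF sg(1)[of i] P, of "- sg i * off i"] unfolding edge_dom_e[OF i] .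
  have P'': "H1_pair (edge_dom (e i)) (on_edge v (e i)) (\<lambda>s. sg i * weak_deriv {0..} ?h (?\<tau> s))"
    by (rule H1_pair_cong[OF P' _ _ dm(1)]) (use on_edge_e[OF i] in auto)
  show "H1_cont (edge_dom (e i)) (on_edge v (e i))" by (rule H1_pair_imp_cont[OF P'' dm(1,3)])
  have "interval_energy (edge_dom (e i)) (on_edge v (e i)) = interval_energy (edge_dom (e i)) (\<lambda>s. ?h (?\<tau> s))"
    unfolding interval_energy_eq(1)[OF P' dm(1-3)] interval_energy_eq(1)[OF P'' dm(1-3)]
    using on_edge_e[OF i] dm(4) by (auto intro!: set_lebesgue_integral_cong)
  also have "\<dots> = interval_energy (D i) ?h"
    by (rule interval_energy_isometry[OF sg(1) P D_props(1-3) edge_dom_e[OF i]])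
  finally show "interval_energy (edge_dom (e i)) (on_edge v (e i)) = interval_energy (D i) ?h" .
  have "interval_Lp (edge_dom (e i)) p (on_edge v (e i)) = (LINT s:edge_dom (e i)|lborel. \<bar>?h (?\<tau> s)\<bar> powr p)"
    unfolding interval_Lp_def by (rule set_lebesgue_integral_cong) (use on_edge_e[OF i] dm(4) in auto)
  also have "\<dots> = interval_Lp (D i) p ?h"
    unfolding interval_Lp_def edge_dom_e[OF i] by (rule set_integral_isometry[OF sg(1)])
  finally show "interval_Lp (edge_dom (e i)) p (on_edge v (e i)) = interval_Lp (D i) p ?h" .
qed

lemma energy_has_sum:
  assumes h: "H1_cont {0..} (\<lambda>t. v (\<gamma> t))"
  shows "(edge_energy v has_sum interval_energy {0..} (\<lambda>t. v (\<gamma> t))) (e ` I)"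
proof -
  let ?h = "\<lambda>t. v (\<gamma> t)"
  define g where "g = weak_deriv {0..} ?h"
  have P: "H1_pair {0..} ?h g" unfolding g_def by (rule H1_cont_imp_pair[OF h]) (simp add: is_interval_ci)
  have I0: "is_interval {0::real..}" "closed {0::real..}" "{0::real..} \<noteq> {}" by (auto simp: is_interval_ci)
  note E = interval_energy_eq[OF P I0]
  have "set_integrable lborel {0..} (\<lambda>t. (g t)\<^sup>2 + (?h t)\<^sup>2)" by (rule set_integral_add(1)[OF E(2,3)])
  then have "(edge_energy v has_sum (LINT t:{0..}|lborel. (g t)\<^sup>2 + (?h t)\<^sup>2)) (e ` I)"
  proof (rule has_sum_pieces)
    fix i assume i: "enat i < N"
    have PD: "H1_pair (D i) ?h g" by (rule H1_pair_subset[OF P D_sub D_props(4)])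
    note ED = interval_energy_eq[OF PD D_props(1-3)]
    have "edge_energy v (e i) = interval_energy (D i) ?h"
      using restrict_to_edge(2)[OF h i] by (simp add: edge_energy_eq)
    then show "edge_energy v (e i) = (LINT t:D i|lborel. (g t)\<^sup>2 + (?h t)\<^sup>2)"
      using ED(1) set_integral_add(2)[OF ED(2,3)] by simp
  qed simp
  then show ?thesis using E(1) set_integral_add(2)[OF E(2,3)] by simp
qed

lemma Lp_has_sum:
  assumes h: "H1_cont {0..} (\<lambda>t. v (\<gamma> t))" and p: "p > 2"
  shows "(edge_Lp p v has_sum interval_Lp {0..} p (\<lambda>t. v (\<gamma> t))) (e ` I)"
proof -
  let ?h = "\<lambda>t. v (\<gamma> t)"
  define g where "g = weak_deriv {0..} ?h"
  have P: "H1_pair {0..} ?h g" unfolding g_def by (rule H1_cont_imp_pair[OF h]) (simp add: is_interval_ci)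
  have "set_integrable lborel {0..} (\<lambda>t. \<bar>?h t\<bar> powr p)"
  proof (rule powr_integrable(1)[OF _ _ _ p])
    show "square_integrable {0..} ?h" using P by (simp add: H1_pair_def)
    fix t :: real assume "t \<in> {0..}"
    then have "(?h t)\<^sup>2 \<le> (2 / 1 + 2 * 1) * interval_energy {0..} ?h"
      by (intro H1_pair_sup_bound[OF P, of 1 t]) (auto simp: is_interval_ci)
    then show "\<bar>?h t\<bar> \<le> sqrt ((2 / 1 + 2 * 1) * interval_energy {0..} ?h)" by (simp add: real_le_rsqrt)
  qed simp
  then show ?thesis
    unfolding interval_Lp_def
  proof (rule has_sum_pieces)
    fix i assume i: "enat i < N"
    show "edge_Lp p v (e i) = (LINT t:D i|lborel. \<bar>?h t\<bar> powr p)"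
      using restrict_to_edge(3)[OF h i, of p] by (simp add: edge_Lp_eq interval_Lp_def)
  qed simp
qed

text \<open>Each edge function is pulled back to its interval of arc length. Values agree at
  vertices since v is one function on the plane, so finite gluing gives the fundamental theorem;
  summability of the energies gives square integrability on the whole half-line.\<close>

lemma glue_edges:
  assumes v: "\<And>f. f \<in> e ` I \<Longrightarrow> edge_H1 v f" and s: "edge_energy v summable_on e ` I"
  shows "H1_cont {0..} (\<lambda>t. v (\<gamma> t))"
proof -
  let ?h = "\<lambda>t. v (\<gamma> t)"
  have "\<exists>g. H1_pair (D i) ?h g \<and> interval_energy (D i) ?h = edge_energy v (e i)" if i: "enat i < N" for i
  proof -
    let ?f = "on_edge v (e i)" and ?\<tau> = "\<lambda>t. off i + sg i * t"
    note dm = edge_dom_props[of "e i"]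
    have "edge_H1 v (e i)" using v i by (auto simp: I_def)
    then have "H1_cont (edge_dom (e i)) ?f" using edge_H1_iff[OF valid_e[OF i]] by simp
    then have P: "H1_pair (edge_dom (e i)) ?f (weak_deriv (edge_dom (e i)) ?f)" by (rule H1_cont_imp_pair[OF _ dm(1)])
    have P': "H1_pair (D i) (\<lambda>t. ?f (?\<tau> t)) (\<lambda>t. sg i * weak_deriv (edge_dom (e i)) ?f (?\<tau> t))"
      using H1_pair_isometry[OF sg(1)[of i] P, of "off i"] unfolding D_e[OF i, symmetric] .
    have P'': "H1_pair (D i) ?h (\<lambda>t. sg i * weak_deriv (edge_dom (e i)) ?f (?\<tau> t))"
      by (rule H1_pair_cong[OF P' _ _ D_props(1)]) (use on_edge_e'[OF i] in auto)
    have "interval_energy (D i) ?h = interval_energy (D i) (\<lambda>t. ?f (?\<tau> t))"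
      unfolding interval_energy_eq(1)[OF P' D_props(1-3)] interval_energy_eq(1)[OF P'' D_props(1-3)]
      using on_edge_e'[OF i] D_props(4) by (auto intro!: set_lebesgue_integral_cong)
    also have "\<dots> = interval_energy (edge_dom (e i)) ?f"
      by (rule interval_energy_isometry[OF sg(1) P dm(1-3) D_e[OF i]])
    finally show ?thesis using P'' by (auto simp: edge_energy_eq)
  qed
  then obtain G where G: "\<And>i. enat i < N \<Longrightarrow> H1_pair (D i) ?h (G i)"
    "\<And>i. enat i < N \<Longrightarrow> interval_energy (D i) ?h = edge_energy v (e i)" by metis
  \<comment> \<open>At a vertex this takes the derivative on the following edge; on D i it differs
    from \<open>G i\<close> at most at the right end point.\<close>
  define g where "g t = G (idx t) t" for t
  have gA: "g t = G i t" if "t \<in> A i" for i t using that by (simp add: g_def idx_eq)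
  have P: "H1_pair (D i) ?h g" if i: "enat i < N" for i
  proof (rule H1_pair_cong_AE[OF G(1)[OF i] _ _ D_props(1)])
    show "AE t in lborel. t \<in> D i \<longrightarrow> G i t = g t"
      using AE_lborel_singleton[of "a (Suc i)"]
    proof eventually_elim
      case (elim t)
      show ?case
      proof
        assume "t \<in> D i"
        then have "t \<in> A i" using D_minus_A[OF i, of t] elim by blast
        from gA[OF this] show "G i t = g t" by (rule sym)
      qed
    qed
    have m: "(\<lambda>t. indicat_real (D i) t *\<^sub>R G i t) \<in> borel_measurable borel"
      using G(1)[OF i] by (simp add: H1_pair_def square_integrable_def set_borel_measurable_def)
    \<comment> \<open>Replacing the single value at the right end point of D i keeps Borel
      measurability.\<close>
    define c where "c = indicat_real (D i) (a (Suc i)) *\<^sub>R g (a (Suc i))"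
    have "(\<lambda>t. if t = a (Suc i) then c else indicat_real (D i) t *\<^sub>R G i t) \<in> borel_measurable borel"
      using m by measurable
    moreover have "(if t = a (Suc i) then c else indicat_real (D i) t *\<^sub>R G i t) = indicat_real (D i) t *\<^sub>R g t" for t
      using D_minus_A[OF i, of t] gA[of t i] by (cases "t \<in> D i"; cases "t \<in> A i") (auto simp: c_def)
    ultimately show "set_borel_measurable lborel (D i) g" by (simp add: set_borel_measurable_def)
  qed
  \<comment> \<open>A majorant for the integrals of both squares over cell i; the value 0 off the
    chain turns the sum over edges into a series over all natural numbers.\<close>
  define q where "q i = (if i \<in> I then edge_energy v (e i) else 0)" for i
  have q0: "0 \<le> q i" for i by (simp add: q_def edge_energy_eq interval_energy_nonneg)
  have "(edge_energy v \<circ> e) summable_on I" using s summable_on_reindex[OF inj_e] by blast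
  then have "q summable_on UNIV"
    by (rule summable_on_cong_neutral[THEN iffD1, rotated -1]) (auto simp: q_def)
  then have sq: "summable q" using summable_on_UNIV_nonneg_real_iff[of q] q0 by simp
  have sqA: "square_integrable {0..} f"
    if sqD: "\<And>i. enat i < N \<Longrightarrow> square_integrable (D i) f" and le: "\<And>i. enat i < N \<Longrightarrow> (LINT t:D i|lborel. (f t)\<^sup>2) \<le> q i" for f
  proof -
    have A: "square_integrable (A i) f" for i
    proof (cases "enat i < N")
      case True then show ?thesis using square_integrable_subset[OF sqD A_borel A_sub_D] by blast
    next
      case False
      then have "A i = {}" by (simp add: A_def)
      then show ?thesis by (simp add: square_integrable_def set_borel_measurable_def)
    qed
    have "set_borel_measurable lborel (\<Union>i. A i) f"
      by (rule set_borel_measurable_UN[OF A_borel]) (use A in \<open>simp add: square_integrable_def\<close>)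
    moreover have "set_integrable lborel (\<Union>i. A i) (\<lambda>t. (f t)\<^sup>2)"
    proof (rule set_integrable_countable_UN[OF A_borel A_disjoint])
      show "set_integrable lborel (A i) (\<lambda>t. (f t)\<^sup>2)" for i using A[of i] by (simp add: square_integrable_def)
      show "summable (\<lambda>i. LINT t:A i|lborel. (f t)\<^sup>2)"
      proof (rule summable_comparison_test'[OF sq, of 0])
        fix i
        have nn: "0 \<le> (LINT t:A i|lborel. (f t)\<^sup>2)" by (rule set_integral_nonneg_real) simp
        have "(LINT t:A i|lborel. (f t)\<^sup>2) \<le> q i"
        proof (cases "enat i < N")
          case True
          then show ?thesis using le[OF True] set_integral_D_A[OF True] sqD[OF True] by (simp add: square_integrable_def)
        next
          case False
          then have "A i = {}" by (simp add: A_def)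
          then show ?thesis using q0[of i] by (simp add: set_lebesgue_integral_def)
        qed
        with nn show "norm (LINT t:A i|lborel. (f t)\<^sup>2) \<le> q i" by simp
      qed
    qed simp
    ultimately show ?thesis by (simp add: square_integrable_def A_cover)
  qed
  have qE: "interval_energy (D i) ?h = q i" if "enat i < N" for i using G(2)[OF that] that by (simp add: q_def I_def)
  have sqh: "square_integrable {0..} ?h"
    by (rule sqA) (use P H1_pair_sq_integrals_le(2)[OF P D_props(1-3)] qE in \<open>auto simp: H1_pair_def\<close>)
  have sqg: "square_integrable {0..} g"
    by (rule sqA) (use P H1_pair_sq_integrals_le(1)[OF P D_props(1-3)] qE in \<open>auto simp: H1_pair_def\<close>)
  \<comment> \<open>Any two points of the half-line lie in one of these initial segments, so no
    limit of gluings is ever needed.\<close>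
  have U: "enat i < N \<Longrightarrow> H1_pair ({0..a i} \<union> D i) ?h g \<and> is_interval ({0..a i} \<union> D i)" for i
  proof (induction i)
    case 0
    have "{0..a 0} \<union> D 0 = D 0" using D_props(5)[of 0] by (auto simp: a_0)
    then show ?case using P[OF 0] D_props(1)[of 0] by simp
  next
    case (Suc i)
    have i: "enat i < N" using Suc.prems by (rule lessN) simp
    have eq: "{0..a i} \<union> D i = {0..a (Suc i)}"
      using Suc.prems a_less[OF Suc.prems] a_nonneg[of i] by (auto simp: D_eq)
    have "H1_pair ({0..a (Suc i)} \<union> D (Suc i)) ?h g"
      by (rule H1_pair_glue[OF _ _ P[OF Suc.prems] D_props(1), of _ "a (Suc i)"])
        (use Suc.IH[OF i] eq D_props(5)[of "Suc i"] a_nonneg[of "Suc i"] in \<open>auto simp: is_interval_cc D_def\<close>)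
    moreover have "is_interval ({0..a (Suc i)} \<union> D (Suc i))"
    proof (cases "enat (Suc (Suc i)) < N")
      case True
      then have "{0..a (Suc i)} \<union> D (Suc i) = {0..a (Suc (Suc i))}"
        using a_less[OF True] a_nonneg[of "Suc i"] by (auto simp: D_eq)
      then show ?thesis by (simp add: is_interval_cc)
    next
      case False
      then have "{0..a (Suc i)} \<union> D (Suc i) = {0..}" using a_nonneg[of "Suc i"] by (auto simp: D_eq)
      then show ?thesis by (simp add: is_interval_ci)
    qed
    ultimately show ?case by blast
  qed
  have "H1_pair {0..} ?h g"
    unfolding H1_pair_def
  proof (intro conjI ballI impI sqh sqg)
    fix s t :: real assume st: "s \<in> {0..}" "t \<in> {0..}" "s \<le> t"
    obtain i where i: "t \<in> A i" using st A_cover by blast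
    then have iN: "enat i < N" by (auto simp: A_def split: if_splits)
    have t: "t \<in> {0..a i} \<union> D i" using i A_sub_D by blast
    have s: "s \<in> {0..a i} \<union> D i" using st t by (auto simp: D_def)
    show "v (\<gamma> t) - v (\<gamma> s) = (LINT u:{s..t}|lborel. g u)"
      using U[OF iN] s t st(3) unfolding H1_pair_def by blast
  qed
  then show ?thesis by (rule H1_pair_imp_cont) (auto simp: is_interval_ci)
qed

lemma piece_chain: "piece (e ` I) \<gamma> {0..}"
  unfolding piece_def
proof (intro conjI allI impI)
  show "{0..} = {0::real..} \<or> (\<exists>L>0. {0..} = {0..L})" by simp
  show "(\<Union>f\<in>e ` I. edge_points f) = \<gamma> ` {0..}" by (rule points_e)
  show "H1_cont {0..} (\<lambda>t. v (\<gamma> t))" if "(\<forall>f\<in>e ` I. edge_H1 v f) \<and> edge_energy v summable_on e ` I" for v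
    by (rule glue_edges) (use that in auto)
  fix v assume h: "H1_cont {0..} (\<lambda>t. v (\<gamma> t))"
  show "\<forall>f\<in>e ` I. edge_H1 v f"
    using restrict_to_edge(1)[OF h] edge_H1_iff[OF valid_e] by (auto simp: I_def)
  show "(edge_energy v has_sum interval_energy {0..} (\<lambda>t. v (\<gamma> t))) (e ` I)" by (rule energy_has_sum[OF h])
  show "(edge_Lp p v has_sum interval_Lp {0..} p (\<lambda>t. v (\<gamma> t))) (e ` I)" if "p > 2" for p by (rule Lp_has_sum[OF h that])
qed

lemma dir_norm: "enat i < N \<Longrightarrow> norm (dir i) = 1"
  using e_last[of i] seg[of i] by (cases "enat (Suc i) < N") (auto simp: dir_def dist_norm norm_minus_commute)

lemma edge_ends_e: "enat i < N \<Longrightarrow> edge_ends (e i) = (if enat (Suc i) < N then {x i, x (Suc i)} else {x i})"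
  using e_last[of i] seg[of i] by (cases "enat (Suc i) < N") auto

lemma \<gamma>_in_edge:
  assumes i: "enat i < N" and t: "t \<in> D i" shows "\<gamma> t \<in> edge_points (e i)"
proof -
  have "off i + sg i * t \<in> edge_dom (e i)" using t unfolding D_e[OF i] by simp
  moreover have "\<gamma> t = edge_param (e i) (off i + sg i * t)" by (simp only: edge_param_e[OF i] \<gamma>_D[OF i t])
  ultimately show ?thesis by (auto simp: edge_points_def)
qed

text \<open>A half-open cell contains its left vertex but not its right one.\<close>

lemma \<gamma>_end:
  assumes t: "t \<in> A i" and y: "\<gamma> t \<in> edge_ends (e i)" shows "t = a i" "\<gamma> t = x i"
proof -
  have i: "enat i < N" using t by (auto simp: A_def split: if_splits)
  have g: "\<gamma> t = x i + (t - a i) *\<^sub>R dir i" by (rule \<gamma>_D[OF i]) (use t A_sub_D in blast)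
  have d: "dir i \<noteq> 0" using dir_norm[OF i] by auto
  have "\<gamma> t \<noteq> x (Suc i)" if s: "enat (Suc i) < N"
  proof
    assume "\<gamma> t = x (Suc i)"
    moreover have "a (Suc i) \<in> D i" using a_mono[of i "Suc i"] by (auto simp: D_def)
    then have "\<gamma> (a (Suc i)) = x i + (a (Suc i) - a i) *\<^sub>R dir i" by (rule \<gamma>_D[OF i])
    moreover have "\<gamma> (a (Suc i)) = x (Suc i)"
      using \<gamma>_D[OF s D_props(5)] by simp
    ultimately have "(t - a i) *\<^sub>R dir i = (a (Suc i) - a i) *\<^sub>R dir i" using g by simp
    then have "t = a (Suc i)" using d by simp
    then show False using t s by (auto simp: A_def split: if_splits)
  qed
  then show "\<gamma> t = x i" using y edge_ends_e[OF i] by (auto split: if_splits)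
  then show "t = a i" using g d by simp
qed

context
  fixes G :: pgraph
  assumes planar: "planar_metric_graph G" and edges_e: "\<And>i. enat i < N \<Longrightarrow> e i \<in> edges G"
    and inner: "\<And>i f. 0 < i \<Longrightarrow> enat i < N \<Longrightarrow> f \<in> edges G \<Longrightarrow> x i \<in> edge_ends f \<Longrightarrow> f \<in> e ` I"
begin

text \<open>Distinct edges of the graph meet only at common ends, and the only end of e i seen by
  the half-open cell is x i.\<close>

lemma common_point:
  assumes "t \<in> A i" "f \<in> edges G" "f \<noteq> e i" "\<gamma> t \<in> edge_points f"
  shows "t = a i" "\<gamma> t = x i" "x i \<in> edge_ends f"
proof -
  have i: "enat i < N" using assms(1) by (auto simp: A_def split: if_splits)
  have "\<gamma> t \<in> edge_points (e i)" by (rule \<gamma>_in_edge[OF i]) (use assms(1) A_sub_D in blast)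
  then have "\<gamma> t \<in> edge_ends (e i) \<inter> edge_ends f"
    using planar edges_e[OF i] assms unfolding planar_metric_graph_def by blast
  then show "t = a i" "\<gamma> t = x i" "x i \<in> edge_ends f" using \<gamma>_end[OF assms(1)] by auto
qed

text \<open>Within one cell the parametrization is affine with nonzero direction. A point shared by
  two cells would be the left vertex of both, contrary to injectivity of the vertices.\<close>

lemma \<gamma>_inj:
  assumes "s \<ge> 0" "t \<ge> 0" "\<gamma> s = \<gamma> t" shows "s = t"
proof -
  obtain i j where ij: "s \<in> A i" "t \<in> A j" using assms A_cover by (metis UN_E atLeast_iff)
  then have N: "enat i < N" "enat j < N" by (auto simp: A_def split: if_splits)
  have D: "s \<in> D i" "t \<in> D j" using ij A_sub_D by blast+
  show ?thesis
  proof (cases "i = j")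
    case True
    then have "\<gamma> t = x i + (t - a i) *\<^sub>R dir i" using \<gamma>_D[OF N(2) D(2)] by blast
    then have "x i + (s - a i) *\<^sub>R dir i = x i + (t - a i) *\<^sub>R dir i"
      using \<gamma>_D[OF N(1) D(1)] assms(3) by metis
    then have "(s - a i) *\<^sub>R dir i = (t - a i) *\<^sub>R dir i" by simp
    moreover have "dir i \<noteq> 0" using dir_norm[OF N(1)] by auto
    ultimately show ?thesis by simp
  next
    case False
    then have ne: "e i \<noteq> e j" using inj_e N by (auto simp: inj_on_def I_def)
    have "\<gamma> s \<in> edge_points (e j)" "\<gamma> t \<in> edge_points (e i)"
      using \<gamma>_in_edge[OF N(2) D(2)] \<gamma>_in_edge[OF N(1) D(1)] assms(3) by simp_all
    then have s: "\<gamma> s = x i" using common_point(2)[OF ij(1) edges_e[OF N(2)] ne[symmetric]] by blast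
    have "\<gamma> t = x j" by (rule common_point(2)[OF ij(2) edges_e[OF N(1)] ne]) fact
    then have "x i = x j" using s assms(3) by metis
    then have "i = j" by (rule inj_onD[OF inj_x]) (use N in simp_all)
    then show ?thesis using False by simp
  qed
qed

text \<open>Foreign edges can meet the chain only at a vertex, and t > 0 excludes x 0, the one
  vertex where they may be attached.\<close>

lemma \<gamma>_isolated:
  assumes t: "t > 0" and f: "f \<in> edges G" "\<gamma> t \<in> edge_points f" shows "f \<in> e ` I"
proof -
  obtain i where i: "t \<in> A i" using t A_cover by (metis UN_E atLeast_iff less_imp_le)
  then have N: "enat i < N" by (auto simp: A_def split: if_splits)
  show ?thesis
  proof (cases "f = e i")
    case True then show ?thesis using N by (auto simp: I_def)
  next
    case False
    note c = common_point[OF i f(1) False f(2)]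
    have "i > 0" using c(1) t by (cases i) (auto simp: a_0)
    then show ?thesis using inner[OF _ N f(1) c(3)] by blast
  qed
qed

text \<open>An end of an edge at positive arc length is a vertex x (Suc k), which belongs to the two
  distinct edges e k and e (Suc k).\<close>

lemma \<gamma>_not_outer:
  assumes t: "t > 0" shows "\<not> outer_vertex G (\<gamma> t)"
proof
  assume out: "outer_vertex G (\<gamma> t)"
  then obtain f where f: "f \<in> edges G" "\<gamma> t \<in> edge_ends f"
    and uniq: "\<And>f'. f' \<in> edges G \<Longrightarrow> \<gamma> t \<in> edge_ends f' \<Longrightarrow> f' = f"
    unfolding outer_vertex_def by blast
  have "valid_edge f" using planar f by (auto simp: planar_metric_graph_def)
  then have fp: "\<gamma> t \<in> edge_points f"
  proof (cases f)
    case (Segment p q)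
    have "p \<noteq> q" using \<open>valid_edge f\<close> Segment by simp
    then have "edge_param f 0 = p" "edge_param f (dist p q) = q" by (simp_all add: Segment)
    moreover have "0 \<in> edge_dom f" "dist p q \<in> edge_dom f" by (simp_all add: Segment)
    ultimately have "p \<in> edge_points f" "q \<in> edge_points f" unfolding edge_points_def by (metis imageI)+
    moreover have "\<gamma> t = p \<or> \<gamma> t = q" using f(2) Segment by simp
    ultimately show ?thesis by metis
  next
    case (Half_line p d)
    then have "p = edge_param f 0" "0 \<in> edge_dom f" by auto
    then show ?thesis using f(2) Half_line unfolding edge_points_def by auto
  qed
  obtain i where i: "t \<in> A i" using t A_cover by (metis UN_E atLeast_iff less_imp_le)
  then have N: "enat i < N" by (auto simp: A_def split: if_splits)
  have c: "t = a i \<and> \<gamma> t = x i"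
  proof (cases "f = e i")
    case True then show ?thesis using \<gamma>_end[OF i] f(2) by simp
  next
    case False then show ?thesis using common_point[OF i f(1) False fp] by simp
  qed
  then obtain k where k: "i = Suc k" using t by (cases i) (auto simp: a_0)
  have Nk: "enat k < N" using N k by (auto intro: lessN)
  have "\<gamma> t \<in> edge_ends (e k)" "\<gamma> t \<in> edge_ends (e i)"
    using edge_ends_e[OF Nk] edge_ends_e[OF N] c k N by auto
  then have "e k = e i" using uniq[OF edges_e[OF Nk]] uniq[OF edges_e[OF N]] by simp
  then have "k = i" by (rule inj_onD[OF inj_e]) (use N Nk in \<open>simp_all add: I_def\<close>)
  then show False using k by simp
qed

end

end

text \<open>Infinite length is what decides the shape: a finite chain ending in a segment has finite
  length, and bounded partial sums of an infinite chain would bound its length.\<close>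

lemma half_line_chain_imp_chain_line:
  assumes c: "half_line_chain G N x e" and G: "planar_metric_graph G"
  shows "chain_line N x e"
proof
  have ch: "\<And>i. enat i < N \<Longrightarrow> e i \<in> edges G \<and> x i \<in> edge_ends (e i)"
    "\<And>i. enat (Suc i) < N \<Longrightarrow> edge_ends (e i) = {x i, x (Suc i)}"
    and inj: "inj_on x {i. enat i < N}" and inf: "(\<Sum>\<^sub>\<infinity>i\<in>{i. enat i < N}. edge_length (e i)) = \<infinity>"
    using c by (auto simp: half_line_chain_def chain_def)
  have le: "enat i < N" if "enat (Suc i) < N" for i using that by (meson enat_ord_simps(2) lessI less_trans)
  have seg: "x i \<noteq> x (Suc i) \<and> (e i = Segment (x i) (x (Suc i)) \<or> e i = Segment (x (Suc i)) (x i))"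
    if i: "enat (Suc i) < N" for i
  proof -
    have ne: "x i \<noteq> x (Suc i)" using inj_onD[OF inj, of i "Suc i"] i le[OF i] by auto
    then show ?thesis using ch(2)[OF i] by (cases "e i") (auto simp: doubleton_eq_iff)
  qed
  show "inj_on x {i. enat i < N}" by (rule inj)
  show "enat 0 < N"
  proof (rule ccontr)
    assume "\<not> enat 0 < N"
    then have "N = 0" by (simp add: zero_enat_def[symmetric])
    then have "{i. enat i < N} = {}" by auto
    then show False using inf by simp
  qed
  show "x i \<noteq> x (Suc i) \<and> (e i = Segment (x i) (x (Suc i)) \<or> e i = Segment (x (Suc i)) (x i))" if "enat (Suc i) < N" for i
    by (rule seg[OF that])
  show "\<exists>d. norm d = 1 \<and> e i = Half_line (x i) d" if i: "enat i < N" "\<not> enat (Suc i) < N" for i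
  proof (cases "e i")
    case (Half_line p d)
    then show ?thesis using ch(1)[OF i(1)] G by (auto simp: planar_metric_graph_def)
  next
    case (Segment p q)
    have N: "N = enat (Suc i)" using i by (cases N) auto
    then have set: "{k. enat k < N} = {..i}" by (auto simp: less_Suc_eq_le)
    have "edge_length (e k) < \<infinity>" if "k \<le> i" for k
      using seg[of k] Segment that N by (cases "k = i") auto
    then have "(\<Sum>k\<le>i. edge_length (e k)) \<noteq> \<infinity>" by (auto simp: less_top[symmetric])
    moreover have "(\<Sum>\<^sub>\<infinity>k\<in>{k. enat k < N}. edge_length (e k)) = (\<Sum>k\<le>i. edge_length (e k))"
      unfolding set by (rule infsum_finite) simp
    ultimately show ?thesis using inf by argo
  qed
  show "\<exists>i. b < (\<Sum>k<i. dist (x k) (x (Suc k)))" if N: "N = \<infinity>" for b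
  proof (rule ccontr)
    assume "\<not> ?thesis"
    then have b: "(\<Sum>k<i. dist (x k) (x (Suc k))) \<le> b" for i by (auto simp: not_less)
    have len: "edge_length (e i) = ennreal (dist (x i) (x (Suc i)))" for i
      using seg[of i] N by (auto simp: dist_commute)
    have "(\<Sum>\<^sub>\<infinity>i\<in>{i. enat i < N}. edge_length (e i)) \<le> ennreal b"
    proof (rule infsum_le_finite_sums)
      show "(\<lambda>i. edge_length (e i)) summable_on {i. enat i < N}" by (rule nonneg_summable_on_complete) simp
      fix F assume F: "finite F" "F \<subseteq> {i. enat i < N}"
      then obtain n where n: "F \<subseteq> {..<n}" using finite_nat_bounded by blast
      have "(\<Sum>i\<in>F. edge_length (e i)) \<le> (\<Sum>i<n. edge_length (e i))" by (rule sum_mono2) (use n in auto)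
      also have "\<dots> = ennreal (\<Sum>i<n. dist (x i) (x (Suc i)))" by (simp add: len)
      also have "\<dots> \<le> ennreal b" by (rule ennreal_leI[OF b])
      finally show "(\<Sum>i\<in>F. edge_length (e i)) \<le> ennreal b" .
    qed
    then show False using inf by (simp add: top_unique)
  qed
qed

section \<open>The Sobolev space of the graph\<close>

lemma has_sum_Union_disjoint:
  fixes f :: "'a \<Rightarrow> real"
  assumes "finite K" "pairwise disjnt K" "\<And>P. P \<in> K \<Longrightarrow> (f has_sum g P) P"
  shows "(f has_sum (\<Sum>P\<in>K. g P)) (\<Union>K)"
  using assms
proof (induction K rule: finite_induct)
  case empty
  then show ?case by simp
next
  case (insert P K)
  have d: "P \<inter> \<Union>K = {}"
    using insert.prems(1) insert.hyps(2) by (auto simp: pairwise_insert disjnt_def)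
  have "(f has_sum (\<Sum>P\<in>K. g P)) (\<Union>K)"
    by (rule insert.IH) (use insert.prems in \<open>auto simp: pairwise_insert\<close>)
  from has_sum_Un_disjoint[OF insert.prems(2)[OF insertI1] this d]
  show ?case using insert.hyps by simp
qed

text \<open>No measurability is assumed: the axioms of \<^locale>\<open>Metric_space\<close> require the symmetry of the distance
  for all functions, including those outside the Sobolev space.\<close>

lemma interval_energy_uminus:
  assumes D: "is_interval D" "closed D" "D \<noteq> {}"
  shows "interval_energy D (\<lambda>t. - f t) = interval_energy D f"
proof -
  have flip: "square_integrable D g \<and> is_weak_deriv D (\<lambda>t. - f t) g \<longleftrightarrow>
      square_integrable D (\<lambda>t. - g t) \<and> is_weak_deriv D f (\<lambda>t. - g t)" for g
  proof -
    have "square_integrable D g \<longleftrightarrow> square_integrable D (\<lambda>t. - g t)"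
      by (simp add: square_integrable_def set_borel_measurable_def)
    moreover have "is_weak_deriv D (\<lambda>t. - f t) g \<longleftrightarrow> is_weak_deriv D f (\<lambda>t. - g t)"
      by (simp add: is_weak_deriv_def set_lebesgue_integral_def)
    ultimately show ?thesis by blast
  qed
  define W where "W = weak_deriv D f"
  define V where "V = weak_deriv D (\<lambda>t. - f t)"
  show ?thesis
  proof (cases "\<exists>g. square_integrable D g \<and> is_weak_deriv D f g")
    case True
    have "square_integrable D W \<and> is_weak_deriv D f W"
      unfolding W_def weak_deriv_def by (rule someI_ex[OF True])
    moreover have "\<exists>g. square_integrable D g \<and> is_weak_deriv D (\<lambda>t. - f t) g"
    proof -
      obtain g where "square_integrable D g \<and> is_weak_deriv D f g" using True by blast
      then show ?thesis using flip[of "\<lambda>t. - g t"] by auto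
    qed
    then have V: "square_integrable D V \<and> is_weak_deriv D (\<lambda>t. - f t) V"
      unfolding V_def weak_deriv_def by (rule someI_ex)
    ultimately have W: "square_integrable D W" "is_weak_deriv D f W"
      and V': "square_integrable D (\<lambda>t. - V t)" "is_weak_deriv D f (\<lambda>t. - V t)"
      using flip[of V] by blast+
    have ae: "AE t in lborel. t \<in> D \<longrightarrow> W t = - V t"
      by (rule weak_deriv_AE_unique[OF D W(1) V'(1) W(2) V'(2)])
    let ?F = "\<lambda>t. indicat_real D t *\<^sub>R ((W t)\<^sup>2 + (f t)\<^sup>2)"
    let ?G = "\<lambda>t. indicat_real D t *\<^sub>R ((V t)\<^sup>2 + (f t)\<^sup>2)"
    have m: "(\<lambda>t. indicat_real D t * (Y t)\<^sup>2) \<in> borel_measurable lborel" if "square_integrable D Y" for Y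
    proof -
      have "(\<lambda>t. indicat_real D t *\<^sub>R (Y t)\<^sup>2) \<in> borel_measurable lborel"
        using that unfolding square_integrable_def set_integrable_def by (intro borel_measurable_integrable) blast
      then show ?thesis by simp
    qed
    have split: "(\<lambda>t. indicat_real D t *\<^sub>R ((Y t)\<^sup>2 + (f t)\<^sup>2)) \<in> borel_measurable lborel \<longleftrightarrow>
        (\<lambda>t. indicat_real D t * (f t)\<^sup>2) \<in> borel_measurable lborel" if "square_integrable D Y" for Y
    proof
      assume *: "(\<lambda>t. indicat_real D t *\<^sub>R ((Y t)\<^sup>2 + (f t)\<^sup>2)) \<in> borel_measurable lborel"
      show "(\<lambda>t. indicat_real D t * (f t)\<^sup>2) \<in> borel_measurable lborel"
        using borel_measurable_diff[OF * m[OF that]] by (simp add: distrib_left)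
    next
      assume *: "(\<lambda>t. indicat_real D t * (f t)\<^sup>2) \<in> borel_measurable lborel"
      show "(\<lambda>t. indicat_real D t *\<^sub>R ((Y t)\<^sup>2 + (f t)\<^sup>2)) \<in> borel_measurable lborel"
        using borel_measurable_add[OF m[OF that] *] by (simp add: distrib_left)
    qed
    have "integral\<^sup>L lborel ?G = integral\<^sup>L lborel ?F"
    proof (cases "(\<lambda>t. indicat_real D t * (f t)\<^sup>2) \<in> borel_measurable lborel")
      case True
      show ?thesis
      proof (rule integral_cong_AE)
        show "?G \<in> borel_measurable lborel" using split V True by blast
        show "?F \<in> borel_measurable lborel" using split W(1) True by blast
        show "AE t in lborel. ?G t = ?F t" using ae by eventually_elim (auto simp: indicator_def)
      qed
    next
      case False
      \<comment> \<open>If f^2 is not measurable on D, neither integrand is integrable, and both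
        integrals have the default value 0.\<close>
      then have n: "\<not> integrable lborel ?G" "\<not> integrable lborel ?F"
        using split[of V] split[of W] V W(1) borel_measurable_integrable by blast+
      show ?thesis unfolding not_integrable_integral_eq[OF n(1)] not_integrable_integral_eq[OF n(2)] ..
    qed
    then show ?thesis by (simp add: interval_energy_def set_lebesgue_integral_def W_def V_def)
  next
    case False
    then have "\<not> (\<exists>g. square_integrable D g \<and> is_weak_deriv D (\<lambda>t. - f t) g)" using flip by blast
    \<comment> \<open>When there is no weak derivative, both choices are made from the same
      unsatisfiable predicate, so they return the same function.\<close>
    then have "(\<lambda>g. square_integrable D g \<and> is_weak_deriv D (\<lambda>t. - f t) g) =
        (\<lambda>g. square_integrable D g \<and> is_weak_deriv D f g)" using False by blast
    then have "V = W" unfolding V_def W_def weak_deriv_def by (rule arg_cong)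
    then show ?thesis by (simp add: interval_energy_def W_def V_def)
  qed
qed

text \<open>The pieces are disjoint sets of edges that exhaust the graph and serve as their own
  indices. The Dirichlet set consists of the outer vertices.\<close>

locale graph_pieces = pieces_with_half_line K D \<gamma> "{y. outer_vertex G y}" p k0
  for G :: pgraph and K :: "edge set set" and D and \<gamma> :: "edge set \<Rightarrow> real \<Rightarrow> real^2" and p k0 +
  assumes cover: "\<Union>K = edges G" and disj: "pairwise disjnt K"
    and piece_K: "\<And>P. P \<in> K \<Longrightarrow> piece P (\<gamma> P) (D P)"
begin

lemma graph_points_eq: "graph_points G = points"
proof -
  have "(\<Union>e\<in>P. edge_points e) = \<gamma> P ` D P" if "P \<in> K" for P by (rule piece_K[OF that, unfolded piece_def, THEN conjunct2, THEN conjunct1])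
  then have eq: "points = (\<Union>P\<in>K. \<Union>e\<in>P. edge_points e)"
    unfolding points_def by (intro SUP_cong refl) (rule sym)
  show ?thesis unfolding eq graph_points_def cover[symmetric] by blast
qed

lemma energy_eq_infsum: "energy G v = (\<Sum>\<^sub>\<infinity>e\<in>edges G. edge_energy v e)"
  by (simp add: energy_def graph_integral_def edge_energy_def)

lemma
  assumes v: "v \<in> X"
  shows energy_has_sum: "(edge_energy v has_sum E v) (edges G)"
    and Lp_has_sum: "(edge_Lp p v has_sum Lp v) (edges G)"
proof -
  have "(edge_energy v has_sum interval_energy (D P) (\<lambda>t. v (\<gamma> P t))) P \<and>
      (edge_Lp p v has_sum interval_Lp (D P) p (\<lambda>t. v (\<gamma> P t))) P" if "P \<in> K" for P
    using piece_K[OF that] XD(3)[OF v that] p unfolding piece_def by blast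
  then show "(edge_energy v has_sum E v) (edges G)" "(edge_Lp p v has_sum Lp v) (edges G)"
    unfolding E_def Lp_def cover[symmetric] by (intro has_sum_Union_disjoint finK disj; blast)+
qed

lemma energy_eq: "v \<in> X \<Longrightarrow> energy G v = E v"
  unfolding energy_eq_infsum by (rule infsumI[OF energy_has_sum])

lemma Lp_eq: "v \<in> X \<Longrightarrow> Lp_integral G p v = Lp v"
  using infsumI[OF Lp_has_sum, of v] by (simp add: Lp_integral_def graph_integral_def edge_Lp_def[abs_def])

text \<open>Summability of the energies over all edges restricts to each piece, where it yields a
  Sobolev function of the arc length; conversely the sums over finitely many disjoint pieces add
  up.\<close>

lemma H10_eq: "H10 G = X"
proof -
  have "(\<forall>e\<in>edges G. edge_H1 v e) \<and> edge_energy v summable_on edges G \<longleftrightarrow>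
      (\<forall>P\<in>K. H1_cont (D P) (\<lambda>t. v (\<gamma> P t)))" for v
  proof
    assume v: "(\<forall>e\<in>edges G. edge_H1 v e) \<and> edge_energy v summable_on edges G"
    show "\<forall>P\<in>K. H1_cont (D P) (\<lambda>t. v (\<gamma> P t))"
    proof
      fix P assume P: "P \<in> K"
      then have "P \<subseteq> edges G" using cover by blast
      then have "(\<forall>e\<in>P. edge_H1 v e) \<and> edge_energy v summable_on P"
        using v summable_on_subset_banach by blast
      then show "H1_cont (D P) (\<lambda>t. v (\<gamma> P t))" using piece_K[OF P] unfolding piece_def by blast
    qed
  next
    assume v: "\<forall>P\<in>K. H1_cont (D P) (\<lambda>t. v (\<gamma> P t))"
    have c: "(\<forall>e\<in>P. edge_H1 v e) \<and> (edge_energy v has_sum interval_energy (D P) (\<lambda>t. v (\<gamma> P t))) P"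
      if "P \<in> K" for P
      using piece_K[OF that] v that unfolding piece_def by blast
    have "(edge_energy v has_sum (\<Sum>P\<in>K. interval_energy (D P) (\<lambda>t. v (\<gamma> P t)))) (\<Union>K)"
      by (rule has_sum_Union_disjoint[OF finK disj]) (use c in blast)
    then have "edge_energy v summable_on edges G" unfolding cover by (rule has_sum_imp_summable)
    then show "(\<forall>e\<in>edges G. edge_H1 v e) \<and> edge_energy v summable_on edges G"
      using c cover by blast
  qed
  moreover have "v \<in> H10 G \<longleftrightarrow> (\<forall>x. x \<notin> points \<longrightarrow> v x = 0) \<and>
      ((\<forall>e\<in>edges G. edge_H1 v e) \<and> edge_energy v summable_on edges G) \<and> (\<forall>x. outer_vertex G x \<longrightarrow> v x = 0)" for v
    unfolding H10_def H1_def graph_points_eq edge_H1_def edge_energy_def by blast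
  ultimately show ?thesis unfolding X_def by blast
qed

lemma best_const_eq: "best_const G p = best"
  unfolding best_const_def best_def H10_eq by (simp add: energy_eq Lp_eq cong: ball_cong)

lemma rayleigh_eq: "v \<in> X \<Longrightarrow> rayleigh_quotient G p v = ray v"
  by (simp add: rayleigh_quotient_def ray_def energy_eq Lp_eq)

lemma min_value_eq: "min_value G p = 1 / best"
  unfolding min_value_def H10_eq min_eq[symmetric] by (rule arg_cong[where f = Inf], rule image_cong) (simp_all add: rayleigh_eq)

lemma minimizing_iff:
  "normalized_minimizing_sequence G p v \<longleftrightarrow>
    (\<forall>n. v n \<in> X - {\<lambda>_. 0} \<and> Lp (v n) = 1) \<and> (\<lambda>n. E (v n)) \<longlonglongrightarrow> 1 / best"
proof -
  have "v n \<in> X - {\<lambda>_. 0} \<and> Lp_integral G p (v n) = 1 \<longleftrightarrow> v n \<in> X - {\<lambda>_. 0} \<and> Lp (v n) = 1" for n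
    using Lp_eq[of "v n"] by auto
  moreover have "rayleigh_quotient G p (v n) = E (v n)" if "\<forall>n. v n \<in> X - {\<lambda>_. 0} \<and> Lp (v n) = 1" for n
    using that rayleigh_eq[of "v n"] by (simp add: ray_def)
  ultimately show ?thesis
    unfolding normalized_minimizing_sequence_def H10_eq min_value_eq by auto
qed

section \<open>The metric space and its compactness criterion\<close>

abbreviation d :: "(real^2 \<Rightarrow> real) \<Rightarrow> (real^2 \<Rightarrow> real) \<Rightarrow> real" where
  "d u v \<equiv> H1_norm G (\<lambda>x. u x - v x)"

lemma d_eq: "u \<in> X \<Longrightarrow> v \<in> X \<Longrightarrow> d u v = sqrt (E (\<lambda>x. u x - v x))"
  by (simp add: H1_norm_def energy_eq X_diff)

lemma d_commute: "d u v = d v u"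
proof -
  have "edge_energy (\<lambda>x. u x - v x) e = edge_energy (\<lambda>x. v x - u x) e" for e
    using interval_energy_uminus[OF edge_dom_props(1-3), of e "on_edge (\<lambda>x. v x - u x) e"]
    by (simp add: edge_energy_eq on_edge_def o_def)
  then show ?thesis by (simp add: H1_norm_def energy_eq_infsum)
qed

text \<open>Cauchy-Schwarz for the polar form B follows from nonnegativity of the energy of all
  linear combinations.\<close>

lemma E_triangle:
  assumes "u \<in> X" "v \<in> X"
  shows "sqrt (E (\<lambda>x. u x + v x)) \<le> sqrt (E u) + sqrt (E v)"
proof -
  have "(B u v)\<^sup>2 \<le> E u * E v"
    using E_nonneg E_lincomb[OF assms] by (intro nonneg_quadratic_discriminant) metis
  then have "B u v \<le> sqrt (E u * E v)" by (rule real_le_rsqrt)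
  moreover have "(sqrt (E u) + sqrt (E v))\<^sup>2 = E u + E v + 2 * sqrt (E u * E v)"
    using E_nonneg by (simp add: power2_sum real_sqrt_mult)
  ultimately have "E (\<lambda>x. u x + v x) \<le> (sqrt (E u) + sqrt (E v))\<^sup>2"
    using E_lincomb[OF assms, of 1 1] by simp
  then show ?thesis by (rule real_le_lsqrt[rotated 1]) (simp add: E_nonneg)
qed

lemma metric: "Metric_space X d"
proof
  show "0 \<le> d u v" for u v
  proof -
    have "0 \<le> energy G (\<lambda>x. u x - v x)"
      unfolding energy_eq_infsum by (rule infsum_nonneg) (simp add: edge_energy_eq interval_energy_nonneg)
    then show ?thesis by (simp add: H1_norm_def)
  qed
  show "d u v = d v u" for u v by (rule d_commute)
  show "d u v = 0 \<longleftrightarrow> u = v" if "u \<in> X" "v \<in> X" for u v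
  proof
    assume "d u v = 0"
    then have "E (\<lambda>x. u x - v x) = 0" using d_eq[OF that] by simp
    then have "(\<lambda>x. u x - v x) = (\<lambda>_. 0)" using E_pos[OF X_diff[OF that]] by fastforce
    then show "u = v" by (metis eq_iff_diff_eq_0 ext)
  next
    assume "u = v"
    then show "d u v = 0" using d_eq[OF that] by (simp add: E_def interval_energy_zero dom_props)
  qed
  show "d u w \<le> d u v + d v w" if "u \<in> X" "v \<in> X" "w \<in> X" for u v w
    using E_triangle[OF X_diff[OF that(1,2)] X_diff[OF that(2,3)]] that by (simp add: d_eq)
qed

text \<open>The Bolzano-Weierstrass form of compactness of the closure, with limit points in the
  whole space. It concerns infinite subsets of the range, so a sequence with finitely many values
  needs no separate treatment.\<close>

lemma relatively_compact_iff:
  "relatively_compact_in_H10 G S \<longleftrightarrow> S \<subseteq> X \<and>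
    (\<forall>T. infinite T \<and> T \<subseteq> S \<longrightarrow> (\<exists>w\<in>X. \<forall>r>0. \<exists>y\<in>T. y \<noteq> w \<and> d w y < r))"
proof -
  interpret Metric_space X d by (rule metric)
  have "(\<exists>w\<in>X. \<forall>r>0. \<exists>y\<in>T. y \<noteq> w \<and> d w y < r) \<longleftrightarrow> mtopology derived_set_of T \<noteq> {}" if "T \<subseteq> X" for T
    unfolding metric_derived_set_of using that by (auto simp: subset_iff)
  then show ?thesis
    unfolding relatively_compact_in_H10_def H10_topology_def H10_eq compact_closure_of_eq_Bolzano_Weierstrass
    by (meson subset_trans)
qed

lemma minimizing_relatively_compact:
  assumes gt: "best > line_best p"
    and v: "\<And>n::nat. v n \<in> X" "\<And>n. Lp (v n) = 1" "(\<lambda>n. E (v n)) \<longlonglongrightarrow> 1 / best"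
  shows "relatively_compact_in_H10 G (range v)"
  unfolding relatively_compact_iff
proof (intro conjI allI impI)
  show "range v \<subseteq> X" using v(1) by blast
  fix T assume T: "infinite T \<and> T \<subseteq> range v"
  \<comment> \<open>One index is kept for each function of the subset, so different indices give
    different functions.\<close>
  then obtain U where U: "inj_on v U" "T = v ` U" using subset_image_inj[of T v UNIV] by blast
  then have inf: "infinite U" using T by blast
  define s where "s = enumerate U"
  have s: "strict_mono s" "\<And>n. s n \<in> U"
    using inf by (simp_all add: s_def strict_mono_enumerate enumerate_in_set)
  have lim: "(\<lambda>n. E (v (s n))) \<longlonglongrightarrow> 1 / best" using LIMSEQ_subseq_LIMSEQ[OF v(3) s(1)] by (simp add: o_def)
  obtain r w where r: "strict_mono r" "w \<in> X" "(\<lambda>n. E (\<lambda>x. v (s (r n)) x - w x)) \<longlonglongrightarrow> 0"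
    by (rule minimizing_subsequence[where v = "\<lambda>n. v (s n)", OF gt v(1) v(2) lim]) blast
  have dlim: "(\<lambda>n. d w (v (s (r n)))) \<longlonglongrightarrow> 0"
    using tendsto_real_sqrt[OF r(3)] by (simp add: d_commute[of w] d_eq[OF v(1) r(2)])
  show "\<exists>w\<in>X. \<forall>\<rho>>0. \<exists>y\<in>T. y \<noteq> w \<and> d w y < \<rho>"
  proof (intro bexI[OF _ r(2)] allI impI)
    fix \<rho> :: real assume "\<rho> > 0"
    then have "\<forall>\<^sub>F n in sequentially. d w (v (s (r n))) < \<rho>" by (rule order_tendstoD(2)[OF dlim])
    then obtain n where n: "\<And>k. k \<ge> n \<Longrightarrow> d w (v (s (r k))) < \<rho>" unfolding eventually_sequentially by blast
    \<comment> \<open>A limit point needs nearby members other than w itself; of two distinct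
      members at most one equals w.\<close>
    have "s (r n) \<noteq> s (r (Suc n))"
      using strict_monoD[OF s(1) strict_monoD[OF r(1), of n "Suc n"]] by simp
    then have "v (s (r n)) \<noteq> v (s (r (Suc n)))" using inj_onD[OF U(1)] s(2) by blast
    then have "v (s (r n)) \<noteq> w \<or> v (s (r (Suc n))) \<noteq> w" by metis
    moreover have "v (s (r k)) \<in> T" for k using s(2) U(2) by blast
    ultimately show "\<exists>y\<in>T. y \<noteq> w \<and> d w y < \<rho>" using n[of n] n[of "Suc n"] by fastforce
  qed
qed

text \<open>A limit point w = 0 is excluded by the lower bound 1 / best for the energies. If w x is
  nonzero, pointwise convergence and disjointness of the supports make the index eventually
  constant, so w is that member, although the approximating members were chosen different from
  w.\<close>

lemma disjoint_supports_not_compact: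
  assumes u: "\<And>n::nat. u n \<in> X - {\<lambda>_. 0}" "\<And>n. Lp (u n) = 1"
    and dis: "\<And>m n x. u m x \<noteq> 0 \<Longrightarrow> u n x \<noteq> 0 \<Longrightarrow> m = n"
  shows "\<not> relatively_compact_in_H10 G (range u)"
proof
  assume c: "relatively_compact_in_H10 G (range u)"
  have "inj u"
  proof (rule injI)
    fix m n assume eq: "u m = u n"
    obtain x where "u m x \<noteq> 0" using u(1)[of m] by fastforce
    then show "m = n" using dis[of m x n] eq by simp
  qed
  then have "infinite (range u)" by (rule range_inj_infinite)
  then obtain w where w: "w \<in> X" "\<And>r. r > 0 \<Longrightarrow> \<exists>y\<in>range u. y \<noteq> w \<and> d w y < r"
    using c unfolding relatively_compact_iff by blast
  have "\<exists>k. u k \<noteq> w \<and> d w (u k) < inverse (real (Suc n))" for n using w(2)[of "inverse (real (Suc n))"] by auto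
  then obtain k where k: "\<And>n. u (k n) \<noteq> w" "\<And>n. d w (u (k n)) < inverse (real (Suc n))" by metis
  have X: "u n \<in> X" for n using u(1) by blast
  have "(\<lambda>n. sqrt (E (\<lambda>x. u (k n) x - w x))) \<longlonglongrightarrow> 0"
  proof (rule tendsto_sandwich)
    show "\<forall>\<^sub>F n in sequentially. 0 \<le> sqrt (E (\<lambda>x. u (k n) x - w x))" by (simp add: E_nonneg)
    show "\<forall>\<^sub>F n in sequentially. sqrt (E (\<lambda>x. u (k n) x - w x)) \<le> inverse (real (Suc n))"
      using k(2) by (simp only: d_commute[of w] d_eq[OF X w(1)]) (simp add: less_imp_le del: of_nat_Suc)
    show "(\<lambda>n. inverse (real (Suc n))) \<longlonglongrightarrow> 0" by (rule LIMSEQ_inverse_real_of_nat)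
  qed simp
  from tendsto_power[OF this, of 2] have lim: "(\<lambda>n. E (\<lambda>x. u (k n) x - w x)) \<longlonglongrightarrow> 0"
    by (simp add: E_nonneg)
  show False
  proof (cases "w = (\<lambda>_. 0)")
    case True
    have "1 / best \<le> E (u (k n))" for n using ray_ge[of "u (k n)"] u by (simp add: ray_def)
    moreover have "(\<lambda>n. E (u (k n))) \<longlonglongrightarrow> 0" using lim True by simp
    ultimately have "1 / best \<le> 0" using LIMSEQ_le_const by blast
    then show False using best_pos by simp
  next
    case False
    have pt: "(\<lambda>n. u (k n) x) \<longlonglongrightarrow> w x" for x by (rule E_tendsto_pointwise[OF X w(1) lim])
    obtain x where "w x \<noteq> 0" using False by blast
    then have "\<forall>\<^sub>F n in sequentially. u (k n) x \<noteq> 0" using tendsto_imp_eventually_ne[OF pt] by blast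
    then obtain n0 where n0: "\<And>n. n \<ge> n0 \<Longrightarrow> u (k n) x \<noteq> 0" unfolding eventually_sequentially by blast
    then have kc: "k n = k n0" if "n \<ge> n0" for n using dis[of "k n" x "k n0"] that by simp
    have "w y = u (k n0) y" for y
    proof (rule LIMSEQ_unique[OF pt])
      show "(\<lambda>n. u (k n) y) \<longlonglongrightarrow> u (k n0) y"
      proof (rule tendsto_eventually)
        have "u (k n) y = u (k n0) y" if "n \<ge> n0" for n by (simp only: kc[OF that])
        then show "\<forall>\<^sub>F n in sequentially. u (k n) y = u (k n0) y" unfolding eventually_sequentially by blast
      qed
    qed
    then have "w = u (k n0)" by (rule ext)
    then show False using k(1)[of n0] by simp
  qed
qed

end

section \<open>Decomposition of the graph and conclusion\<close>

lemma best_const_line_eq: "best_const_line p = line_best p"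
proof -
  have "H1_cont UNIV f \<longleftrightarrow> continuous_on UNIV f \<and> H1_interval UNIV f"
    "interval_Lp UNIV p f = (LINT t|lborel. \<bar>f t\<bar> powr p)"
    "interval_energy UNIV f = (LINT t|lborel. (weak_deriv UNIV f t)\<^sup>2 + (f t)\<^sup>2)" for f
    by (simp_all add: H1_cont_def interval_Lp_def interval_energy_def set_lebesgue_integral_def)
  then show ?thesis by (simp add: best_const_line_def line_best_def)
qed

text \<open>Each edge of the compact part is a piece and each chain is a piece. Different numbers j
  may list the same chain; as the pieces are collected in a set of edge sets, it suffices that
  chains with a common edge have the same edges.\<close>

lemma graph_pieces_exist:
  assumes G: "planar_metric_graph G" "unbounded_only_along_half_lines G" and p: "p > 2"
  obtains K D \<gamma> k0 where "graph_pieces G K D \<gamma> p k0"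
proof -
  from G(2) obtain V0 E0 m N x e where E0': "\<forall>f\<in>E0. bounded_edge f \<and> edge_ends f \<subseteq> V0" and fin: "finite E0"
    and m: "0 < (m::nat)"
    and ch': "\<forall>j<m. half_line_chain G (N j) (x j) (e j) \<and> x j 0 \<in> V0 \<and>
      (\<forall>i. 0 < i \<and> enat i < N j \<longrightarrow> x j i \<notin> V0 \<and>
        (\<forall>f\<in>edges G. x j i \<in> edge_ends f \<longrightarrow> f \<in> e j ` {k. enat k < N j}))"
    and edges: "edges G = E0 \<union> (\<Union>j<m. e j ` {i. enat i < N j})"
    unfolding unbounded_only_along_half_lines_def by (elim exE conjE) (rule that; assumption)
  note E0 = bspec[OF E0']
  have ch: "half_line_chain G (N j) (x j) (e j) \<and> x j 0 \<in> V0" if "j < m" for j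
    using ch' that by blast
  have inner: "x j i \<notin> V0 \<and> (\<forall>f\<in>edges G. x j i \<in> edge_ends f \<longrightarrow> f \<in> e j ` {k. enat k < N j})"
    if "j < m" "0 < i" "enat i < N j" for j i using ch' that by blast
  define Ch where "Ch j = e j ` {i. enat i < N j}" for j
  have cl: "chain_line (N j) (x j) (e j)" if "j < m" for j
    by (rule half_line_chain_imp_chain_line) (use ch[OF that] G(1) in auto)
  have ends: "edge_ends (e j i) = (if enat (Suc i) < N j then {x j i, x j (Suc i)} else {x j i})"
    if "j < m" "enat i < N j" for j i by (rule chain_line.edge_ends_e[OF cl[OF that(1)] that(2)])
  have less: "enat i < N j" if "enat (Suc i) < N j" for i j
    using that by (meson enat_ord_simps(2) lessI less_trans)
  have sub: "Ch j \<subseteq> edges G" if "j < m" for j using edges that by (auto simp: Ch_def)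
  \<comment> \<open>Membership in the other chain is passed on across each inner vertex, in both
    directions, and so spreads from one common edge to the entire chain.\<close>
  have overlap: "Ch j \<subseteq> Ch j'" if j: "j < m" "j' < m" and f: "f \<in> Ch j" "f \<in> Ch j'" for j j' f
  proof -
    \<comment> \<open>The first vertex of a chain lies in V0, so a vertex outside V0 has a positive
      index and belongs to no edges other than those of the chain.\<close>
    have vertex: "g \<in> Ch j'" if y: "y \<notin> V0" "h \<in> Ch j'" "y \<in> edge_ends h" and g: "g \<in> edges G" "y \<in> edge_ends g" for y g h
    proof -
      obtain l where l: "enat l < N j'" "h = e j' l" using y(2) by (auto simp: Ch_def)
      obtain k where k: "enat k < N j'" "y = x j' k"
        using y(3) ends[OF j(2) l(1)] l by (cases "enat (Suc l) < N j'") auto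
      have "k \<noteq> 0" using k(2) y(1) ch[OF j(2)] by metis
      then show ?thesis using inner[OF j(2) _ k(1)] g k(2) by (auto simp: Ch_def)
    qed
    have step: "e j i \<in> Ch j' \<longleftrightarrow> e j (Suc i) \<in> Ch j'" if i: "enat (Suc i) < N j" for i
    proof -
      have V: "x j (Suc i) \<notin> V0" using inner[OF j(1) _ i] by blast
      have "x j (Suc i) \<in> edge_ends (e j i)" "x j (Suc i) \<in> edge_ends (e j (Suc i))"
        using ends[OF j(1) less[OF i]] ends[OF j(1) i] i by auto
      moreover have "e j i \<in> edges G" "e j (Suc i) \<in> edges G" using sub[OF j(1)] i less[OF i] by (auto simp: Ch_def)
      ultimately show ?thesis using vertex[OF V] by blast
    qed
    have base: "enat i < N j \<Longrightarrow> e j i \<in> Ch j' \<longleftrightarrow> e j 0 \<in> Ch j'" for i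
      by (induction i) (use step less in blast)+
    moreover obtain l where "enat l < N j" "f = e j l" using f(1) by (auto simp: Ch_def)
    ultimately have "e j 0 \<in> Ch j'" using f(2) by blast
    then show ?thesis using base unfolding Ch_def[of j] by blast
  qed
  \<comment> \<open>An edge of the compact part is bounded with both ends in V0, whereas an edge of
    a chain is a half-line or has its far vertex outside V0.\<close>
  have E0_Ch: "f \<notin> Ch j" if f: "f \<in> E0" and j: "j < m" for f j
  proof
    assume "f \<in> Ch j"
    then obtain i where i: "enat i < N j" "f = e j i" by (auto simp: Ch_def)
    show False
    proof (cases "enat (Suc i) < N j")
      case True
      then have "x j (Suc i) \<in> edge_ends f" using ends[OF j i(1)] i(2) by simp
      then show False using E0[OF f] inner[OF j _ True] by blast
    next
      case False
      then obtain d where "e j i = Half_line (x j i) d" using chain_line.last[OF cl[OF j] i(1)] by blast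
      then show False using E0[OF f] i(2) by simp
    qed
  qed
  define K where "K = (\<lambda>f. {f}) ` E0 \<union> Ch ` {..<m}"
  have disj: "pairwise disjnt K"
  proof (rule pairwiseI)
    fix P Q assume PQ: "P \<in> K" "Q \<in> K" "P \<noteq> Q"
    show "disjnt P Q"
    proof (rule ccontr)
      assume "\<not> disjnt P Q"
      then obtain f where f: "f \<in> P" "f \<in> Q" by (auto simp: disjnt_def)
      have "P = Q" if "f \<in> E0"
        using PQ(1,2) f that E0_Ch unfolding K_def by auto
      moreover have "P = Q" if "f \<notin> E0"
      proof -
        have "\<exists>i<m. R = Ch i" if "R \<in> K" "f \<in> R" for R
          using that \<open>f \<notin> E0\<close> unfolding K_def by blast
        then obtain i j where "i < m" "j < m" "P = Ch i" "Q = Ch j" using PQ(1,2) f by metis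
        then show ?thesis using overlap f by blast
      qed
      ultimately show False using PQ(3) by blast
    qed
  qed
  define k0 where "k0 = Ch 0"
  have k0: "k0 \<in> K" using m by (auto simp: K_def k0_def)
  have piece_Ch: "piece (Ch j) (chain_line.\<gamma> N' x' e') {0..}"
    if "j < m" "N' = N j" "x' = x j" "e' = e j" for j N' x' e'
    using chain_line.piece_chain[OF cl[OF that(1)]] by (simp add: Ch_def chain_line.I_def[OF cl[OF that(1)]] that)
  have "\<exists>\<gamma> D. piece P \<gamma> D" if P: "P \<in> K" for P
  proof (cases "\<exists>f\<in>E0. P = {f}")
    case True
    then obtain f where f: "f \<in> E0" "P = {f}" by blast
    then have "valid_edge f" using G(1) edges by (auto simp: planar_metric_graph_def)
    then show ?thesis using piece_single f(2) by blast
  next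
    case False
    then obtain j where "j < m" "P = Ch j" using P by (auto simp: K_def)
    then show ?thesis using piece_Ch by blast
  qed
  then obtain \<Gamma> \<Delta> where \<Gamma>: "\<And>P. P \<in> K \<Longrightarrow> piece P (\<Gamma> P) (\<Delta> P)" by metis
  interpret C: chain_line "N 0" "x 0" "e 0" by (rule cl[OF m])
  have I: "e 0 ` C.I = k0" by (simp add: C.I_def k0_def Ch_def)
  have eG: "\<And>i. enat i < N 0 \<Longrightarrow> e 0 i \<in> edges G" using sub[OF m] by (auto simp: Ch_def)
  have inn: "\<And>i f. 0 < i \<Longrightarrow> enat i < N 0 \<Longrightarrow> f \<in> edges G \<Longrightarrow> x 0 i \<in> edge_ends f \<Longrightarrow> f \<in> e 0 ` C.I"
    unfolding I k0_def Ch_def using inner[OF m] by blast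
  have C1: "s = t" if "s \<ge> 0" "t \<ge> 0" "C.\<gamma> s = C.\<gamma> t" for s t
    by (rule C.\<gamma>_inj[OF G(1) _ _ that]) (erule eG, rule inn)
  have C2: "f \<in> k0" if "t > 0" "f \<in> edges G" "C.\<gamma> t \<in> edge_points f" for f t
    by (rule C.\<gamma>_isolated[OF G(1) _ _ that, unfolded I]) (erule eG, rule inn[unfolded I])
  have C3: "\<not> outer_vertex G (C.\<gamma> t)" if "t > 0" for t
    by (rule C.\<gamma>_not_outer[OF G(1) _ _ that]) (erule eG, rule inn)
  \<comment> \<open>For the other pieces any parametrization will do; on the distinguished half-line
    it has to be the arc length of the chain, for which injectivity and isolation have been
    shown.\<close>
  define \<gamma> where "\<gamma> = \<Gamma>(k0 := C.\<gamma>)"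
  define D where "D = \<Delta>(k0 := {0..})"
  have pc: "piece P (\<gamma> P) (D P)" if "P \<in> K" for P
    using \<Gamma>[OF that] piece_Ch[OF m refl refl refl] by (cases "P = k0") (simp_all add: \<gamma>_def D_def k0_def)
  have cover: "\<Union>K = edges G" by (auto simp: K_def edges Ch_def)
  have "graph_pieces G K D \<gamma> p k0"
  proof
    show "finite K" using fin by (simp add: K_def)
    show "D P = {0..} \<or> (\<exists>L>0. D P = {0..L})" if "P \<in> K" for P using pc[OF that] unfolding piece_def by blast
    show "p > 2" "k0 \<in> K" "\<Union>K = edges G" "pairwise disjnt K" by fact+
    show "D k0 = {0..}" by (simp add: D_def)
    show "piece P (\<gamma> P) (D P)" if "P \<in> K" for P by (rule pc[OF that])
    show "\<gamma> k0 t \<notin> {y. outer_vertex G y}" if "t > 0" for t using C3[OF that] by (simp add: \<gamma>_def)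
    show "k = k0 \<and> s = t" if t: "t > 0" and k: "k \<in> K" "s \<in> D k" "\<gamma> k0 t = \<gamma> k s" for t k s
    proof -
      have "\<gamma> k s \<in> (\<Union>f\<in>k. edge_points f)" using pc[OF k(1)] k(2) unfolding piece_def by blast
      then obtain f where f: "f \<in> k" "C.\<gamma> t \<in> edge_points f" using k(3) by (auto simp: \<gamma>_def)
      have "f \<in> edges G" using f(1) k(1) cover by blast
      then have "f \<in> k0" using C2 t f(2) by blast
      then have "k = k0" using pairwiseD[OF disj k(1) k0] f(1) by (auto simp: disjnt_def)
      moreover from this have "s = t" using C1[of s t] t k(2,3) by (simp add: \<gamma>_def D_def)
      ultimately show ?thesis by blast
    qed
  qed
  then show thesis by (rule that)
qed

theorem theorem8:
  fixes G :: pgraph and p :: real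
  assumes "p > 2"
    and "planar_metric_graph G"
    and "locally_finite_graph G"
    and "unbounded_only_along_half_lines G"
  shows "1 / best_const G p = min_value G p \<and>
         ((\<forall>v. normalized_minimizing_sequence G p v \<longrightarrow>
                relatively_compact_in_H10 G (range v))
            \<longleftrightarrow> best_const G p > best_const_line p) \<and>
         (best_const G p > best_const_line p \<longrightarrow>
            (\<exists>v\<in>H10 G - {\<lambda>x. 0}. rayleigh_quotient G p v = min_value G p))"
proof -
  obtain K D \<gamma> k0 where "graph_pieces G K D \<gamma> p k0"
    by (rule graph_pieces_exist[OF assms(2,4,1)])
  then interpret graph_pieces G K D \<gamma> p k0 .
  have compact: "relatively_compact_in_H10 G (range v)"
    if "best > line_best p" "normalized_minimizing_sequence G p v" for v
    by (rule minimizing_relatively_compact[OF that(1)]) (use that(2) in \<open>auto simp: minimizing_iff\<close>)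
  \<comment> \<open>Contraposition: if the constant of the graph does not exceed that of the line, a
    normalized minimizing sequence with disjoint supports is the counterexample.\<close>
  have not_compact: "\<exists>v. normalized_minimizing_sequence G p v \<and> \<not> relatively_compact_in_H10 G (range v)"
    if le: "best \<le> line_best p"
  proof -
    obtain u where u: "\<And>n::nat. u n \<in> X - {\<lambda>_. 0}" "\<And>n. Lp (u n) = 1" "(\<lambda>n. E (u n)) \<longlonglongrightarrow> 1 / best"
      and dis: "\<And>m n x. u m x \<noteq> 0 \<Longrightarrow> u n x \<noteq> 0 \<Longrightarrow> m = n"
      by (rule escaping_minimizing_sequence[OF le]) blast
    have "normalized_minimizing_sequence G p u" using u by (simp add: minimizing_iff)
    moreover have "\<not> relatively_compact_in_H10 G (range u)"
      by (rule disjoint_supports_not_compact[OF u(1,2) dis])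
    ultimately show ?thesis by blast
  qed
  have attained: "\<exists>v\<in>X - {\<lambda>x. 0}. rayleigh_quotient G p v = min_value G p" if gt: "best > line_best p"
  proof -
    obtain v where v: "\<And>n::nat. v n \<in> X - {\<lambda>_. 0}" "\<And>n. Lp (v n) = 1" "(\<lambda>n. E (v n)) \<longlonglongrightarrow> 1 / best"
      by (rule minimizing_sequence_exists) blast
    have vX: "v n \<in> X" for n using v(1) by blast
    obtain w where w: "w \<in> X" "Lp w = 1" "E w = 1 / best"
      by (rule minimizing_subsequence[where v = v, OF gt vX v(2,3)]) blast
    have "w \<noteq> (\<lambda>_. 0)" using w(2) by (auto simp: Lp_def interval_Lp_def)
    then show ?thesis using w by (intro bexI[of _ w]) (simp_all add: rayleigh_eq ray_def min_value_eq)
  qed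
  show ?thesis
    unfolding best_const_eq best_const_line_eq H10_eq
    using compact not_compact attained min_value_eq by (metis not_le)
qed

end
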